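(* Let $F$ be a solution of the linear wave equation on $\mathbb{R}\times\mathbb{R}^3$, let $I=[a,b]\subseteq[0,\infty)$ be a compact time interval, and let $v:I\times\mathbb{R}^3\to\mathbb{R}$ be a solution of the forced nonlinear wave equation $-\partial_{tt}v+\Delta v=(v+F)^5$ with data in $\dot H^1_x(\mathbb{R}^3)\times L^2_x(\mathbb{R}^3)$. Let $w\in L^1_\tau(\mathbb{R})$ be nonnegative. Then $$\begin{aligned} \int_I\int_{\mathbb{R}^3}w(t+|x|)\,|v|^6(t,x)\,dx\,dt \lesssim\;& \|w\|_{L^1_\tau(\mathbb{R})}\sup_{t\in I}E[v](t)+\|w\|_{L^1_\tau(\mathbb{R})}\|F\|_{L^\infty_tL^6_x(I\times\mathbb{R}^3)}\sup_{t\in I}E[v](t)^{\frac56}\\ &+\left|\int_I\int_{\mathbb{R}^3}\left(\int_{t+|x|}^{\infty}w(\tau)\,d\tau\right)\partial_t(F)\,v^5\,dx\,dt\right|+\left|\int_I\int_{\mathbb{R}^3}w(t+|x|)\,F\,v^5\,dx\,dt\right|\\ &+\|w\|_{L^1_\tau(\mathbb{R})}\int_I\int_{\mathbb{R}^3}|F|^2(|F|+|v|)^3|\partial_tv|\,dx\,dt , \end{aligned}$$ where the implicit constant is absolute.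
   Context: The energy is $E[v](t)=\int_{\mathbb{R}^3}\frac12|\nabla v|^2+\frac12|\partial_tv|^2+\frac16|v|^6\,dx$. All functions are real-valued. $F$ solves $-\partial_{tt}F+\Delta F=0$ and lies in $L_t^5L_x^{10}(\mathbb{R}\times\mathbb{R}^3)$; the solution $v$ satisfies $v\in C_t^0\dot H^1_x(I\times\mathbb{R}^3)\cap L^5_{t,\mathrm{loc}}L^{10}_x(I\times\mathbb{R}^3)$, $\partial_tv\in C_t^0L^2_x(I\times\mathbb{R}^3)$. The inequality is an a priori estimate: it is understood that the signed integrals on the right-hand side are well defined (absolutely convergent). *)

theory Defs
  imports "HOL-Probability.Probability"
begin

type_synonym R3 = "real ^ 3"

text \<open>Function classes are modelled by Borel representatives. Space-time functions are curried,
  and a function on \<open>J \<times> \<real>\<^sup>3\<close> is a total function whose values for times outside \<open>J\<close> are never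
  used. Norms and energies take values in \<^typ>\<open>ennreal\<close>, so that they may be infinite.\<close>

text \<open>Real powers of extended nonnegative numbers, for positive exponents only.\<close>

definition epowr :: "ennreal \<Rightarrow> real \<Rightarrow> ennreal" where
  "epowr x p = (if x = \<top> then \<top> else ennreal (enn2real x powr p))"

definition Lnorm :: "real \<Rightarrow> ('a::euclidean_space \<Rightarrow> 'b::real_normed_vector) \<Rightarrow> ennreal" where
  "Lnorm p f = epowr (\<integral>\<^sup>+x. ennreal (norm (f x) powr p) \<partial>lborel) (1 / p)"

definition in_L :: "real \<Rightarrow> ('a::euclidean_space \<Rightarrow> 'b::euclidean_space) \<Rightarrow> bool" where
  "in_L p f \<longleftrightarrow> f \<in> borel_measurable borel \<and> Lnorm p f < \<top>"

definition measurable_on_strip :: "real set \<Rightarrow> (real \<Rightarrow> R3 \<Rightarrow> 'b::euclidean_space) \<Rightarrow> bool" where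
  "measurable_on_strip J u \<longleftrightarrow> set_borel_measurable lborel (J \<times> UNIV) (\<lambda>(t, x). u t x)"

text \<open>The norm of \<open>L\<^sup>q\<^sub>t L\<^sup>p\<^sub>x(J \<times> \<real>\<^sup>3)\<close> for finite \<open>q\<close>, then the space itself, then the norm for
  \<open>q = \<infinity>\<close>.\<close>

definition mixed_norm :: "real \<Rightarrow> real \<Rightarrow> real set \<Rightarrow> (real \<Rightarrow> R3 \<Rightarrow> real) \<Rightarrow> ennreal" where
  "mixed_norm q p J u = epowr (\<integral>\<^sup>+t\<in>J. epowr (Lnorm p (u t)) q \<partial>lborel) (1 / q)"

definition in_mixed_L :: "real \<Rightarrow> real \<Rightarrow> real set \<Rightarrow> (real \<Rightarrow> R3 \<Rightarrow> real) \<Rightarrow> bool" where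
  "in_mixed_L q p J u \<longleftrightarrow> measurable_on_strip J u \<and> mixed_norm q p J u < \<top>"

definition mixed_norm_infty :: "real \<Rightarrow> real set \<Rightarrow> (real \<Rightarrow> R3 \<Rightarrow> real) \<Rightarrow> ennreal" where
  "mixed_norm_infty p J u = esssup (restrict_space lborel J) (\<lambda>t. Lnorm p (u t))"

definition locally_integrable_on :: "'a::euclidean_space set \<Rightarrow> ('a \<Rightarrow> real) \<Rightarrow> bool" where
  "locally_integrable_on S u \<longleftrightarrow> (\<forall>K. compact K \<and> K \<subseteq> S \<longrightarrow> set_integrable lborel K u)"

definition partial :: "'a::euclidean_space \<Rightarrow> ('a \<Rightarrow> real) \<Rightarrow> 'a \<Rightarrow> real" where
  "partial e f x = frechet_derivative f (at x) e"

primrec Ck :: "nat \<Rightarrow> ('a::euclidean_space \<Rightarrow> real) \<Rightarrow> bool" where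
  "Ck 0 f \<longleftrightarrow> continuous_on UNIV f"
| "Ck (Suc k) f \<longleftrightarrow> f differentiable_on UNIV \<and> (\<forall>e\<in>Basis. Ck k (partial e f))"

definition test_function :: "'a::euclidean_space set \<Rightarrow> ('a \<Rightarrow> real) \<Rightarrow> bool" where
  "test_function S \<phi> \<longleftrightarrow> (\<forall>k. Ck k \<phi>) \<and> (\<exists>K. compact K \<and> K \<subseteq> S \<and> (\<forall>x. x \<notin> K \<longrightarrow> \<phi> x = 0))"

definition weak_gradient :: "(R3 \<Rightarrow> real) \<Rightarrow> (R3 \<Rightarrow> R3) \<Rightarrow> bool" where
  "weak_gradient f g \<longleftrightarrow>
     locally_integrable_on UNIV f \<and>
     (\<forall>e\<in>Basis. locally_integrable_on UNIV (\<lambda>x. g x \<bullet> e)) \<and>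
     (\<forall>\<phi>. test_function UNIV \<phi> \<longrightarrow>
        (\<forall>e\<in>Basis. (LINT x|lborel. f x * partial e \<phi> x) = - (LINT x|lborel. (g x \<bullet> e) * \<phi> x)))"

definition weak_time_derivative ::
    "(real \<times> R3) set \<Rightarrow> (real \<Rightarrow> R3 \<Rightarrow> real) \<Rightarrow> (real \<Rightarrow> R3 \<Rightarrow> real) \<Rightarrow> bool" where
  "weak_time_derivative S u u' \<longleftrightarrow>
     locally_integrable_on S (\<lambda>(t, x). u t x) \<and>
     locally_integrable_on S (\<lambda>(t, x). u' t x) \<and>
     (\<forall>\<phi>. test_function S \<phi> \<longrightarrow>
        (LINT (t, x):S|lborel. u t x * partial (1, 0) \<phi> (t, x))
          = - (LINT (t, x):S|lborel. u' t x * \<phi> (t, x)))"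

definition wave_op :: "(real \<times> R3 \<Rightarrow> real) \<Rightarrow> real \<times> R3 \<Rightarrow> real" where
  "wave_op \<phi> z = - partial (1, 0) (partial (1, 0) \<phi>) z
                 + (\<Sum>e\<in>Basis. partial (0, e) (partial (0, e) \<phi>) z)"

text \<open>\<open>- \<partial>\<^sub>t\<^sub>tu + \<Delta>u = G\<close> in the sense of distributions on the open set \<open>S\<close>; the operator is
  formally self-adjoint.\<close>

definition solves_wave ::
    "(real \<times> R3) set \<Rightarrow> (real \<Rightarrow> R3 \<Rightarrow> real) \<Rightarrow> (real \<Rightarrow> R3 \<Rightarrow> real) \<Rightarrow> bool" where
  "solves_wave S u G \<longleftrightarrow>
     locally_integrable_on S (\<lambda>(t, x). u t x) \<and>
     locally_integrable_on S (\<lambda>(t, x). G t x) \<and>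
     (\<forall>\<phi>. test_function S \<phi> \<longrightarrow>
        (LINT (t, x):S|lborel. u t x * wave_op \<phi> (t, x))
          = (LINT (t, x):S|lborel. G t x * \<phi> (t, x)))"

text \<open>In three dimensions the homogeneous Sobolev space is realised as the space of functions in
  \<open>L\<^sup>6\<close> with weak gradient in \<open>L\<^sup>2\<close> (this excludes nonzero constants). Its norm is the \<open>L\<^sup>2\<close> norm
  of the gradient. The gradient \<open>g\<close>, unique up to null sets, is carried along explicitly.\<close>

definition in_Hdot1 :: "(R3 \<Rightarrow> real) \<Rightarrow> (R3 \<Rightarrow> R3) \<Rightarrow> bool" where
  "in_Hdot1 f g \<longleftrightarrow> in_L 6 f \<and> in_L 2 g \<and> weak_gradient f g"

definition C0_L2 :: "real set \<Rightarrow> (real \<Rightarrow> R3 \<Rightarrow> 'b::euclidean_space) \<Rightarrow> bool" where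
  "C0_L2 J u \<longleftrightarrow>
     measurable_on_strip J u \<and>
     (\<forall>t\<in>J. in_L 2 (u t)) \<and>
     (\<forall>s\<in>J. ((\<lambda>t. Lnorm 2 (\<lambda>x. u t x - u s x)) \<longlongrightarrow> 0) (at s within J))"

definition C0_Hdot1 :: "real set \<Rightarrow> (real \<Rightarrow> R3 \<Rightarrow> real) \<Rightarrow> (real \<Rightarrow> R3 \<Rightarrow> R3) \<Rightarrow> bool" where
  "C0_Hdot1 J v Dv \<longleftrightarrow>
     measurable_on_strip J v \<and> (\<forall>t\<in>J. in_Hdot1 (v t) (Dv t)) \<and> C0_L2 J Dv"

text \<open>\<open>v\<close> is a solution on \<open>[a, b] \<times> \<real>\<^sup>3\<close> with spatial gradient \<open>Dv\<close> and time derivative \<open>vt\<close>.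
  The initial data \<open>(v a, vt a)\<close> are in the energy space by the continuity in time, and on a
  compact interval the local space-time integrability is global.\<close>

definition forced_nlw_solution ::
    "(real \<Rightarrow> R3 \<Rightarrow> real) \<Rightarrow> real \<Rightarrow> real \<Rightarrow>
     (real \<Rightarrow> R3 \<Rightarrow> real) \<Rightarrow> (real \<Rightarrow> R3 \<Rightarrow> R3) \<Rightarrow> (real \<Rightarrow> R3 \<Rightarrow> real) \<Rightarrow> bool" where
  "forced_nlw_solution F a b v Dv vt \<longleftrightarrow>
     C0_Hdot1 {a..b} v Dv \<and>
     C0_L2 {a..b} vt \<and>
     in_mixed_L 5 10 {a..b} v \<and>
     weak_time_derivative ({a<..<b} \<times> UNIV) v vt \<and>
     solves_wave ({a<..<b} \<times> UNIV) v (\<lambda>t x. (v t x + F t x) ^ 5)"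

text \<open>The energy at one time of a function \<open>f\<close> with gradient \<open>g\<close> and time derivative \<open>h\<close>.\<close>

definition energy :: "(R3 \<Rightarrow> real) \<Rightarrow> (R3 \<Rightarrow> R3) \<Rightarrow> (R3 \<Rightarrow> real) \<Rightarrow> ennreal" where
  "energy f g h =
     (\<integral>\<^sup>+x. ennreal (1/2 * (norm (g x))\<^sup>2 + 1/2 * \<bar>h x\<bar>\<^sup>2 + 1/6 * \<bar>f x\<bar> ^ 6) \<partial>lborel)"

end

theory Submission
  imports Defs
begin

text \<open>Put \<open>W(s) = \<integral>\<^sub>s\<^sup>\<infinity> w\<close> and multiply the equation by \<open>\<eta>(t) W(t + |x|) \<partial>\<^sub>tv\<close> with a time cutoff \<open>\<eta>\<close>. Since
  \<open>W(t + |x|)\<close> decreases along \<open>t\<close> and \<open>|x|\<close> at the same rate, differentiating it produces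
  \<open>- w(t + |x|)\<close> times \<open>1/2 |\<nabla>v|\<^sup>2 + 1/2 (\<partial>\<^sub>tv)\<^sup>2 + 1/6 v\<^sup>6 - \<partial>\<^sub>tv x/|x| \<cdot> \<nabla>v \<ge> 1/6 v\<^sup>6\<close>. Of the forcing terms,
  \<open>5 F v\<^sup>4 \<partial>\<^sub>tv = F \<partial>\<^sub>t(v\<^sup>5)\<close> is integrated by parts in time, which gives the two signed integrals and a
  boundary term controlled by Hoelder's inequality; the terms of degree at least two in \<open>F\<close> form the
  last integral.

  For solutions in the energy class the multiplication is carried out after mollifying in space-time.
  Products of derivatives of \<open>v\<close> converge in \<open>L\<^sup>1\<close>, as does \<open>\<partial>\<^sub>tv (v + F)\<^sup>5\<close>, because
  \<open>\<partial>\<^sub>tv\<close> is in \<open>L\<^sup>\<infinity>\<^sub>t L\<^sup>2\<^sub>x\<close> and \<open>(v + F)\<^sup>5\<close> in \<open>L\<^sup>1\<^sub>t L\<^sup>2\<^sub>x\<close>. The product \<open>F \<partial>\<^sub>t(v\<^sup>5)\<close> is treated with bounded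
  truncations of \<open>v\<^sup>5\<close>, because \<open>\<partial>\<^sub>tF\<close> is only locally integrable. Finally \<open>w\<close> is approximated from below
  by bounded weights supported where \<open>W\<close> is bounded below, so that integrability of \<open>W \<partial>\<^sub>tF v\<^sup>5\<close> gives that of \<open>\<partial>\<^sub>tF v\<^sup>5\<close> on the region that matters.\<close>

section \<open>Smooth bump functions\<close>

text \<open>The left side is controlled by an average, with density \<open>w\<close>, of the energy
  fluxes through the incoming cones t + |x| = const; this is why the weight and its tail appear
  together. The potential energy is not part of the differentiated quantity. The whole right side (v
  + F)^5 is treated as a source of a linear wave equation, which gives an inequality for the
  quadratic energy alone; v^6 and F v^5 enter afterwards through one product rule, used once with
  \<open>F\<close> and once with v in place of \<open>F\<close>. Thus only linear equations are
  mollified. The solution lives on a strip, and \<open>Ft\<close> is only locally integrable on the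
  open strip, so all functions are cut to a compact set and extended by zero. The mollified
  equations then hold only away from the boundary of that set, which forces the weight to have a
  smaller compact support: hence the cutoff in time and the truncation of \<open>w\<close>. The kink
  of |x| at the origin is harmless, because integration by parts is carried out along lines and
  tolerates finitely many exceptional points on each line.\<close>

lemma Ck_SucD: "Ck (Suc k) f \<Longrightarrow> Ck k f"
proof (induction k arbitrary: f)
  case 0
  then show ?case by (simp add: differentiable_imp_continuous_on)
next
  case (Suc k)
  then show ?case by (metis Ck.simps(2))
qed

lemma partial_eqI:
  assumes "(f has_derivative D) (at x)"
  shows "partial e f x = D e"
  using frechet_derivative_at[OF assms] by (simp add: partial_def)

lemma Ck_Suc_has_derivative:
  assumes "Ck (Suc k) f"
  shows "(f has_derivative (\<lambda>e. partial e f x)) (at x)"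
proof -
  have "f differentiable (at x)"
    using assms by (simp add: differentiable_on_def)
  then show ?thesis
    unfolding partial_def by (metis frechet_derivative_works eta_contract_eq)
qed

lemma Ck_const: "Ck k (\<lambda>x. c)"
proof (induction k arbitrary: c)
  case (Suc k)
  have "partial e (\<lambda>x::'a. c) = (\<lambda>x. 0)" for e
    by (rule ext) (rule partial_eqI[where D = "\<lambda>_. 0"], simp)
  then show ?case using Suc by simp
qed simp

lemma Ck_add:
  assumes "Ck k f" "Ck k g"
  shows "Ck k (\<lambda>x. f x + g x)"
  using assms
proof (induction k arbitrary: f g)
  case 0
  then show ?case by (simp add: continuous_on_add)
next
  case (Suc k)
  have "partial e (\<lambda>x. f x + g x) = (\<lambda>x. partial e f x + partial e g x)" for e
    by (rule ext, rule partial_eqI, rule has_derivative_add)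
       (rule Ck_Suc_has_derivative[OF Suc.prems(1)] Ck_Suc_has_derivative[OF Suc.prems(2)])+
  then show ?case using Suc by auto
qed

lemma Ck_mult:
  assumes "Ck k f" "Ck k g"
  shows "Ck k (\<lambda>x. f x * g x)"
  using assms
proof (induction k arbitrary: f g)
  case 0
  then show ?case by (simp add: continuous_on_mult)
next
  case (Suc k)
  have "partial e (\<lambda>x. f x * g x) = (\<lambda>x. f x * partial e g x + partial e f x * g x)" for e
    by (rule ext, rule partial_eqI, rule has_derivative_mult)
       (rule Ck_Suc_has_derivative[OF Suc.prems(1)] Ck_Suc_has_derivative[OF Suc.prems(2)])+
  moreover have "Ck k f" "Ck k g" using Suc.prems by (auto intro: Ck_SucD)
  moreover have "(\<lambda>x. f x * g x) differentiable_on UNIV"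
    using Suc.prems by (auto simp: differentiable_on_def)
  ultimately show ?case using Suc by (auto intro: Ck_add)
qed

lemma Ck_inner: "Ck k (\<lambda>x. x \<bullet> c)"
proof (cases k)
  case (Suc k)
  have "partial e (\<lambda>x. x \<bullet> c) = (\<lambda>x. e \<bullet> c)" for e
    by (rule ext) (rule partial_eqI, auto intro!: derivative_eq_intros)
  moreover have "(\<lambda>x. x \<bullet> c) differentiable_on UNIV"
    by (simp add: differentiable_on_def)
  ultimately show ?thesis using Suc by (simp add: Ck_const)
qed (simp add: continuous_on_inner)

text \<open>Distributional identities are tested with \<open>y \<mapsto> \<phi> (z - y)\<close>;
  each derivative moved from \<open>y\<close> to the kernel costs one sign.\<close>

lemma partial_reflect:
  assumes "Ck (Suc k) f"
  shows "partial e (\<lambda>y. f (z - y)) y = - partial e f (z - y)"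
proof -
  have "((\<lambda>y. f (z - y)) has_derivative (\<lambda>d. partial (- d) f (z - y))) (at y)"
    by (rule has_derivative_compose[where g = f and f = "\<lambda>y. z - y"])
       (auto intro!: derivative_eq_intros Ck_Suc_has_derivative[OF assms])
  then have "partial e (\<lambda>y. f (z - y)) y = partial (- e) f (z - y)"
    by (rule partial_eqI)
  also have "\<dots> = - partial e f (z - y)"
    by (rule linear_neg[OF has_derivative_linear[OF Ck_Suc_has_derivative[OF assms]]])
  finally show ?thesis .
qed

lemma Ck_reflect: "Ck k f \<Longrightarrow> Ck k (\<lambda>y. f (z - y))"
proof (induction k arbitrary: f)
  case 0
  then show ?case
    by (auto intro!: continuous_on_compose2[of UNIV f] continuous_intros)
next
  case (Suc k)
  have "partial e (\<lambda>y. f (z - y)) = (\<lambda>y. (-1) * partial e f (z - y))" for e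
    using partial_reflect[OF Suc.prems] by auto
  moreover have "(\<lambda>y. f (z - y)) differentiable_on UNIV"
    unfolding differentiable_on_def differentiable_def
    using has_derivative_compose[where f = "\<lambda>y. z - y" and g = f and f' = uminus]
      Ck_Suc_has_derivative[OF Suc.prems] by (fastforce intro!: derivative_eq_intros)
  moreover have "Ck k (\<lambda>y. (-1) * partial e f (z - y))" if "e \<in> Basis" for e
    by (rule Ck_mult[OF Ck_const Suc.IH]) (use that Suc.prems in simp)
  ultimately show ?case by simp
qed

text \<open>The profiles \<open>s\<^sup>-\<^sup>n exp(-1/s)\<close>, extended by zero, are closed under differentiation up to
  linear combinations.\<close>

definition bump_profile :: "nat \<Rightarrow> real \<Rightarrow> real" where
  "bump_profile n s = (if s > 0 then exp (- (1 / s)) / s ^ n else 0)"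

text \<open>With u = 1/s the profile is u^n / exp u, and u tends to infinity.\<close>

lemma bump_profile_right_limit: "(bump_profile n \<longlongrightarrow> 0) (at_right 0)"
proof -
  have "((\<lambda>s::real. (inverse s) ^ n / exp (inverse s)) \<longlongrightarrow> 0) (at_right 0)"
    using filterlim_compose[OF tendsto_power_div_exp_0 filterlim_inverse_at_top_right] by simp
  moreover have "eventually (\<lambda>s. (inverse s) ^ n / exp (inverse s) = bump_profile n s) (at_right 0)"
    by (auto simp: bump_profile_def eventually_at_right_field field_simps exp_minus intro!: exI[of _ 1])
  ultimately show ?thesis by (rule Lim_transform_eventually)
qed

lemma bump_profile_limit: "(bump_profile n \<longlongrightarrow> 0) (at 0)"
proof -
  have "(bump_profile n \<longlongrightarrow> 0) (at_left 0)"
    by (rule tendsto_eventually)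
       (auto simp: bump_profile_def eventually_at_left_field intro!: exI[of _ "-1"])
  then show ?thesis using bump_profile_right_limit by (simp add: filterlim_split_at)
qed

lemma bump_profile_deriv:
  "(bump_profile n has_real_derivative (bump_profile (n + 2) s - n * bump_profile (n + 1) s)) (at s)"
proof -
  consider "s > 0" | "s < 0" | "s = 0" by linarith
  then show ?thesis
  proof cases
    case 1
    have "((\<lambda>s. exp (- (1 / s)) / s ^ n) has_real_derivative
        (bump_profile (n + 2) s - n * bump_profile (n + 1) s)) (at s)"
      using 1
      apply (auto intro!: derivative_eq_intros simp: bump_profile_def)
      \<comment> \<open>The power rule leaves \<open>s ^ (n - 1)\<close>, whose truncated exponent
        has to be resolved.\<close>
      apply (cases n)
       apply (auto simp: field_simps power2_eq_square)
      done
    then show ?thesis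
      by (rule has_field_derivative_transform_within_open[where S = "{0<..}"])
         (use 1 in \<open>auto simp: bump_profile_def\<close>)
  next
    case 2
    have "((\<lambda>s. 0) has_real_derivative
        (bump_profile (n + 2) s - n * bump_profile (n + 1) s)) (at s)"
      using 2 by (simp add: bump_profile_def)
    then show ?thesis
      by (rule has_field_derivative_transform_within_open[where S = "{..<0}"])
         (use 2 in \<open>auto simp: bump_profile_def\<close>)
  next
    case 3
    \<comment> \<open>The difference quotient at 0 is the profile of index \<open>Suc n\<close>
      itself, so the limit 0 of every profile gives the derivative 0.\<close>
    have "((\<lambda>h. (bump_profile n (0 + h) - bump_profile n 0) / h) \<longlongrightarrow> 0) (at 0)"
      by (rule Lim_transform_eventually[OF bump_profile_limit[of "Suc n"]])
         (auto simp: bump_profile_def eventually_at_filter field_simps)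
    then show ?thesis
      using 3 by (simp add: DERIV_def bump_profile_def)
  qed
qed

text \<open>A profile of r^2 - |x|^2 is smooth at the origin as well, unlike one of r - |x|. Index 0
  becomes the mollifier; the higher indices occur in its derivatives.\<close>

definition bump :: "nat \<Rightarrow> real \<Rightarrow> 'a::euclidean_space \<Rightarrow> real" where
  "bump n r x = bump_profile n (r\<^sup>2 - x \<bullet> x)"

lemma bump_has_derivative:
  "(bump n r has_derivative
     (\<lambda>e. - 2 * (x \<bullet> e) * (bump (n + 2) r x - n * bump (n + 1) r x))) (at x)"
proof -
  have *: "((\<lambda>x. r\<^sup>2 - x \<bullet> x) has_derivative (\<lambda>e. - 2 * (x \<bullet> e))) (at x)"
    by (auto intro!: derivative_eq_intros simp: inner_commute)
  have "((\<lambda>x. bump_profile n (r\<^sup>2 - x \<bullet> x)) has_derivative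
     (\<lambda>e. - 2 * (x \<bullet> e) * (bump_profile (n + 2) (r\<^sup>2 - x \<bullet> x)
        - n * bump_profile (n + 1) (r\<^sup>2 - x \<bullet> x)))) (at x)"
    using has_derivative_compose[OF *
      bump_profile_deriv[unfolded has_field_derivative_def, of n "r\<^sup>2 - x \<bullet> x"]]
    by (simp add: mult.commute)
  then show ?thesis by (simp add: bump_def[abs_def])
qed

lemma partial_bump:
  "partial e (bump n r) =
     (\<lambda>x. (-2) * ((x \<bullet> e) * (bump (n + 2) r x + (- real n) * bump (n + 1) r x)))"
  by (rule ext, subst partial_eqI[OF bump_has_derivative]) (simp add: algebra_simps)

text \<open>The induction on \<open>k\<close> runs over all \<open>n\<close> at once, because a
  derivative combines the indices \<open>n + 1\<close> and \<open>n + 2\<close> with polynomial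
  coefficients.\<close>

lemma Ck_bump: "Ck k (bump n r :: 'a::euclidean_space \<Rightarrow> real)"
proof (induction k arbitrary: n)
  case 0
  have "bump n r differentiable (at x)" for x :: 'a
    using bump_has_derivative differentiable_def by blast
  then show ?case
    by (simp add: continuous_on_eq_continuous_at differentiable_imp_continuous_within)
next
  case (Suc k)
  have "(bump n r :: 'a \<Rightarrow> real) differentiable_on UNIV"
    unfolding differentiable_on_def using bump_has_derivative differentiable_def by blast
  then show ?case
    unfolding Ck.simps partial_bump
    by (intro conjI ballI Ck_mult[OF Ck_const] Ck_mult[OF Ck_inner] Ck_add Suc)
qed

lemma bump_nonneg: "0 \<le> bump n r x"
  by (simp add: bump_def bump_profile_def)

lemma bump_pos_iff: "0 < r \<Longrightarrow> 0 < bump n r x \<longleftrightarrow> norm x < r"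
  using power2_less_imp_less[of "norm x" r] power_strict_mono[of "norm x" r 2]
  by (auto simp: bump_def bump_profile_def power2_norm_eq_inner)

lemma bump_eq_0: "0 < r \<Longrightarrow> r \<le> norm x \<Longrightarrow> bump n r x = 0"
  using bump_pos_iff[of r n x] bump_nonneg[of n r x] by linarith

lemma partial_cmult:
  assumes "Ck (Suc 0) f"
  shows "partial e (\<lambda>x. c * f x) = (\<lambda>x. c * partial e f x)"
  by (rule ext, rule partial_eqI, rule has_derivative_mult_right, rule Ck_Suc_has_derivative[OF assms])

text \<open>The explicit second derivative is symmetric in \<open>d\<close> and \<open>e\<close>.
  The exchange is needed to identify the time derivative of the mollified gradient with the gradient
  of the mollified time derivative.\<close>

lemma partial_partial_bump_commute:
  fixes d e :: "'a::euclidean_space"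
  shows   "partial d (partial e (bump n r)) = partial e (partial d (bump n r))"
proof -
  have *: "partial d (partial e (bump n r)) x =
      (-2) * ((d \<bullet> e) * (bump (n + 2) r x + (- real n) * bump (n + 1) r x)
        + (x \<bullet> e) * ((-2) * (x \<bullet> d) * (bump (n + 4) r x - real (n + 2) * bump (n + 3) r x
          - real n * (bump (n + 3) r x - real (n + 1) * bump (n + 2) r x))))"
    for d e x :: 'a
    unfolding partial_bump[of e]
    by (rule partial_eqI)
       (auto intro!: derivative_eq_intros bump_has_derivative
         simp: algebra_simps numeral_eq_Suc)
  show ?thesis
    unfolding fun_eq_iff * by (simp add: inner_commute[of d e] algebra_simps)
qed

section \<open>Approximation in Lebesgue spaces\<close>

lemma nn_integral_lborel_shift:
  fixes f :: "'a::euclidean_space \<Rightarrow> ennreal"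
  assumes "f \<in> borel_measurable borel"
  shows "(\<integral>\<^sup>+x. f (c + x) \<partial>lborel) = (\<integral>\<^sup>+x. f x \<partial>lborel)"
proof -
  have "(\<integral>\<^sup>+x. f x \<partial>lborel) = (\<integral>\<^sup>+x. f x \<partial>distr lborel borel ((+) c))"
    by (simp add: lborel_distr_plus)
  also have "\<dots> = (\<integral>\<^sup>+x. f (c + x) \<partial>lborel)"
    by (rule nn_integral_distr) (use assms in auto)
  finally show ?thesis by simp
qed

lemma integral_lborel_shift:
  fixes f :: "'a::euclidean_space \<Rightarrow> real"
  assumes "f \<in> borel_measurable borel"
  shows "(LINT x|lborel. f (c + x)) = (LINT x|lborel. f x)"
proof -
  have "(LINT x|lborel. f x) = (LINT x|distr lborel borel ((+) c). f x)"
    by (simp add: lborel_distr_plus)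
  also have "\<dots> = (LINT x|lborel. f (c + x))"
    by (rule integral_distr) (use assms in auto)
  finally show ?thesis by simp
qed

lemma integrable_lborel_shift:
  fixes f :: "'a::euclidean_space \<Rightarrow> real"
  assumes "integrable lborel f"
  shows "integrable lborel (\<lambda>x. f (c + x))"
proof -
  have "integrable (distr lborel borel ((+) c)) f"
    using assms by (simp add: lborel_distr_plus)
  then show ?thesis
    by (subst (asm) integrable_distr_eq) (use assms in auto)
qed

lemma integrable_continuous_compact_support:
  fixes f :: "'a::euclidean_space \<Rightarrow> real"
  assumes "continuous_on UNIV f" "compact K" "\<And>x. x \<notin> K \<Longrightarrow> f x = 0"
  shows "integrable lborel f"
proof -
  have "integrable lborel (\<lambda>x. indicator K x *\<^sub>R f x)"
    using assms by (intro borel_integrable_compact) (auto intro: continuous_on_subset)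
  moreover have "(\<lambda>x. indicator K x *\<^sub>R f x) = f"
    using assms(3) by (force simp: indicator_def)
  ultimately show ?thesis by simp
qed

lemma bounded_continuous_compact_support:
  fixes f :: "'a::euclidean_space \<Rightarrow> real"
  assumes "continuous_on UNIV f" "compact K" "\<And>x. x \<notin> K \<Longrightarrow> f x = 0"
  obtains M where "0 \<le> M" "\<And>x. \<bar>f x\<bar> \<le> M"
proof -
  have "compact (f ` K)"
    using assms by (intro compact_continuous_image) (auto intro: continuous_on_subset)
  then obtain B where "\<And>x. x \<in> K \<Longrightarrow> \<bar>f x\<bar> \<le> B"
    by (meson bounded_real compact_imp_bounded imageI)
  then have "\<bar>f x\<bar> \<le> max B 0" for x
    using assms(3)[of x] by (cases "x \<in> K") force+
  then show ?thesis using that[of "max B 0"] by simp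
qed

text \<open>From |a + b| <= 2 max(|a|, |b|). This replaces Minkowski's inequality in the
  approximation arguments, so that no p-th roots occur there.\<close>

lemma abs_add_power_le:
  fixes a b :: real
  shows "\<bar>a + b\<bar> ^ p \<le> 2 ^ p * (\<bar>a\<bar> ^ p + \<bar>b\<bar> ^ p)"
proof -
  have "\<bar>a + b\<bar> ^ p \<le> (2 * max \<bar>a\<bar> \<bar>b\<bar>) ^ p"
    by (rule power_mono) auto
  also have "\<dots> \<le> 2 ^ p * (\<bar>a\<bar> ^ p + \<bar>b\<bar> ^ p)"
    by (auto simp: power_mult_distrib max_def)
  finally show ?thesis .
qed

lemma nn_integral_abs_add_power_le:
  fixes f g :: "'a \<Rightarrow> real"
  assumes [measurable]: "f \<in> borel_measurable M" "g \<in> borel_measurable M"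
  shows "(\<integral>\<^sup>+x. ennreal (\<bar>f x + g x\<bar> ^ p) \<partial>M)
    \<le> 2 ^ p * ((\<integral>\<^sup>+x. ennreal (\<bar>f x\<bar> ^ p) \<partial>M) + (\<integral>\<^sup>+x. ennreal (\<bar>g x\<bar> ^ p) \<partial>M))"
proof -
  have "(\<integral>\<^sup>+x. ennreal (\<bar>f x + g x\<bar> ^ p) \<partial>M)
      \<le> (\<integral>\<^sup>+x. 2 ^ p * (ennreal (\<bar>f x\<bar> ^ p) + ennreal (\<bar>g x\<bar> ^ p)) \<partial>M)"
  proof (rule nn_integral_mono)
    fix x
    have "ennreal (\<bar>f x + g x\<bar> ^ p) \<le> ennreal (2 ^ p * (\<bar>f x\<bar> ^ p + \<bar>g x\<bar> ^ p))"
      by (intro ennreal_leI abs_add_power_le)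
    also have "\<dots> = 2 ^ p * (ennreal (\<bar>f x\<bar> ^ p) + ennreal (\<bar>g x\<bar> ^ p))"
      by (simp add: ennreal_mult ennreal_power[symmetric])
    finally show "ennreal (\<bar>f x + g x\<bar> ^ p) \<le> 2 ^ p * (ennreal (\<bar>f x\<bar> ^ p) + ennreal (\<bar>g x\<bar> ^ p))" .
  qed
  also have "\<dots> = 2 ^ p * ((\<integral>\<^sup>+x. ennreal (\<bar>f x\<bar> ^ p) \<partial>M) + (\<integral>\<^sup>+x. ennreal (\<bar>g x\<bar> ^ p) \<partial>M))"
    by (subst nn_integral_cmult) (auto simp: nn_integral_add)
  finally show ?thesis .
qed

definition radial_cutoff :: "nat \<Rightarrow> 'a::euclidean_space \<Rightarrow> real" where
  "radial_cutoff m x = max 0 (min 1 (real m + 1 - norm x))"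

definition clip :: "real \<Rightarrow> real \<Rightarrow> real" where
  "clip m s = max (- m) (min m s)"

lemma abs_clip_le: "0 \<le> m \<Longrightarrow> \<bar>clip m s\<bar> \<le> m" "0 \<le> m \<Longrightarrow> \<bar>clip m s\<bar> \<le> \<bar>s\<bar>"
  and clip_diff_le: "0 \<le> m \<Longrightarrow> \<bar>clip m s - s\<bar> \<le> \<bar>s\<bar>"
  and continuous_clip: "continuous_on UNIV (clip m)"
  and clip_measurable [measurable]: "clip m \<in> borel_measurable borel"
proof -
  show *: "continuous_on UNIV (clip m)"
    unfolding clip_def[abs_def] by (intro continuous_intros)
  show "clip m \<in> borel_measurable borel"
    by (rule borel_measurable_continuous_onI[OF *])
qed (auto simp: clip_def)

lemma radial_cutoff_bounds: "0 \<le> radial_cutoff m x" "radial_cutoff m x \<le> 1"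
  and radial_cutoff_eq_0: "x \<notin> cball 0 (real m + 1) \<Longrightarrow> radial_cutoff m x = 0"
  and continuous_radial_cutoff: "continuous_on UNIV (radial_cutoff m :: 'a::euclidean_space \<Rightarrow> real)"
  and radial_cutoff_measurable [measurable]: "(radial_cutoff m :: 'a \<Rightarrow> real) \<in> borel_measurable borel"
proof -
  show *: "continuous_on UNIV (radial_cutoff m :: 'a \<Rightarrow> real)"
    unfolding radial_cutoff_def[abs_def] by (intro continuous_intros)
  show "(radial_cutoff m :: 'a \<Rightarrow> real) \<in> borel_measurable borel"
    by (rule borel_measurable_continuous_onI[OF *])
qed (auto simp: radial_cutoff_def)

lemma clip_radial_cutoff_eventually:
  "eventually (\<lambda>m. clip (real m) s * radial_cutoff m x = s) sequentially"
proof -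
  have "eventually (\<lambda>m. max \<bar>s\<bar> (norm x) \<le> real m) sequentially"
    using filterlim_at_top filterlim_real_sequentially by blast
  then show ?thesis
    by eventually_elim (auto simp: clip_def radial_cutoff_def min_def max_def abs_if split: if_splits)
qed

text \<open>Clipping and cutting only move values towards 0, so the error is dominated by |f|^p, and
  at each point it is eventually 0.\<close>

lemma Lp_approx_truncated:
  fixes f :: "'a::euclidean_space \<Rightarrow> real"
  assumes [measurable]: "f \<in> borel_measurable borel"
    and fin: "(\<integral>\<^sup>+x. ennreal (\<bar>f x\<bar> ^ p) \<partial>lborel) < \<infinity>" and "p > 0" "\<epsilon> > 0"
  obtains m where "(\<integral>\<^sup>+x. ennreal (\<bar>clip (real m) (f x) * radial_cutoff m x - f x\<bar> ^ p) \<partial>lborel) < \<epsilon>"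
proof -
  have "(\<lambda>m. \<integral>\<^sup>+x. ennreal (\<bar>clip (real m) (f x) * radial_cutoff m x - f x\<bar> ^ p) \<partial>lborel)
      \<longlonglongrightarrow> (\<integral>\<^sup>+x. 0 \<partial>(lborel :: 'a measure))"
  proof (rule nn_integral_dominated_convergence)
    show "(\<integral>\<^sup>+x. ennreal (\<bar>f x\<bar> ^ p) \<partial>lborel) < \<infinity>" by fact
    show "AE x in lborel. ennreal (\<bar>clip (real m) (f x) * radial_cutoff m x - f x\<bar> ^ p)
        \<le> ennreal (\<bar>f x\<bar> ^ p)" for m
    proof (intro AE_I2 ennreal_leI power_mono)
      fix x
      have "\<bar>clip (real m) (f x) * radial_cutoff m x - f x\<bar> \<le> \<bar>f x\<bar>"
      proof (cases "f x \<ge> 0")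
        case True
        then have "0 \<le> clip (real m) (f x)" "clip (real m) (f x) \<le> f x" by (auto simp: clip_def)
        moreover from this have "0 \<le> clip (real m) (f x) * radial_cutoff m x"
          "clip (real m) (f x) * radial_cutoff m x \<le> clip (real m) (f x)"
          using radial_cutoff_bounds[of m x] by (auto intro: mult_right_le_one_le)
        ultimately show ?thesis by linarith
      next
        case False
        then have "0 \<le> - clip (real m) (f x)" "- clip (real m) (f x) \<le> - f x" by (auto simp: clip_def)
        moreover from this have "0 \<le> - clip (real m) (f x) * radial_cutoff m x"
          "- clip (real m) (f x) * radial_cutoff m x \<le> - clip (real m) (f x)"
          using radial_cutoff_bounds[of m x] by (intro mult_nonneg_nonneg mult_right_le_one_le; simp)+
        ultimately show ?thesis by linarith
      qed
      then show "\<bar>clip (real m) (f x) * radial_cutoff m x - f x\<bar> \<le> \<bar>f x\<bar>" .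
    qed simp
    show "AE x in lborel. (\<lambda>m. ennreal (\<bar>clip (real m) (f x) * radial_cutoff m x - f x\<bar> ^ p)) \<longlonglongrightarrow> 0"
    proof (intro AE_I2 tendsto_eventually)
      fix x
      show "eventually (\<lambda>m. ennreal (\<bar>clip (real m) (f x) * radial_cutoff m x - f x\<bar> ^ p) = 0) sequentially"
        using clip_radial_cutoff_eventually[of "f x" x] by eventually_elim (use \<open>p > 0\<close> in simp)
    qed
  qed auto
  then have "eventually (\<lambda>m. (\<integral>\<^sup>+x. ennreal (\<bar>clip (real m) (f x) * radial_cutoff m x - f x\<bar> ^ p) \<partial>lborel) < \<epsilon>) sequentially"
    using \<open>\<epsilon> > 0\<close> by (auto intro: order_tendstoD(2))
  then show ?thesis
    using that by (auto simp: eventually_sequentially)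
qed

text \<open>A Borel function is Lebesgue measurable, which yields \<open>measurable_on\<close>,
  whose definition supplies continuous approximants outside a negligible set. This serves twice: for
  density in L^p and, later, to replace the weight \<open>w\<close> by continuous ones.\<close>

lemma borel_AE_limit_continuous:
  fixes f :: "'a::euclidean_space \<Rightarrow> real"
  assumes "f \<in> borel_measurable borel"
  obtains g where "\<And>n::nat. continuous_on UNIV (g n)" "AE x in lborel. (\<lambda>n. g n x) \<longlonglongrightarrow> f x"
proof -
  have "f \<in> borel_measurable lebesgue"
    using assms by (simp add: measurable_completion)
  then have "f measurable_on UNIV"
    by (rule lebesgue_measurable_imp_measurable_on_real) simp
  then obtain N g where N: "negligible N" and g: "\<And>n. continuous_on UNIV (g n)"
    and lim: "\<And>x. x \<notin> N \<Longrightarrow> (\<lambda>n::nat. g n x) \<longlonglongrightarrow> f x"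
    unfolding measurable_on_def by auto
  from N have "AE x in lebesgue. x \<notin> N"
    by (simp add: negligible_iff_null_sets AE_not_in)
  then have "AE x in lborel. x \<notin> N"
    by (simp add: AE_completion_iff)
  then have "AE x in lborel. (\<lambda>n. g n x) \<longlonglongrightarrow> f x"
    by eventually_elim (rule lim)
  then show ?thesis using that g by blast
qed

text \<open>After truncating \<open>f\<close>, the same clip and cutoff are applied to continuous
  approximants. These converge almost everywhere to the truncation and are dominated by a constant
  on a fixed ball.\<close>

lemma Lp_approx_continuous:
  fixes f :: "'a::euclidean_space \<Rightarrow> real"
  assumes [measurable]: "f \<in> borel_measurable borel"
    and fin: "(\<integral>\<^sup>+x. ennreal (\<bar>f x\<bar> ^ p) \<partial>lborel) < \<infinity>" and "p > 0" "\<epsilon> > 0"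
  obtains g R where "continuous_on UNIV g" "\<And>x. x \<notin> cball 0 R \<Longrightarrow> g x = 0" "R > 0"
    "(\<integral>\<^sup>+x. ennreal (\<bar>f x - g x\<bar> ^ p) \<partial>lborel) < \<epsilon>"
proof -
  \<comment> \<open>Two errors of size \<delta> are added, and the sum is multiplied by 2^p.\<close>
  define \<delta> where "\<delta> = (if \<epsilon> = \<top> then 1 else \<epsilon> / (2 * 2 ^ p))"
  have pos: "\<delta> > 0"
    using \<open>\<epsilon> > 0\<close> unfolding \<delta>_def
    by (auto simp: ennreal_zero_less_divide ennreal_mult_less_top power_less_top_ennreal)
  have \<delta>: "2 ^ p * (\<delta> + \<delta>) \<le> \<epsilon>"
  proof (cases "\<epsilon> = \<top>")
    case False
    then obtain r where "\<epsilon> = ennreal r" "r \<ge> 0" by (cases \<epsilon>) auto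
    then have "\<delta> = ennreal (r / (2 * 2 ^ p))"
      using False by (simp add: \<delta>_def divide_ennreal[symmetric] ennreal_mult ennreal_power[symmetric])
    define q where "q = r / (2 * 2 ^ p)"
    have q: "\<delta> = ennreal q" "q \<ge> 0" "2 ^ p * (q + q) = r"
      using \<open>r \<ge> 0\<close> \<open>\<delta> = ennreal (r / (2 * 2 ^ p))\<close> by (simp_all add: q_def)
    have "(2::ennreal) ^ p = ennreal (2 ^ p)" by (simp add: ennreal_power[symmetric])
    then have "2 ^ p * (\<delta> + \<delta>) = ennreal (2 ^ p * (q + q))"
      unfolding q(1) using q(2) by (simp only: ennreal_mult ennreal_plus add_nonneg_nonneg zero_le_power zero_le_numeral)
    then show ?thesis using \<open>\<epsilon> = ennreal r\<close> q(3) by simp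
  qed simp
  obtain m where m: "(\<integral>\<^sup>+x. ennreal (\<bar>clip (real m) (f x) * radial_cutoff m x - f x\<bar> ^ p) \<partial>lborel) < \<delta>"
    using Lp_approx_truncated[OF assms(1) fin \<open>p > 0\<close> pos] by blast
  obtain g where g: "\<And>n::nat. continuous_on UNIV (g n)" and lim: "AE x in lborel. (\<lambda>n. g n x) \<longlonglongrightarrow> f x"
    using borel_AE_limit_continuous[OF assms(1)] by blast
  have [measurable]: "g n \<in> borel_measurable borel" for n
    using g by (simp add: borel_measurable_continuous_onI)
  define h where "h n x = clip (real m) (g n x) * radial_cutoff m x" for n and x :: 'a
  have [measurable]: "h n \<in> borel_measurable borel" for n
    unfolding h_def by measurable
  have [measurable]: "cball (0::'a) (real m + 1) \<in> sets borel" by simp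
  have "(\<lambda>n. \<integral>\<^sup>+x. ennreal (\<bar>h n x - clip (real m) (f x) * radial_cutoff m x\<bar> ^ p) \<partial>lborel)
      \<longlonglongrightarrow> (\<integral>\<^sup>+x. 0 \<partial>(lborel :: 'a measure))"
  proof (rule nn_integral_dominated_convergence)
    let ?w = "\<lambda>x::'a. ennreal ((2 * real m) ^ p) * indicator (cball 0 (real m + 1)) x"
    have "emeasure lborel (cball (0::'a) (real m + 1)) < \<infinity>"
      by (rule emeasure_lborel_cball_finite)
    then show "(\<integral>\<^sup>+x. ?w x \<partial>lborel) < \<infinity>"
      by (simp add: nn_integral_cmult_indicator ennreal_mult_less_top)
    show "AE x in lborel. ennreal (\<bar>h n x - clip (real m) (f x) * radial_cutoff m x\<bar> ^ p) \<le> ?w x" for n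
    proof (intro AE_I2)
      fix x :: 'a
      show "ennreal (\<bar>h n x - clip (real m) (f x) * radial_cutoff m x\<bar> ^ p) \<le> ?w x"
      proof (cases "x \<in> cball 0 (real m + 1)")
        case True
        have "\<bar>(clip (real m) (g n x) - clip (real m) (f x)) * radial_cutoff m x\<bar> \<le> 2 * real m * 1"
          unfolding abs_mult
        proof (rule mult_mono)
          show "\<bar>clip (real m) (g n x) - clip (real m) (f x)\<bar> \<le> 2 * real m"
            using abs_clip_le(1)[of "real m" "g n x"] abs_clip_le(1)[of "real m" "f x"] by linarith
        qed (use radial_cutoff_bounds[of m x] in auto)
        then have "\<bar>h n x - clip (real m) (f x) * radial_cutoff m x\<bar> ^ p \<le> (2 * real m) ^ p"
          by (intro power_mono) (auto simp: h_def left_diff_distrib)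
        then show ?thesis
          using True by (simp add: ennreal_leI del: power_mult_distrib)
      next
        case False
        then show ?thesis using radial_cutoff_eq_0[OF False] \<open>p > 0\<close> by (simp add: h_def)
      qed
    qed
    show "AE x in lborel. (\<lambda>n. ennreal (\<bar>h n x - clip (real m) (f x) * radial_cutoff m x\<bar> ^ p)) \<longlonglongrightarrow> 0"
      using lim
    proof eventually_elim
      fix x assume "(\<lambda>n. g n x) \<longlonglongrightarrow> f x"
      then have "(\<lambda>n. clip (real m) (g n x)) \<longlonglongrightarrow> clip (real m) (f x)"
        by (intro continuous_on_tendsto_compose[OF continuous_clip]) auto
      then have "(\<lambda>n. \<bar>h n x - clip (real m) (f x) * radial_cutoff m x\<bar> ^ p) \<longlonglongrightarrow>
          \<bar>clip (real m) (f x) * radial_cutoff m x - clip (real m) (f x) * radial_cutoff m x\<bar> ^ p"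
        unfolding h_def by (intro tendsto_intros)
      then have "(\<lambda>n. \<bar>h n x - clip (real m) (f x) * radial_cutoff m x\<bar> ^ p) \<longlonglongrightarrow> 0"
        by (simp only: diff_self abs_zero zero_power[OF \<open>p > 0\<close>])
      then show "(\<lambda>n. ennreal (\<bar>h n x - clip (real m) (f x) * radial_cutoff m x\<bar> ^ p)) \<longlonglongrightarrow> 0"
        using tendsto_ennrealI by fastforce
    qed
  qed measurable
  then have "eventually (\<lambda>n. (\<integral>\<^sup>+x. ennreal (\<bar>h n x - clip (real m) (f x) * radial_cutoff m x\<bar> ^ p) \<partial>lborel) < \<delta>) sequentially"
    using pos by (auto intro: order_tendstoD(2))
  then obtain n where n: "(\<integral>\<^sup>+x. ennreal (\<bar>h n x - clip (real m) (f x) * radial_cutoff m x\<bar> ^ p) \<partial>lborel) < \<delta>"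
    by (auto simp: eventually_sequentially)
  have two_p: "0 < (2::ennreal) ^ p"
    using ennreal_power[of 2 p] by (metis ennreal_less_zero_iff ennreal_numeral zero_le_numeral zero_less_numeral zero_less_power)
  let ?k = "\<lambda>x. clip (real m) (f x) * radial_cutoff m x"
  have "(\<integral>\<^sup>+x. ennreal (\<bar>(h n x - ?k x) + (?k x - f x)\<bar> ^ p) \<partial>lborel)
    \<le> 2 ^ p * ((\<integral>\<^sup>+x. ennreal (\<bar>h n x - ?k x\<bar> ^ p) \<partial>lborel) + (\<integral>\<^sup>+x. ennreal (\<bar>?k x - f x\<bar> ^ p) \<partial>lborel))"
    by (rule nn_integral_abs_add_power_le) auto
  also have "\<dots> < 2 ^ p * (\<delta> + \<delta>)"
    using m n two_p
    by (intro ennreal_mult_strict_left_mono add_strict_mono) (auto simp: power_less_top_ennreal)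
  also note \<delta>
  finally have "(\<integral>\<^sup>+x. ennreal (\<bar>f x - h n x\<bar> ^ p) \<partial>lborel) < \<epsilon>"
    by (simp add: abs_minus_commute)
  moreover have "continuous_on UNIV (h n)"
    unfolding h_def
    by (intro continuous_intros continuous_on_compose2[OF continuous_clip g] continuous_radial_cutoff) auto
  ultimately show ?thesis
    using that[of "h n" "real m + 1"] radial_cutoff_eq_0 by (auto simp: h_def)
qed

section \<open>Convolution and mollifiers\<close>

lemma uniformly_continuous_compact_support:
  fixes g :: "'a::euclidean_space \<Rightarrow> real"
  assumes g: "continuous_on UNIV g" "\<And>x. x \<notin> cball 0 R \<Longrightarrow> g x = 0" and "\<eta> > 0"
  obtains d where "d > 0" "d \<le> 1" "\<And>x h. norm h < d \<Longrightarrow> \<bar>g (h + x) - g x\<bar> < \<eta>"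
proof -
  \<comment> \<open>The radius \<open>R + 1\<close> leaves room: a shift shorter than 1 with an
    endpoint outside this ball has both endpoints outside \<open>cball 0 R\<close>, where
    \<open>g\<close> vanishes.\<close>
  have "uniformly_continuous_on (cball 0 (R + 1)) g"
    using g by (intro compact_uniformly_continuous) (auto intro: continuous_on_subset)
  then obtain d where d: "d > 0" "\<And>x x'. x \<in> cball 0 (R + 1) \<Longrightarrow> x' \<in> cball 0 (R + 1) \<Longrightarrow>
      dist x' x < d \<Longrightarrow> dist (g x') (g x) < \<eta>"
    using \<open>\<eta> > 0\<close> unfolding uniformly_continuous_on_def by metis
  have "\<bar>g (h + x) - g x\<bar> < \<eta>" if h: "norm h < min d 1" for x h
  proof (cases "x \<in> cball 0 (R + 1) \<and> h + x \<in> cball 0 (R + 1)")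
    case True
    then show ?thesis using d(2)[of x "h + x"] h by (simp add: dist_norm)
  next
    case False
    moreover have "norm x \<le> norm (h + x) + norm h" "norm (h + x) \<le> norm h + norm x"
      using norm_triangle_ineq4[of "h + x" h] norm_triangle_ineq[of h x] by auto
    ultimately have "x \<notin> cball 0 R \<and> h + x \<notin> cball 0 R"
      using h by auto
    then show ?thesis using g(2) \<open>\<eta> > 0\<close> by simp
  qed
  then show ?thesis using d(1) that[of "min d 1"] by auto
qed

lemma Lp_translation_continuous:
  fixes f :: "'a::euclidean_space \<Rightarrow> real" and \<epsilon> :: real
  assumes [measurable]: "f \<in> borel_measurable borel"
    and fin: "(\<integral>\<^sup>+x. ennreal (\<bar>f x\<bar> ^ p) \<partial>lborel) < \<infinity>" and "p > 0" "\<epsilon> > 0"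
  obtains d where "d > 0"
    "\<And>h. norm h < d \<Longrightarrow> (\<integral>\<^sup>+x. ennreal (\<bar>f (h + x) - f x\<bar> ^ p) \<partial>lborel) \<le> ennreal \<epsilon>"
proof -
  \<comment> \<open>Splitting into three pieces by two uses of the 2^p inequality costs 2^p
    (\<delta> + 2^p (2 \<delta>)), which is at most 3 * 4^p * \<delta>.\<close>
  define \<delta> where "\<delta> = \<epsilon> / (3 * 4 ^ p)"
  have "\<delta> > 0" using \<open>\<epsilon> > 0\<close> by (simp add: \<delta>_def)
  obtain g R where g: "continuous_on UNIV g" "\<And>x. x \<notin> cball 0 R \<Longrightarrow> g x = 0" "R > 0"
    and fg: "(\<integral>\<^sup>+x. ennreal (\<bar>f x - g x\<bar> ^ p) \<partial>lborel) < ennreal \<delta>"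
    using Lp_approx_continuous[OF assms(1) fin \<open>p > 0\<close>, of "ennreal \<delta>"] \<open>\<delta> > 0\<close> by auto
  have [measurable]: "g \<in> borel_measurable borel"
    using g(1) by (rule borel_measurable_continuous_onI)
  define V where "V = measure lborel (cball (0::'a) (R + 1))"
  have "V \<ge> 0" by (simp add: V_def)
  have V: "emeasure lborel (cball (0::'a) (R + 1)) = ennreal V"
    unfolding V_def by (rule emeasure_eq_ennreal_measure) (use emeasure_lborel_cball_finite[of "0::'a" "R+1"] in auto)
  \<comment> \<open>Capping \<eta> at 1 gives \<eta>^p <= \<eta>, hence a total error of at most
    \<delta> on a ball of volume \<open>V\<close>.\<close>
  define \<eta> where "\<eta> = min 1 (\<delta> / (V + 1))"
  have \<eta>: "0 < \<eta>" "\<eta> ^ p * V \<le> \<delta>"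
  proof -
    show "0 < \<eta>" using \<open>\<delta> > 0\<close> \<open>V \<ge> 0\<close> by (simp add: \<eta>_def)
    have "\<eta> ^ p \<le> \<eta> ^ 1"
      using \<open>0 < \<eta>\<close> \<open>p > 0\<close> by (intro power_decreasing) (auto simp: \<eta>_def)
    then have "\<eta> ^ p * V \<le> \<delta> / (V + 1) * V"
      using \<open>V \<ge> 0\<close> by (intro mult_right_mono) (auto simp: \<eta>_def)
    also have "\<dots> \<le> \<delta>" using \<open>V \<ge> 0\<close> \<open>\<delta> > 0\<close> by (simp add: field_simps)
    finally show "\<eta> ^ p * V \<le> \<delta>" .
  qed
  obtain d where d: "d > 0" "d \<le> 1" "\<And>x h. norm h < d \<Longrightarrow> \<bar>g (h + x) - g x\<bar> < \<eta>"
    using uniformly_continuous_compact_support[OF g(1) g(2) \<eta>(1)] by blast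
  have "(\<integral>\<^sup>+x. ennreal (\<bar>f (h + x) - f x\<bar> ^ p) \<partial>lborel) \<le> ennreal \<epsilon>" if h: "norm h < d" for h
  proof -
    let ?I = "\<lambda>u. (\<integral>\<^sup>+x. ennreal (\<bar>u x\<bar> ^ p) \<partial>(lborel :: 'a measure))"
    have g_part: "?I (\<lambda>x. g (h + x) - g x) \<le> ennreal \<delta>"
    proof -
      have "?I (\<lambda>x. g (h + x) - g x) \<le> (\<integral>\<^sup>+x. ennreal (\<eta> ^ p) * indicator (cball 0 (R + 1)) x \<partial>(lborel :: 'a measure))"
      proof (rule nn_integral_mono)
        fix x :: 'a
        show "ennreal (\<bar>g (h + x) - g x\<bar> ^ p) \<le> ennreal (\<eta> ^ p) * indicator (cball 0 (R + 1)) x"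
        proof (cases "x \<in> cball 0 (R + 1)")
          case True
          then show ?thesis using d(3)[OF h, of x] by (auto intro!: ennreal_leI power_mono)
        next
          case False
          have "norm x \<le> norm (h + x) + norm h"
            using norm_triangle_ineq4[of "h + x" h] by auto
          then have "g (h + x) = 0" "g x = 0" using False h d(2) by (auto intro!: g(2))
          then show ?thesis using \<open>p > 0\<close> by (simp add: zero_power)
        qed
      qed
      also have "\<dots> = ennreal (\<eta> ^ p * V)"
        using \<eta>(1) \<open>V \<ge> 0\<close> by (simp add: nn_integral_cmult_indicator V ennreal_mult)
      finally show ?thesis using \<eta>(2) by (meson ennreal_leI order_trans)
    qed
    have two_p: "(2::ennreal) ^ p = ennreal (2 ^ p)" by (simp add: ennreal_power[symmetric])
    have fg1: "?I (\<lambda>x. f (h + x) - g (h + x)) < ennreal \<delta>"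
      using fg nn_integral_lborel_shift[of "\<lambda>x. ennreal (\<bar>f x - g x\<bar> ^ p)" h] by simp
    have fg2: "?I (\<lambda>x. g x - f x) < ennreal \<delta>"
      using fg by (simp add: abs_minus_commute)
    have "?I (\<lambda>x. (f (h + x) - g (h + x)) + ((g (h + x) - g x) + (g x - f x)))
        \<le> 2 ^ p * (?I (\<lambda>x. f (h + x) - g (h + x)) + ?I (\<lambda>x. (g (h + x) - g x) + (g x - f x)))"
      by (rule nn_integral_abs_add_power_le) auto
    also have "\<dots> \<le> 2 ^ p * (?I (\<lambda>x. f (h + x) - g (h + x))
        + 2 ^ p * (?I (\<lambda>x. g (h + x) - g x) + ?I (\<lambda>x. g x - f x)))"
      by (intro mult_left_mono add_left_mono nn_integral_abs_add_power_le) auto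
    also have "\<dots> \<le> 2 ^ p * (ennreal \<delta> + 2 ^ p * (ennreal \<delta> + ennreal \<delta>))"
      using fg1 fg2 g_part by (intro mult_left_mono add_mono) auto
    also have "\<dots> = ennreal (2 ^ p * (\<delta> + 2 ^ p * (\<delta> + \<delta>)))"
      using \<open>\<delta> > 0\<close> unfolding two_p
      by (simp only: ennreal_mult ennreal_plus add_nonneg_nonneg mult_nonneg_nonneg zero_le_power
          zero_le_numeral less_imp_le)
    also have "\<dots> \<le> ennreal \<epsilon>"
    proof (rule ennreal_leI)
      have "(2::real) ^ p * (\<delta> + 2 ^ p * (\<delta> + \<delta>)) \<le> 2 ^ p * (2 ^ p * \<delta> + 2 ^ p * (\<delta> + \<delta>))"
        using \<open>\<delta> > 0\<close> by (intro mult_left_mono add_right_mono) auto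
      also have "\<dots> = 3 * (2 ^ p * 2 ^ p) * \<delta>" by (simp add: algebra_simps)
      also have "\<dots> = \<epsilon>" unfolding \<delta>_def power_mult_distrib[symmetric] by simp
      finally show "2 ^ p * (\<delta> + 2 ^ p * (\<delta> + \<delta>)) \<le> \<epsilon>" .
    qed
    finally show ?thesis by simp
  qed
  then show ?thesis using d(1) that by blast
qed

text \<open>The kernel is evaluated at \<open>z - y\<close>, so that derivatives in \<open>z\<close>
  fall on \<phi> and \<open>f\<close> need only be integrable.\<close>

definition conv :: "('a::euclidean_space \<Rightarrow> real) \<Rightarrow> ('a \<Rightarrow> real) \<Rightarrow> 'a \<Rightarrow> real" where
  "conv \<phi> f z = (LINT y|lborel. \<phi> (z - y) * f y)"

lemma integrable_conv:
  fixes \<phi> :: "'a::euclidean_space \<Rightarrow> real"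
  assumes "\<phi> \<in> borel_measurable borel" "\<And>x. \<bar>\<phi> x\<bar> \<le> M" "integrable lborel f"
  shows "integrable lborel (\<lambda>y. \<phi> (z - y) * f y)"
proof (rule Bochner_Integration.integrable_bound)
  show "integrable lborel (\<lambda>y. M * \<bar>f y\<bar>)" using assms(3) by auto
  show "AE y in lborel. norm (\<phi> (z - y) * f y) \<le> norm (M * \<bar>f y\<bar>)"
    using assms(2) by (intro AE_I2) (simp add: abs_mult mult_right_mono order_trans[OF _ abs_ge_self])
  show "(\<lambda>y. \<phi> (z - y) * f y) \<in> borel_measurable lborel"
    using assms(1,3) by measurable
qed

lemma continuous_conv:
  fixes \<phi> :: "'a::euclidean_space \<Rightarrow> real"
  assumes "continuous_on UNIV \<phi>" "\<And>x. \<bar>\<phi> x\<bar> \<le> M" "integrable lborel f"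
  shows "continuous_on UNIV (conv \<phi> f)"
proof -
  have [measurable]: "\<phi> \<in> borel_measurable borel"
    using assms(1) by (rule borel_measurable_continuous_onI)
  have [measurable]: "f \<in> borel_measurable borel" using assms(3) by auto
  have "(\<lambda>n. conv \<phi> f (X n)) \<longlonglongrightarrow> conv \<phi> f z" if "X \<longlonglongrightarrow> z" for X z
    unfolding conv_def
  proof (rule integral_dominated_convergence)
    show "integrable lborel (\<lambda>y. M * \<bar>f y\<bar>)" using assms(3) by auto
    show "AE y in lborel. norm (\<phi> (X n - y) * f y) \<le> M * \<bar>f y\<bar>" for n
      using assms(2) by (intro AE_I2) (simp add: abs_mult mult_right_mono)
    show "AE y in lborel. (\<lambda>n. \<phi> (X n - y) * f y) \<longlonglongrightarrow> \<phi> (z - y) * f y"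
      by (intro AE_I2 tendsto_mult tendsto_const continuous_on_tendsto_compose[OF assms(1)] tendsto_diff that) auto
  qed measurable
  then show ?thesis
    by (auto simp: continuous_on_sequentially o_def)
qed

text \<open>The mean value theorem bounds the difference quotients of the kernel by
  \<open>M\<close>, so M |f| dominates those of the convolution. Only derivatives along a line are
  recorded, because the later integration by parts works line by line.\<close>

lemma conv_has_real_derivative:
  assumes \<phi>: "\<And>x. (\<phi> has_derivative (\<lambda>e. partial e \<phi> x)) (at x)" "\<And>x. \<bar>\<phi> x\<bar> \<le> B"
    and d\<phi>: "partial e \<phi> \<in> borel_measurable borel" "\<And>x. \<bar>partial e \<phi> x\<bar> \<le> M"
    and f: "integrable lborel f"
  shows "((\<lambda>s. conv \<phi> f (z + s *\<^sub>R e)) has_real_derivative conv (partial e \<phi>) f (z + s *\<^sub>R e)) (at s)"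
proof -
  have "continuous_on UNIV \<phi>"
    by (intro continuous_at_imp_continuous_on ballI has_derivative_continuous[OF \<phi>(1)])
  then have [measurable]: "\<phi> \<in> borel_measurable borel" by (rule borel_measurable_continuous_onI)
  note [measurable] = d\<phi>(1)
  have [measurable]: "f \<in> borel_measurable borel" using f by auto
  have line: "((\<lambda>s. \<phi> (x + s *\<^sub>R e)) has_real_derivative partial e \<phi> (x + s *\<^sub>R e)) (at s)" for x s
  proof -
    have "((\<lambda>s. \<phi> (x + s *\<^sub>R e)) has_derivative (\<lambda>h. partial (h *\<^sub>R e) \<phi> (x + s *\<^sub>R e))) (at s)"
      by (rule has_derivative_compose[OF _ \<phi>(1)]) (auto intro!: derivative_eq_intros)
    moreover have "partial (h *\<^sub>R e) \<phi> y = h * partial e \<phi> y" for h y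
      using linear_scale[OF has_derivative_linear[OF \<phi>(1)[of y]], of h e] by simp
    ultimately show ?thesis
      by (simp add: has_field_derivative_def mult.commute[of _ "partial e \<phi> _"])
  qed
  have quot: "\<bar>\<phi> (x + h *\<^sub>R e) - \<phi> x\<bar> \<le> M * \<bar>h\<bar>" for x h
    using field_differentiable_bound[of UNIV "\<lambda>s. \<phi> (x + s *\<^sub>R e)" "\<lambda>s. partial e \<phi> (x + s *\<^sub>R e)" M h 0]
      line d\<phi>(2) by simp
  define c where "c = z + s *\<^sub>R e"
  have "((\<lambda>h. (conv \<phi> f (c + h *\<^sub>R e) - conv \<phi> f c) / h) \<longlongrightarrow> conv (partial e \<phi>) f c) (at 0)"
    unfolding tendsto_at_iff_sequentially o_def
  proof (intro allI impI)
    fix X :: "nat \<Rightarrow> real" assume X: "\<forall>i. X i \<in> UNIV - {0}" "X \<longlonglongrightarrow> 0"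
    have eq: "(conv \<phi> f (c + X i *\<^sub>R e) - conv \<phi> f c) / X i
        = (LINT y|lborel. (\<phi> (c - y + X i *\<^sub>R e) - \<phi> (c - y)) / X i * f y)" for i
    proof -
      have "conv \<phi> f (c + X i *\<^sub>R e) - conv \<phi> f c
          = (LINT y|lborel. \<phi> (c + X i *\<^sub>R e - y) * f y - \<phi> (c - y) * f y)"
        unfolding conv_def
        by (rule Bochner_Integration.integral_diff[symmetric]; rule integrable_conv[OF _ \<phi>(2) f]) auto
      then show ?thesis
        by (simp add: algebra_simps diff_divide_distrib flip: integral_divide_zero)
    qed
    have "(\<lambda>i. LINT y|lborel. (\<phi> (c - y + X i *\<^sub>R e) - \<phi> (c - y)) / X i * f y)
        \<longlonglongrightarrow> (LINT y|lborel. partial e \<phi> (c - y) * f y)"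
    proof (rule integral_dominated_convergence)
      show "integrable lborel (\<lambda>y. M * \<bar>f y\<bar>)" using f by auto
      show "AE y in lborel. norm ((\<phi> (c - y + X i *\<^sub>R e) - \<phi> (c - y)) / X i * f y) \<le> M * \<bar>f y\<bar>" for i
      proof (rule AE_I2)
        fix y
        have "\<bar>(\<phi> (c - y + X i *\<^sub>R e) - \<phi> (c - y)) / X i\<bar> \<le> M"
          using quot[of "c - y" "X i"] X(1) by (simp add: abs_divide divide_le_eq)
        then show "norm ((\<phi> (c - y + X i *\<^sub>R e) - \<phi> (c - y)) / X i * f y) \<le> M * \<bar>f y\<bar>"
          unfolding real_norm_def abs_mult[of _ "f y"] by (rule mult_right_mono) simp
      qed
      show "AE y in lborel. (\<lambda>i. (\<phi> (c - y + X i *\<^sub>R e) - \<phi> (c - y)) / X i * f y) \<longlonglongrightarrow> partial e \<phi> (c - y) * f y"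
      proof (intro AE_I2 tendsto_mult tendsto_const)
        fix y
        have "((\<lambda>h. (\<phi> (c - y + h *\<^sub>R e) - \<phi> (c - y)) / h) \<longlongrightarrow> partial e \<phi> (c - y)) (at 0)"
          using line[of "c - y" 0] by (simp add: DERIV_def)
        then show "(\<lambda>i. (\<phi> (c - y + X i *\<^sub>R e) - \<phi> (c - y)) / X i) \<longlonglongrightarrow> partial e \<phi> (c - y)"
          using X unfolding tendsto_at_iff_sequentially o_def by blast
      qed
    qed measurable
    then show "(\<lambda>i. (conv \<phi> f (c + X i *\<^sub>R e) - conv \<phi> f c) / X i) \<longlonglongrightarrow> conv (partial e \<phi>) f c"
      unfolding eq by (simp add: conv_def)
  qed
  then show ?thesis
    by (simp add: DERIV_def c_def algebra_simps)
qed

text \<open>These are the properties on which convergence in L^p rests; differentiability is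
  supplied separately by \<open>test_function\<close>. The mass is stated as an extended integral so
  that it enters Tonelli arguments directly.\<close>

locale mollifier =
  fixes \<rho> :: "'a::euclidean_space \<Rightarrow> real" and r :: real
  assumes continuous: "continuous_on UNIV \<rho>"
    and nonneg: "0 \<le> \<rho> x"
    and support: "r \<le> norm x \<Longrightarrow> \<rho> x = 0"
    and even: "\<rho> (- x) = \<rho> x"
    and total: "(\<integral>\<^sup>+x. ennreal (\<rho> x) \<partial>lborel) = 1"
begin

lemma borel [measurable]: "\<rho> \<in> borel_measurable borel"
  using continuous by (rule borel_measurable_continuous_onI)

lemma minus_commute: "\<rho> (x - y) = \<rho> (y - x)"
  using even[of "x - y"] by simp

lemma bounded_abs:
  obtains M where "0 \<le> M" "\<And>x. \<bar>\<rho> x\<bar> \<le> M"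
proof -
  have "\<rho> x = 0" if "x \<notin> cball 0 r" for x
    using that by (intro support) simp
  then show ?thesis
    using bounded_continuous_compact_support[OF continuous compact_cball] that by metis
qed

lemma total_shift: "(\<integral>\<^sup>+y. ennreal (\<rho> (z - y)) \<partial>lborel) = 1"
proof -
  have "(\<integral>\<^sup>+y. ennreal (\<rho> (z - y)) \<partial>lborel) = (\<integral>\<^sup>+y. ennreal (\<rho> (- z + y)) \<partial>lborel)"
    by (simp add: minus_commute[of z])
  also have "\<dots> = 1"
    using nn_integral_lborel_shift[of "\<lambda>x. ennreal (\<rho> x)" "- z"] total by simp
  finally show ?thesis .
qed

lemma LINT_shift: "integrable lborel (\<lambda>y. \<rho> (z - y))" "(LINT y|lborel. \<rho> (z - y)) = 1"
proof -
  show "integrable lborel (\<lambda>y. \<rho> (z - y))"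
    using total_shift[of z] nonneg by (intro integrableI_bounded) auto
  show "(LINT y|lborel. \<rho> (z - y)) = 1"
    by (subst integral_eq_nn_integral) (use total_shift[of z] nonneg in auto)
qed

lemma conv_measurable [measurable]:
  assumes "integrable lborel f"
  shows "conv \<rho> f \<in> borel_measurable borel"
proof -
  obtain M where "\<And>x. \<bar>\<rho> x\<bar> \<le> M" using bounded_abs by blast
  then show ?thesis
    by (intro borel_measurable_continuous_onI continuous_conv[OF continuous _ assms])
qed

text \<open>Jensen's inequality for the probability density \<open>\<rho> (z - y)\<close>; the
  exponents 1 and 2 are the ones that occur below.\<close>

lemma conv_diff_power_le:
  assumes f: "integrable lborel f" and p: "p = 1 \<or> p = 2"
  shows "ennreal (\<bar>conv \<rho> f z - f z\<bar> ^ p) \<le> (\<integral>\<^sup>+y. ennreal (\<rho> (z - y)) * ennreal (\<bar>f y - f z\<bar> ^ p) \<partial>lborel)"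
proof -
  have [measurable]: "f \<in> borel_measurable borel" using f by auto
  obtain M where M: "\<And>x. \<bar>\<rho> x\<bar> \<le> M" using bounded_abs by blast
  have int: "integrable lborel (\<lambda>y. \<rho> (z - y) * f y)" by (rule integrable_conv[OF _ M f]) measurable
  have int': "integrable lborel (\<lambda>y. \<rho> (z - y) * (f y - f z))"
    unfolding right_diff_distrib using int LINT_shift(1)[of z] by auto
  have "conv \<rho> f z - f z = (LINT y|lborel. \<rho> (z - y) * (f y - f z))"
    unfolding right_diff_distrib conv_def
    by (subst Bochner_Integration.integral_diff) (use int LINT_shift in auto)
  then have le: "ennreal \<bar>conv \<rho> f z - f z\<bar> \<le> (\<integral>\<^sup>+y. ennreal (\<rho> (z - y)) * ennreal \<bar>f y - f z\<bar> \<partial>lborel)"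
    using integral_norm_bound_ennreal[OF int'] nonneg by (simp add: abs_mult ennreal_mult)
  from p show ?thesis
  proof
    assume "p = 1"
    then show ?thesis using le by simp
  next
    assume "p = 2"
    have "ennreal (\<bar>conv \<rho> f z - f z\<bar> ^ 2) = (ennreal \<bar>conv \<rho> f z - f z\<bar>)\<^sup>2"
      by (simp add: ennreal_power)
    also have "\<dots> \<le> (\<integral>\<^sup>+y. ennreal (\<rho> (z - y)) * ennreal \<bar>f y - f z\<bar> \<partial>lborel)\<^sup>2"
      by (rule power_mono[OF le]) simp
    \<comment> \<open>Writing \<rho> as the square of its root leaves one factor of mass 1 in the
      Cauchy-Schwarz inequality.\<close>
    also have "\<dots> = (\<integral>\<^sup>+y. ennreal (sqrt (\<rho> (z - y))) * (ennreal (sqrt (\<rho> (z - y))) * ennreal \<bar>f y - f z\<bar>) \<partial>lborel)\<^sup>2"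
    proof -
      have "ennreal (\<rho> (z - y)) * ennreal \<bar>f y - f z\<bar>
          = ennreal (sqrt (\<rho> (z - y))) * (ennreal (sqrt (\<rho> (z - y))) * ennreal \<bar>f y - f z\<bar>)" for y
        unfolding mult.assoc[symmetric] using nonneg[of "z - y"] by (simp flip: ennreal_mult)
      then show ?thesis by simp
    qed
    also have "\<dots> \<le> (\<integral>\<^sup>+y. ennreal (sqrt (\<rho> (z - y))) ^ 2 \<partial>lborel)
        * (\<integral>\<^sup>+y. (ennreal (sqrt (\<rho> (z - y))) * ennreal \<bar>f y - f z\<bar>) ^ 2 \<partial>lborel)"
      by (rule Cauchy_Schwarz_nn_integral) measurable
    also have "\<dots> = (\<integral>\<^sup>+y. ennreal (\<rho> (z - y)) * ennreal (\<bar>f y - f z\<bar> ^ p) \<partial>lborel)"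
      using nonneg total_shift[of z] \<open>p = 2\<close> by (simp add: power_mult_distrib ennreal_power)
    finally show ?thesis using \<open>p = 2\<close> by simp
  qed
qed

text \<open>By Jensen and Tonelli the error is at most an average, over shifts \<open>h\<close> in
  the support of \<rho>, of the translation errors of \<open>f\<close>.\<close>

lemma Lp_conv_le:
  assumes f: "integrable lborel f" and p: "p = 1 \<or> p = 2"
    and mod: "\<And>h. norm h < r \<Longrightarrow> (\<integral>\<^sup>+x. ennreal (\<bar>f (h + x) - f x\<bar> ^ p) \<partial>lborel) \<le> c"
  shows "(\<integral>\<^sup>+z. ennreal (\<bar>conv \<rho> f z - f z\<bar> ^ p) \<partial>lborel) \<le> c"
proof -
  have [measurable]: "f \<in> borel_measurable borel" using f by auto
  have "(\<integral>\<^sup>+z. ennreal (\<bar>conv \<rho> f z - f z\<bar> ^ p) \<partial>lborel)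
      \<le> (\<integral>\<^sup>+z. (\<integral>\<^sup>+y. ennreal (\<rho> (z - y)) * ennreal (\<bar>f y - f z\<bar> ^ p) \<partial>lborel) \<partial>lborel)"
    by (intro nn_integral_mono conv_diff_power_le f p)
  also have "\<dots> = (\<integral>\<^sup>+z. (\<integral>\<^sup>+h. ennreal (\<rho> h) * ennreal (\<bar>f (h + z) - f z\<bar> ^ p) \<partial>lborel) \<partial>lborel)"
  proof (rule nn_integral_cong)
    fix z
    show "(\<integral>\<^sup>+y. ennreal (\<rho> (z - y)) * ennreal (\<bar>f y - f z\<bar> ^ p) \<partial>lborel)
        = (\<integral>\<^sup>+h. ennreal (\<rho> h) * ennreal (\<bar>f (h + z) - f z\<bar> ^ p) \<partial>lborel)"
      using nn_integral_lborel_shift[of "\<lambda>y. ennreal (\<rho> (z - y)) * ennreal (\<bar>f y - f z\<bar> ^ p)" z]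
      by (simp add: even add.commute)
  qed
  also have "\<dots> = (\<integral>\<^sup>+h. (\<integral>\<^sup>+z. ennreal (\<rho> h) * ennreal (\<bar>f (h + z) - f z\<bar> ^ p) \<partial>lborel) \<partial>lborel)"
    by (rule lborel_pair.Fubini') measurable
  also have "\<dots> \<le> (\<integral>\<^sup>+h. ennreal (\<rho> h) * c \<partial>lborel)"
  proof (rule nn_integral_mono)
    fix h :: 'a
    have "(\<integral>\<^sup>+z. ennreal (\<rho> h) * ennreal (\<bar>f (h + z) - f z\<bar> ^ p) \<partial>lborel)
        = ennreal (\<rho> h) * (\<integral>\<^sup>+z. ennreal (\<bar>f (h + z) - f z\<bar> ^ p) \<partial>lborel)"
      by (rule nn_integral_cmult) measurable
    also have "\<dots> \<le> ennreal (\<rho> h) * c"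
      by (cases "norm h < r") (auto intro: mult_left_mono mod simp: support)
    finally show "(\<integral>\<^sup>+z. ennreal (\<rho> h) * ennreal (\<bar>f (h + z) - f z\<bar> ^ p) \<partial>lborel) \<le> ennreal (\<rho> h) * c" .
  qed
  also have "\<dots> = c" by (simp add: nn_integral_multc total)
  finally show ?thesis .
qed

end

text \<open>For a prescribed error, \<open>r n\<close> eventually drops below the size of shifts
  that continuity of translation permits.\<close>

lemma mollifier_Lp_tendsto:
  fixes f :: "'a::euclidean_space \<Rightarrow> real"
  assumes \<rho>: "\<And>n. mollifier (\<rho> n) (r n)" and r: "r \<longlonglongrightarrow> 0"
    and f: "integrable lborel f" and p: "p = 1 \<or> p = 2"
    and fin: "(\<integral>\<^sup>+x. ennreal (\<bar>f x\<bar> ^ p) \<partial>lborel) < \<infinity>"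
  shows "(\<lambda>n. \<integral>\<^sup>+z. ennreal (\<bar>conv (\<rho> n) f z - f z\<bar> ^ p) \<partial>lborel) \<longlonglongrightarrow> 0"
proof (rule tendsto_0_if_Limsup_eq_0_ennreal)
  show "limsup (\<lambda>n. \<integral>\<^sup>+z. ennreal (\<bar>conv (\<rho> n) f z - f z\<bar> ^ p) \<partial>lborel) = 0"
  proof (rule antisym)
    show "limsup (\<lambda>n. \<integral>\<^sup>+z. ennreal (\<bar>conv (\<rho> n) f z - f z\<bar> ^ p) \<partial>lborel) \<le> 0"
    proof (rule ennreal_le_epsilon)
      fix e :: real assume "e > 0"
      have "p > 0" using p by auto
      obtain d where d: "d > 0"
        "\<And>h. norm h < d \<Longrightarrow> (\<integral>\<^sup>+x. ennreal (\<bar>f (h + x) - f x\<bar> ^ p) \<partial>lborel) \<le> ennreal e"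
        using Lp_translation_continuous[OF _ fin \<open>p > 0\<close> \<open>e > 0\<close>] f by auto
      have "eventually (\<lambda>n. r n < d) sequentially"
        using r d(1) by (rule order_tendstoD)
      then have "eventually (\<lambda>n. (\<integral>\<^sup>+z. ennreal (\<bar>conv (\<rho> n) f z - f z\<bar> ^ p) \<partial>lborel) \<le> ennreal e) sequentially"
        by eventually_elim (rule mollifier.Lp_conv_le[OF \<rho> f p], use d(2) in auto)
      then show "limsup (\<lambda>n. \<integral>\<^sup>+z. ennreal (\<bar>conv (\<rho> n) f z - f z\<bar> ^ p) \<partial>lborel) \<le> 0 + ennreal e"
        by (simp add: Limsup_bounded)
    qed
  qed simp
qed

section \<open>The standard mollifier and convolutions with test functions\<close>

definition std_mollifier :: "real \<Rightarrow> 'a::euclidean_space \<Rightarrow> real" where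
  "std_mollifier r x = (1 / (LINT y|lborel. bump 0 r (y::'a))) * bump 0 r x"

text \<open>If the integral vanished, the open ball on which the bump is positive would be a null
  set.\<close>

lemma integral_bump_pos:
  assumes "r > 0"
  shows "integrable lborel (bump n r :: 'a::euclidean_space \<Rightarrow> real)"
    and "0 < (LINT y|lborel. bump n r (y::'a))"
proof -
  have cont: "continuous_on UNIV (bump n r :: 'a \<Rightarrow> real)"
    using Ck_bump[of 0 n r] by simp
  show int: "integrable lborel (bump n r :: 'a \<Rightarrow> real)"
    by (rule integrable_continuous_compact_support[OF cont compact_cball[of 0 r]])
       (use assms in \<open>auto intro: bump_eq_0\<close>)
  have "(LINT y|lborel. bump n r (y::'a)) \<noteq> 0"
  proof
    assume "(LINT y|lborel. bump n r (y::'a)) = 0"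
    then have "AE y in lborel. bump n r (y::'a) = 0"
      using integral_nonneg_eq_0_iff_AE[OF int] bump_nonneg by auto
    then have "AE y in lborel. y \<notin> ball (0::'a) r"
      by eventually_elim (use assms bump_pos_iff[of r n] in force)
    then have "ball (0::'a) r \<in> null_sets lborel"
      by (subst (asm) AE_iff_null_sets[symmetric]) auto
    then have "negligible (ball (0::'a) r)"
      by (simp add: negligible_iff_null_sets null_sets_completionI)
    then show False
      using open_not_negligible[of "ball (0::'a) r"] assms by simp
  qed
  moreover have "0 \<le> (LINT y|lborel. bump n r (y::'a))"
    by (intro Bochner_Integration.integral_nonneg) (auto simp: bump_nonneg)
  ultimately show "0 < (LINT y|lborel. bump n r (y::'a))" by linarith
qed

lemma mollifier_std_mollifier:
  assumes "r > 0"
  shows "mollifier (std_mollifier r :: 'a::euclidean_space \<Rightarrow> real) r"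
proof
  let ?c = "LINT y|lborel. bump 0 r (y::'a)"
  have c: "?c > 0" and int: "integrable lborel (bump 0 r :: 'a \<Rightarrow> real)"
    using integral_bump_pos[OF assms] by auto
  have cont: "continuous_on UNIV (bump 0 r :: 'a \<Rightarrow> real)"
    using Ck_bump[of 0 0 r] by simp
  show "continuous_on UNIV (std_mollifier r :: 'a \<Rightarrow> real)"
    unfolding std_mollifier_def[abs_def] by (intro continuous_intros cont)
  show nn: "0 \<le> std_mollifier r x" for x :: 'a
    using c by (simp add: std_mollifier_def bump_nonneg)
  show "std_mollifier r x = 0" if "r \<le> norm x" for x :: 'a
    using bump_eq_0[OF assms that] by (simp add: std_mollifier_def)
  show "std_mollifier r (- x) = std_mollifier r x" for x :: 'a
    by (simp add: std_mollifier_def bump_def)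
  have "(\<integral>\<^sup>+x. ennreal (std_mollifier r (x::'a)) \<partial>lborel) = ennreal (LINT x|lborel. std_mollifier r (x::'a))"
    by (rule nn_integral_eq_integral) (use nn int in \<open>auto simp: std_mollifier_def[abs_def]\<close>)
  also have "(LINT x|lborel. std_mollifier r (x::'a)) = 1"
    using c by (simp add: std_mollifier_def)
  finally show "(\<integral>\<^sup>+x. ennreal (std_mollifier r (x::'a)) \<partial>lborel) = 1" by simp
qed

lemma test_function_std_mollifier:
  assumes "r > 0"
  shows "test_function UNIV (std_mollifier r :: 'a::euclidean_space \<Rightarrow> real)"
  unfolding test_function_def
proof (intro conjI allI exI[of _ "cball 0 r"])
  show "Ck k (std_mollifier r :: 'a \<Rightarrow> real)" for k
    unfolding std_mollifier_def[abs_def] by (rule Ck_mult[OF Ck_const Ck_bump])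
qed (use assms in \<open>auto simp: std_mollifier_def intro: bump_eq_0\<close>)

lemma partial_std_mollifier_commute:
  fixes d e :: "'a::euclidean_space"
  assumes "e \<in> Basis" "d \<in> Basis"
  shows "partial d (partial e (std_mollifier r)) = partial e (partial d (std_mollifier r))"
proof -
  have "partial d (partial e (std_mollifier r)) x =
      (1 / (LINT y|lborel. bump 0 r (y::'a))) * partial d (partial e (bump 0 r)) x"
    if "e \<in> Basis" for d e x :: 'a
    unfolding std_mollifier_def[abs_def]
    by (subst partial_cmult[OF Ck_bump], subst partial_cmult)
       (use Ck_bump[of "Suc (Suc 0)" 0 r] that in auto)
  then show ?thesis
    using partial_partial_bump_commute[of d e] assms by (intro ext) simp
qed

text \<open>The complement of a compact set is open, so the function vanishes in a neighbourhood of
  \<open>x\<close>.\<close>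

lemma partial_zero_outside:
  assumes "compact K" "\<And>x. x \<notin> K \<Longrightarrow> \<phi> x = 0" "x \<notin> K"
  shows "partial e \<phi> x = 0"
proof -
  have "((\<lambda>x. 0::real) has_derivative (\<lambda>e. 0)) (at x)" by simp
  moreover have "open (- K)" using assms(1) by (simp add: compact_imp_closed open_Compl)
  ultimately have "(\<phi> has_derivative (\<lambda>e. 0)) (at x)"
    by (rule has_derivative_transform_within_open[where s = "- K"]) (use assms in auto)
  then show ?thesis by (rule partial_eqI)
qed

lemma test_function_partial:
  assumes "test_function S \<phi>" "e \<in> Basis"
  shows "test_function S (partial e \<phi>)"
proof -
  obtain K where K: "compact K" "K \<subseteq> S" "\<And>x. x \<notin> K \<Longrightarrow> \<phi> x = 0"
    and Ck: "\<And>k. Ck k \<phi>" using assms(1) unfolding test_function_def by blast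
  have "Ck k (partial e \<phi>)" for k using Ck[of "Suc k"] assms(2) by simp
  moreover have "partial e \<phi> x = 0" if "x \<notin> K" for x
    by (rule partial_zero_outside[OF K(1,3) that])
  ultimately show ?thesis
    unfolding test_function_def by (intro conjI allI exI[of _ K] impI K)
qed

lemma test_function_continuous: "test_function S \<phi> \<Longrightarrow> continuous_on UNIV \<phi>"
  unfolding test_function_def by (metis Ck.simps(1))

lemma test_function_borel: "test_function S \<phi> \<Longrightarrow> \<phi> \<in> borel_measurable borel"
  by (intro borel_measurable_continuous_onI test_function_continuous)

lemma test_function_bounded:
  assumes "test_function S \<phi>"
  obtains M where "0 \<le> M" "\<And>x. \<bar>\<phi> x\<bar> \<le> M"
proof -
  obtain K where K: "compact K" "\<And>x. x \<notin> K \<Longrightarrow> \<phi> x = 0"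
    using assms unfolding test_function_def by blast
  show ?thesis
    by (rule bounded_continuous_compact_support[OF test_function_continuous[OF assms] K]) (assumption, rule that)
qed

lemma test_function_has_derivative:
  assumes "test_function S \<phi>"
  shows "(\<phi> has_derivative (\<lambda>e. partial e \<phi> x)) (at x)"
  by (rule Ck_Suc_has_derivative[of 0]) (use assms in \<open>auto simp: test_function_def\<close>)

lemma conv_test_derivative:
  assumes "test_function UNIV \<phi>" "e \<in> Basis" "integrable lborel f"
  shows "((\<lambda>s. conv \<phi> f (z + s *\<^sub>R e)) has_real_derivative conv (partial e \<phi>) f (z + s *\<^sub>R e)) (at s)"
proof -
  note t = test_function_partial[OF assms(1,2)]
  obtain B M where "\<And>x. \<bar>\<phi> x\<bar> \<le> B" "\<And>x. \<bar>partial e \<phi> x\<bar> \<le> M"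
    using test_function_bounded[OF assms(1)] test_function_bounded[OF t] by metis
  then show ?thesis
    by (intro conv_has_real_derivative test_function_has_derivative[OF assms(1)] test_function_borel[OF t] assms(3))
qed

lemma conv_test_continuous:
  assumes "test_function UNIV \<phi>" "integrable lborel f"
  shows "continuous_on UNIV (conv \<phi> f)"
proof -
  obtain B where "\<And>x. \<bar>\<phi> x\<bar> \<le> B" using test_function_bounded[OF assms(1)] by metis
  then show ?thesis by (intro continuous_conv test_function_continuous[OF assms(1)] assms(2))
qed

lemma integral_line_derivative_eq_0:
  fixes f f' :: "'a::euclidean_space \<Rightarrow> real" and e :: 'a
  assumes f: "integrable lborel f" and f': "integrable lborel f'"
    and S: "\<And>z. finite (S z)"
    and deriv: "\<And>z s. s \<notin> S z \<Longrightarrow> ((\<lambda>s. f (z + s *\<^sub>R e)) has_real_derivative f' (z + s *\<^sub>R e)) (at s)"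
    and cont: "continuous_on UNIV f"
  shows "(LINT x|lborel. f' x) = 0"
proof -
  have [measurable]: "f \<in> borel_measurable borel" "f' \<in> borel_measurable borel"
    using f f' by auto
  let ?g = "\<lambda>s z. indicator {0..1::real} s * f' (s *\<^sub>R e + z)"
  have int: "integrable (lborel \<Otimes>\<^sub>M lborel) (case_prod ?g)"
  proof (rule lborel_pair.Fubini_integrable)
    show "case_prod ?g \<in> borel_measurable (lborel \<Otimes>\<^sub>M lborel)" by measurable
    have "(LINT z|lborel. norm (case (s, z) of (s, z) \<Rightarrow> ?g s z)) = indicator {0..1} s * (LINT z|lborel. \<bar>f' z\<bar>)" for s
      using integral_lborel_shift[of "\<lambda>z. \<bar>f' z\<bar>" "s *\<^sub>R e"] by (simp add: abs_mult)
    then show "integrable lborel (\<lambda>s. LINT z|lborel. norm (case (s, z) of (s, z) \<Rightarrow> ?g s z))"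
      by simp
    show "AE s in lborel. integrable lborel (\<lambda>z. case (s, z) of (s, z) \<Rightarrow> ?g s z)"
      using integrable_lborel_shift[OF f'] by simp
  qed
  have "(LINT z|lborel. LINT s|lborel. ?g s z) = (LINT s|lborel. LINT z|lborel. ?g s z)"
    by (rule lborel_pair.Fubini_integral[OF int])
  also have "\<dots> = (LINT s|lborel. indicator {0..1::real} s * (LINT z|lborel. f' z))"
    using integral_lborel_shift[of f'] by simp
  also have "\<dots> = (LINT z|lborel. f' z)" by simp
  finally have A: "(LINT z|lborel. LINT s|lborel. ?g s z) = (LINT z|lborel. f' z)" .
  have m1: "(\<lambda>z. LINT s|lborel. ?g s z) \<in> borel_measurable lborel" by measurable
  have m2: "(\<lambda>z. f (e + z) - f z) \<in> borel_measurable lborel" by measurable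
  have "AE z in lborel. integrable lborel (\<lambda>s. ?g s z)"
    using lborel_pair.AE_integrable_snd[OF int] by simp
  then have "AE z in lborel. (LINT s|lborel. ?g s z) = f (e + z) - f z"
  proof eventually_elim
    case (elim z)
    then have "set_integrable lborel {0..1} (\<lambda>s. f' (z + s *\<^sub>R e))"
      unfolding set_integrable_def by (simp add: add.commute)
    from set_borel_integral_eq_integral(2)[OF this]
    have "(LINT s|lborel. ?g s z) = integral {0..1} (\<lambda>s. f' (z + s *\<^sub>R e))"
      by (simp add: set_lebesgue_integral_def add.commute)
    also have "((\<lambda>s. f' (z + s *\<^sub>R e)) has_integral f (z + 1 *\<^sub>R e) - f (z + 0 *\<^sub>R e)) {0..1}"
    proof (rule fundamental_theorem_of_calculus_strong[OF S[of z]])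
      show "((\<lambda>s. f (z + s *\<^sub>R e)) has_vector_derivative f' (z + s *\<^sub>R e)) (at s)" if "s \<in> {0..1} - S z" for s
        using deriv[of s z] that by (simp add: has_real_derivative_iff_has_vector_derivative)
      show "continuous_on {0..1} (\<lambda>s. f (z + s *\<^sub>R e))"
        by (rule continuous_on_compose2[OF cont]) (auto intro!: continuous_intros)
    qed simp
    then have "integral {0..1} (\<lambda>s. f' (z + s *\<^sub>R e)) = f (e + z) - f z"
      by (simp add: integral_unique add.commute)
    finally show ?case .
  qed
  then have "(LINT z|lborel. LINT s|lborel. ?g s z) = (LINT z|lborel. f (e + z) - f z)"
    by (rule integral_cong_AE[OF m1 m2])
  also have "\<dots> = 0"
    using integrable_lborel_shift[OF f] f by (simp add: integral_lborel_shift)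
  finally show ?thesis using A by simp
qed

lemma integrable_bounded_compact_support:
  fixes f :: "'a::euclidean_space \<Rightarrow> real"
  assumes "f \<in> borel_measurable borel" "compact K" "\<And>x. x \<notin> K \<Longrightarrow> f x = 0" "\<And>x. x \<in> K \<Longrightarrow> \<bar>f x\<bar> \<le> M"
  shows "integrable lborel f"
proof (rule Bochner_Integration.integrable_bound)
  show "integrable lborel (\<lambda>x. indicator K x *\<^sub>R M)"
    using emeasure_compact_finite[OF assms(2)] compact_imp_closed[OF assms(2)]
    by (intro integrable_scaleR_left integrable_real_indicator) auto
  show "AE x in lborel. norm (f x) \<le> norm (indicator K x *\<^sub>R M)"
    using assms(3,4) by (intro AE_I2) (force simp: indicator_def)
qed (use assms(1) in simp)

text \<open>The product \<psi> q is integrated along lines. The derivative of \<psi> is assumed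
  bounded and measurable rather than continuous, because the spatial derivative of the weight jumps
  at x = 0; compact support of \<psi> takes care of the growth of \<open>q\<close>.\<close>

lemma weighted_integration_by_parts:
  fixes \<psi> \<psi>' q q' :: "'a::euclidean_space \<Rightarrow> real" and e :: 'a
  assumes \<psi>: "continuous_on UNIV \<psi>" "compact K" "\<And>z. z \<notin> K \<Longrightarrow> \<psi> z = 0"
    and \<psi>': "\<psi>' \<in> borel_measurable borel" "\<And>z. z \<notin> K \<Longrightarrow> \<psi>' z = 0" "\<And>z. \<bar>\<psi>' z\<bar> \<le> M"
    and S: "\<And>z. finite (S z)"
    and d\<psi>: "\<And>z s. s \<notin> S z \<Longrightarrow> ((\<lambda>s. \<psi> (z + s *\<^sub>R e)) has_real_derivative \<psi>' (z + s *\<^sub>R e)) (at s)"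
    and q: "continuous_on UNIV q" "continuous_on UNIV q'"
    and dq: "\<And>z s. ((\<lambda>s. q (z + s *\<^sub>R e)) has_real_derivative q' (z + s *\<^sub>R e)) (at s)"
  shows "integrable lborel (\<lambda>z. \<psi>' z * q z)" "integrable lborel (\<lambda>z. \<psi> z * q' z)"
    and "(LINT z|lborel. \<psi>' z * q z) + (LINT z|lborel. \<psi> z * q' z) = 0"
proof -
  have "compact (q ` K)"
    using q(1) \<psi>(2) by (intro compact_continuous_image) (auto intro: continuous_on_subset)
  then obtain B where B: "\<And>z. z \<in> K \<Longrightarrow> \<bar>q z\<bar> \<le> B"
    by (meson bounded_real compact_imp_bounded imageI)
  have [measurable]: "q \<in> borel_measurable borel"
    using q(1) by (rule borel_measurable_continuous_onI)
  note [measurable] = \<psi>'(1)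
  show i1: "integrable lborel (\<lambda>z. \<psi>' z * q z)"
  proof (rule integrable_bounded_compact_support[OF _ \<psi>(2)])
    show "\<bar>\<psi>' z * q z\<bar> \<le> M * B" if "z \<in> K" for z
      unfolding abs_mult using B[OF that] \<psi>'(3)[of z] by (intro mult_mono) auto
  qed (use \<psi>'(2) in auto)
  show i2: "integrable lborel (\<lambda>z. \<psi> z * q' z)"
    by (rule integrable_continuous_compact_support[OF _ \<psi>(2)])
       (use \<psi> q in \<open>auto intro!: continuous_intros\<close>)
  have "(LINT z|lborel. \<psi>' z * q z + \<psi> z * q' z) = 0"
  proof (rule integral_line_derivative_eq_0[OF _ _ S])
    show "integrable lborel (\<lambda>z. \<psi> z * q z)"
      by (rule integrable_continuous_compact_support[OF _ \<psi>(2)])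
         (use \<psi> q in \<open>auto intro!: continuous_intros\<close>)
    show "continuous_on UNIV (\<lambda>z. \<psi> z * q z)" by (intro continuous_intros \<psi> q)
    show "((\<lambda>s. \<psi> (z + s *\<^sub>R e) * q (z + s *\<^sub>R e)) has_real_derivative
        \<psi>' (z + s *\<^sub>R e) * q (z + s *\<^sub>R e) + \<psi> (z + s *\<^sub>R e) * q' (z + s *\<^sub>R e)) (at s)"
      if "s \<notin> S z" for z s
      by (rule DERIV_cong[OF DERIV_mult[OF d\<psi>[OF that] dq]]) simp
  qed (use i1 i2 in auto)
  then show "(LINT z|lborel. \<psi>' z * q z) + (LINT z|lborel. \<psi> z * q' z) = 0"
    using i1 i2 by simp
qed

section \<open>The weighted identities for smooth functions\<close>

type_synonym spacetime = "real \<times> R3"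

lemma time_basis: "(1, 0) \<in> (Basis :: spacetime set)"
  by (simp add: Basis_prod_def)

lemma space_basis: "e \<in> Basis \<Longrightarrow> (0, e) \<in> (Basis :: spacetime set)"
  by (simp add: Basis_prod_def)

text \<open>\<open>W\<close> is a C^1 tail with density \<open>w\<close>, localised in time by
  \<eta>. Vanishing beyond \<open>T\<close> bounds |x| on the support of the weight, and
  \<open>M\<close> bounds the spatial derivative.\<close>

locale cone_weight =
  fixes \<eta> \<eta>' W w :: "real \<Rightarrow> real" and a b T M :: real
  assumes \<eta>: "\<And>t. (\<eta> has_real_derivative \<eta>' t) (at t)" "continuous_on UNIV \<eta>'"
      "\<And>t. t \<notin> {a..b} \<Longrightarrow> \<eta> t = 0" "\<And>t. 0 \<le> \<eta> t" "\<And>t. \<eta> t \<le> 1"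
    and W: "\<And>s. (W has_real_derivative - w s) (at s)" "continuous_on UNIV w"
      "\<And>s. s \<ge> T \<Longrightarrow> W s = 0" "\<And>s. 0 \<le> w s" "\<And>s. w s \<le> M"
begin

text \<open>On the support of the weight a <= t and t + |x| <= T, whence |x| <= T - a.\<close>

definition K0 :: "spacetime set" where "K0 = {a..b} \<times> cball 0 (T - a)"

definition \<psi> :: "spacetime \<Rightarrow> real" where
  "\<psi> z = \<eta> (fst z) * W (fst z + norm (snd z))"

definition \<psi>t :: "spacetime \<Rightarrow> real" where
  "\<psi>t z = \<eta>' (fst z) * W (fst z + norm (snd z)) - \<eta> (fst z) * w (fst z + norm (snd z))"

text \<open>At x = 0 division by zero makes this 0; no derivative is asserted there, the point being
  exceptional on the lines through it.\<close>

definition \<psi>x :: "R3 \<Rightarrow> spacetime \<Rightarrow> real" where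
  "\<psi>x e z = - (\<eta> (fst z) * w (fst z + norm (snd z))) * ((snd z \<bullet> e) / norm (snd z))"

lemma compact_K0: "compact K0"
  unfolding K0_def by (intro compact_Times) auto

lemma continuous_\<eta>: "continuous_on UNIV \<eta>"
  using \<eta>(1) by (meson DERIV_continuous continuous_at_imp_continuous_on)

lemma continuous_W: "continuous_on UNIV W"
  using W(1) by (meson DERIV_continuous continuous_at_imp_continuous_on)

lemma \<eta>'_eq_0: assumes "t \<notin> {a..b}" shows "\<eta>' t = 0"
proof -
  have "(\<eta> has_real_derivative 0) (at t)"
  proof (rule has_field_derivative_transform_within_open[where f = "\<lambda>_. 0" and S = "- {a..b}"])
    show "open (- {a..b})" by (intro open_Compl) simp
  qed (use assms \<eta>(3) in auto)
  then show ?thesis using DERIV_unique[OF \<eta>(1)] by blast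
qed

text \<open>Beyond \<open>T\<close> the function \<open>W\<close> is locally constant; at
  \<open>T\<close> itself continuity of \<open>w\<close> is used.\<close>

lemma w_eq_0: assumes "s \<ge> T" shows "w s = 0"
proof -
  have "w s = 0" if "s > T" for s
  proof -
    have "(W has_real_derivative 0) (at s)"
      by (rule has_field_derivative_transform_within_open[where f = "\<lambda>_. 0" and S = "{T<..}"])
         (use that W(3) in auto)
    then show ?thesis using DERIV_unique[OF W(1)] by fastforce
  qed
  moreover have "w T = 0"
  proof -
    have "(\<lambda>n. w (T + inverse (real (Suc n)))) \<longlonglongrightarrow> w (T + 0)"
      by (intro continuous_on_tendsto_compose[OF W(2)] tendsto_add tendsto_const LIMSEQ_inverse_real_of_nat) auto
    moreover have "(\<lambda>n. w (T + inverse (real (Suc n)))) = (\<lambda>n. 0)"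
      using calculation \<open>\<And>s. s > T \<Longrightarrow> w s = 0\<close> by (intro ext) simp
    ultimately show ?thesis by (simp add: LIMSEQ_const_iff)
  qed
  ultimately show ?thesis using assms by (cases "s = T") auto
qed

lemma outside_K0:
  assumes "z \<notin> K0"
  shows "\<psi> z = 0" "\<psi>t z = 0" "\<psi>x e z = 0"
proof -
  obtain t x where z: "z = (t, x)" by (cases z)
  consider "t \<notin> {a..b}" | "t + norm x \<ge> T"
    using assms unfolding z K0_def by fastforce
  then show "\<psi> z = 0" "\<psi>t z = 0" "\<psi>x e z = 0"
    by (cases; simp add: z \<psi>_def \<psi>t_def \<psi>x_def \<eta>(3) \<eta>'_eq_0 W(3) w_eq_0)+
qed

lemma continuous_\<psi>: "continuous_on UNIV \<psi>"
  unfolding \<psi>_def[abs_def]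
  by (intro continuous_intros continuous_on_compose2[OF continuous_\<eta>] continuous_on_compose2[OF continuous_W]) auto

lemma continuous_\<psi>t: "continuous_on UNIV \<psi>t"
  unfolding \<psi>t_def[abs_def]
  by (intro continuous_intros continuous_on_compose2[OF continuous_\<eta>] continuous_on_compose2[OF continuous_W]
      continuous_on_compose2[OF \<eta>(2)] continuous_on_compose2[OF W(2)]) auto

lemma borel_weights [measurable]:
  "\<eta> \<in> borel_measurable borel" "\<eta>' \<in> borel_measurable borel"
  "W \<in> borel_measurable borel" "w \<in> borel_measurable borel"
  by (intro borel_measurable_continuous_onI continuous_\<eta> \<eta>(2) continuous_W W(2))+

lemma borel_\<psi> [measurable]:
  "\<psi> \<in> borel_measurable borel" "\<psi>t \<in> borel_measurable borel" "\<psi>x e \<in> borel_measurable borel"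
proof -
  show "\<psi> \<in> borel_measurable borel" "\<psi>t \<in> borel_measurable borel"
    by (intro borel_measurable_continuous_onI continuous_\<psi> continuous_\<psi>t)+
  have [measurable]: "(fst :: spacetime \<Rightarrow> real) \<in> borel_measurable borel"
    "(snd :: spacetime \<Rightarrow> R3) \<in> borel_measurable borel"
    by (intro borel_measurable_continuous_onI continuous_intros)+
  show "\<psi>x e \<in> borel_measurable borel"
    unfolding \<psi>x_def[abs_def] by measurable
qed

lemma bounded_\<psi>:
  obtains B where "0 \<le> B" "\<And>z. \<bar>\<psi> z\<bar> \<le> B" "\<And>z. \<bar>\<psi>t z\<bar> \<le> B" "\<And>z e. e \<in> Basis \<Longrightarrow> \<bar>\<psi>x e z\<bar> \<le> B"
proof -
  obtain B1 where B1: "0 \<le> B1" "\<And>z. \<bar>\<psi> z\<bar> \<le> B1"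
    using bounded_continuous_compact_support[OF continuous_\<psi> compact_K0] outside_K0(1) by metis
  obtain B2 where B2: "0 \<le> B2" "\<And>z. \<bar>\<psi>t z\<bar> \<le> B2"
    using bounded_continuous_compact_support[OF continuous_\<psi>t compact_K0] outside_K0(2) by metis
  have B3: "\<bar>\<psi>x e z\<bar> \<le> M" if "e \<in> Basis" for e z
  proof -
    have "\<bar>(snd z \<bullet> e) / norm (snd z)\<bar> \<le> 1"
      using Basis_le_norm[OF that, of "snd z"] by (cases "snd z = 0") (auto simp: divide_le_eq_1)
    moreover have "\<bar>\<eta> (fst z) * w (fst z + norm (snd z))\<bar> \<le> 1 * M"
      unfolding abs_mult using \<eta>(4,5) W(4,5) by (intro mult_mono) auto
    ultimately have "\<bar>\<eta> (fst z) * w (fst z + norm (snd z))\<bar> * \<bar>(snd z \<bullet> e) / norm (snd z)\<bar> \<le> (1 * M) * 1"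
      by (intro mult_mono) linarith+
    then show ?thesis by (simp add: \<psi>x_def abs_mult)
  qed
  show ?thesis
  proof (rule that[of "max B1 (max B2 M)"])
    show "\<bar>\<psi> z\<bar> \<le> max B1 (max B2 M)" "\<bar>\<psi>t z\<bar> \<le> max B1 (max B2 M)" for z
      using B1(2)[of z] B2(2)[of z] by linarith+
    show "\<bar>\<psi>x e z\<bar> \<le> max B1 (max B2 M)" if "e \<in> Basis" for z e
      using B3[OF that, of z] by linarith
  qed (use B1 in simp)
qed

lemma \<psi>_time_derivative:
  "((\<lambda>s. \<psi> (z + s *\<^sub>R (1, 0))) has_real_derivative \<psi>t (z + s *\<^sub>R (1, 0))) (at s)"
proof -
  have "((\<lambda>s. \<eta> (fst z + s) * W (fst z + s + norm (snd z))) has_real_derivative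
      \<eta>' (fst z + s) * W (fst z + s + norm (snd z)) + (- w (fst z + s + norm (snd z))) * \<eta> (fst z + s)) (at s)"
    by (rule DERIV_mult; rule DERIV_chain'[where g = \<eta>, OF _ \<eta>(1), THEN DERIV_cong]
        DERIV_chain'[where g = W, OF _ W(1), THEN DERIV_cong])
       (auto intro!: derivative_eq_intros)
  then show ?thesis
    by (simp add: \<psi>_def \<psi>t_def algebra_simps)
qed

text \<open>Off the origin, |x| has derivative (x . e) / |x| in direction \<open>e\<close>, and the
  chain rule gives the factor -w.\<close>

lemma \<psi>_space_derivative:
  assumes "snd z + s *\<^sub>R e \<noteq> 0"
  shows "((\<lambda>s. \<psi> (z + s *\<^sub>R (0, e))) has_real_derivative \<psi>x e (z + s *\<^sub>R (0, e))) (at s)"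
proof -
  have "((\<lambda>s. norm (snd z + s *\<^sub>R e)) has_derivative
      (\<lambda>h. (h *\<^sub>R e) \<bullet> sgn (snd z + s *\<^sub>R e))) (at s)"
    by (rule has_derivative_compose[where g = norm and g' = "\<lambda>h. h \<bullet> sgn (snd z + s *\<^sub>R e)"])
       (auto intro!: derivative_eq_intros has_derivative_norm assms)
  then have n: "((\<lambda>s. fst z + norm (snd z + s *\<^sub>R e)) has_real_derivative
      (snd z + s *\<^sub>R e) \<bullet> e / norm (snd z + s *\<^sub>R e)) (at s)"
    unfolding has_field_derivative_def
    by (auto intro!: derivative_eq_intros simp: sgn_div_norm inner_commute fun_eq_iff divide_inverse)
  have "((\<lambda>s. \<eta> (fst z) * W (fst z + norm (snd z + s *\<^sub>R e))) has_real_derivative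
      \<eta> (fst z) * (- w (fst z + norm (snd z + s *\<^sub>R e)) * ((snd z + s *\<^sub>R e) \<bullet> e / norm (snd z + s *\<^sub>R e)))) (at s)"
    by (intro DERIV_cmult DERIV_chain'[OF n W(1), THEN DERIV_cong]) simp
  then show ?thesis
    by (simp add: \<psi>_def \<psi>x_def algebra_simps)
qed

text \<open>Pairing the equation with \<open>e\<close> determines \<open>s\<close>: a line in
  direction \<open>e\<close> meets x = 0 at most once.\<close>

lemma finite_singular:
  assumes "e \<noteq> 0"
  shows "finite {s::real. snd (z::spacetime) + s *\<^sub>R e = 0}"
proof (rule finite_subset)
  show "{s. snd z + s *\<^sub>R e = 0} \<subseteq> {- (snd z \<bullet> e) / (e \<bullet> e)}"
  proof safe
    fix s assume "snd z + s *\<^sub>R e = 0"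
    then have "(snd z + s *\<^sub>R e) \<bullet> e = 0" by simp
    then have "s * (e \<bullet> e) = - (snd z \<bullet> e)" by (simp add: inner_add_left)
    then show "s = - (snd z \<bullet> e) / (e \<bullet> e)" using assms by (simp add: field_simps)
  qed
qed simp

lemma time_by_parts:
  assumes q: "continuous_on UNIV q" "continuous_on UNIV q'"
    and dq: "\<And>z s. ((\<lambda>s. q (z + s *\<^sub>R (1, 0))) has_real_derivative q' (z + s *\<^sub>R (1, 0))) (at s)"
  shows "integrable lborel (\<lambda>z. \<psi>t z * q z)" "integrable lborel (\<lambda>z. \<psi> z * q' z)"
    and "(LINT z|lborel. \<psi>t z * q z) + (LINT z|lborel. \<psi> z * q' z) = 0"
proof -
  obtain B where B: "\<And>z. \<bar>\<psi>t z\<bar> \<le> B" using bounded_\<psi> by metis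
  note * = weighted_integration_by_parts[where S = "\<lambda>_. {}" and e = "(1, 0)",
    OF continuous_\<psi> compact_K0 outside_K0(1) borel_\<psi>(2) outside_K0(2) B _ \<psi>_time_derivative q dq]
  show "integrable lborel (\<lambda>z. \<psi>t z * q z)" "integrable lborel (\<lambda>z. \<psi> z * q' z)"
    "(LINT z|lborel. \<psi>t z * q z) + (LINT z|lborel. \<psi> z * q' z) = 0"
    using * by auto
qed

lemma space_by_parts:
  assumes e: "e \<in> Basis" and q: "continuous_on UNIV q" "continuous_on UNIV q'"
    and dq: "\<And>z s. ((\<lambda>s. q (z + s *\<^sub>R (0, e))) has_real_derivative q' (z + s *\<^sub>R (0, e))) (at s)"
  shows "integrable lborel (\<lambda>z. \<psi>x e z * q z)" "integrable lborel (\<lambda>z. \<psi> z * q' z)"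
    and "(LINT z|lborel. \<psi>x e z * q z) + (LINT z|lborel. \<psi> z * q' z) = 0"
proof -
  obtain B where B: "\<And>z. \<bar>\<psi>x e z\<bar> \<le> B" using bounded_\<psi> e by metis
  have d: "((\<lambda>s. \<psi> (z + s *\<^sub>R (0, e))) has_real_derivative \<psi>x e (z + s *\<^sub>R (0, e))) (at s)"
    if "s \<notin> {s. snd z + s *\<^sub>R e = 0}" for z s
    using that by (intro \<psi>_space_derivative) simp
  have "e \<noteq> 0" using e by auto
  note * = weighted_integration_by_parts[OF continuous_\<psi> compact_K0 outside_K0(1) borel_\<psi>(3)
    outside_K0(3) B finite_singular[OF \<open>e \<noteq> 0\<close>] d q dq]
  show "integrable lborel (\<lambda>z. \<psi>x e z * q z)" "integrable lborel (\<lambda>z. \<psi> z * q' z)"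
    "(LINT z|lborel. \<psi>x e z * q z) + (LINT z|lborel. \<psi> z * q' z) = 0"
    using * by auto
qed

text \<open>\<open>vt\<close> and \<open>D e\<close> stand for time derivative and gradient,
  \<open>G\<close> for the source. If Y and U_e are their mollifications and q is the quadratic
  energy, the two equations give \<partial>_t q - sum_e \<partial>_e (Y U_e) = - Y G. Integrating by
  parts against the weight produces -\<eta> w (q - Y n . U) with n = x/|x|, which is at most 0 and
  is dropped. The equations are needed on \<open>K0\<close> alone because \<psi> vanishes
  elsewhere.\<close>

lemma energy_inequality_smooth:
  fixes v vt G :: "spacetime \<Rightarrow> real" and D :: "R3 \<Rightarrow> spacetime \<Rightarrow> real"
  assumes \<phi>: "test_function UNIV \<phi>"
    and int: "integrable lborel vt" "integrable lborel G" "\<And>e. e \<in> Basis \<Longrightarrow> integrable lborel (D e)"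
    and H1: "\<And>z e. z \<in> K0 \<Longrightarrow> e \<in> Basis \<Longrightarrow>
      conv (partial (1, 0) \<phi>) (D e) z = conv (partial (0, e) \<phi>) vt z"
    and H2: "\<And>z. z \<in> K0 \<Longrightarrow>
      conv (partial (1, 0) \<phi>) vt z - (\<Sum>e\<in>Basis. conv (partial (0, e) \<phi>) (D e) z) = - conv \<phi> G z"
  shows "(LINT z|lborel. \<psi> z * conv \<phi> vt z * conv \<phi> G z)
    \<le> (LINT z|lborel. \<eta>' (fst z) * W (fst z + norm (snd z)) *
        (1/2 * (conv \<phi> vt z)\<^sup>2 + (\<Sum>e\<in>Basis. 1/2 * (conv \<phi> (D e) z)\<^sup>2)))"
proof -
  define Y where "Y = conv \<phi> vt"
  define U where "U e = conv \<phi> (D e)" for e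
  define Yt where "Yt = conv (partial (1, 0) \<phi>) vt"
  define Ut where "Ut e = conv (partial (1, 0) \<phi>) (D e)" for e
  define Yx where "Yx e = conv (partial (0, e) \<phi>) vt" for e
  define Ux where "Ux e = conv (partial (0, e) \<phi>) (D e)" for e
  note \<phi>t = test_function_partial[OF \<phi> time_basis]
  note \<phi>x = test_function_partial[OF \<phi> space_basis]
  have cont: "continuous_on UNIV Y" "continuous_on UNIV Yt"
    "\<And>e. e \<in> Basis \<Longrightarrow> continuous_on UNIV (U e)" "\<And>e. e \<in> Basis \<Longrightarrow> continuous_on UNIV (Ut e)"
    "\<And>e. e \<in> Basis \<Longrightarrow> continuous_on UNIV (Yx e)" "\<And>e. e \<in> Basis \<Longrightarrow> continuous_on UNIV (Ux e)"
    unfolding Y_def U_def Yt_def Ut_def Yx_def Ux_def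
    by (intro conv_test_continuous \<phi> \<phi>t \<phi>x int; assumption)+
  have contG: "continuous_on UNIV (conv \<phi> G)" by (intro conv_test_continuous \<phi> int)
  have dt: "((\<lambda>s. Y (z + s *\<^sub>R (1, 0))) has_real_derivative Yt (z + s *\<^sub>R (1, 0))) (at s)"
    "e \<in> Basis \<Longrightarrow> ((\<lambda>s. U e (z + s *\<^sub>R (1, 0))) has_real_derivative Ut e (z + s *\<^sub>R (1, 0))) (at s)"
    "e \<in> Basis \<Longrightarrow> ((\<lambda>s. Y (z + s *\<^sub>R (0, e))) has_real_derivative Yx e (z + s *\<^sub>R (0, e))) (at s)"
    "e \<in> Basis \<Longrightarrow> ((\<lambda>s. U e (z + s *\<^sub>R (0, e))) has_real_derivative Ux e (z + s *\<^sub>R (0, e))) (at s)"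
    for z s e
    unfolding Y_def U_def Yt_def Ut_def Yx_def Ux_def
    by (intro conv_test_derivative[OF \<phi>] time_basis space_basis int; assumption)+
  define q where "q z = 1/2 * (Y z)\<^sup>2 + (\<Sum>e\<in>Basis. 1/2 * (U e z)\<^sup>2)" for z
  define q' where "q' z = Y z * Yt z + (\<Sum>e\<in>Basis. U e z * Ut e z)" for z
  have contq: "continuous_on UNIV q" "continuous_on UNIV q'"
    unfolding q_def[abs_def] q'_def[abs_def] by (intro continuous_intros cont; assumption)+
  have dq: "((\<lambda>s. q (z + s *\<^sub>R (1, 0))) has_real_derivative q' (z + s *\<^sub>R (1, 0))) (at s)" for z s
    unfolding q_def q'_def
    by (rule DERIV_add DERIV_sum DERIV_cong[OF DERIV_cmult[OF DERIV_power[OF dt(1)]]]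
        DERIV_cong[OF DERIV_cmult[OF DERIV_power[OF dt(2)]]] | assumption | simp)+
  note T = time_by_parts[OF contq dq]
  have X: "integrable lborel (\<lambda>z. \<psi>x e z * (Y z * U e z))"
    "integrable lborel (\<lambda>z. \<psi> z * (Yx e z * U e z + Ux e z * Y z))"
    "(LINT z|lborel. \<psi>x e z * (Y z * U e z)) + (LINT z|lborel. \<psi> z * (Yx e z * U e z + Ux e z * Y z)) = 0"
    if e: "e \<in> Basis" for e
  proof -
    have c: "continuous_on UNIV (\<lambda>z. Y z * U e z)"
      "continuous_on UNIV (\<lambda>z. Yx e z * U e z + Ux e z * Y z)"
      by (intro continuous_intros cont e)+
    note * = space_by_parts[OF e c DERIV_mult[OF dt(3)[OF e] dt(4)[OF e]]]
    show "integrable lborel (\<lambda>z. \<psi>x e z * (Y z * U e z))"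
      "integrable lborel (\<lambda>z. \<psi> z * (Yx e z * U e z + Ux e z * Y z))"
      "(LINT z|lborel. \<psi>x e z * (Y z * U e z)) + (LINT z|lborel. \<psi> z * (Yx e z * U e z + Ux e z * Y z)) = 0"
      by (rule *)+
  qed
  have intG: "integrable lborel (\<lambda>z. \<psi> z * Y z * conv \<phi> G z)"
    by (rule integrable_continuous_compact_support[OF _ compact_K0])
       (use outside_K0(1) contG cont(1) continuous_\<psi> in \<open>auto intro!: continuous_intros\<close>)
  \<comment> \<open>The pointwise energy identity, multiplied by the weight: \<open>H1\<close>
    cancels the mixed terms and \<open>H2\<close> brings in the source.\<close>
  have eq: "\<psi> z * Y z * conv \<phi> G z
      = (\<Sum>e\<in>Basis. \<psi> z * (Yx e z * U e z + Ux e z * Y z)) - \<psi> z * q' z" for z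
  proof (cases "z \<in> K0")
    case True
    have "q' z - (\<Sum>e\<in>Basis. Yx e z * U e z + Ux e z * Y z) = Y z * (Yt z - (\<Sum>e\<in>Basis. Ux e z))"
      using H1[OF True]
      by (simp add: q'_def Ut_def Yx_def sum.distrib sum_distrib_left algebra_simps)
    also have "\<dots> = - Y z * conv \<phi> G z"
      using H2[OF True] by (simp add: Yt_def Ux_def)
    finally have "Y z * conv \<phi> G z = (\<Sum>e\<in>Basis. Yx e z * U e z + Ux e z * Y z) - q' z"
      by linarith
    then show ?thesis
      unfolding mult.assoc sum_distrib_left[symmetric] right_diff_distrib[symmetric] by simp
  qed (use outside_K0 in simp)
  have "(LINT z|lborel. \<psi> z * Y z * conv \<phi> G z)
      = (\<Sum>e\<in>Basis. LINT z|lborel. \<psi> z * (Yx e z * U e z + Ux e z * Y z)) - (LINT z|lborel. \<psi> z * q' z)"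
    unfolding eq using X(2) T(2)
    by (subst Bochner_Integration.integral_diff) (auto intro!: Bochner_Integration.integrable_sum)
  also have "\<dots> = (LINT z|lborel. \<psi>t z * q z) - (\<Sum>e\<in>Basis. LINT z|lborel. \<psi>x e z * (Y z * U e z))"
  proof -
    have "(\<Sum>e\<in>Basis. LINT z|lborel. \<psi> z * (Yx e z * U e z + Ux e z * Y z))
        = - (\<Sum>e\<in>Basis. LINT z|lborel. \<psi>x e z * (Y z * U e z))"
      unfolding sum_negf[symmetric] using X(3) by (intro sum.cong) (auto simp: add_eq_0_iff)
    then show ?thesis using T(3) by linarith
  qed
  also have "\<dots> = (LINT z|lborel. \<psi>t z * q z - (\<Sum>e\<in>Basis. \<psi>x e z * (Y z * U e z)))"
    using X(1) T(1)
    by (subst Bochner_Integration.integral_diff) (auto intro!: Bochner_Integration.integrable_sum)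
  also have "\<dots> \<le> (LINT z|lborel. \<eta>' (fst z) * W (fst z + norm (snd z)) * q z)"
  proof (rule integral_mono)
    show "integrable lborel (\<lambda>z. \<psi>t z * q z - (\<Sum>e\<in>Basis. \<psi>x e z * (Y z * U e z)))"
      using X(1) T(1) by (auto intro!: Bochner_Integration.integrable_sum)
    show "integrable lborel (\<lambda>z. \<eta>' (fst z) * W (fst z + norm (snd z)) * q z)"
    proof (rule integrable_continuous_compact_support[OF _ compact_K0])
      show "continuous_on UNIV (\<lambda>z. \<eta>' (fst z) * W (fst z + norm (snd z)) * q z)"
        by (intro continuous_intros continuous_on_compose2[OF \<eta>(2)] continuous_on_compose2[OF continuous_W] contq) auto
      show "\<eta>' (fst z) * W (fst z + norm (snd z)) * q z = 0" if "z \<notin> K0" for z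
      proof -
        have "fst z \<notin> {a..b} \<or> fst z + norm (snd z) \<ge> T"
          using that unfolding K0_def by (cases z) fastforce
        then show ?thesis using \<eta>'_eq_0 W(3) by auto
      qed
    qed
    fix z :: spacetime
    \<comment> \<open>The radial unit vector, but 0 at the origin, so that its squared length is at
      most 1 in every case.\<close>
    define n where "n e = (snd z \<bullet> e) / norm (snd z)" for e
    have n: "(\<Sum>e\<in>Basis. (n e)\<^sup>2) \<le> 1"
    proof (cases "snd z = 0")
      case False
      have "(\<Sum>e\<in>Basis. (n e)\<^sup>2) = (\<Sum>e\<in>Basis. (snd z \<bullet> e)\<^sup>2) / (norm (snd z))\<^sup>2"
        by (simp add: n_def power_divide sum_divide_distrib)
      also have "(\<Sum>e\<in>Basis. (snd z \<bullet> e)\<^sup>2) = (norm (snd z))\<^sup>2"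
        by (subst power2_norm_eq_inner, subst euclidean_inner) (simp add: power2_eq_square)
      finally show ?thesis using False by simp
    qed (simp add: n_def)
    have "(\<Sum>e\<in>Basis. n e * (Y z * U e z)) \<le> (\<Sum>e\<in>Basis. 1/2 * (Y z)\<^sup>2 * (n e)\<^sup>2 + 1/2 * (U e z)\<^sup>2)"
    proof (rule sum_mono)
      fix e :: R3
      \<comment> \<open>Completing the square; this is the nonnegativity of the quadratic flux
        through the cone.\<close>
      have "0 \<le> (Y z * n e - U e z)\<^sup>2" by simp
      then show "n e * (Y z * U e z) \<le> 1/2 * (Y z)\<^sup>2 * (n e)\<^sup>2 + 1/2 * (U e z)\<^sup>2"
        by (simp add: power2_eq_square algebra_simps)
    qed
    also have "\<dots> = 1/2 * (Y z)\<^sup>2 * (\<Sum>e\<in>Basis. (n e)\<^sup>2) + (\<Sum>e\<in>Basis. 1/2 * (U e z)\<^sup>2)"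
      by (simp add: sum.distrib sum_distrib_left)
    also have "\<dots> \<le> q z"
      using mult_left_mono[OF n, of "1/2 * (Y z)\<^sup>2"] by (simp add: q_def)
    finally have "\<eta> (fst z) * w (fst z + norm (snd z)) * (\<Sum>e\<in>Basis. n e * (Y z * U e z))
        \<le> \<eta> (fst z) * w (fst z + norm (snd z)) * q z"
      using \<eta>(4) W(4) by (intro mult_left_mono) auto
    moreover have "(\<Sum>e\<in>Basis. \<psi>x e z * (Y z * U e z))
        = - (\<eta> (fst z) * w (fst z + norm (snd z)) * (\<Sum>e\<in>Basis. n e * (Y z * U e z)))"
      by (simp add: \<psi>x_def n_def sum_distrib_left sum_negf mult.assoc)
    ultimately show "\<psi>t z * q z - (\<Sum>e\<in>Basis. \<psi>x e z * (Y z * U e z))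
        \<le> \<eta>' (fst z) * W (fst z + norm (snd z)) * q z"
      by (simp add: \<psi>t_def left_diff_distrib)
  qed
  finally show ?thesis by (simp add: Y_def U_def q_def)
qed

text \<open>The product rule for \<Phi>(v) F, integrated against the weight. A general \<Phi> is
  kept so that bounded truncations of the fifth power can be inserted before the mollification is
  removed.\<close>

lemma product_identity_smooth:
  fixes v vt F Ft :: "spacetime \<Rightarrow> real"
  assumes \<phi>: "test_function UNIV \<phi>"
    and int: "integrable lborel v" "integrable lborel vt" "integrable lborel F" "integrable lborel Ft"
    and H1: "\<And>z. z \<in> K0 \<Longrightarrow> conv (partial (1, 0) \<phi>) v z = conv \<phi> vt z"
    and H2: "\<And>z. z \<in> K0 \<Longrightarrow> conv (partial (1, 0) \<phi>) F z = conv \<phi> Ft z"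
    and \<Phi>: "\<And>s. (\<Phi> has_real_derivative \<Phi>' s) (at s)" "continuous_on UNIV \<Phi>'"
  shows "(LINT z|lborel. \<psi>t z * (\<Phi> (conv \<phi> v z) * conv \<phi> F z))
    + (LINT z|lborel. \<psi> z * (\<Phi>' (conv \<phi> v z) * conv \<phi> vt z * conv \<phi> F z + conv \<phi> Ft z * \<Phi> (conv \<phi> v z))) = 0"
proof -
  note \<phi>t = test_function_partial[OF \<phi> time_basis]
  have cont: "continuous_on UNIV (conv \<phi> v)" "continuous_on UNIV (conv \<phi> F)"
    "continuous_on UNIV (conv (partial (1, 0) \<phi>) v)" "continuous_on UNIV (conv (partial (1, 0) \<phi>) F)"
    by (intro conv_test_continuous \<phi> \<phi>t int)+
  have cont\<Phi>: "continuous_on UNIV \<Phi>"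
    using \<Phi>(1) by (meson DERIV_continuous continuous_at_imp_continuous_on)
  let ?q' = "\<lambda>z. (\<Phi>' (conv \<phi> v z) * conv (partial (1, 0) \<phi>) v z) * conv \<phi> F z
      + conv (partial (1, 0) \<phi>) F z * \<Phi> (conv \<phi> v z)"
  have "(LINT z|lborel. \<psi>t z * (\<Phi> (conv \<phi> v z) * conv \<phi> F z)) + (LINT z|lborel. \<psi> z * ?q' z) = 0"
  proof (rule time_by_parts(3))
    show "continuous_on UNIV (\<lambda>z. \<Phi> (conv \<phi> v z) * conv \<phi> F z)" "continuous_on UNIV ?q'"
      by (intro continuous_intros cont continuous_on_compose2[OF cont\<Phi>] continuous_on_compose2[OF \<Phi>(2)]; simp)+
    fix z s
    show "((\<lambda>s. \<Phi> (conv \<phi> v (z + s *\<^sub>R (1, 0))) * conv \<phi> F (z + s *\<^sub>R (1, 0))) has_real_derivative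
        ?q' (z + s *\<^sub>R (1, 0))) (at s)"
      by (rule DERIV_mult[OF DERIV_chain'[OF conv_test_derivative[OF \<phi> time_basis int(1)] \<Phi>(1)]
            conv_test_derivative[OF \<phi> time_basis int(3)]])
  qed
  moreover have "\<psi> z * ?q' z = \<psi> z * (\<Phi>' (conv \<phi> v z) * conv \<phi> vt z * conv \<phi> F z + conv \<phi> Ft z * \<Phi> (conv \<phi> v z))" for z
    by (cases "z \<in> K0") (simp_all add: H1 H2 outside_K0(1))
  ultimately show ?thesis by simp
qed

end

section \<open>Convergence of mollified products\<close>

lemma epowr_mono: "0 < p \<Longrightarrow> x \<le> y \<Longrightarrow> epowr x p \<le> epowr y p"
  unfolding epowr_def
  by (auto simp: top_unique intro!: ennreal_leI powr_mono2 enn2real_mono simp: less_top)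

lemma epowr_measurable [measurable]: "(\<lambda>x. epowr x p) \<in> borel_measurable borel"
  unfolding epowr_def by measurable

lemma epowr_ennreal: "0 \<le> r \<Longrightarrow> epowr (ennreal r) p = ennreal (r powr p)"
  by (simp add: epowr_def)

lemma epowr_half_power2: "(epowr x (1/2))\<^sup>2 = x"
proof (cases x)
  case (real r)
  then have "(epowr x (1/2))\<^sup>2 = ennreal ((r powr (1/2))\<^sup>2)"
    by (simp add: epowr_ennreal ennreal_power)
  also have "(r powr (1/2))\<^sup>2 = r" using real by (simp add: powr_half_sqrt)
  finally show ?thesis using real by simp
qed (simp add: epowr_def power2_eq_square)

lemma ennreal_power2_le_imp_le:
  fixes x y :: ennreal
  assumes "x\<^sup>2 \<le> y\<^sup>2" shows "x \<le> y"
proof (cases y)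
  case (real s)
  then have "x\<^sup>2 \<le> ennreal (s\<^sup>2)" using assms by (simp add: ennreal_power)
  then have "x \<noteq> \<top>" by (auto simp: power2_eq_square top_unique)
  then obtain r where r: "x = ennreal r" "r \<ge> 0" by (cases x) auto
  then have "r\<^sup>2 \<le> s\<^sup>2" using assms real by (simp add: ennreal_power)
  then have "r \<le> s" using real(1) by (rule power2_le_imp_le)
  then show ?thesis using r real by (simp add: ennreal_leI)
qed simp

lemma nn_Cauchy_Schwarz:
  assumes [measurable]: "f \<in> borel_measurable M" "g \<in> borel_measurable M"
  shows "(\<integral>\<^sup>+x. ennreal (\<bar>f x\<bar> * \<bar>g x\<bar>) \<partial>M)
    \<le> epowr (\<integral>\<^sup>+x. ennreal ((f x)\<^sup>2) \<partial>M) (1/2) * epowr (\<integral>\<^sup>+x. ennreal ((g x)\<^sup>2) \<partial>M) (1/2)"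
proof (rule ennreal_power2_le_imp_le)
  have "(\<integral>\<^sup>+x. ennreal \<bar>f x\<bar> * ennreal \<bar>g x\<bar> \<partial>M)\<^sup>2
      \<le> (\<integral>\<^sup>+x. (ennreal \<bar>f x\<bar>)\<^sup>2 \<partial>M) * (\<integral>\<^sup>+x. (ennreal \<bar>g x\<bar>)\<^sup>2 \<partial>M)"
    by (rule Cauchy_Schwarz_nn_integral) measurable
  then show "(\<integral>\<^sup>+x. ennreal (\<bar>f x\<bar> * \<bar>g x\<bar>) \<partial>M)\<^sup>2 \<le>
      (epowr (\<integral>\<^sup>+x. ennreal ((f x)\<^sup>2) \<partial>M) (1/2) * epowr (\<integral>\<^sup>+x. ennreal ((g x)\<^sup>2) \<partial>M) (1/2))\<^sup>2"
    by (simp add: power_mult_distrib epowr_half_power2 ennreal_mult ennreal_power)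
qed

text \<open>Bounds are compared after squaring: a root of at least c forces the argument to be at
  least c^2.\<close>

lemma epowr_half_tendsto_0:
  assumes "(f \<longlongrightarrow> 0) F" shows "((\<lambda>n. epowr (f n) (1/2)) \<longlongrightarrow> 0) F"
proof (rule order_tendstoI)
  fix c :: ennreal assume "0 < c"
  then have "0 < c\<^sup>2" by (simp add: power2_eq_square zero_less_iff_neq_zero)
  with assms have "eventually (\<lambda>n. f n < c\<^sup>2) F" by (rule order_tendstoD)
  then show "eventually (\<lambda>n. epowr (f n) (1/2) < c) F"
  proof eventually_elim
    case (elim n)
    show ?case
    proof (rule ccontr)
      assume "\<not> epowr (f n) (1/2) < c"
      then have "c\<^sup>2 \<le> (epowr (f n) (1/2))\<^sup>2" by (intro power_mono) auto
      then show False using elim by (simp add: epowr_half_power2)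
    qed
  qed
qed simp

lemma ennreal_tendsto_0_le:
  fixes f g :: "'a \<Rightarrow> ennreal"
  assumes "(g \<longlongrightarrow> 0) F" "\<And>n. f n \<le> g n"
  shows "(f \<longlongrightarrow> 0) F"
  by (rule tendsto_sandwich[of "\<lambda>_. 0" f F g]) (use assms in auto)

lemma ennreal_tendsto_0_cmult:
  fixes g :: "'a \<Rightarrow> ennreal"
  assumes "(g \<longlongrightarrow> 0) F" "c < \<top>"
  shows "((\<lambda>n. c * g n) \<longlongrightarrow> 0) F"
  using ennreal_tendsto_cmult[OF assms(2,1)] by simp

text \<open>Expand around the limits as (f_n - f)(g_n - g) + f (g_n - g) + g (f_n - f) and apply
  Cauchy-Schwarz to each term.\<close>

lemma L2_product_tendsto:
  fixes f g :: "'a \<Rightarrow> real"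
  assumes [measurable]: "\<And>n. fn n \<in> borel_measurable M" "\<And>n. gn n \<in> borel_measurable M"
      "f \<in> borel_measurable M" "g \<in> borel_measurable M"
    and fin: "(\<integral>\<^sup>+x. ennreal ((f x)\<^sup>2) \<partial>M) < \<top>" "(\<integral>\<^sup>+x. ennreal ((g x)\<^sup>2) \<partial>M) < \<top>"
    and lim: "(\<lambda>n::nat. \<integral>\<^sup>+x. ennreal ((fn n x - f x)\<^sup>2) \<partial>M) \<longlonglongrightarrow> 0"
      "(\<lambda>n. \<integral>\<^sup>+x. ennreal ((gn n x - g x)\<^sup>2) \<partial>M) \<longlonglongrightarrow> 0"
  shows "(\<lambda>n. \<integral>\<^sup>+x. ennreal \<bar>fn n x * gn n x - f x * g x\<bar> \<partial>M) \<longlonglongrightarrow> 0"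
proof -
  let ?e = "\<lambda>u. epowr (\<integral>\<^sup>+x. ennreal ((u x)\<^sup>2) \<partial>M) (1/2)"
  let ?a = "\<lambda>n. ?e (\<lambda>x. fn n x - f x)" and ?b = "\<lambda>n. ?e (\<lambda>x. gn n x - g x)"
  have e: "?a \<longlonglongrightarrow> 0" "?b \<longlonglongrightarrow> 0"
    by (rule epowr_half_tendsto_0[OF lim(1)], rule epowr_half_tendsto_0[OF lim(2)])
  have fin': "?e f < \<top>" "?e g < \<top>"
    using fin by (auto simp: epowr_def)
  have ab: "(\<lambda>n. ?a n * ?b n) \<longlonglongrightarrow> 0 * 0"
    by (rule tendsto_mult_ennreal[OF e]) auto
  have lim': "(\<lambda>n. ?a n * ?b n + (?e f * ?b n + ?e g * ?a n)) \<longlonglongrightarrow> 0 + (0 + 0)"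
    using ab e fin' by (intro tendsto_add ennreal_tendsto_0_cmult) auto
  show ?thesis
  proof (rule ennreal_tendsto_0_le)
    show "(\<lambda>n. ?a n * ?b n + (?e f * ?b n + ?e g * ?a n)) \<longlonglongrightarrow> 0"
      using lim' by (simp only: add_0_right)
    fix n
    have "(\<integral>\<^sup>+x. ennreal \<bar>fn n x * gn n x - f x * g x\<bar> \<partial>M)
        \<le> (\<integral>\<^sup>+x. ennreal (\<bar>fn n x - f x\<bar> * \<bar>gn n x - g x\<bar>)
            + (ennreal (\<bar>f x\<bar> * \<bar>gn n x - g x\<bar>) + ennreal (\<bar>g x\<bar> * \<bar>fn n x - f x\<bar>)) \<partial>M)"
    proof (rule nn_integral_mono)
      fix x
      have "fn n x * gn n x - f x * g x
          = (fn n x - f x) * (gn n x - g x) + f x * (gn n x - g x) + g x * (fn n x - f x)"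
        by (simp add: algebra_simps)
      then have "\<bar>fn n x * gn n x - f x * g x\<bar>
          \<le> \<bar>fn n x - f x\<bar> * \<bar>gn n x - g x\<bar> + (\<bar>f x\<bar> * \<bar>gn n x - g x\<bar> + \<bar>g x\<bar> * \<bar>fn n x - f x\<bar>)"
        unfolding abs_mult[symmetric] by linarith
      then show "ennreal \<bar>fn n x * gn n x - f x * g x\<bar> \<le> ennreal (\<bar>fn n x - f x\<bar> * \<bar>gn n x - g x\<bar>)
            + (ennreal (\<bar>f x\<bar> * \<bar>gn n x - g x\<bar>) + ennreal (\<bar>g x\<bar> * \<bar>fn n x - f x\<bar>))"
        by (subst ennreal_plus[symmetric], simp, simp)+ (rule ennreal_leI)
    qed
    also have "\<dots> = (\<integral>\<^sup>+x. ennreal (\<bar>fn n x - f x\<bar> * \<bar>gn n x - g x\<bar>) \<partial>M)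
        + ((\<integral>\<^sup>+x. ennreal (\<bar>f x\<bar> * \<bar>gn n x - g x\<bar>) \<partial>M) + (\<integral>\<^sup>+x. ennreal (\<bar>g x\<bar> * \<bar>fn n x - f x\<bar>) \<partial>M))"
      by (simp add: nn_integral_add)
    also have "\<dots> \<le> ?a n * ?b n + (?e f * ?b n + ?e g * ?a n)"
      by (intro add_mono nn_Cauchy_Schwarz) measurable
    finally show "(\<integral>\<^sup>+x. ennreal \<bar>fn n x * gn n x - f x * g x\<bar> \<partial>M) \<le> \<dots>" .
  qed
qed

text \<open>b_n (u_n - u) is small because b_n is bounded, and (b_n - b) u is small by dominated
  convergence. Almost everywhere convergence of the coefficients is therefore enough.\<close>

lemma bounded_times_L1_tendsto:
  fixes u :: "'a \<Rightarrow> real"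
  assumes int: "\<And>n::nat. integrable M (un n)" "integrable M u"
    and lim: "(\<lambda>n. \<integral>\<^sup>+x. ennreal \<bar>un n x - u x\<bar> \<partial>M) \<longlonglongrightarrow> 0"
    and b: "\<And>n. bn n \<in> borel_measurable M" "b \<in> borel_measurable M" "\<And>n x. \<bar>bn n x\<bar> \<le> B"
      "AE x in M. (\<lambda>n. bn n x) \<longlonglongrightarrow> b x"
  shows "(\<lambda>n. LINT x|M. bn n x * un n x) \<longlonglongrightarrow> (LINT x|M. b x * u x)"
proof (rule tendsto_L1_int)
  note [measurable] = b(1,2)
  have [measurable]: "\<And>n. un n \<in> borel_measurable M" "u \<in> borel_measurable M" using int by auto
  have "B \<ge> 0" using b(3) abs_ge_zero order_trans by blast
  have bB: "AE x in M. \<bar>b x\<bar> \<le> B"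
    using b(4) by eventually_elim (use b(3) in \<open>auto intro: LIMSEQ_le_const2[OF tendsto_rabs]\<close>)
  show "integrable M (\<lambda>x. bn n x * un n x)" for n
    by (rule Bochner_Integration.integrable_bound[OF integrable_mult_right[OF integrable_norm[OF int(1)[of n]], of B]])
       (use \<open>B \<ge> 0\<close> b(3) in \<open>auto simp: abs_mult intro!: mult_right_mono\<close>)
  show "integrable M (\<lambda>x. b x * u x)"
    by (rule Bochner_Integration.integrable_bound[OF integrable_mult_right[OF integrable_norm[OF int(2)], of B]])
       (use \<open>B \<ge> 0\<close> bB in \<open>auto simp: abs_mult intro!: mult_right_mono\<close>)
  have "(\<lambda>n. \<integral>\<^sup>+x. ennreal (\<bar>bn n x - b x\<bar> * \<bar>u x\<bar>) \<partial>M) \<longlonglongrightarrow> (\<integral>\<^sup>+x. 0 \<partial>M)"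
  proof (rule nn_integral_dominated_convergence)
    show "(\<integral>\<^sup>+x. ennreal (2 * B * \<bar>u x\<bar>) \<partial>M) < \<infinity>"
      using int(2) \<open>B \<ge> 0\<close>
      by (simp add: integrable_iff_bounded ennreal_mult nn_integral_cmult ennreal_mult_less_top)
    show "AE x in M. ennreal (\<bar>bn n x - b x\<bar> * \<bar>u x\<bar>) \<le> ennreal (2 * B * \<bar>u x\<bar>)" for n
      using bB
    proof eventually_elim
      case (elim x)
      then show ?case using b(3)[of n x] by (intro ennreal_leI mult_right_mono) auto
    qed
    show "AE x in M. (\<lambda>n. ennreal (\<bar>bn n x - b x\<bar> * \<bar>u x\<bar>)) \<longlonglongrightarrow> 0"
      using b(4)
    proof eventually_elim
      case (elim x)
      then have "(\<lambda>n. \<bar>bn n x - b x\<bar> * \<bar>u x\<bar>) \<longlonglongrightarrow> \<bar>b x - b x\<bar> * \<bar>u x\<bar>" by (intro tendsto_intros)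
      then have "(\<lambda>n. \<bar>bn n x - b x\<bar> * \<bar>u x\<bar>) \<longlonglongrightarrow> 0" by simp
      then show ?case using tendsto_ennrealI by fastforce
    qed
  qed measurable
  then have lim2: "(\<lambda>n. ennreal B * (\<integral>\<^sup>+x. ennreal \<bar>un n x - u x\<bar> \<partial>M)
      + (\<integral>\<^sup>+x. ennreal (\<bar>bn n x - b x\<bar> * \<bar>u x\<bar>) \<partial>M)) \<longlonglongrightarrow> 0 + 0"
    using lim by (intro tendsto_add ennreal_tendsto_0_cmult) auto
  show "(\<lambda>n. \<integral>\<^sup>+x. ennreal (norm (bn n x * un n x - b x * u x)) \<partial>M) \<longlonglongrightarrow> 0"
  proof (rule ennreal_tendsto_0_le)
    fix n
    have "(\<integral>\<^sup>+x. ennreal (norm (bn n x * un n x - b x * u x)) \<partial>M)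
        \<le> (\<integral>\<^sup>+x. ennreal B * ennreal \<bar>un n x - u x\<bar> + ennreal (\<bar>bn n x - b x\<bar> * \<bar>u x\<bar>) \<partial>M)"
    proof (rule nn_integral_mono)
      fix x
      have "bn n x * un n x - b x * u x = bn n x * (un n x - u x) + (bn n x - b x) * u x"
        by (simp add: algebra_simps)
      then have "\<bar>bn n x * un n x - b x * u x\<bar> \<le> \<bar>bn n x\<bar> * \<bar>un n x - u x\<bar> + \<bar>bn n x - b x\<bar> * \<bar>u x\<bar>"
        unfolding abs_mult[symmetric] by linarith
      also have "\<dots> \<le> B * \<bar>un n x - u x\<bar> + \<bar>bn n x - b x\<bar> * \<bar>u x\<bar>"
        using b(3) by (intro add_right_mono mult_right_mono) auto
      finally show "ennreal (norm (bn n x * un n x - b x * u x))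
          \<le> ennreal B * ennreal \<bar>un n x - u x\<bar> + ennreal (\<bar>bn n x - b x\<bar> * \<bar>u x\<bar>)"
        using \<open>B \<ge> 0\<close> by (simp add: ennreal_leI flip: ennreal_mult ennreal_plus)
    qed
    also have "\<dots> = ennreal B * (\<integral>\<^sup>+x. ennreal \<bar>un n x - u x\<bar> \<partial>M)
      + (\<integral>\<^sup>+x. ennreal (\<bar>bn n x - b x\<bar> * \<bar>u x\<bar>) \<partial>M)"
      by (simp add: nn_integral_add nn_integral_cmult)
    finally show "(\<integral>\<^sup>+x. ennreal (norm (bn n x * un n x - b x * u x)) \<partial>M) \<le> \<dots>" .
  qed (use lim2 in simp)
qed

lemma integrable_product_L2:
  fixes f g :: "'a \<Rightarrow> real"
  assumes [measurable]: "f \<in> borel_measurable M" "g \<in> borel_measurable M"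
    and fin: "(\<integral>\<^sup>+x. ennreal ((f x)\<^sup>2) \<partial>M) < \<top>" "(\<integral>\<^sup>+x. ennreal ((g x)\<^sup>2) \<partial>M) < \<top>"
  shows "integrable M (\<lambda>x. f x * g x)"
proof (rule integrableI_bounded)
  have "(\<integral>\<^sup>+x. ennreal (norm (f x * g x)) \<partial>M) \<le> epowr (\<integral>\<^sup>+x. ennreal ((f x)\<^sup>2) \<partial>M) (1/2) * epowr (\<integral>\<^sup>+x. ennreal ((g x)\<^sup>2) \<partial>M) (1/2)"
    using nn_Cauchy_Schwarz[of f M g] by (simp add: abs_mult)
  also have "\<dots> < \<infinity>"
    using fin by (auto simp: epowr_def ennreal_mult_less_top)
  finally show "(\<integral>\<^sup>+x. ennreal (norm (f x * g x)) \<partial>M) < \<infinity>" .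
qed measurable

section \<open>Bounds for mollified functions and their pairings\<close>

context mollifier
begin

text \<open>The 2^p inequality alone bounds the translation error uniformly over all shifts, so the
  mollification error is finite; \<open>f\<close> is then added back.\<close>

lemma conv_Lp_finite:
  assumes f: "integrable lborel f" and p: "p = 1 \<or> p = 2"
    and fin: "(\<integral>\<^sup>+x. ennreal (\<bar>f x\<bar> ^ p) \<partial>lborel) < \<top>"
  shows "(\<integral>\<^sup>+x. ennreal (\<bar>conv \<rho> f x\<bar> ^ p) \<partial>lborel) < \<top>"
proof -
  have [measurable]: "f \<in> borel_measurable borel" using f by auto
  note [measurable] = conv_measurable[OF f]
  let ?I = "\<lambda>u. (\<integral>\<^sup>+x. ennreal (\<bar>u x\<bar> ^ p) \<partial>(lborel :: 'a measure))"
  let ?c = "2 ^ p * (?I f + ?I f)"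
  have "?I (\<lambda>x. conv \<rho> f x - f x) \<le> ?c"
  proof (rule Lp_conv_le[OF f p])
    fix h :: 'a
    have "?I (\<lambda>x. f (h + x) + (- f x)) \<le> 2 ^ p * (?I (\<lambda>x. f (h + x)) + ?I (\<lambda>x. - f x))"
      by (rule nn_integral_abs_add_power_le) measurable
    also have "?I (\<lambda>x. f (h + x)) = ?I f"
      using nn_integral_lborel_shift[of "\<lambda>x. ennreal (\<bar>f x\<bar> ^ p)" h] by simp
    finally show "?I (\<lambda>x. f (h + x) - f x) \<le> ?c" by simp
  qed
  moreover have "?c < \<top>"
    using fin by (simp add: ennreal_mult_less_top power_less_top_ennreal)
  ultimately have "?I (\<lambda>x. conv \<rho> f x - f x) < \<top>" by (rule order.strict_trans1)
  moreover have "?I (\<lambda>x. (conv \<rho> f x - f x) + f x) \<le> 2 ^ p * (?I (\<lambda>x. conv \<rho> f x - f x) + ?I f)"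
    by (rule nn_integral_abs_add_power_le) measurable
  ultimately show ?thesis
    using fin by (simp add: ennreal_mult_less_top power_less_top_ennreal order.strict_trans1)
qed

lemma integrable_conv_mollifier:
  assumes f: "integrable lborel f"
  shows "integrable lborel (conv \<rho> f)"
  by (rule integrableI_bounded)
     (use conv_measurable[OF f] conv_Lp_finite[OF f, of 1] f in \<open>auto simp: integrable_iff_bounded\<close>)

lemma abs_conv_le_nn:
  assumes f: "integrable lborel f"
  shows "ennreal \<bar>conv \<rho> f z\<bar> \<le> (\<integral>\<^sup>+y. ennreal (\<rho> y) * ennreal \<bar>f (y + z)\<bar> \<partial>lborel)"
proof -
  have [measurable]: "f \<in> borel_measurable borel" using f by auto
  obtain M where M: "\<And>x. \<bar>\<rho> x\<bar> \<le> M" using bounded_abs by blast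
  have "ennreal \<bar>conv \<rho> f z\<bar> \<le> (\<integral>\<^sup>+y. ennreal (\<rho> (z - y)) * ennreal \<bar>f y\<bar> \<partial>lborel)"
    using integral_norm_bound_ennreal[OF integrable_conv[OF borel M f, of z]] nonneg
    by (simp add: conv_def abs_mult ennreal_mult)
  also have "\<dots> = (\<integral>\<^sup>+y. ennreal (\<rho> (z - (z + y))) * ennreal \<bar>f (z + y)\<bar> \<partial>lborel)"
    by (subst nn_integral_lborel_shift[of "\<lambda>y. ennreal (\<rho> (z - y)) * ennreal \<bar>f y\<bar>" z]) auto
  finally show ?thesis by (simp add: even add.commute)
qed

text \<open>The two mollifications average over independent shifts \<open>y\<close> and
  \<open>y'\<close>. A bound uniform in both shifts survives the averaging, with a constant
  independent of \<rho>.\<close>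

lemma conv_pairing_le:
  assumes f: "integrable lborel f" and h: "integrable lborel h"
    and le: "\<And>y y'. (\<integral>\<^sup>+z. ennreal (\<bar>f (y + z)\<bar> * \<bar>h (y' + z)\<bar>) \<partial>lborel) \<le> c"
  shows "(\<integral>\<^sup>+z. ennreal (\<bar>conv \<rho> f z\<bar> * \<bar>conv \<rho> h z\<bar>) \<partial>lborel) \<le> c"
proof -
  have [measurable]: "f \<in> borel_measurable borel" "h \<in> borel_measurable borel" using f h by auto
  have "(\<integral>\<^sup>+z. ennreal (\<bar>conv \<rho> f z\<bar> * \<bar>conv \<rho> h z\<bar>) \<partial>lborel)
      \<le> (\<integral>\<^sup>+z. (\<integral>\<^sup>+y. ennreal (\<rho> y) * ennreal \<bar>f (y + z)\<bar> \<partial>lborel)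
          * (\<integral>\<^sup>+y'. ennreal (\<rho> y') * ennreal \<bar>h (y' + z)\<bar> \<partial>lborel) \<partial>lborel)"
    unfolding ennreal_mult[OF abs_ge_zero abs_ge_zero]
    by (intro nn_integral_mono mult_mono abs_conv_le_nn f h) auto
  also have "\<dots> = (\<integral>\<^sup>+z. (\<integral>\<^sup>+y. (\<integral>\<^sup>+y'. ennreal (\<rho> y) * ennreal (\<rho> y') * ennreal (\<bar>f (y + z)\<bar> * \<bar>h (y' + z)\<bar>) \<partial>lborel) \<partial>lborel) \<partial>lborel)"
  proof (rule nn_integral_cong)
    fix z
    have "(\<integral>\<^sup>+y. (\<integral>\<^sup>+y'. ennreal (\<rho> y) * ennreal (\<rho> y') * ennreal (\<bar>f (y + z)\<bar> * \<bar>h (y' + z)\<bar>) \<partial>lborel) \<partial>lborel)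
        = (\<integral>\<^sup>+y. (\<integral>\<^sup>+y'. (ennreal (\<rho> y) * ennreal \<bar>f (y + z)\<bar>) * (ennreal (\<rho> y') * ennreal \<bar>h (y' + z)\<bar>) \<partial>lborel) \<partial>lborel)"
      by (intro nn_integral_cong) (simp add: ennreal_mult mult_ac)
    also have "\<dots> = (\<integral>\<^sup>+y. (ennreal (\<rho> y) * ennreal \<bar>f (y + z)\<bar>) * (\<integral>\<^sup>+y'. ennreal (\<rho> y') * ennreal \<bar>h (y' + z)\<bar> \<partial>lborel) \<partial>lborel)"
      by (intro nn_integral_cong nn_integral_cmult) measurable
    also have "\<dots> = (\<integral>\<^sup>+y. ennreal (\<rho> y) * ennreal \<bar>f (y + z)\<bar> \<partial>lborel)
          * (\<integral>\<^sup>+y'. ennreal (\<rho> y') * ennreal \<bar>h (y' + z)\<bar> \<partial>lborel)"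
      by (rule nn_integral_multc) measurable
    finally show "(\<integral>\<^sup>+y. ennreal (\<rho> y) * ennreal \<bar>f (y + z)\<bar> \<partial>lborel)
          * (\<integral>\<^sup>+y'. ennreal (\<rho> y') * ennreal \<bar>h (y' + z)\<bar> \<partial>lborel)
        = (\<integral>\<^sup>+y. (\<integral>\<^sup>+y'. ennreal (\<rho> y) * ennreal (\<rho> y') * ennreal (\<bar>f (y + z)\<bar> * \<bar>h (y' + z)\<bar>) \<partial>lborel) \<partial>lborel)" ..
  qed
  also have "\<dots> = (\<integral>\<^sup>+y. (\<integral>\<^sup>+z. (\<integral>\<^sup>+y'. ennreal (\<rho> y) * ennreal (\<rho> y') * ennreal (\<bar>f (y + z)\<bar> * \<bar>h (y' + z)\<bar>) \<partial>lborel) \<partial>lborel) \<partial>lborel)"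
    by (rule lborel_pair.Fubini') measurable
  also have "\<dots> = (\<integral>\<^sup>+y. (\<integral>\<^sup>+y'. (\<integral>\<^sup>+z. ennreal (\<rho> y) * ennreal (\<rho> y') * ennreal (\<bar>f (y + z)\<bar> * \<bar>h (y' + z)\<bar>) \<partial>lborel) \<partial>lborel) \<partial>lborel)"
    by (intro nn_integral_cong lborel_pair.Fubini') measurable
  also have "\<dots> = (\<integral>\<^sup>+y. (\<integral>\<^sup>+y'. ennreal (\<rho> y) * ennreal (\<rho> y') * (\<integral>\<^sup>+z. ennreal (\<bar>f (y + z)\<bar> * \<bar>h (y' + z)\<bar>) \<partial>lborel) \<partial>lborel) \<partial>lborel)"
    by (intro nn_integral_cong nn_integral_cmult) measurable
  also have "\<dots> \<le> (\<integral>\<^sup>+y. (\<integral>\<^sup>+y'. ennreal (\<rho> y) * ennreal (\<rho> y') * c \<partial>lborel) \<partial>lborel)"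
    by (intro nn_integral_mono mult_left_mono le) auto
  also have "\<dots> = c"
    by (simp add: nn_integral_multc nn_integral_cmult total)
  finally show ?thesis .
qed

end

section \<open>Slices in time and mixed norms\<close>

lemma nn_integral_spacetime:
  fixes f :: "'a::euclidean_space \<times> 'b::euclidean_space \<Rightarrow> ennreal"
  assumes "f \<in> borel_measurable borel"
  shows "(\<integral>\<^sup>+z. f z \<partial>lborel) = (\<integral>\<^sup>+t. (\<integral>\<^sup>+x. f (t, x) \<partial>lborel) \<partial>lborel)"
proof -
  have "f \<in> borel_measurable (lborel \<Otimes>\<^sub>M lborel)"
    using assms by (simp add: lborel_prod)
  from lborel.nn_integral_fst[OF this] show ?thesis
    by (simp add: lborel_prod)
qed

text \<open>The squared L^2 norm on one time slice; the time integral of its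
  \<open>epowr _ (1/2)\<close> is the L^1 norm in time of the L^2 norm in space.\<close>

definition slice_sq :: "(spacetime \<Rightarrow> real) \<Rightarrow> real \<Rightarrow> ennreal" where
  "slice_sq f t = (\<integral>\<^sup>+x. ennreal ((f (t, x))\<^sup>2) \<partial>lborel)"

lemma slice_sq_measurable [measurable]:
  assumes [measurable]: "f \<in> borel_measurable borel"
  shows "slice_sq f \<in> borel_measurable borel"
  unfolding slice_sq_def[abs_def] by measurable

lemma nn_integral_slice_sq:
  assumes [measurable]: "f \<in> borel_measurable borel"
  shows "(\<integral>\<^sup>+z. ennreal ((f z)\<^sup>2) \<partial>lborel) = (\<integral>\<^sup>+t. slice_sq f t \<partial>lborel)"
  unfolding slice_sq_def by (rule nn_integral_spacetime) measurable

text \<open>Cauchy-Schwarz on each slice. A spacetime shift moves slices in time and translates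
  within them, so the bound is uniform in \<open>y\<close> and \<open>y'\<close>, as
  \<open>conv_pairing_le\<close> demands.\<close>

lemma mixed_pairing_le:
  assumes [measurable]: "f \<in> borel_measurable borel" "h \<in> borel_measurable borel"
    and c: "\<And>t. slice_sq f t \<le> c"
  shows "(\<integral>\<^sup>+z. ennreal (\<bar>f (y + z)\<bar> * \<bar>h (y' + z)\<bar>) \<partial>lborel)
    \<le> epowr c (1/2) * (\<integral>\<^sup>+t. epowr (slice_sq h t) (1/2) \<partial>lborel)"
proof -
  have shift: "slice_sq (\<lambda>z. u (y + z)) t = slice_sq u (fst y + t)"
    if [measurable]: "u \<in> borel_measurable borel" for u y t
    unfolding slice_sq_def
    using nn_integral_lborel_shift[of "\<lambda>x. ennreal ((u (fst y + t, x))\<^sup>2)" "snd y"]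
    by (cases y) simp
  have "(\<integral>\<^sup>+z. ennreal (\<bar>f (y + z)\<bar> * \<bar>h (y' + z)\<bar>) \<partial>lborel)
      = (\<integral>\<^sup>+t. (\<integral>\<^sup>+x. ennreal (\<bar>f (y + (t, x))\<bar> * \<bar>h (y' + (t, x))\<bar>) \<partial>lborel) \<partial>lborel)"
    by (rule nn_integral_spacetime) measurable
  also have "\<dots> \<le> (\<integral>\<^sup>+t. epowr c (1/2) * epowr (slice_sq h (fst y' + t)) (1/2) \<partial>lborel)"
  proof (rule nn_integral_mono)
    fix t
    have "(\<integral>\<^sup>+x. ennreal (\<bar>f (y + (t, x))\<bar> * \<bar>h (y' + (t, x))\<bar>) \<partial>lborel)
        \<le> epowr (slice_sq (\<lambda>z. f (y + z)) t) (1/2) * epowr (slice_sq (\<lambda>z. h (y' + z)) t) (1/2)"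
      unfolding slice_sq_def by (rule nn_Cauchy_Schwarz) measurable
    also have "\<dots> \<le> epowr c (1/2) * epowr (slice_sq h (fst y' + t)) (1/2)"
      using c by (simp add: shift mult_right_mono epowr_mono)
    finally show "(\<integral>\<^sup>+x. ennreal (\<bar>f (y + (t, x))\<bar> * \<bar>h (y' + (t, x))\<bar>) \<partial>lborel) \<le> \<dots>" .
  qed
  also have "\<dots> = epowr c (1/2) * (\<integral>\<^sup>+t. epowr (slice_sq h (fst y' + t)) (1/2) \<partial>lborel)"
    by (rule nn_integral_cmult) measurable
  also have "(\<integral>\<^sup>+t. epowr (slice_sq h (fst y' + t)) (1/2) \<partial>lborel) = (\<integral>\<^sup>+t. epowr (slice_sq h t) (1/2) \<partial>lborel)"
    by (rule nn_integral_lborel_shift) measurable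
  finally show ?thesis .
qed

lemma integrable_mixed_product:
  assumes [measurable]: "f \<in> borel_measurable borel" "h \<in> borel_measurable borel"
    and c: "\<And>t. slice_sq f t \<le> c" "c < \<top>"
    and fin: "(\<integral>\<^sup>+t. epowr (slice_sq h t) (1/2) \<partial>lborel) < \<top>"
  shows "integrable lborel (\<lambda>z. f z * h z)"
proof (rule integrableI_bounded)
  have "epowr c (1/2) < \<top>" using c(2) by (auto simp: epowr_def)
  with mixed_pairing_le[OF assms(1,2) c(1), of 0 0] fin
  show "(\<integral>\<^sup>+z. ennreal (norm (f z * h z)) \<partial>lborel) < \<infinity>"
    by (simp add: abs_mult ennreal_mult_less_top order.strict_trans1)
qed measurable

text \<open>The slice norm is integrable, hence finite at almost every time; such a time leaves the
  level sets as \<open>k\<close> grows, and the slice norm itself dominates.\<close>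

lemma mixed_tail_tendsto_0:
  assumes [measurable]: "g \<in> borel_measurable borel"
    and fin: "(\<integral>\<^sup>+t. epowr (slice_sq g t) (1/2) \<partial>lborel) < \<top>"
  shows "(\<lambda>k::nat. \<integral>\<^sup>+t. epowr (slice_sq g t) (1/2) * indicator {t. slice_sq g t > of_nat k} t \<partial>lborel) \<longlonglongrightarrow> 0"
proof -
  have "(\<lambda>k::nat. \<integral>\<^sup>+t. epowr (slice_sq g t) (1/2) * indicator {t. slice_sq g t > of_nat k} t \<partial>lborel)
      \<longlonglongrightarrow> (\<integral>\<^sup>+t. 0 \<partial>(lborel :: real measure))"
  proof (rule nn_integral_dominated_convergence)
    show "(\<integral>\<^sup>+t. epowr (slice_sq g t) (1/2) \<partial>lborel) < \<infinity>" using fin by simp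
    have "AE t in lborel. epowr (slice_sq g t) (1/2) \<noteq> \<infinity>"
      by (rule nn_integral_PInf_AE) (use fin in auto)
    then show "AE t in lborel. (\<lambda>k. epowr (slice_sq g t) (1/2) * indicator {t. slice_sq g t > of_nat k} t) \<longlonglongrightarrow> 0"
    proof eventually_elim
      case (elim t)
      then have "slice_sq g t \<noteq> \<top>" by (auto simp: epowr_def)
      then have "slice_sq g t < \<top>" by (simp add: less_top)
      then obtain k where k: "slice_sq g t < of_nat k" using ennreal_Ex_less_of_nat by blast
      have "eventually (\<lambda>j. epowr (slice_sq g t) (1/2) * indicator {t. slice_sq g t > of_nat j} t = 0) sequentially"
        using eventually_ge_at_top[of k]
      proof eventually_elim
        case (elim j)
        then have "of_nat k \<le> (of_nat j :: ennreal)" by simp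
        then have "\<not> of_nat j < slice_sq g t" using k by (meson leD less_le_trans order.strict_implies_order)
        then show ?case by simp
      qed
      then show ?case by (rule tendsto_eventually)
    qed
    show "AE t in lborel. epowr (slice_sq g t) (1/2) * indicator {t. slice_sq g t > of_nat k} t \<le> epowr (slice_sq g t) (1/2)" for k :: nat
      by (intro AE_I2) (simp add: indicator_def)
  qed measurable
  then show ?thesis by simp
qed

text \<open>In the pairing of \<open>L\<^sup>\<infinity>\<^sub>t L\<^sup>2\<^sub>x\<close> with \<open>L\<^sup>1\<^sub>t L\<^sup>2\<^sub>x\<close> both mollified factors converge: the times at which
  \<open>g\<close> is large contribute little uniformly in the mollification parameter, and at the remaining
  times \<open>g\<close> is square integrable.\<close>

lemma mollified_pairing_tendsto:
  fixes f g :: "spacetime \<Rightarrow> real"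
  assumes \<rho>: "\<And>n. mollifier (\<rho> n) (r n)" and r: "r \<longlonglongrightarrow> 0"
    and f: "integrable lborel f" "\<And>t. slice_sq f t \<le> c" "c < \<top>" "(\<integral>\<^sup>+z. ennreal ((f z)\<^sup>2) \<partial>lborel) < \<top>"
    and g: "integrable lborel g" "(\<integral>\<^sup>+t. epowr (slice_sq g t) (1/2) \<partial>lborel) < \<top>"
  shows "(\<lambda>n. \<integral>\<^sup>+z. ennreal \<bar>conv (\<rho> n) f z * conv (\<rho> n) g z - f z * g z\<bar> \<partial>lborel) \<longlonglongrightarrow> 0"
proof (rule tendsto_0_if_Limsup_eq_0_ennreal, rule antisym)
  have [measurable]: "f \<in> borel_measurable borel" "g \<in> borel_measurable borel" using f g by auto
  define N where "N = slice_sq g"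
  have [measurable]: "N \<in> borel_measurable borel" unfolding N_def by measurable
  have [measurable]: "(fst :: spacetime \<Rightarrow> real) \<in> borel_measurable borel"
    by (intro borel_measurable_continuous_onI continuous_intros)
  define gk where "gk k z = g z * indicator {z. N (fst z) \<le> of_nat k} z" for k :: nat and z :: spacetime
  define hk where "hk k z = g z * indicator {z. N (fst z) > of_nat k} z" for k :: nat and z :: spacetime
  have meas [measurable]: "gk k \<in> borel_measurable borel" "hk k \<in> borel_measurable borel" for k
    unfolding gk_def[abs_def] hk_def[abs_def] by measurable
  have gh: "g z = gk k z + hk k z" for k z
    by (auto simp: gk_def hk_def indicator_def not_le[symmetric])
  have int: "integrable lborel (gk k)" "integrable lborel (hk k)" for k
    by (rule Bochner_Integration.integrable_bound[OF g(1)]; auto simp: gk_def hk_def indicator_def)+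
  have N_hk: "slice_sq (hk k) t = N t * indicator {t. N t > of_nat k} t" for k t
    by (auto simp: slice_sq_def hk_def N_def indicator_def)
  have N_gk: "slice_sq (gk k) t = N t * indicator {t. N t \<le> of_nat k} t" for k t
    by (auto simp: slice_sq_def gk_def N_def indicator_def)
  have e_hk: "epowr (slice_sq (hk k) t) (1/2) = epowr (N t) (1/2) * indicator {t. N t > of_nat k} t" for k t
    unfolding N_hk by (auto simp: indicator_def epowr_def)
  have gk_L2: "(\<integral>\<^sup>+z. ennreal ((gk k z)\<^sup>2) \<partial>lborel) < \<top>" for k
  proof -
    have "(\<integral>\<^sup>+z. ennreal ((gk k z)\<^sup>2) \<partial>lborel) = (\<integral>\<^sup>+t. slice_sq (gk k) t \<partial>lborel)"
      by (rule nn_integral_slice_sq) measurable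
    \<comment> \<open>Where N <= k one has N <= sqrt k * sqrt N, so integrability of sqrt N gives
      square integrability in spacetime.\<close>
    also have "\<dots> \<le> (\<integral>\<^sup>+t. epowr (of_nat k) (1/2) * epowr (N t) (1/2) \<partial>lborel)"
    proof (rule nn_integral_mono)
      fix t
      show "slice_sq (gk k) t \<le> epowr (of_nat k) (1/2) * epowr (N t) (1/2)"
      proof (cases "N t \<le> of_nat k")
        case True
        have "slice_sq (gk k) t \<le> (epowr (N t) (1/2))\<^sup>2"
          by (simp add: N_gk epowr_half_power2 indicator_def)
        also have "\<dots> \<le> epowr (of_nat k) (1/2) * epowr (N t) (1/2)"
          unfolding power2_eq_square using True by (intro mult_right_mono epowr_mono) auto
        finally show ?thesis .
      qed (simp add: N_gk)
    qed
    also have "\<dots> = epowr (of_nat k) (1/2) * (\<integral>\<^sup>+t. epowr (N t) (1/2) \<partial>lborel)"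
      by (rule nn_integral_cmult) measurable
    also have "\<dots> < \<top>" using g(2) by (simp add: N_def ennreal_mult_less_top epowr_def less_top)
    finally show ?thesis .
  qed
  define \<epsilon> where "\<epsilon> k = epowr c (1/2) * (\<integral>\<^sup>+t. epowr (slice_sq (hk k) t) (1/2) \<partial>lborel)" for k
  have \<epsilon>: "\<epsilon> \<longlonglongrightarrow> 0"
    unfolding \<epsilon>_def[abs_def] e_hk N_def using mixed_tail_tendsto_0[OF _ g(2)] f(3)
    by (intro ennreal_tendsto_0_cmult) (auto simp: epowr_def less_top)
  show "limsup (\<lambda>n. \<integral>\<^sup>+z. ennreal \<bar>conv (\<rho> n) f z * conv (\<rho> n) g z - f z * g z\<bar> \<partial>lborel) \<le> 0"
  proof (rule ennreal_le_epsilon)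
    fix e :: real assume "e > 0"
    then have "0 < ennreal (e / 3)" by simp
    then have "eventually (\<lambda>k. \<epsilon> k < ennreal (e / 3)) sequentially" by (rule order_tendstoD(2)[OF \<epsilon>])
    \<comment> \<open>\<open>k\<close> is fixed before \<open>n\<close>: the part of
      \<open>g\<close> at bad times costs at most \<open>\<epsilon> k\<close> for every
      mollification parameter, and once more in the limit.\<close>
    then obtain k where k: "\<epsilon> k < ennreal (e / 3)" by (auto simp: eventually_sequentially)
    have m [measurable]: "conv (\<rho> n) u \<in> borel_measurable borel" if "integrable lborel u" for n u
      by (rule mollifier.conv_measurable[OF \<rho> that])
    have L2: "(\<lambda>n. \<integral>\<^sup>+z. ennreal ((conv (\<rho> n) u z - u z)\<^sup>2) \<partial>lborel) \<longlonglongrightarrow> 0"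
      if "integrable lborel u" "(\<integral>\<^sup>+z. ennreal ((u z)\<^sup>2) \<partial>lborel) < \<top>" for u
      using mollifier_Lp_tendsto[OF \<rho> r that(1), of 2] that(2) by simp
    have "(\<lambda>n. \<integral>\<^sup>+z. ennreal \<bar>conv (\<rho> n) f z * conv (\<rho> n) (gk k) z - f z * gk k z\<bar> \<partial>lborel) \<longlonglongrightarrow> 0"
      by (rule L2_product_tendsto)
         (use f gk_L2[of k] in \<open>auto intro!: L2 int simp: m[OF f(1)] m[OF int(1)]\<close>)
    then have "eventually (\<lambda>n. (\<integral>\<^sup>+z. ennreal \<bar>conv (\<rho> n) f z * conv (\<rho> n) (gk k) z - f z * gk k z\<bar> \<partial>lborel) < ennreal (e / 3)) sequentially"
      using \<open>0 < ennreal (e / 3)\<close> by (rule order_tendstoD(2))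
    then have "eventually (\<lambda>n. (\<integral>\<^sup>+z. ennreal \<bar>conv (\<rho> n) f z * conv (\<rho> n) g z - f z * g z\<bar> \<partial>lborel) \<le> ennreal e) sequentially"
    proof eventually_elim
      case (elim n)
      note [measurable] = m[OF f(1)] m[OF int(1)] m[OF int(2)] m[OF g(1)]
      have lin: "conv (\<rho> n) g z = conv (\<rho> n) (gk k) z + conv (\<rho> n) (hk k) z" for z
      proof -
        obtain M where M: "\<And>x. \<bar>\<rho> n x\<bar> \<le> M" using mollifier.bounded_abs[OF \<rho>] by blast
        have "conv (\<rho> n) g z = (LINT y|lborel. \<rho> n (z - y) * gk k y + \<rho> n (z - y) * hk k y)"
          unfolding conv_def gh[of _ k] by (simp add: distrib_left)
        also have "\<dots> = conv (\<rho> n) (gk k) z + conv (\<rho> n) (hk k) z"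
          unfolding conv_def
          by (intro Bochner_Integration.integral_add integrable_conv[OF mollifier.borel[OF \<rho>] M] int)
        finally show ?thesis .
      qed
      let ?J = "\<lambda>u. (\<integral>\<^sup>+z. ennreal (u z) \<partial>(lborel :: spacetime measure))"
      have "?J (\<lambda>z. \<bar>conv (\<rho> n) f z * conv (\<rho> n) g z - f z * g z\<bar>)
          \<le> (\<integral>\<^sup>+z. ennreal \<bar>conv (\<rho> n) f z * conv (\<rho> n) (gk k) z - f z * gk k z\<bar>
            + (ennreal (\<bar>conv (\<rho> n) f z\<bar> * \<bar>conv (\<rho> n) (hk k) z\<bar>) + ennreal (\<bar>f z\<bar> * \<bar>hk k z\<bar>)) \<partial>lborel)"
      proof (rule nn_integral_mono)
        fix z
        have "conv (\<rho> n) f z * conv (\<rho> n) g z - f z * g z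
            = (conv (\<rho> n) f z * conv (\<rho> n) (gk k) z - f z * gk k z)
              + conv (\<rho> n) f z * conv (\<rho> n) (hk k) z - f z * hk k z"
          unfolding lin gh[of z k] by (simp add: algebra_simps)
        then have "\<bar>conv (\<rho> n) f z * conv (\<rho> n) g z - f z * g z\<bar>
            \<le> \<bar>conv (\<rho> n) f z * conv (\<rho> n) (gk k) z - f z * gk k z\<bar>
              + (\<bar>conv (\<rho> n) f z\<bar> * \<bar>conv (\<rho> n) (hk k) z\<bar> + \<bar>f z\<bar> * \<bar>hk k z\<bar>)"
          unfolding abs_mult[symmetric] by linarith
        then show "ennreal \<bar>conv (\<rho> n) f z * conv (\<rho> n) g z - f z * g z\<bar>
            \<le> ennreal \<bar>conv (\<rho> n) f z * conv (\<rho> n) (gk k) z - f z * gk k z\<bar>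
            + (ennreal (\<bar>conv (\<rho> n) f z\<bar> * \<bar>conv (\<rho> n) (hk k) z\<bar>) + ennreal (\<bar>f z\<bar> * \<bar>hk k z\<bar>))"
          by (subst ennreal_plus[symmetric], simp, simp)+ (rule ennreal_leI)
      qed
      also have "\<dots> = ?J (\<lambda>z. \<bar>conv (\<rho> n) f z * conv (\<rho> n) (gk k) z - f z * gk k z\<bar>)
          + (?J (\<lambda>z. \<bar>conv (\<rho> n) f z\<bar> * \<bar>conv (\<rho> n) (hk k) z\<bar>) + ?J (\<lambda>z. \<bar>f z\<bar> * \<bar>hk k z\<bar>))"
        by (simp add: nn_integral_add)
      also have "\<dots> \<le> ennreal (e / 3) + (\<epsilon> k + \<epsilon> k)"
      proof (intro add_mono)
        show "?J (\<lambda>z. \<bar>conv (\<rho> n) f z\<bar> * \<bar>conv (\<rho> n) (hk k) z\<bar>) \<le> \<epsilon> k"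
          unfolding \<epsilon>_def by (rule mollifier.conv_pairing_le[OF \<rho> f(1) int(2)], rule mixed_pairing_le) (use f in auto)
        show "?J (\<lambda>z. \<bar>f z\<bar> * \<bar>hk k z\<bar>) \<le> \<epsilon> k"
          unfolding \<epsilon>_def using mixed_pairing_le[of f "hk k" c 0 0] f(2) by simp
      qed (use elim in auto)
      also have "\<dots> \<le> ennreal (e / 3) + (ennreal (e / 3) + ennreal (e / 3))"
        using k by (intro add_mono) auto
      also have "\<dots> = ennreal e"
        using \<open>e > 0\<close> by (simp flip: ennreal_plus)
      finally show ?case .
    qed
    then show "limsup (\<lambda>n. \<integral>\<^sup>+z. ennreal \<bar>conv (\<rho> n) f z * conv (\<rho> n) g z - f z * g z\<bar> \<partial>lborel) \<le> 0 + ennreal e"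
      by (simp add: Limsup_bounded)
  qed
qed simp

lemma integrable_bounded_mult:
  fixes u b :: "'a \<Rightarrow> real"
  assumes "integrable M u" "b \<in> borel_measurable M" "\<And>x. \<bar>b x\<bar> \<le> B"
  shows "integrable M (\<lambda>x. b x * u x)"
proof -
  have "B \<ge> 0" using assms(3) abs_ge_zero order_trans by blast
  have [measurable]: "u \<in> borel_measurable M" using assms by auto
  show ?thesis
    by (rule Bochner_Integration.integrable_bound[OF integrable_mult_right[OF integrable_norm[OF assms(1)], of B]])
       (use \<open>B \<ge> 0\<close> assms(2,3) in \<open>auto simp: abs_mult intro!: mult_right_mono\<close>)
qed

definition \<rho>\<^sub>n :: "nat \<Rightarrow> spacetime \<Rightarrow> real" where
  "\<rho>\<^sub>n n = std_mollifier (inverse (real (Suc n)))"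

lemma mollifier_seq:
  "mollifier (\<rho>\<^sub>n n) (inverse (real (Suc n)))" "test_function UNIV (\<rho>\<^sub>n n)"
  "(\<lambda>n. inverse (real (Suc n))) \<longlonglongrightarrow> 0"
  unfolding \<rho>\<^sub>n_def
  by (rule mollifier_std_mollifier test_function_std_mollifier LIMSEQ_inverse_real_of_nat, simp?)+

section \<open>Removing the mollification from the two weighted identities\<close>

context cone_weight
begin

text \<open>The quadratic terms converge because mollification converges in L^2. The source term
  pairs a function bounded in time with values in L^2 with one whose slice norms are merely
  integrable, which is the case treated by \<open>mollified_pairing_tendsto\<close>. The equations
  need hold only eventually, once the mollification radius is small.\<close>

lemma energy_inequality:
  fixes vt G :: "spacetime \<Rightarrow> real" and D :: "R3 \<Rightarrow> spacetime \<Rightarrow> real"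
  assumes vt: "integrable lborel vt" "\<And>t. slice_sq vt t \<le> c" "c < \<top>" "(\<integral>\<^sup>+z. ennreal ((vt z)\<^sup>2) \<partial>lborel) < \<top>"
    and D: "\<And>e. e \<in> Basis \<Longrightarrow> integrable lborel (D e)" "\<And>e. e \<in> Basis \<Longrightarrow> (\<integral>\<^sup>+z. ennreal ((D e z)\<^sup>2) \<partial>lborel) < \<top>"
    and G: "integrable lborel G" "(\<integral>\<^sup>+t. epowr (slice_sq G t) (1/2) \<partial>lborel) < \<top>"
    and H1: "\<forall>\<^sub>F n in sequentially. \<forall>z\<in>K0. \<forall>e\<in>Basis.
      conv (partial (1, 0) (\<rho>\<^sub>n n)) (D e) z = conv (partial (0, e) (\<rho>\<^sub>n n)) vt z"
    and H2: "\<forall>\<^sub>F n in sequentially. \<forall>z\<in>K0.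
      conv (partial (1, 0) (\<rho>\<^sub>n n)) vt z - (\<Sum>e\<in>Basis. conv (partial (0, e) (\<rho>\<^sub>n n)) (D e) z) = - conv (\<rho>\<^sub>n n) G z"
  shows "(LINT z|lborel. \<psi> z * (vt z * G z))
    \<le> (LINT z|lborel. \<eta>' (fst z) * W (fst z + norm (snd z)) * (1/2 * (vt z)\<^sup>2 + (\<Sum>e\<in>Basis. 1/2 * (D e z)\<^sup>2)))"
proof -
  note mol = mollifier_seq
  define beta where "beta z = \<eta>' (fst z) * W (fst z + norm (snd z))" for z :: spacetime
  have cb: "continuous_on UNIV beta"
    unfolding beta_def[abs_def]
    by (intro continuous_intros continuous_on_compose2[OF \<eta>(2)] continuous_on_compose2[OF continuous_W]) auto
  have beta0: "beta z = 0" if "z \<notin> K0" for z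
  proof -
    have "fst z \<notin> {a..b} \<or> fst z + norm (snd z) \<ge> T"
      using that unfolding K0_def by (cases z) fastforce
    then show ?thesis using \<eta>'_eq_0 W(3) by (auto simp: beta_def)
  qed
  obtain B where B: "\<And>z. \<bar>beta z\<bar> \<le> B"
    using bounded_continuous_compact_support[OF cb compact_K0 beta0] by metis
  have [measurable]: "beta \<in> borel_measurable borel" using cb by (rule borel_measurable_continuous_onI)
  obtain B' where B': "\<And>z. \<bar>\<psi> z\<bar> \<le> B'" using bounded_\<psi> by metis
  have fin2: "(\<integral>\<^sup>+z. ennreal ((conv (\<rho>\<^sub>n n) u z)\<^sup>2) \<partial>lborel) < \<top>"
    if "integrable lborel u" "(\<integral>\<^sup>+z. ennreal ((u z)\<^sup>2) \<partial>lborel) < \<top>" for u n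
    using mollifier.conv_Lp_finite[OF mol(1) that(1), of 2] that(2) by simp
  have meas [measurable]: "conv (\<rho>\<^sub>n n) u \<in> borel_measurable borel" if "integrable lborel u" for n u
    by (rule mollifier.conv_measurable[OF mol(1) that])
  have sq: "integrable lborel (\<lambda>z. conv (\<rho>\<^sub>n n) u z * conv (\<rho>\<^sub>n n) u z)" "integrable lborel (\<lambda>z. u z * u z)"
    "(\<lambda>n. LINT z|lborel. beta z * (conv (\<rho>\<^sub>n n) u z * conv (\<rho>\<^sub>n n) u z)) \<longlonglongrightarrow> (LINT z|lborel. beta z * (u z * u z))"
    if u: "integrable lborel u" "(\<integral>\<^sup>+z. ennreal ((u z)\<^sup>2) \<partial>lborel) < \<top>" for u n
  proof -
    have [measurable]: "u \<in> borel_measurable borel" using u by auto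
    note [measurable] = meas[OF u(1)]
    show 1: "integrable lborel (\<lambda>z. conv (\<rho>\<^sub>n n) u z * conv (\<rho>\<^sub>n n) u z)" for n
      by (rule integrable_product_L2) (auto intro: fin2[OF u])
    show 2: "integrable lborel (\<lambda>z. u z * u z)"
      by (rule integrable_product_L2) (auto intro: u)
    have "(\<lambda>n. \<integral>\<^sup>+z. ennreal \<bar>conv (\<rho>\<^sub>n n) u z * conv (\<rho>\<^sub>n n) u z - u z * u z\<bar> \<partial>lborel) \<longlonglongrightarrow> 0"
      by (rule L2_product_tendsto)
         (use mollifier_Lp_tendsto[OF mol(1,3) u(1), of 2] u(2) in auto)
    then show "(\<lambda>n. LINT z|lborel. beta z * (conv (\<rho>\<^sub>n n) u z * conv (\<rho>\<^sub>n n) u z)) \<longlonglongrightarrow> (LINT z|lborel. beta z * (u z * u z))"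
      by (rule bounded_times_L1_tendsto[OF 1 2, where B = B]) (use B in auto)
  qed
  define R where "R V U = (LINT z|lborel. beta z * (1/2 * (V z)\<^sup>2 + (\<Sum>e\<in>Basis. 1/2 * (U e z)\<^sup>2)))"
    for V :: "spacetime \<Rightarrow> real" and U :: "R3 \<Rightarrow> spacetime \<Rightarrow> real"
  have R_eq: "R V U = 1/2 * (LINT z|lborel. beta z * (V z * V z)) + (\<Sum>e\<in>Basis. 1/2 * (LINT z|lborel. beta z * (U e z * U e z)))"
    if "integrable lborel (\<lambda>z. V z * V z)" "\<And>e. e \<in> Basis \<Longrightarrow> integrable lborel (\<lambda>z. U e z * U e z)" for V U
  proof -
    have i: "integrable lborel (\<lambda>z. beta z * (V z * V z))" "\<And>e. e \<in> Basis \<Longrightarrow> integrable lborel (\<lambda>z. beta z * (U e z * U e z))"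
      by (intro integrable_bounded_mult[where b = beta and B = B] that; use B in simp)+
    have "R V U = (LINT z|lborel. 1/2 * (beta z * (V z * V z)) + (\<Sum>e\<in>Basis. 1/2 * (beta z * (U e z * U e z))))"
      unfolding R_def by (intro Bochner_Integration.integral_cong) (simp_all add: algebra_simps power2_eq_square sum_distrib_left)
    also have "\<dots> = (LINT z|lborel. 1/2 * (beta z * (V z * V z))) + (\<Sum>e\<in>Basis. LINT z|lborel. 1/2 * (beta z * (U e z * U e z)))"
      using i by (subst Bochner_Integration.integral_add)
        (auto intro!: Bochner_Integration.integrable_sum Bochner_Integration.integral_sum)
    finally show ?thesis by simp
  qed
  have limR: "(\<lambda>n. R (conv (\<rho>\<^sub>n n) vt) (\<lambda>e. conv (\<rho>\<^sub>n n) (D e))) \<longlonglongrightarrow> R vt D"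
    by (subst R_eq; (intro sq vt(1,4) D; assumption)?)+
       (intro tendsto_intros sq vt(1,4) D; assumption)
  have i1: "integrable lborel (\<lambda>z. conv (\<rho>\<^sub>n n) vt z * conv (\<rho>\<^sub>n n) G z)" for n
  proof (rule integrableI_bounded)
    note [measurable] = meas[OF vt(1)] meas[OF G(1)]
    show "(\<lambda>z. conv (\<rho>\<^sub>n n) vt z * conv (\<rho>\<^sub>n n) G z) \<in> borel_measurable lborel" by measurable
    have "(\<integral>\<^sup>+z. ennreal (\<bar>conv (\<rho>\<^sub>n n) vt z\<bar> * \<bar>conv (\<rho>\<^sub>n n) G z\<bar>) \<partial>lborel)
        \<le> epowr c (1/2) * (\<integral>\<^sup>+t. epowr (slice_sq G t) (1/2) \<partial>lborel)"
      by (rule mollifier.conv_pairing_le[OF mol(1) vt(1) G(1)], rule mixed_pairing_le) (use vt G in auto)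
    also have "\<dots> < \<top>" using G(2) vt(3) by (simp add: ennreal_mult_less_top epowr_def less_top)
    finally show "(\<integral>\<^sup>+z. ennreal (norm (conv (\<rho>\<^sub>n n) vt z * conv (\<rho>\<^sub>n n) G z)) \<partial>lborel) < \<infinity>"
      by (simp add: abs_mult)
  qed
  have i2: "integrable lborel (\<lambda>z. vt z * G z)"
    by (rule integrable_mixed_product[OF _ _ vt(2,3) G(2)]) (use vt G in auto)
  have limL: "(\<lambda>n. LINT z|lborel. \<psi> z * (conv (\<rho>\<^sub>n n) vt z * conv (\<rho>\<^sub>n n) G z)) \<longlonglongrightarrow> (LINT z|lborel. \<psi> z * (vt z * G z))"
    by (rule bounded_times_L1_tendsto[OF i1 i2 mollified_pairing_tendsto[OF mol(1,3) vt G], where B = B'])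
       (use B' in auto)
  have "(LINT z|lborel. \<psi> z * (vt z * G z)) \<le> R vt D"
  proof (rule tendsto_le[OF _ limR limL])
    show "\<forall>\<^sub>F n in sequentially. (LINT z|lborel. \<psi> z * (conv (\<rho>\<^sub>n n) vt z * conv (\<rho>\<^sub>n n) G z))
        \<le> R (conv (\<rho>\<^sub>n n) vt) (\<lambda>e. conv (\<rho>\<^sub>n n) (D e))"
      using H1 H2
    proof eventually_elim
      case (elim n)
      show ?case
        using energy_inequality_smooth[OF mol(2) vt(1) G(1) D(1)] elim
        by (simp add: R_def beta_def mult.assoc)
    qed
  qed simp
  then show ?thesis by (simp add: R_def beta_def)
qed

text \<open>Boundedness of \<Phi> and \<Phi>' lets almost everywhere convergence of the mollified
  \<open>v\<close> combine with L^1 convergence of \<open>F\<close>, of \<open>Ft\<close> and of the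
  product \<open>vt * F\<close>.\<close>

lemma product_identity_bounded:
  fixes v vt F Ft :: "spacetime \<Rightarrow> real"
  assumes int: "integrable lborel v" "integrable lborel vt" "integrable lborel F" "integrable lborel Ft"
    and L2: "(\<integral>\<^sup>+z. ennreal ((vt z)\<^sup>2) \<partial>lborel) < \<top>" "(\<integral>\<^sup>+z. ennreal ((F z)\<^sup>2) \<partial>lborel) < \<top>"
    and H: "\<forall>\<^sub>F n in sequentially. \<forall>z\<in>K0. conv (partial (1, 0) (\<rho>\<^sub>n n)) v z = conv (\<rho>\<^sub>n n) vt z"
      "\<forall>\<^sub>F n in sequentially. \<forall>z\<in>K0. conv (partial (1, 0) (\<rho>\<^sub>n n)) F z = conv (\<rho>\<^sub>n n) Ft z"
    and \<Phi>: "\<And>s. (\<Phi> has_real_derivative \<Phi>' s) (at s)" "continuous_on UNIV \<Phi>'"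
      "\<And>s. \<bar>\<Phi> s\<bar> \<le> B" "\<And>s. \<bar>\<Phi>' s\<bar> \<le> B"
  shows "(LINT z|lborel. \<psi>t z * \<Phi> (v z) * F z) + (LINT z|lborel. \<psi> z * \<Phi>' (v z) * (vt z * F z))
    + (LINT z|lborel. \<psi> z * \<Phi> (v z) * Ft z) = 0"
proof -
  note mol = mollifier_seq
  have cont\<Phi>: "continuous_on UNIV \<Phi>"
    using \<Phi>(1) by (meson DERIV_continuous continuous_at_imp_continuous_on)
  have [measurable]: "\<Phi> \<in> borel_measurable borel" "\<Phi>' \<in> borel_measurable borel"
    using cont\<Phi> \<Phi>(2) by (auto intro: borel_measurable_continuous_onI)
  have [measurable]: "v \<in> borel_measurable borel" "vt \<in> borel_measurable borel"
    "F \<in> borel_measurable borel" "Ft \<in> borel_measurable borel" using int by auto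
  have meas [measurable]: "conv (\<rho>\<^sub>n n) u \<in> borel_measurable borel" if "integrable lborel u" for n u
    by (rule mollifier.conv_measurable[OF mol(1) that])
  note [measurable] = meas[OF int(1)] meas[OF int(2)] meas[OF int(3)] meas[OF int(4)]
  have ic: "integrable lborel (conv (\<rho>\<^sub>n n) u)" if "integrable lborel u" for n u
    by (rule mollifier.integrable_conv_mollifier[OF mol(1) that])
  have L1: "(\<lambda>n. \<integral>\<^sup>+z. ennreal \<bar>conv (\<rho>\<^sub>n n) u z - u z\<bar> \<partial>lborel) \<longlonglongrightarrow> 0" if "integrable lborel u" for u
    using mollifier_Lp_tendsto[OF mol(1,3) that, of 1] that by (simp add: integrable_iff_bounded)
  have "(\<lambda>n. LINT z|lborel. norm (conv (\<rho>\<^sub>n n) v z - v z)) \<longlonglongrightarrow> 0"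
  proof -
    have "(\<lambda>n. \<integral>\<^sup>+z. ennreal \<bar>conv (\<rho>\<^sub>n n) v z - v z\<bar> \<partial>lborel)
        = (\<lambda>n. ennreal (LINT z|lborel. norm (conv (\<rho>\<^sub>n n) v z - v z)))"
    proof
      fix n
      show "(\<integral>\<^sup>+z. ennreal \<bar>conv (\<rho>\<^sub>n n) v z - v z\<bar> \<partial>lborel) = ennreal (LINT z|lborel. norm (conv (\<rho>\<^sub>n n) v z - v z))"
        unfolding real_norm_def[symmetric]
        by (rule nn_integral_eq_integral) (use ic[OF int(1)] int(1) in auto)
    qed
    with L1[OF int(1)] have "(\<lambda>n. ennreal (LINT z|lborel. norm (conv (\<rho>\<^sub>n n) v z - v z))) \<longlonglongrightarrow> ennreal 0"
      by simp
    then show ?thesis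
      by (subst (asm) tendsto_ennreal_iff) auto
  qed
  \<comment> \<open>L^1 convergence gives almost everywhere convergence only along a subsequence;
    the limit of the identity is taken along it.\<close>
  then obtain s :: "nat \<Rightarrow> nat" where s: "strict_mono s"
    and "AE z in lborel. (\<lambda>n. conv (\<rho>\<^sub>n (s n)) v z - v z) \<longlonglongrightarrow> 0"
    using tendsto_L1_AE_subseq[of lborel "\<lambda>n z. conv (\<rho>\<^sub>n n) v z - v z"] ic[OF int(1)] int(1) by auto
  then have ae: "AE z in lborel. (\<lambda>n. conv (\<rho>\<^sub>n (s n)) v z) \<longlonglongrightarrow> v z"
    by (auto simp: Lim_null[of _ "v _"])
  have ae\<Phi>: "AE z in lborel. (\<lambda>n. \<Phi> (conv (\<rho>\<^sub>n (s n)) v z)) \<longlonglongrightarrow> \<Phi> (v z)"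
    "AE z in lborel. (\<lambda>n. \<Phi>' (conv (\<rho>\<^sub>n (s n)) v z)) \<longlonglongrightarrow> \<Phi>' (v z)"
    using ae by (eventually_elim, intro continuous_on_tendsto_compose[OF cont\<Phi>] continuous_on_tendsto_compose[OF \<Phi>(2)]; simp)+
  obtain B' where B': "\<And>z. \<bar>\<psi> z\<bar> \<le> B'" "\<And>z. \<bar>\<psi>t z\<bar> \<le> B'" "0 \<le> B'" using bounded_\<psi> by metis
  have bd: "\<bar>\<psi>t z * \<Phi> x\<bar> \<le> B' * B" "\<bar>\<psi> z * \<Phi> x\<bar> \<le> B' * B" "\<bar>\<psi> z * \<Phi>' x\<bar> \<le> B' * B" for z x
    unfolding abs_mult by (intro mult_mono B' \<Phi>(3,4) abs_ge_zero)+
  have lim1: "(\<lambda>n. LINT z|lborel. \<psi>t z * \<Phi> (conv (\<rho>\<^sub>n (s n)) v z) * conv (\<rho>\<^sub>n (s n)) F z)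
      \<longlonglongrightarrow> (LINT z|lborel. \<psi>t z * \<Phi> (v z) * F z)"
  proof (rule bounded_times_L1_tendsto[OF ic[OF int(3)] int(3), where B = "B' * B"])
    show "(\<lambda>n. \<integral>\<^sup>+z. ennreal \<bar>conv (\<rho>\<^sub>n (s n)) F z - F z\<bar> \<partial>lborel) \<longlonglongrightarrow> 0"
      using LIMSEQ_subseq_LIMSEQ[OF L1[OF int(3)] s] by (simp add: o_def)
    show "AE z in lborel. (\<lambda>n. \<psi>t z * \<Phi> (conv (\<rho>\<^sub>n (s n)) v z)) \<longlonglongrightarrow> \<psi>t z * \<Phi> (v z)"
      using ae\<Phi>(1) by eventually_elim (intro tendsto_intros)
  qed (use bd in auto)
  have lim3: "(\<lambda>n. LINT z|lborel. \<psi> z * \<Phi> (conv (\<rho>\<^sub>n (s n)) v z) * conv (\<rho>\<^sub>n (s n)) Ft z)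
      \<longlonglongrightarrow> (LINT z|lborel. \<psi> z * \<Phi> (v z) * Ft z)"
  proof (rule bounded_times_L1_tendsto[OF ic[OF int(4)] int(4), where B = "B' * B"])
    show "(\<lambda>n. \<integral>\<^sup>+z. ennreal \<bar>conv (\<rho>\<^sub>n (s n)) Ft z - Ft z\<bar> \<partial>lborel) \<longlonglongrightarrow> 0"
      using LIMSEQ_subseq_LIMSEQ[OF L1[OF int(4)] s] by (simp add: o_def)
    show "AE z in lborel. (\<lambda>n. \<psi> z * \<Phi> (conv (\<rho>\<^sub>n (s n)) v z)) \<longlonglongrightarrow> \<psi> z * \<Phi> (v z)"
      using ae\<Phi>(1) by eventually_elim (intro tendsto_intros)
  qed (use bd in auto)
  have fin2: "(\<integral>\<^sup>+z. ennreal ((conv (\<rho>\<^sub>n n) u z)\<^sup>2) \<partial>lborel) < \<top>"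
    if "integrable lborel u" "(\<integral>\<^sup>+z. ennreal ((u z)\<^sup>2) \<partial>lborel) < \<top>" for u n
    using mollifier.conv_Lp_finite[OF mol(1) that(1), of 2] that(2) by simp
  have i1: "integrable lborel (\<lambda>z. conv (\<rho>\<^sub>n n) vt z * conv (\<rho>\<^sub>n n) F z)" for n
    by (rule integrable_product_L2) (auto intro: fin2 int L2)
  have i2: "integrable lborel (\<lambda>z. vt z * F z)"
    by (rule integrable_product_L2) (auto intro: L2)
  have L1': "(\<lambda>n. \<integral>\<^sup>+z. ennreal \<bar>conv (\<rho>\<^sub>n n) vt z * conv (\<rho>\<^sub>n n) F z - vt z * F z\<bar> \<partial>lborel) \<longlonglongrightarrow> 0"
    by (rule L2_product_tendsto)
       (use mollifier_Lp_tendsto[OF mol(1,3) int(2), of 2] mollifier_Lp_tendsto[OF mol(1,3) int(3), of 2] L2 in auto)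
  have lim2: "(\<lambda>n. LINT z|lborel. \<psi> z * \<Phi>' (conv (\<rho>\<^sub>n (s n)) v z) * (conv (\<rho>\<^sub>n (s n)) vt z * conv (\<rho>\<^sub>n (s n)) F z))
      \<longlonglongrightarrow> (LINT z|lborel. \<psi> z * \<Phi>' (v z) * (vt z * F z))"
  proof (rule bounded_times_L1_tendsto[OF i1 i2, where B = "B' * B"])
    show "(\<lambda>n. \<integral>\<^sup>+z. ennreal \<bar>conv (\<rho>\<^sub>n (s n)) vt z * conv (\<rho>\<^sub>n (s n)) F z - vt z * F z\<bar> \<partial>lborel) \<longlonglongrightarrow> 0"
      using LIMSEQ_subseq_LIMSEQ[OF L1' s] by (simp add: o_def)
    show "AE z in lborel. (\<lambda>n. \<psi> z * \<Phi>' (conv (\<rho>\<^sub>n (s n)) v z)) \<longlonglongrightarrow> \<psi> z * \<Phi>' (v z)"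
      using ae\<Phi>(2) by eventually_elim (intro tendsto_intros)
  qed (use bd in auto)
  let ?S = "\<lambda>n. (LINT z|lborel. \<psi>t z * \<Phi> (conv (\<rho>\<^sub>n n) v z) * conv (\<rho>\<^sub>n n) F z)
      + (LINT z|lborel. \<psi> z * \<Phi>' (conv (\<rho>\<^sub>n n) v z) * (conv (\<rho>\<^sub>n n) vt z * conv (\<rho>\<^sub>n n) F z))
      + (LINT z|lborel. \<psi> z * \<Phi> (conv (\<rho>\<^sub>n n) v z) * conv (\<rho>\<^sub>n n) Ft z)"
  have "\<forall>\<^sub>F n in sequentially. ?S n = 0"
    using H
  proof eventually_elim
    case (elim n)
    have j: "integrable lborel (\<lambda>z. \<psi> z * \<Phi>' (conv (\<rho>\<^sub>n n) v z) * (conv (\<rho>\<^sub>n n) vt z * conv (\<rho>\<^sub>n n) F z))"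
      "integrable lborel (\<lambda>z. \<psi> z * \<Phi> (conv (\<rho>\<^sub>n n) v z) * conv (\<rho>\<^sub>n n) Ft z)"
      using bd by (intro integrable_bounded_mult[where B = "B' * B"] i1 ic int; simp)+
    have "(LINT z|lborel. \<psi> z * (\<Phi>' (conv (\<rho>\<^sub>n n) v z) * conv (\<rho>\<^sub>n n) vt z * conv (\<rho>\<^sub>n n) F z + conv (\<rho>\<^sub>n n) Ft z * \<Phi> (conv (\<rho>\<^sub>n n) v z)))
        = (LINT z|lborel. \<psi> z * \<Phi>' (conv (\<rho>\<^sub>n n) v z) * (conv (\<rho>\<^sub>n n) vt z * conv (\<rho>\<^sub>n n) F z)
          + \<psi> z * \<Phi> (conv (\<rho>\<^sub>n n) v z) * conv (\<rho>\<^sub>n n) Ft z)"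
      by (intro Bochner_Integration.integral_cong) (simp_all add: algebra_simps)
    then show ?case
      using product_identity_smooth[OF mol(2) int elim(1)[rule_format] elim(2)[rule_format] \<Phi>(1,2)] j
      by (simp add: mult.assoc)
  qed
  then have "\<forall>\<^sub>F n in sequentially. ?S (s n) = 0"
    using s by (rule eventually_subseq[rotated])
  then have "(\<lambda>n. ?S (s n)) \<longlonglongrightarrow> 0" by (rule tendsto_eventually)
  then show ?thesis
    using tendsto_add[OF tendsto_add[OF lim1 lim2] lim3] LIMSEQ_unique by blast
qed

end

section \<open>Mollified distributional derivatives\<close>

lemma has_derivative_slice:
  assumes "(f has_derivative D) (at (t, x))"
  shows "((\<lambda>x. f (t, x)) has_derivative (\<lambda>e. D (0, e))) (at x)"
  by (rule has_derivative_compose[where f = "\<lambda>x. (t, x)" and f' = "\<lambda>e. (0, e)" and g = f and g' = D])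
     (auto intro!: derivative_eq_intros assms)

lemma partial_slice:
  assumes "Ck (Suc k) f"
  shows "partial e (\<lambda>x. f (t, x)) = (\<lambda>x. partial (0, e) f (t, x))"
  by (rule ext, rule partial_eqI, rule has_derivative_slice[OF Ck_Suc_has_derivative[OF assms]])

lemma Ck_slice:
  fixes f :: "'a::euclidean_space \<times> 'b::euclidean_space \<Rightarrow> real"
  shows "Ck k f \<Longrightarrow> Ck k (\<lambda>x. f (t, x))"
proof (induction k arbitrary: f)
  case 0
  then show ?case
    by (auto intro!: continuous_on_compose2[of UNIV f] continuous_intros)
next
  case (Suc k)
  have "(\<lambda>x. f (t, x)) differentiable (at x)" for x
    using has_derivative_slice[OF Ck_Suc_has_derivative[OF Suc.prems]] by (rule differentiableI)
  moreover have "(0, e) \<in> (Basis :: ('a \<times> 'b) set)" if "e \<in> Basis" for e :: 'b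
    using that by (simp add: Basis_prod_def)
  ultimately show ?case
    using Suc by (simp add: partial_slice[OF Suc.prems] differentiable_on_def)
qed

text \<open>Weak gradients are posed at each fixed time, so spacetime test functions have to be
  restricted to time slices.\<close>

lemma test_function_slice:
  fixes \<phi> :: "'a::euclidean_space \<times> 'b::euclidean_space \<Rightarrow> real"
  assumes "test_function S \<phi>"
  shows "test_function UNIV (\<lambda>x. \<phi> (t, x))"
proof -
  obtain K where K: "compact K" "\<And>x. x \<notin> K \<Longrightarrow> \<phi> x = 0" and Ck: "\<And>k. Ck k \<phi>"
    using assms unfolding test_function_def by blast
  show ?thesis
    unfolding test_function_def
  proof (intro conjI allI exI[of _ "snd ` K"])
    show "compact (snd ` K)" using K(1) by (intro compact_continuous_image continuous_intros)
  qed (use K(2) in \<open>auto intro!: Ck_slice Ck simp: image_iff\<close>, force)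
qed

text \<open>Smoothness and the radius of the support are inherited by derivatives, which serve as
  convolution kernels alongside the mollifier itself.\<close>

definition kernel :: "real \<Rightarrow> (spacetime \<Rightarrow> real) \<Rightarrow> bool" where
  "kernel r \<sigma> \<longleftrightarrow> test_function UNIV \<sigma> \<and> (\<forall>x. x \<notin> cball 0 r \<longrightarrow> \<sigma> x = 0)"

lemma kernel_partial: "kernel r \<sigma> \<Longrightarrow> e \<in> Basis \<Longrightarrow> kernel r (partial e \<sigma>)"
  unfolding kernel_def using test_function_partial partial_zero_outside[OF compact_cball] by blast

lemma kernel_mollifier: "kernel (inverse (real (Suc n))) (\<rho>\<^sub>n n)"
  unfolding kernel_def
  using mollifier_seq(2)[of n] mollifier.support[OF mollifier_seq(1)[of n]] by auto

lemma kernel_reflect: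
  assumes "kernel r \<sigma>" "cball z r \<subseteq> S"
  shows "test_function S (\<lambda>y. \<sigma> (z - y))" "y \<notin> cball z r \<Longrightarrow> \<sigma> (z - y) = 0"
proof -
  show 0: "\<sigma> (z - y) = 0" if "y \<notin> cball z r" for y
  proof -
    have "z - y \<notin> cball 0 r" using that by (simp add: dist_norm norm_minus_commute)
    then show ?thesis using assms(1) unfolding kernel_def by blast
  qed
  show "test_function S (\<lambda>y. \<sigma> (z - y))"
    unfolding test_function_def using assms 0
    by (intro conjI allI exI[of _ "cball z r"] impI Ck_reflect) (auto simp: kernel_def test_function_def)
qed

lemma kernel_Ck: "kernel r \<sigma> \<Longrightarrow> Ck k \<sigma>"
  by (simp add: kernel_def test_function_def)

text \<open>Extension by zero turns a function that is integrable on a compact set into one that can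
  be convolved on all of spacetime.\<close>

definition res :: "spacetime set \<Rightarrow> (real \<Rightarrow> R3 \<Rightarrow> real) \<Rightarrow> spacetime \<Rightarrow> real" where
  "res A u z = indicator A z * u (fst z) (snd z)"

text \<open>The kernel centred at \<open>z\<close> vanishes outside \<open>K\<close>, so cutting
  \<open>u\<close> to \<open>K\<close> does not change the value at \<open>z\<close>.\<close>

lemma conv_res:
  assumes "kernel r \<sigma>" "cball z r \<subseteq> K" "K \<subseteq> S"
  shows "conv \<sigma> (res K u) z = (LINT (t, x):S|lborel. u t x * \<sigma> (z - (t, x)))"
  unfolding conv_def set_lebesgue_integral_def
proof (rule Bochner_Integration.integral_cong)
  fix y :: spacetime
  have "\<sigma> (z - y) = 0" if "y \<notin> K"
    using kernel_reflect(2)[OF assms(1,2), of y] assms(2) that by blast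
  then show "\<sigma> (z - y) * res K u y = indicator S y *\<^sub>R (case y of (t, x) \<Rightarrow> u t x * \<sigma> (z - (t, x)))"
    using assms(3) by (cases "y \<in> K"; cases y) (auto simp: res_def)
qed simp

text \<open>The sign in the definition of the weak derivative cancels the one from reflecting the
  kernel.\<close>

lemma conv_time_derivative:
  assumes "weak_time_derivative S u u'" "kernel r \<sigma>" "cball z r \<subseteq> K" "K \<subseteq> S"
  shows "conv (partial (1, 0) \<sigma>) (res K u) z = conv \<sigma> (res K u') z"
proof -
  have "(LINT (t, x):S|lborel. u t x * partial (1, 0) (\<lambda>y. \<sigma> (z - y)) (t, x))
      = - (LINT (t, x):S|lborel. u' t x * \<sigma> (z - (t, x)))"
    using assms(1) kernel_reflect(1)[OF assms(2), of z S] assms(3,4) unfolding weak_time_derivative_def by auto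
  moreover have "(LINT (t, x):S|lborel. u t x * partial (1, 0) (\<lambda>y. \<sigma> (z - y)) (t, x))
      = - (LINT (t, x):S|lborel. u t x * partial (1, 0) \<sigma> (z - (t, x)))"
    unfolding partial_reflect[OF kernel_Ck[OF assms(2), of "Suc 0"]] set_lebesgue_integral_def
    by (simp add: case_prod_beta flip: integral_minus)
  ultimately show ?thesis
    using conv_res[OF assms(2-4)] conv_res[OF kernel_partial[OF assms(2) time_basis] assms(3,4)] by simp
qed

text \<open>In second derivatives the two reflection signs cancel, so the wave operator passes to
  the kernel unchanged. Integrability on \<open>K\<close> permits splitting the integral into its
  terms.\<close>

lemma conv_wave:
  assumes "solves_wave S u G" "kernel r \<sigma>" "cball z r \<subseteq> K" "K \<subseteq> S" "integrable lborel (res K u)"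
  shows "- conv (partial (1, 0) (partial (1, 0) \<sigma>)) (res K u) z
    + (\<Sum>e\<in>Basis. conv (partial (0, e) (partial (0, e) \<sigma>)) (res K u) z) = conv \<sigma> (res K G) z"
proof -
  have pp: "partial e (partial e (\<lambda>y. \<sigma> (z - y))) y = partial e (partial e \<sigma>) (z - y)" if "e \<in> Basis" for e y
  proof -
    have 1: "partial e (\<lambda>y. \<sigma> (z - y)) = (\<lambda>y. (-1) * partial e \<sigma> (z - y))"
      by (rule ext, subst partial_reflect[OF kernel_Ck[OF assms(2), of "Suc 0"]]) simp
    show ?thesis
      unfolding 1
      by (subst partial_cmult[OF Ck_reflect[OF kernel_Ck[OF kernel_partial[OF assms(2) that]]]])
         (simp add: partial_reflect[OF kernel_Ck[OF kernel_partial[OF assms(2) that], of "Suc 0"]])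
  qed
  have wave: "wave_op (\<lambda>y. \<sigma> (z - y)) y = - partial (1, 0) (partial (1, 0) \<sigma>) (z - y)
      + (\<Sum>e\<in>Basis. partial (0, e) (partial (0, e) \<sigma>) (z - y))" for y
    unfolding wave_op_def by (simp add: pp time_basis space_basis)
  have int: "integrable lborel (\<lambda>y. partial e (partial e \<sigma>) (z - y) * res K u y)" if "e \<in> Basis" for e
  proof -
    have k: "test_function UNIV (partial e (partial e \<sigma>))"
      using kernel_partial[OF kernel_partial[OF assms(2) that] that] by (simp add: kernel_def)
    obtain M where "\<And>x. \<bar>partial e (partial e \<sigma>) x\<bar> \<le> M" using test_function_bounded[OF k] by metis
    then show ?thesis by (rule integrable_conv[OF test_function_borel[OF k] _ assms(5)])
  qed
  have "(LINT (t, x):S|lborel. u t x * wave_op (\<lambda>y. \<sigma> (z - y)) (t, x))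
      = (LINT (t, x):S|lborel. G t x * \<sigma> (z - (t, x)))"
    using assms(1) kernel_reflect(1)[OF assms(2), of z S] assms(3,4) unfolding solves_wave_def by auto
  also have "\<dots> = conv \<sigma> (res K G) z" by (rule conv_res[OF assms(2-4), symmetric])
  finally have 1: "(LINT (t, x):S|lborel. u t x * wave_op (\<lambda>y. \<sigma> (z - y)) (t, x)) = conv \<sigma> (res K G) z" .
  have "(LINT (t, x):S|lborel. u t x * wave_op (\<lambda>y. \<sigma> (z - y)) (t, x))
      = (LINT y|lborel. - (partial (1, 0) (partial (1, 0) \<sigma>) (z - y) * res K u y)
          + (\<Sum>e\<in>Basis. partial (0, e) (partial (0, e) \<sigma>) (z - y) * res K u y))"
    unfolding set_lebesgue_integral_def
  proof (rule Bochner_Integration.integral_cong)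
    fix y :: spacetime
    have 0: "partial e (partial e \<sigma>) (z - y) = 0" if "y \<notin> K" "e \<in> Basis" for e
      using kernel_reflect(2)[OF kernel_partial[OF kernel_partial[OF assms(2) that(2)] that(2)] assms(3)] that(1) assms(3)
      by blast
    show "indicator S y *\<^sub>R (case y of (t, x) \<Rightarrow> u t x * wave_op (\<lambda>y. \<sigma> (z - y)) (t, x))
        = - (partial (1, 0) (partial (1, 0) \<sigma>) (z - y) * res K u y)
          + (\<Sum>e\<in>Basis. partial (0, e) (partial (0, e) \<sigma>) (z - y) * res K u y)"
    proof (cases "y \<in> K")
      case True
      then have "y \<in> S" using assms(4) by auto
      with True show ?thesis
        unfolding wave by (cases y) (simp add: res_def algebra_simps sum_distrib_left)
    next
      case False
      then show ?thesis
        using 0[OF False time_basis] 0[OF False space_basis] unfolding wave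
        by (cases y) (simp add: res_def)
    qed
  qed simp
  also have "\<dots> = - conv (partial (1, 0) (partial (1, 0) \<sigma>)) (res K u) z
    + (\<Sum>e\<in>Basis. conv (partial (0, e) (partial (0, e) \<sigma>)) (res K u) z)"
    unfolding conv_def using int time_basis space_basis
    by (subst Bochner_Integration.integral_add) (auto intro!: Bochner_Integration.integrable_sum)
  finally show ?thesis using 1 by simp
qed

lemma LINT_spacetime:
  fixes f :: "'a::euclidean_space \<times> 'b::euclidean_space \<Rightarrow> real"
  assumes "integrable lborel f"
  shows "(LINT z|lborel. f z) = (LINT t|lborel. LINT x|lborel. f (t, x))"
proof -
  have "integrable (lborel \<Otimes>\<^sub>M lborel) f" using assms by (simp add: lborel_prod)
  from lborel_pair.integral_fst'[OF this] show ?thesis by (simp add: lborel_prod)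
qed

text \<open>The gradient is given weakly on each time slice rather than in spacetime; the slice
  identities are integrated over time by Fubini's theorem.\<close>

lemma conv_space_derivative:
  assumes grad: "\<And>t. t \<in> {a..b} \<Longrightarrow> weak_gradient (v t) (Dv t)"
    and \<sigma>: "kernel r \<sigma>" "cball z r \<subseteq> K" "K \<subseteq> {a..b} \<times> UNIV" and e: "e \<in> Basis"
    and int: "integrable lborel (res K v)" "integrable lborel (res K (\<lambda>t x. Dv t x \<bullet> e))"
  shows "conv (partial (0, e) \<sigma>) (res K v) z = conv \<sigma> (res K (\<lambda>t x. Dv t x \<bullet> e)) z"
proof -
  note \<sigma>' = kernel_partial[OF \<sigma>(1) space_basis[OF e]]
  have i: "integrable lborel (\<lambda>y. \<tau> (z - y) * u y)" if "kernel r \<tau>" "integrable lborel u" for \<tau> u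
  proof -
    have k: "test_function UNIV \<tau>" using that(1) by (simp add: kernel_def)
    obtain M where "\<And>x. \<bar>\<tau> x\<bar> \<le> M" using test_function_bounded[OF k] by metis
    then show ?thesis by (rule integrable_conv[OF test_function_borel[OF k] _ that(2)])
  qed
  have eq: "(LINT x|lborel. partial (0, e) \<sigma> (z - (t, x)) * res K v (t, x))
      = (LINT x|lborel. \<sigma> (z - (t, x)) * res K (\<lambda>t x. Dv t x \<bullet> e) (t, x))" for t
  proof (cases "t \<in> {a..b}")
    case True
    have drop: "\<tau> (z - (t, x)) * res K u (t, x) = u t x * \<tau> (z - (t, x))" if "kernel r \<tau>" for \<tau> u x
    proof -
      have "\<tau> (z - (t, x)) = 0" if "(t, x) \<notin> K"
        using kernel_reflect(2)[OF \<open>kernel r \<tau>\<close> \<sigma>(2), of "(t, x)"] \<sigma>(2) that by blast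
      then show ?thesis by (cases "(t, x) \<in> K") (auto simp: res_def)
    qed
    have "test_function UNIV (\<lambda>x. \<sigma> (z - (t, x)))"
      by (rule test_function_slice[OF kernel_reflect(1)[OF \<sigma>(1,2)]])
    then have "(LINT x|lborel. v t x * partial e (\<lambda>x. \<sigma> (z - (t, x))) x)
        = - (LINT x|lborel. (Dv t x \<bullet> e) * \<sigma> (z - (t, x)))"
      using grad[OF True] e unfolding weak_gradient_def by blast
    moreover have "partial e (\<lambda>x. \<sigma> (z - (t, x))) = (\<lambda>x. - partial (0, e) \<sigma> (z - (t, x)))"
      using partial_slice[OF Ck_reflect[OF kernel_Ck[OF \<sigma>(1), of "Suc 0"]], of e z t]
        partial_reflect[OF kernel_Ck[OF \<sigma>(1), of "Suc 0"]] by simp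
    ultimately show ?thesis by (simp add: drop[OF \<sigma>(1)] drop[OF \<sigma>'])
  next
    case False
    then have "(t, x) \<notin> K" for x using \<sigma>(3) by auto
    then show ?thesis by (simp add: res_def)
  qed
  show ?thesis
    unfolding conv_def LINT_spacetime[OF i[OF \<sigma>' int(1)]] LINT_spacetime[OF i[OF \<sigma>(1) int(2)]] eq ..
qed

section \<open>Integrability of the solution\<close>

lemma epowr_half_le: "x \<le> y\<^sup>2 \<Longrightarrow> epowr x (1/2) \<le> y"
  by (rule ennreal_power2_le_imp_le) (simp add: epowr_half_power2)

lemma epowr_less_top: "epowr x p < \<top> \<longleftrightarrow> x < \<top>"
  by (auto simp: epowr_def less_top)

lemma epowr_epowr: "epowr (epowr x p) q = epowr x (p * q)"
  by (auto simp: epowr_def powr_powr)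

lemma epowr_le_ennrealD:
  assumes "epowr x (1 / real n) \<le> ennreal c" "0 \<le> c" "0 < n"
  shows "x \<le> ennreal (c ^ n)"
proof (cases x)
  case (real r)
  then have "r powr (1 / real n) \<le> c" using assms by (simp add: epowr_ennreal)
  then have "(r powr (1 / real n)) ^ n \<le> c ^ n" by (intro power_mono) auto
  also have "(r powr (1 / real n)) ^ n = r"
    using real(1) \<open>0 < n\<close> by (cases "r = 0") (auto simp: powr_realpow[symmetric] powr_powr)
  finally show ?thesis using real by (simp add: ennreal_leI)
qed (use assms in \<open>simp add: epowr_def top_unique\<close>)

lemma res_measurable:
  fixes u :: "real \<Rightarrow> R3 \<Rightarrow> real"
  assumes "measurable_on_strip J u"
  shows "res (J \<times> UNIV) u \<in> borel_measurable borel"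
proof -
  have "res (J \<times> UNIV) u = (\<lambda>z. indicator (J \<times> UNIV) z *\<^sub>R (case z of (t, x) \<Rightarrow> u t x))"
    by (auto simp: res_def fun_eq_iff)
  then show ?thesis
    using assms by (simp add: measurable_on_strip_def set_borel_measurable_def)
qed

lemma res_inner_measurable:
  fixes u :: "real \<Rightarrow> R3 \<Rightarrow> R3"
  assumes "measurable_on_strip J u"
  shows "res (J \<times> UNIV) (\<lambda>t x. u t x \<bullet> e) \<in> borel_measurable borel"
proof -
  have eq: "res (J \<times> UNIV) (\<lambda>t x. u t x \<bullet> e) = (\<lambda>z. (indicator (J \<times> UNIV) z *\<^sub>R (case z of (t, x) \<Rightarrow> u t x)) \<bullet> e)"
    by (auto simp: res_def fun_eq_iff)
  have "(\<lambda>z. indicator (J \<times> UNIV) z *\<^sub>R (case z of (t, x) \<Rightarrow> u t x)) \<in> borel_measurable borel"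
    using assms by (simp add: measurable_on_strip_def set_borel_measurable_def)
  then show ?thesis
    unfolding eq by (intro borel_measurable_inner borel_measurable_const)
qed

lemma integrable_res:
  assumes "locally_integrable_on S (\<lambda>(t, x). u t x)" "compact K" "K \<subseteq> S"
  shows "integrable lborel (res K u)"
proof -
  have "res K u = (\<lambda>z. indicator K z *\<^sub>R (case z of (t, x) \<Rightarrow> u t x))"
    by (auto simp: res_def fun_eq_iff)
  then show ?thesis
    using assms by (simp add: locally_integrable_on_def set_integrable_def)
qed

lemma res_subset: "K \<subseteq> A \<Longrightarrow> res K u z = indicator K z * res A u z"
  by (auto simp: res_def indicator_def)

text \<open>Finite bounds \<open>S\<close> for the energy and \<open>M\<close> for the norm of
  \<open>F\<close> allow real arithmetic; infinite norms are dealt with in the final theorem. The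
  bound on \<open>F\<close> holds at almost every time, as an essential supremum provides.\<close>

locale nlw_data =
  fixes F Ft v vt :: "real \<Rightarrow> R3 \<Rightarrow> real" and Dv :: "real \<Rightarrow> R3 \<Rightarrow> R3" and a b S M :: real
  assumes F: "in_mixed_L 5 10 UNIV F"
    and Ft: "weak_time_derivative ({a<..<b} \<times> UNIV) F Ft"
    and sol: "forced_nlw_solution F a b v Dv vt"
    and energy_le: "\<And>t. t \<in> {a..b} \<Longrightarrow> energy (v t) (Dv t) (vt t) \<le> ennreal S" "0 \<le> S"
    and F_le: "AE t in lborel. t \<in> {a..b} \<longrightarrow> Lnorm 6 (F t) \<le> ennreal M" "0 \<le> M"
begin

definition strip :: "spacetime set" where "strip = {a..b} \<times> UNIV"
definition sv where "sv = res strip v"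
definition svt where "svt = res strip vt"
definition sF where "sF = res strip F"
definition sD where "sD e = res strip (\<lambda>t x. Dv t x \<bullet> e)" for e :: R3
definition sG where "sG = res strip (\<lambda>t x. (v t x + F t x) ^ 5)"
text \<open>The potential energy is left out: it is produced by the product rule and not by the
  quadratic energy inequality.\<close>

definition edens :: "spacetime \<Rightarrow> real" where
  "edens z = 1/2 * (svt z)\<^sup>2 + (\<Sum>e\<in>Basis. 1/2 * (sD e z)\<^sup>2)"

lemma sol_simps:
  "measurable_on_strip {a..b} v" "measurable_on_strip {a..b} vt" "measurable_on_strip {a..b} Dv"
  "t \<in> {a..b} \<Longrightarrow> weak_gradient (v t) (Dv t)" "in_mixed_L 5 10 {a..b} v"
  "weak_time_derivative ({a<..<b} \<times> UNIV) v vt"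
  "solves_wave ({a<..<b} \<times> UNIV) v (\<lambda>t x. (v t x + F t x) ^ 5)"
  using sol by (auto simp: forced_nlw_solution_def C0_Hdot1_def C0_L2_def in_Hdot1_def)

lemma strip_borel [measurable]: "strip \<in> sets borel"
  unfolding strip_def by (intro borel_closed closed_Times) auto

lemma sF_eq: "sF z = indicator strip z * res UNIV F z"
  unfolding sF_def by (rule res_subset) simp

lemma sG_eq: "sG z = (sv z + sF z) ^ 5"
  by (auto simp: sG_def sv_def sF_def res_def indicator_def)

lemma borel_s [measurable]:
  "sv \<in> borel_measurable borel" "svt \<in> borel_measurable borel" "sF \<in> borel_measurable borel"
  "sD e \<in> borel_measurable borel" "sG \<in> borel_measurable borel"
proof -
  show [measurable]: "sv \<in> borel_measurable borel" "svt \<in> borel_measurable borel" "sD e \<in> borel_measurable borel"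
    unfolding sv_def svt_def sD_def strip_def
    by (intro res_measurable res_inner_measurable sol_simps)+
  have [measurable]: "res UNIV F \<in> borel_measurable borel"
    using F res_measurable[of UNIV F] by (simp add: in_mixed_L_def)
  show [measurable]: "sF \<in> borel_measurable borel"
    unfolding sF_eq[abs_def] by measurable
  show "sG \<in> borel_measurable borel"
    unfolding sG_eq[abs_def] by measurable
qed

lemma borel_edens [measurable]: "edens \<in> borel_measurable borel"
  unfolding edens_def[abs_def] by measurable

lemma edens_nonneg: "0 \<le> edens z"
  unfolding edens_def by (intro add_nonneg_nonneg sum_nonneg) auto

lemma s_inside: "t \<in> {a..b} \<Longrightarrow> sv (t, x) = v t x" "t \<in> {a..b} \<Longrightarrow> svt (t, x) = vt t x"
  "t \<in> {a..b} \<Longrightarrow> sF (t, x) = F t x" "t \<in> {a..b} \<Longrightarrow> sD e (t, x) = Dv t x \<bullet> e"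
  by (auto simp: sv_def svt_def sF_def sD_def res_def strip_def)

lemma s_outside: "t \<notin> {a..b} \<Longrightarrow> sv (t, x) = 0" "t \<notin> {a..b} \<Longrightarrow> svt (t, x) = 0"
  "t \<notin> {a..b} \<Longrightarrow> sF (t, x) = 0" "t \<notin> {a..b} \<Longrightarrow> sD e (t, x) = 0"
  by (auto simp: sv_def svt_def sF_def sD_def res_def strip_def)

lemma edens_energy:
  assumes "t \<in> {a..b}"
  shows "edens (t, x) + 1/6 * \<bar>sv (t, x)\<bar> ^ 6
    = 1/2 * (norm (Dv t x))\<^sup>2 + 1/2 * \<bar>vt t x\<bar>\<^sup>2 + 1/6 * \<bar>v t x\<bar> ^ 6"
proof -
  have "(norm (Dv t x))\<^sup>2 = (\<Sum>e\<in>Basis. (Dv t x \<bullet> e)\<^sup>2)"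
    by (subst power2_norm_eq_inner, subst euclidean_inner) (simp add: power2_eq_square)
  then show ?thesis by (simp add: edens_def s_inside[OF assms] sum_divide_distrib)
qed

lemma slice_energy: "(\<integral>\<^sup>+x. ennreal (edens (t, x) + 1/6 * \<bar>sv (t, x)\<bar> ^ 6) \<partial>lborel) \<le> ennreal S"
proof (cases "t \<in> {a..b}")
  case True
  then show ?thesis using energy_le(1)[OF True] by (simp only: edens_energy energy_def)
next
  case False
  then have "edens (t, x) + 1/6 * \<bar>sv (t, x)\<bar> ^ 6 = 0" for x
    by (simp add: edens_def s_outside)
  then show ?thesis by simp
qed

text \<open>A pointwise majorant by the energy density transfers the energy bound to each time;
  outside the interval everything vanishes.\<close>

lemma slice_le:
  assumes "\<And>x. 0 \<le> f x" "\<And>x. f x \<le> c * (edens (t, x) + 1/6 * \<bar>sv (t, x)\<bar> ^ 6)" "0 \<le> c"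
  shows "(\<integral>\<^sup>+x. ennreal (f x) \<partial>lborel) \<le> ennreal (c * S)"
proof -
  have "(\<integral>\<^sup>+x. ennreal (f x) \<partial>lborel)
      \<le> (\<integral>\<^sup>+x. ennreal c * ennreal (edens (t, x) + 1/6 * \<bar>sv (t, x)\<bar> ^ 6) \<partial>lborel)"
    using assms by (intro nn_integral_mono) (simp add: ennreal_mult'[symmetric] ennreal_leI)
  also have "\<dots> = ennreal c * (\<integral>\<^sup>+x. ennreal (edens (t, x) + 1/6 * \<bar>sv (t, x)\<bar> ^ 6) \<partial>lborel)"
    by (rule nn_integral_cmult) measurable
  also have "\<dots> \<le> ennreal c * ennreal S" by (intro mult_left_mono slice_energy) simp
  finally show ?thesis using assms(3) energy_le(2) by (simp add: ennreal_mult)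
qed

lemma slice_svt: "slice_sq svt t \<le> ennreal (2 * S)"
proof -
  have "(svt z)\<^sup>2 \<le> 2 * (edens z + 1/6 * \<bar>sv z\<bar> ^ 6)" for z
  proof -
    have "0 \<le> (\<Sum>e\<in>Basis. 1/2 * (sD e z)\<^sup>2)" by (intro sum_nonneg) auto
    moreover have "q \<le> 2 * (1/2 * q + s + 1/6 * p)" if "0 \<le> s" "0 \<le> p" for q s p :: real
      using that by (simp add: field_simps)
    ultimately show ?thesis unfolding edens_def by simp
  qed
  then show ?thesis unfolding slice_sq_def by (intro slice_le) auto
qed

lemma slice_sD: assumes "e \<in> Basis" shows "slice_sq (sD e) t \<le> ennreal (2 * S)"
proof -
  have "(sD e z)\<^sup>2 \<le> 2 * (edens z + 1/6 * \<bar>sv z\<bar> ^ 6)" for z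
  proof -
    have "1/2 * (sD e z)\<^sup>2 \<le> (\<Sum>e\<in>Basis. 1/2 * (sD e z)\<^sup>2)"
      by (rule member_le_sum[OF assms]) auto
    moreover have "q \<le> 2 * (1/2 * r + s + 1/6 * p)" if "1/2 * q \<le> s" "0 \<le> p" "0 \<le> r" for q r s p :: real
      using that by (simp add: field_simps)
    ultimately show ?thesis unfolding edens_def by (metis zero_le_power2 zero_le_power abs_ge_zero)
  qed
  then show ?thesis unfolding slice_sq_def by (intro slice_le) auto
qed

lemma slice_sv6: "(\<integral>\<^sup>+x. ennreal (\<bar>sv (t, x)\<bar> ^ 6) \<partial>lborel) \<le> ennreal (6 * S)"
  by (rule slice_le[where t = t]) (use edens_nonneg[of "(t, _)"] in auto)

lemma slice_sF6: "AE t in lborel. (\<integral>\<^sup>+x. ennreal (\<bar>sF (t, x)\<bar> ^ 6) \<partial>lborel) \<le> ennreal (M ^ 6)"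
  using F_le(1)
proof eventually_elim
  case (elim t)
  show ?case
  proof (cases "t \<in> {a..b}")
    case True
    then have "Lnorm 6 (F t) \<le> ennreal M" using elim by simp
    then have "(\<integral>\<^sup>+x. ennreal (norm (F t x) powr 6) \<partial>lborel) \<le> ennreal (M ^ 6)"
      unfolding Lnorm_def using epowr_le_ennrealD[of _ 6 M] F_le(2) by simp
    then show ?thesis by (simp add: s_inside[OF True])
  qed (simp add: s_outside)
qed

text \<open>The time interval has finite length, so bounds uniform in time give integrability on the
  strip.\<close>

lemma strip_integral_less_top:
  assumes [measurable]: "f \<in> borel_measurable borel"
    and le: "AE t in lborel. (\<integral>\<^sup>+x. f (t, x) \<partial>lborel) \<le> ennreal c"
    and out: "\<And>t x. t \<notin> {a..b} \<Longrightarrow> f (t, x) = 0"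
  shows "(\<integral>\<^sup>+z. f z \<partial>lborel) < \<top>"
proof -
  have "(\<integral>\<^sup>+z. f z \<partial>lborel) = (\<integral>\<^sup>+t. (\<integral>\<^sup>+x. f (t, x) \<partial>lborel) \<partial>lborel)"
    by (rule nn_integral_spacetime) measurable
  also have "\<dots> \<le> (\<integral>\<^sup>+t. ennreal c * indicator {a..b} t \<partial>lborel)"
    using le by (intro nn_integral_mono_AE, eventually_elim) (use out in \<open>auto simp: indicator_def\<close>)
  also have "\<dots> < \<top>"
    by (simp add: nn_integral_cmult_indicator ennreal_mult_less_top emeasure_lborel_Icc_eq)
  finally show ?thesis .
qed

lemma L2_svt: "(\<integral>\<^sup>+z. ennreal ((svt z)\<^sup>2) \<partial>lborel) < \<top>"
  by (rule strip_integral_less_top[where c = "2 * S"])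
     (use slice_svt in \<open>auto simp: slice_sq_def s_outside\<close>)

lemma L2_sD: "e \<in> Basis \<Longrightarrow> (\<integral>\<^sup>+z. ennreal ((sD e z)\<^sup>2) \<partial>lborel) < \<top>"
  by (rule strip_integral_less_top[where c = "2 * S"])
     (use slice_sD in \<open>auto simp: slice_sq_def s_outside\<close>)

lemma L6_sv: "(\<integral>\<^sup>+z. ennreal (\<bar>sv z\<bar> ^ 6) \<partial>lborel) < \<top>"
  by (rule strip_integral_less_top[where c = "6 * S"])
     (use slice_sv6 in \<open>auto simp: s_outside\<close>)

lemma L6_sF: "(\<integral>\<^sup>+z. ennreal (\<bar>sF z\<bar> ^ 6) \<partial>lborel) < \<top>"
  by (rule strip_integral_less_top[OF _ slice_sF6]) (auto simp: s_outside)

text \<open>The fifth power of the L^10 norm is the square root of the integral of |u|^10. So an L^5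
  norm in time of the L^10 norm is exactly what places u^5 in the space of integrable slice
  norms.\<close>

lemma mixed_10:
  assumes "in_mixed_L 5 10 J u" "{a..b} \<subseteq> J"
  shows "(\<integral>\<^sup>+t. epowr (\<integral>\<^sup>+x. ennreal (\<bar>res strip u (t, x)\<bar> ^ 10) \<partial>lborel) (1/2) \<partial>lborel) < \<top>"
proof -
  have "(\<integral>\<^sup>+t\<in>J. epowr (Lnorm 10 (u t)) 5 \<partial>lborel) < \<top>"
    using assms(1) by (simp add: in_mixed_L_def mixed_norm_def epowr_less_top)
  moreover have "(\<integral>\<^sup>+t. epowr (\<integral>\<^sup>+x. ennreal (\<bar>res strip u (t, x)\<bar> ^ 10) \<partial>lborel) (1/2) \<partial>lborel)
      \<le> (\<integral>\<^sup>+t\<in>J. epowr (Lnorm 10 (u t)) 5 \<partial>lborel)"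
  proof (rule nn_integral_mono)
    fix t
    show "epowr (\<integral>\<^sup>+x. ennreal (\<bar>res strip u (t, x)\<bar> ^ 10) \<partial>lborel) (1/2)
        \<le> epowr (Lnorm 10 (u t)) 5 * indicator J t"
    proof (cases "t \<in> {a..b}")
      case True
      then show ?thesis
        using assms(2) by (auto simp: Lnorm_def epowr_epowr res_def strip_def)
    qed (simp add: res_def strip_def epowr_def)
  qed
  ultimately show ?thesis by (rule order.strict_trans1[rotated])
qed

text \<open>From (p + q)^2 <= 2 (p^2 + q^2), which gives the factor 2 C^2, and subadditivity of the
  square root.\<close>

lemma mixed_quintic:
  assumes [measurable]: "h \<in> borel_measurable borel"
    and h: "\<And>z. \<bar>h z\<bar> \<le> C * (\<bar>sv z\<bar> ^ 5 + \<bar>sF z\<bar> ^ 5)"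
  shows "(\<integral>\<^sup>+t. epowr (slice_sq h t) (1/2) \<partial>lborel) < \<top>"
proof -
  let ?A = "\<lambda>u t. (\<integral>\<^sup>+x. ennreal (\<bar>u (t, x)\<bar> ^ 10) \<partial>lborel)"
  let ?c = "ennreal (2 * C\<^sup>2)"
  have "(\<integral>\<^sup>+t. epowr (slice_sq h t) (1/2) \<partial>lborel)
      \<le> (\<integral>\<^sup>+t. epowr ?c (1/2) * (epowr (?A sv t) (1/2) + epowr (?A sF t) (1/2)) \<partial>lborel)"
  proof (rule nn_integral_mono, rule epowr_half_le)
    fix t
    have "slice_sq h t \<le> (\<integral>\<^sup>+x. ?c * (ennreal (\<bar>sv (t, x)\<bar> ^ 10) + ennreal (\<bar>sF (t, x)\<bar> ^ 10)) \<partial>lborel)"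
      unfolding slice_sq_def
    proof (rule nn_integral_mono)
      fix x
      have "(h (t, x))\<^sup>2 \<le> (C * (\<bar>sv (t, x)\<bar> ^ 5 + \<bar>sF (t, x)\<bar> ^ 5))\<^sup>2"
        unfolding power2_abs[of "h (t, x)", symmetric] by (intro power_mono h) auto
      also have "\<dots> \<le> 2 * C\<^sup>2 * (\<bar>sv (t, x)\<bar> ^ 10 + \<bar>sF (t, x)\<bar> ^ 10)"
      proof -
        have "(p + q)\<^sup>2 \<le> 2 * (p\<^sup>2 + q\<^sup>2)" for p q :: real
          using zero_le_power2[of "p - q"] by (simp add: power2_eq_square algebra_simps)
        from this[of "\<bar>sv (t, x)\<bar> ^ 5" "\<bar>sF (t, x)\<bar> ^ 5"]
        have "C\<^sup>2 * (\<bar>sv (t, x)\<bar> ^ 5 + \<bar>sF (t, x)\<bar> ^ 5)\<^sup>2 \<le> C\<^sup>2 * (2 * ((\<bar>sv (t, x)\<bar> ^ 5)\<^sup>2 + (\<bar>sF (t, x)\<bar> ^ 5)\<^sup>2))"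
          by (intro mult_left_mono) auto
        then show ?thesis
          unfolding power_mult_distrib[of C] by (simp add: power_mult[symmetric] mult.assoc mult.left_commute distrib_left)
      qed
      finally have "ennreal ((h (t, x))\<^sup>2) \<le> ennreal (2 * C\<^sup>2 * (\<bar>sv (t, x)\<bar> ^ 10 + \<bar>sF (t, x)\<bar> ^ 10))"
        by (rule ennreal_leI)
      also have "\<dots> = ?c * (ennreal (\<bar>sv (t, x)\<bar> ^ 10) + ennreal (\<bar>sF (t, x)\<bar> ^ 10))"
        by (simp only: ennreal_mult ennreal_plus zero_le_power abs_ge_zero add_nonneg_nonneg
            mult_nonneg_nonneg zero_le_numeral zero_le_power2)
      finally show "ennreal ((h (t, x))\<^sup>2) \<le> ?c * (ennreal (\<bar>sv (t, x)\<bar> ^ 10) + ennreal (\<bar>sF (t, x)\<bar> ^ 10))" .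
    qed
    also have "\<dots> = ?c * (?A sv t + ?A sF t)"
      by (subst nn_integral_cmult) (auto simp: nn_integral_add)
    also have "\<dots> = (epowr ?c (1/2))\<^sup>2 * ((epowr (?A sv t) (1/2))\<^sup>2 + (epowr (?A sF t) (1/2))\<^sup>2)"
      by (simp only: epowr_half_power2)
    also have "\<dots> \<le> (epowr ?c (1/2) * (epowr (?A sv t) (1/2) + epowr (?A sF t) (1/2)))\<^sup>2"
      unfolding power_mult_distrib
      by (intro mult_left_mono) (auto simp: power2_eq_square distrib_left distrib_right add_ac intro!: add_left_mono add_increasing)
    finally show "slice_sq h t \<le> \<dots>" .
  qed
  also have "\<dots> = epowr ?c (1/2) * ((\<integral>\<^sup>+t. epowr (?A sv t) (1/2) \<partial>lborel) + (\<integral>\<^sup>+t. epowr (?A sF t) (1/2) \<partial>lborel))"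
    by (subst nn_integral_cmult) (auto simp: nn_integral_add)
  also have "\<dots> < \<top>"
    using mixed_10[OF sol_simps(5)] mixed_10[OF F]
    by (simp add: ennreal_mult_less_top epowr_less_top sv_def sF_def)
  finally show ?thesis .
qed

lemma integrable_svt_quintic:
  assumes "h \<in> borel_measurable borel" "\<And>z. \<bar>h z\<bar> \<le> C * (\<bar>sv z\<bar> ^ 5 + \<bar>sF z\<bar> ^ 5)"
  shows "integrable lborel (\<lambda>z. svt z * h z)"
  by (rule integrable_mixed_product[OF _ assms(1) slice_svt _ mixed_quintic[OF assms]]) auto

text \<open>The larger of |x| and |y| dominates each mixed product; 32 is 2^5.\<close>

lemma quintic_bounds:
  fixes x y :: real
  shows "\<bar>x ^ 4 * y\<bar> \<le> \<bar>x\<bar> ^ 5 + \<bar>y\<bar> ^ 5" "\<bar>(x + y) ^ 5\<bar> \<le> 32 * (\<bar>x\<bar> ^ 5 + \<bar>y\<bar> ^ 5)"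
    "\<bar>x ^ 5 * y\<bar> \<le> \<bar>x\<bar> ^ 6 + \<bar>y\<bar> ^ 6"
proof -
  have mono: "\<bar>x\<bar> ^ k * \<bar>y\<bar> \<le> \<bar>x\<bar> ^ Suc k + \<bar>y\<bar> ^ Suc k" for k
  proof (cases "\<bar>y\<bar> \<le> \<bar>x\<bar>")
    case True
    then have "\<bar>x\<bar> ^ k * \<bar>y\<bar> \<le> \<bar>x\<bar> ^ k * \<bar>x\<bar>" by (intro mult_left_mono) auto
    then show ?thesis by (simp add: mult.commute add_increasing2)
  next
    case False
    then have "\<bar>x\<bar> ^ k * \<bar>y\<bar> \<le> \<bar>y\<bar> ^ k * \<bar>y\<bar>" by (intro mult_right_mono power_mono) auto
    then show ?thesis by (simp add: mult.commute add_increasing)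
  qed
  show "\<bar>x ^ 4 * y\<bar> \<le> \<bar>x\<bar> ^ 5 + \<bar>y\<bar> ^ 5" "\<bar>x ^ 5 * y\<bar> \<le> \<bar>x\<bar> ^ 6 + \<bar>y\<bar> ^ 6"
    using mono[of 4] mono[of 5] by (simp_all add: abs_mult power_abs)
  show "\<bar>(x + y) ^ 5\<bar> \<le> 32 * (\<bar>x\<bar> ^ 5 + \<bar>y\<bar> ^ 5)"
    using abs_add_power_le[of x y 5] by (simp add: power_abs)
qed

lemma integrable_sv6: "integrable lborel (\<lambda>z. \<bar>sv z\<bar> ^ 6)"
  by (rule integrableI_bounded) (use L6_sv in auto)

lemma integrable_sF6: "integrable lborel (\<lambda>z. \<bar>sF z\<bar> ^ 6)"
  by (rule integrableI_bounded) (use L6_sF in auto)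

lemma integrable_sv5_sF: "integrable lborel (\<lambda>z. sv z ^ 5 * sF z)"
  by (rule Bochner_Integration.integrable_bound[OF Bochner_Integration.integrable_add[OF integrable_sv6 integrable_sF6]])
     (use quintic_bounds(3) in auto)

lemma integrable_edens: "integrable lborel edens"
proof -
  have "integrable lborel (\<lambda>z. svt z * svt z)" "\<And>e. e \<in> Basis \<Longrightarrow> integrable lborel (\<lambda>z. sD e z * sD e z)"
    by (auto intro!: integrable_product_L2 L2_svt L2_sD)
  then show ?thesis
    unfolding edens_def[abs_def] power2_eq_square
    by (intro Bochner_Integration.integrable_add Bochner_Integration.integrable_sum integrable_mult_right) auto
qed

end

section \<open>The weighted estimate for smooth weights\<close>

lemma slice_sq_mono:
  assumes "\<And>z. \<bar>f z\<bar> \<le> \<bar>g z\<bar>"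
  shows "slice_sq f t \<le> slice_sq g t"
  unfolding slice_sq_def
  by (intro nn_integral_mono ennreal_leI) (simp add: abs_le_square_iff[symmetric] assms)

text \<open>Smooth truncations of \<open>s\<^sup>5\<close>: bounded with bounded derivative, but dominated by the untruncated
  quantities, so that no integrability is lost.\<close>

definition trunc5 :: "nat \<Rightarrow> real \<Rightarrow> real" where
  "trunc5 k s = (real (Suc k) * arctan (s / real (Suc k))) ^ 5"

definition trunc5' :: "nat \<Rightarrow> real \<Rightarrow> real" where
  "trunc5' k s = 5 * (real (Suc k) * arctan (s / real (Suc k))) ^ 4 / (1 + (s / real (Suc k))\<^sup>2)"

text \<open>|arctan y| <= |y| makes the truncation dominated, and |arctan y| <= 2 makes it
  bounded.\<close>

lemma trunc_le: "\<bar>real (Suc k) * arctan (s / real (Suc k))\<bar> \<le> \<bar>s\<bar>"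
  "\<bar>real (Suc k) * arctan (s / real (Suc k))\<bar> \<le> 2 * real (Suc k)"
proof -
  have "\<bar>arctan (s / real (Suc k))\<bar> \<le> \<bar>s / real (Suc k)\<bar>" by (rule abs_arctan_le)
  then have "real (Suc k) * \<bar>arctan (s / real (Suc k))\<bar> \<le> real (Suc k) * \<bar>s / real (Suc k)\<bar>"
    by (intro mult_left_mono) auto
  then show "\<bar>real (Suc k) * arctan (s / real (Suc k))\<bar> \<le> \<bar>s\<bar>"
    by (simp add: abs_mult abs_divide)
  have "\<bar>arctan (s / real (Suc k))\<bar> \<le> 2"
    using arctan_bounded[of "s / real (Suc k)"] pi_less_4 by (simp add: abs_le_iff)
  then have "real (Suc k) * \<bar>arctan (s / real (Suc k))\<bar> \<le> real (Suc k) * 2"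
    by (intro mult_left_mono) auto
  then show "\<bar>real (Suc k) * arctan (s / real (Suc k))\<bar> \<le> 2 * real (Suc k)"
    by (simp add: abs_mult)
qed

lemma trunc5_derivative: "(trunc5 k has_real_derivative trunc5' k s) (at s)"
proof -
  have "((\<lambda>s. (real (Suc k) * arctan (s / real (Suc k))) ^ 5) has_real_derivative
      5 * (real (Suc k) * arctan (s / real (Suc k))) ^ 4 *
        (real (Suc k) * (inverse (1 + (s / real (Suc k))\<^sup>2) * (1 / real (Suc k))))) (at s)"
    by (auto intro!: derivative_eq_intros simp del: of_nat_Suc)
  then show ?thesis
    unfolding trunc5_def[abs_def]
    by (rule DERIV_cong)
       (simp add: trunc5'_def divide_inverse mult.left_commute[of "real (Suc k)"] del: of_nat_Suc)
qed

lemma trunc5'_continuous: "continuous_on UNIV (trunc5' k)"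
proof -
  have "1 + (s / real (Suc k))\<^sup>2 \<noteq> 0" for s :: real
    using zero_le_power2[of "s / real (Suc k)"] by linarith
  then show ?thesis
    unfolding trunc5'_def[abs_def] by (auto intro!: continuous_intros simp del: of_nat_Suc)
qed

lemma trunc5_bounds:
  "\<bar>trunc5 k s\<bar> \<le> \<bar>s\<bar> ^ 5" "\<bar>trunc5' k s\<bar> \<le> 5 * s ^ 4"
  "\<bar>trunc5 k s\<bar> \<le> max ((2 * real (Suc k)) ^ 5) (5 * (2 * real (Suc k)) ^ 4)"
  "\<bar>trunc5' k s\<bar> \<le> max ((2 * real (Suc k)) ^ 5) (5 * (2 * real (Suc k)) ^ 4)"
proof -
  let ?p = "real (Suc k) * arctan (s / real (Suc k))"
  have d: "\<bar>trunc5' k s\<bar> \<le> 5 * \<bar>?p\<bar> ^ 4"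
  proof -
    have "\<bar>trunc5' k s\<bar> = 5 * \<bar>?p\<bar> ^ 4 / (1 + (s / real (Suc k))\<^sup>2)"
      unfolding trunc5'_def by (simp add: abs_divide abs_mult power_abs del: of_nat_Suc)
    also have "\<dots> \<le> 5 * \<bar>?p\<bar> ^ 4 / 1"
      by (rule divide_left_mono) (auto simp: add_pos_nonneg simp del: of_nat_Suc)
    finally show ?thesis by simp
  qed
  have "\<bar>?p\<bar> ^ 5 \<le> \<bar>s\<bar> ^ 5" "\<bar>?p\<bar> ^ 5 \<le> (2 * real (Suc k)) ^ 5"
    "\<bar>?p\<bar> ^ 4 \<le> \<bar>s\<bar> ^ 4" "\<bar>?p\<bar> ^ 4 \<le> (2 * real (Suc k)) ^ 4"
    by (intro power_mono trunc_le abs_ge_zero)+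
  moreover have "\<bar>trunc5 k s\<bar> = \<bar>?p\<bar> ^ 5"
    unfolding trunc5_def by (rule power_abs)
  moreover have "\<bar>s\<bar> ^ 4 = s ^ 4" by simp
  ultimately show "\<bar>trunc5 k s\<bar> \<le> \<bar>s\<bar> ^ 5" "\<bar>trunc5' k s\<bar> \<le> 5 * s ^ 4"
    "\<bar>trunc5 k s\<bar> \<le> max ((2 * real (Suc k)) ^ 5) (5 * (2 * real (Suc k)) ^ 4)"
    "\<bar>trunc5' k s\<bar> \<le> max ((2 * real (Suc k)) ^ 5) (5 * (2 * real (Suc k)) ^ 4)"
    using d by linarith+
qed

text \<open>The derivative of arctan at 0 is 1, so arctan h / h tends to 1.\<close>

lemma trunc_tendsto: "(\<lambda>k. real (Suc k) * arctan (s / real (Suc k))) \<longlonglongrightarrow> s"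
proof (cases "s = 0")
  case False
  have "((\<lambda>h. arctan h / h) \<longlongrightarrow> 1) (at 0)"
    using DERIV_arctan[of 0] by (simp add: DERIV_def)
  moreover have "filterlim (\<lambda>k. s / real (Suc k)) (at 0) sequentially"
    unfolding filterlim_at
    using False by (auto intro!: tendsto_divide_0[OF tendsto_const] filterlim_compose[OF filterlim_at_top_imp_at_infinity[OF filterlim_real_sequentially]] filterlim_Suc simp del: of_nat_Suc)
  ultimately have "(\<lambda>k. arctan (s / real (Suc k)) / (s / real (Suc k))) \<longlonglongrightarrow> 1"
    by (rule filterlim_compose)
  then have "(\<lambda>k. s * (arctan (s / real (Suc k)) / (s / real (Suc k)))) \<longlonglongrightarrow> s * 1"
    by (intro tendsto_mult tendsto_const)
  then show ?thesis using False by (simp add: field_simps del: of_nat_Suc)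
qed simp

lemma trunc5_tendsto: "(\<lambda>k. trunc5 k s) \<longlonglongrightarrow> s ^ 5" "(\<lambda>k. trunc5' k s) \<longlonglongrightarrow> 5 * s ^ 4"
proof -
  show "(\<lambda>k. trunc5 k s) \<longlonglongrightarrow> s ^ 5"
    unfolding trunc5_def by (intro tendsto_power trunc_tendsto)
  have "(\<lambda>k. s / real (Suc k)) \<longlonglongrightarrow> 0"
    by (rule LIMSEQ_Suc[of "\<lambda>k. s / real k"]) (rule lim_const_over_n)
  then have "(\<lambda>k. trunc5' k s) \<longlonglongrightarrow> 5 * s ^ 4 / (1 + 0\<^sup>2)"
    unfolding trunc5'_def by (intro tendsto_intros trunc_tendsto) auto
  then show "(\<lambda>k. trunc5' k s) \<longlonglongrightarrow> 5 * s ^ 4" by simp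
qed

text \<open>The support of the time cutoff lies strictly inside the interval of the solution, which
  leaves room for mollification.\<close>

locale nlw_weight = nlw_data F Ft v vt Dv a b S M + cone_weight \<eta> \<eta>' W w a1 b1 T B
  for F Ft v vt :: "real \<Rightarrow> R3 \<Rightarrow> real" and Dv :: "real \<Rightarrow> R3 \<Rightarrow> R3" and a b S M :: real
    and \<eta> \<eta>' W w :: "real \<Rightarrow> real" and a1 b1 T B :: real +
  assumes inside: "a < a1" "a1 \<le> b1" "b1 < b"
begin

text \<open>A compact set around \<open>K0\<close> inside the open strip, with half the gap as
  margin at either end of the time interval and margin 1 in space. The absolute value keeps the
  radius positive if T < a1.\<close>

definition K :: "spacetime set" where
  "K = {(a + a1) / 2..(b1 + b) / 2} \<times> cball 0 (\<bar>T - a1\<bar> + 1)"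

lemma K_facts: "compact K" "K \<subseteq> {a<..<b} \<times> UNIV" "K \<subseteq> strip" "K0 \<subseteq> K" "K \<in> sets borel"
proof -
  show "compact K" unfolding K_def by (intro compact_Times) auto
  then show "K \<in> sets borel" by (simp add: borel_compact)
  show "K \<subseteq> {a<..<b} \<times> UNIV" "K \<subseteq> strip" using inside by (auto simp: K_def strip_def)
  show "K0 \<subseteq> K" using inside by (auto simp: K_def K0_def)
qed

lemma K_margin:
  obtains d where "d > 0" "\<And>z r. z \<in> K0 \<Longrightarrow> r \<le> d \<Longrightarrow> cball z r \<subseteq> K"
proof
  let ?d = "min ((a1 - a) / 2) (min ((b - b1) / 2) 1)"
  show "?d > 0" using inside by auto
  fix z r assume z: "z \<in> K0" and r: "r \<le> ?d"
  show "cball z r \<subseteq> K"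
  proof
    fix y assume "y \<in> cball z r"
    then have "dist (fst z) (fst y) \<le> r" "dist (snd z) (snd y) \<le> r"
      using dist_fst_le[of z y] dist_snd_le[of z y] by auto
    moreover have "norm (snd y) \<le> norm (snd z) + dist (snd z) (snd y)"
      using norm_triangle_ineq4[of "snd z" "snd z - snd y"] by (simp add: dist_norm)
    moreover have "norm (snd z) \<le> T - a1" "a1 \<le> fst z" "fst z \<le> b1"
      using z by (auto simp: K0_def)
    ultimately show "y \<in> K"
      using r by (cases y) (auto simp: K_def dist_real_def abs_le_iff field_simps)
  qed
qed

text \<open>The margin around \<open>K0\<close> is positive and the mollification radii tend to
  0.\<close>

lemma eventually_kernel:
  "\<forall>\<^sub>F n in sequentially. \<forall>z\<in>K0. cball z (inverse (real (Suc n))) \<subseteq> K"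
proof -
  obtain d where d: "d > 0" "\<And>z r. z \<in> K0 \<Longrightarrow> r \<le> d \<Longrightarrow> cball z r \<subseteq> K"
    using K_margin by blast
  have "\<forall>\<^sub>F n in sequentially. inverse (real (Suc n)) < d"
    using LIMSEQ_inverse_real_of_nat d(1) by (rule order_tendstoD)
  then show ?thesis
    by eventually_elim (use d(2) in auto)
qed

lemma integrable_res_K:
  "integrable lborel (res K v)" "integrable lborel (res K vt)" "integrable lborel (res K F)"
  "integrable lborel (res K Ft)" "integrable lborel (res K (\<lambda>t x. (v t x + F t x) ^ 5))"
  using sol_simps(6,7) Ft
  by (auto intro!: integrable_res[OF _ K_facts(1,2)] simp: weak_time_derivative_def solves_wave_def)

lemma res_K: "res K u z = indicator K z * res strip u z"
  by (rule res_subset[OF K_facts(3)])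

lemma res_K_abs_le: "\<bar>res K u z\<bar> \<le> \<bar>res strip u z\<bar>"
  unfolding res_K by (simp add: indicator_def)

lemma L2_res_K:
  assumes "(\<integral>\<^sup>+z. ennreal ((res strip u z)\<^sup>2) \<partial>lborel) < \<top>"
  shows "(\<integral>\<^sup>+z. ennreal ((res K u z)\<^sup>2) \<partial>lborel) < \<top>"
  by (rule order.strict_trans1[OF _ assms])
     (intro nn_integral_mono ennreal_leI, simp add: abs_le_square_iff[symmetric] res_K_abs_le)

text \<open>On a set of finite measure, |y| <= 1 + y^2 converts square integrability into
  integrability.\<close>

lemma integrable_res_K_D:
  assumes e: "e \<in> Basis"
  shows "integrable lborel (res K (\<lambda>t x. Dv t x \<bullet> e))"
proof (rule Bochner_Integration.integrable_bound)
  have "integrable lborel (\<lambda>z. sD e z * sD e z)"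
    by (auto intro!: integrable_product_L2 L2_sD e)
  moreover have "integrable lborel (indicator K :: spacetime \<Rightarrow> real)"
    using K_facts(5) emeasure_compact_finite[OF K_facts(1)] by (intro integrable_real_indicator) auto
  ultimately show "integrable lborel (\<lambda>z. indicator K z + sD e z * sD e z)"
    by (intro Bochner_Integration.integrable_add)
  have [measurable]: "K \<in> sets borel" by (rule K_facts)
  show "res K (\<lambda>t x. Dv t x \<bullet> e) \<in> borel_measurable lborel"
    unfolding res_K[abs_def] sD_def[symmetric] by measurable
  show "AE z in lborel. norm (res K (\<lambda>t x. Dv t x \<bullet> e) z) \<le> norm (indicator K z + sD e z * sD e z)"
  proof (rule AE_I2)
    fix z
    have "\<bar>y\<bar> \<le> 1 + y * y" for y :: real
      using zero_le_power2[of "\<bar>y\<bar> - 1"] by (simp add: power2_eq_square algebra_simps)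
    from this[of "sD e z"] show "norm (res K (\<lambda>t x. Dv t x \<bullet> e) z) \<le> norm (indicator K z + sD e z * sD e z)"
      unfolding res_K sD_def[symmetric] by (auto simp: indicator_def)
  qed
qed

text \<open>Both sides of the compatibility condition between gradient and time derivative are
  convolutions of \<open>v\<close> with the same mixed second derivative of the mollifier.
  Convolving the wave equation gives the other condition. Points of \<open>K0\<close> keep the
  distance from the boundary of \<open>K\<close> that these identities require.\<close>

lemma weighted_energy:
  "(LINT z|lborel. \<psi> z * (svt z * sG z))
    \<le> (LINT z|lborel. \<eta>' (fst z) * W (fst z + norm (snd z)) * edens z)"
proof -
  let ?D = "\<lambda>e. res K (\<lambda>t x. Dv t x \<bullet> e)" and ?G = "\<lambda>t x. (v t x + F t x) ^ 5"
  have conv_D: "conv (partial (0, e) \<sigma>) (res K v) z = conv \<sigma> (?D e) z"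
    if "kernel r \<sigma>" "cball z r \<subseteq> K" "e \<in> Basis" for r \<sigma> z e
    using K_facts(3) unfolding strip_def
    by (intro conv_space_derivative[OF sol_simps(4) that(1,2) _ that(3) integrable_res_K(1) integrable_res_K_D[OF that(3)]])
  have conv_t: "conv (partial (1, 0) \<sigma>) (res K v) z = conv \<sigma> (res K vt) z"
    if "kernel r \<sigma>" "cball z r \<subseteq> K" for r \<sigma> z
    by (rule conv_time_derivative[OF sol_simps(6) that K_facts(2)])
  have "(LINT z|lborel. \<psi> z * (res K vt z * res K ?G z))
    \<le> (LINT z|lborel. \<eta>' (fst z) * W (fst z + norm (snd z)) *
        (1/2 * (res K vt z)\<^sup>2 + (\<Sum>e\<in>Basis. 1/2 * (?D e z)\<^sup>2)))"
  proof (rule energy_inequality[where c = "ennreal (2 * S)"])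
    show "slice_sq (res K vt) t \<le> ennreal (2 * S)" for t
      using slice_sq_mono[of "res K vt" svt t] slice_svt[of t] res_K_abs_le unfolding svt_def
      by (meson order_trans)
    show "(\<integral>\<^sup>+z. ennreal ((res K vt z)\<^sup>2) \<partial>lborel) < \<top>"
      using L2_svt unfolding svt_def by (rule L2_res_K)
    show "(\<integral>\<^sup>+z. ennreal ((?D e z)\<^sup>2) \<partial>lborel) < \<top>" if "e \<in> Basis" for e
      using L2_sD[OF that] unfolding sD_def by (rule L2_res_K)
    have "(\<integral>\<^sup>+t. epowr (slice_sq sG t) (1/2) \<partial>lborel) < \<top>"
      by (rule mixed_quintic[where C = 32]) (use quintic_bounds(2) in \<open>auto simp: sG_eq\<close>)
    moreover have "(\<integral>\<^sup>+t. epowr (slice_sq (res K ?G) t) (1/2) \<partial>lborel) \<le> (\<integral>\<^sup>+t. epowr (slice_sq sG t) (1/2) \<partial>lborel)"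
      unfolding sG_def by (intro nn_integral_mono epowr_mono slice_sq_mono res_K_abs_le) simp
    ultimately show "(\<integral>\<^sup>+t. epowr (slice_sq (res K ?G) t) (1/2) \<partial>lborel) < \<top>"
      by (rule order.strict_trans1[rotated])
    show "\<forall>\<^sub>F n in sequentially. \<forall>z\<in>K0. \<forall>e\<in>Basis.
        conv (partial (1, 0) (\<rho>\<^sub>n n)) (?D e) z = conv (partial (0, e) (\<rho>\<^sub>n n)) (res K vt) z"
      using eventually_kernel
    proof eventually_elim
      case (elim n)
      show ?case
      proof (intro ballI)
        fix z and e :: R3 assume z: "z \<in> K0" and e: "e \<in> Basis"
        note c = bspec[OF elim z]
        show "conv (partial (1, 0) (\<rho>\<^sub>n n)) (?D e) z = conv (partial (0, e) (\<rho>\<^sub>n n)) (res K vt) z"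
          using conv_D[OF kernel_partial[OF kernel_mollifier time_basis] c e]
            conv_t[OF kernel_partial[OF kernel_mollifier space_basis[OF e]] c]
            partial_std_mollifier_commute[OF time_basis space_basis[OF e]]
          by (simp add: \<rho>\<^sub>n_def)
      qed
    qed
    show "\<forall>\<^sub>F n in sequentially. \<forall>z\<in>K0. conv (partial (1, 0) (\<rho>\<^sub>n n)) (res K vt) z
        - (\<Sum>e\<in>Basis. conv (partial (0, e) (\<rho>\<^sub>n n)) (?D e) z) = - conv (\<rho>\<^sub>n n) (res K ?G) z"
      using eventually_kernel
    proof eventually_elim
      case (elim n)
      show ?case
      proof (intro ballI)
        fix z assume z: "z \<in> K0"
        note c = bspec[OF elim z]
        have "(\<Sum>e\<in>Basis. conv (partial (0, e) (\<rho>\<^sub>n n)) (?D e) z)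
            = (\<Sum>e\<in>Basis. conv (partial (0, e) (partial (0, e) (\<rho>\<^sub>n n))) (res K v) z)"
          by (intro sum.cong refl conv_D[OF kernel_partial[OF kernel_mollifier space_basis] c, symmetric])
        moreover have "conv (partial (1, 0) (\<rho>\<^sub>n n)) (res K vt) z
            = conv (partial (1, 0) (partial (1, 0) (\<rho>\<^sub>n n))) (res K v) z"
          by (rule conv_t[OF kernel_partial[OF kernel_mollifier time_basis] c, symmetric])
        ultimately show "conv (partial (1, 0) (\<rho>\<^sub>n n)) (res K vt) z
            - (\<Sum>e\<in>Basis. conv (partial (0, e) (\<rho>\<^sub>n n)) (?D e) z) = - conv (\<rho>\<^sub>n n) (res K ?G) z"
          using conv_wave[OF sol_simps(7) kernel_mollifier c K_facts(2) integrable_res_K(1)] by simp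
      qed
    qed
  qed (auto intro: integrable_res_K integrable_res_K_D)
  also have "(\<lambda>z. \<psi> z * (res K vt z * res K ?G z)) = (\<lambda>z. \<psi> z * (svt z * sG z))"
  proof
    fix z
    show "\<psi> z * (res K vt z * res K ?G z) = \<psi> z * (svt z * sG z)"
      using outside_K0(1)[of z] K_facts(4) by (cases "z \<in> K0") (auto simp: res_K svt_def sG_def)
  qed
  also have "(\<lambda>z. \<eta>' (fst z) * W (fst z + norm (snd z)) *
        (1/2 * (res K vt z)\<^sup>2 + (\<Sum>e\<in>Basis. 1/2 * (?D e z)\<^sup>2)))
      = (\<lambda>z. \<eta>' (fst z) * W (fst z + norm (snd z)) * edens z)"
  proof
    fix z
    show "\<eta>' (fst z) * W (fst z + norm (snd z)) * (1/2 * (res K vt z)\<^sup>2 + (\<Sum>e\<in>Basis. 1/2 * (?D e z)\<^sup>2))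
        = \<eta>' (fst z) * W (fst z + norm (snd z)) * edens z"
    proof (cases "z \<in> K0")
      case True
      then show ?thesis using K_facts(4) by (auto simp: res_K svt_def sD_def edens_def)
    next
      case False
      then have "fst z \<notin> {a1..b1} \<or> fst z + norm (snd z) \<ge> T"
        unfolding K0_def by (cases z) fastforce
      then show ?thesis using \<eta>'_eq_0 W(3) by auto
    qed
  qed
  finally show ?thesis .
qed

text \<open>The identity for bounded functions is applied to \<open>trunc5\<close>. Its bounds |s|^5
  and 5 s^4 make the three untruncated integrands dominating functions, so the truncation can be
  removed. The cases \<open>u = v\<close> and \<open>u = F\<close> are the ones used.\<close>

lemma weighted_product:
  fixes u ut :: "real \<Rightarrow> R3 \<Rightarrow> real"
  assumes u: "weak_time_derivative ({a<..<b} \<times> UNIV) u ut" "res strip u \<in> borel_measurable borel"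
      "(\<integral>\<^sup>+z. ennreal ((res K u z)\<^sup>2) \<partial>lborel) < \<top>"
    and int: "integrable lborel (\<lambda>z. sv z ^ 5 * res strip u z)"
      "integrable lborel (\<lambda>z. svt z * (sv z ^ 4 * res strip u z))"
      "integrable lborel (\<lambda>z. \<psi> z * (sv z ^ 5 * res K ut z))"
  shows "(LINT z|lborel. \<psi>t z * (sv z ^ 5 * res strip u z))
    + 5 * (LINT z|lborel. \<psi> z * (svt z * (sv z ^ 4 * res strip u z)))
    + (LINT z|lborel. \<psi> z * (sv z ^ 5 * res K ut z)) = 0"
proof -
  have iu: "integrable lborel (res K u)" "integrable lborel (res K ut)"
    using u(1) by (auto intro!: integrable_res[OF _ K_facts(1,2)] simp: weak_time_derivative_def)
  note [measurable] = u(2)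
  have [measurable]: "res K ut \<in> borel_measurable borel" using iu by auto
  have [measurable]: "trunc5 k \<in> borel_measurable borel" "trunc5' k \<in> borel_measurable borel" for k
    by (auto intro!: borel_measurable_continuous_onI trunc5'_continuous continuous_at_imp_continuous_on
        DERIV_continuous[OF trunc5_derivative])
  \<comment> \<open>Both weights vanish outside \<open>K0\<close>, which lies in \<open>K\<close>,
    so integrands need only agree on \<open>K\<close>.\<close>
  have on_K: "\<psi> z * g = \<psi> z * h" "\<psi>t z * g = \<psi>t z * h" if "z \<in> K \<Longrightarrow> g = h" for z g h
    using that outside_K0[of z] K_facts(4) by (cases "z \<in> K0"; auto)+
  have conv_t: "conv (partial (1, 0) \<sigma>) (res K f) z = conv \<sigma> (res K f') z"
    if "weak_time_derivative ({a<..<b} \<times> UNIV) f f'" "kernel r \<sigma>" "cball z r \<subseteq> K" for r \<sigma> z f f'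
    by (rule conv_time_derivative[OF that K_facts(2)])
  have ident: "(LINT z|lborel. \<psi>t z * (trunc5 k (sv z) * res strip u z))
      + (LINT z|lborel. \<psi> z * (trunc5' k (sv z) * (svt z * res strip u z)))
      + (LINT z|lborel. \<psi> z * (trunc5 k (sv z) * res K ut z)) = 0" for k
  proof -
    have "(LINT z|lborel. \<psi>t z * trunc5 k (res K v z) * res K u z)
      + (LINT z|lborel. \<psi> z * trunc5' k (res K v z) * (res K vt z * res K u z))
      + (LINT z|lborel. \<psi> z * trunc5 k (res K v z) * res K ut z) = 0"
    proof (rule product_identity_bounded)
      show "(\<integral>\<^sup>+z. ennreal ((res K vt z)\<^sup>2) \<partial>lborel) < \<top>"
        using L2_svt unfolding svt_def by (rule L2_res_K)
      show "\<forall>\<^sub>F n in sequentially. \<forall>z\<in>K0. conv (partial (1, 0) (\<rho>\<^sub>n n)) (res K v) z = conv (\<rho>\<^sub>n n) (res K vt) z"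
        "\<forall>\<^sub>F n in sequentially. \<forall>z\<in>K0. conv (partial (1, 0) (\<rho>\<^sub>n n)) (res K u) z = conv (\<rho>\<^sub>n n) (res K ut) z"
        using eventually_kernel
        by (eventually_elim, use conv_t[OF sol_simps(6) kernel_mollifier] conv_t[OF u(1) kernel_mollifier] in blast)+
    qed (rule integrable_res_K iu u trunc5_derivative trunc5'_continuous trunc5_bounds)+
    moreover have "\<psi>t z * trunc5 k (res K v z) * res K u z = \<psi>t z * (trunc5 k (sv z) * res strip u z)"
      "\<psi> z * trunc5' k (res K v z) * (res K vt z * res K u z) = \<psi> z * (trunc5' k (sv z) * (svt z * res strip u z))"
      "\<psi> z * trunc5 k (res K v z) * res K ut z = \<psi> z * (trunc5 k (sv z) * res K ut z)" for z
      unfolding mult.assoc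
      by (rule on_K, simp add: res_K sv_def svt_def)+
    ultimately show ?thesis by simp
  qed
  obtain B' where B': "\<And>z. \<bar>\<psi> z\<bar> \<le> B'" "\<And>z. \<bar>\<psi>t z\<bar> \<le> B'" using bounded_\<psi> by metis
  have b: "integrable lborel (\<lambda>z. \<psi>t z * (sv z ^ 5 * res strip u z))"
    "integrable lborel (\<lambda>z. \<psi> z * (svt z * (sv z ^ 4 * res strip u z)))"
    by (rule integrable_bounded_mult[where B = B']; use int B' in auto)+
  have lim1: "(\<lambda>k. LINT z|lborel. \<psi>t z * (trunc5 k (sv z) * res strip u z)) \<longlonglongrightarrow> (LINT z|lborel. \<psi>t z * (sv z ^ 5 * res strip u z))"
  proof (rule integral_dominated_convergence)
    show "integrable lborel (\<lambda>z. \<bar>\<psi>t z * (sv z ^ 5 * res strip u z)\<bar>)" using b(1) by (rule integrable_abs)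
    show "AE z in lborel. norm (\<psi>t z * (trunc5 k (sv z) * res strip u z)) \<le> \<bar>\<psi>t z * (sv z ^ 5 * res strip u z)\<bar>" for k
      by (intro AE_I2) (auto simp: abs_mult power_abs intro!: mult_left_mono mult_right_mono trunc5_bounds)
  qed (measurable, intro AE_I2 tendsto_intros trunc5_tendsto)
  have lim2: "(\<lambda>k. LINT z|lborel. \<psi> z * (trunc5' k (sv z) * (svt z * res strip u z)))
      \<longlonglongrightarrow> (LINT z|lborel. \<psi> z * (5 * sv z ^ 4 * (svt z * res strip u z)))"
  proof (rule integral_dominated_convergence)
    show "integrable lborel (\<lambda>z. 5 * \<bar>\<psi> z * (svt z * (sv z ^ 4 * res strip u z))\<bar>)"
      using b(2) by (intro integrable_mult_right integrable_abs)
    show "AE z in lborel. norm (\<psi> z * (trunc5' k (sv z) * (svt z * res strip u z)))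
        \<le> 5 * \<bar>\<psi> z * (svt z * (sv z ^ 4 * res strip u z))\<bar>" for k
    proof (rule AE_I2)
      fix z
      have "\<bar>trunc5' k (sv z)\<bar> * \<bar>\<psi> z * svt z * res strip u z\<bar> \<le> 5 * sv z ^ 4 * \<bar>\<psi> z * svt z * res strip u z\<bar>"
        by (intro mult_right_mono trunc5_bounds) simp
      then show "norm (\<psi> z * (trunc5' k (sv z) * (svt z * res strip u z)))
        \<le> 5 * \<bar>\<psi> z * (svt z * (sv z ^ 4 * res strip u z))\<bar>"
        by (simp add: abs_mult mult_ac)
    qed
  qed (measurable, intro AE_I2 tendsto_intros trunc5_tendsto)
  have lim3: "(\<lambda>k. LINT z|lborel. \<psi> z * (trunc5 k (sv z) * res K ut z)) \<longlonglongrightarrow> (LINT z|lborel. \<psi> z * (sv z ^ 5 * res K ut z))"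
  proof (rule integral_dominated_convergence)
    show "integrable lborel (\<lambda>z. \<bar>\<psi> z * (sv z ^ 5 * res K ut z)\<bar>)" using int(3) by (rule integrable_abs)
    show "AE z in lborel. norm (\<psi> z * (trunc5 k (sv z) * res K ut z)) \<le> \<bar>\<psi> z * (sv z ^ 5 * res K ut z)\<bar>" for k
      by (intro AE_I2) (auto simp: abs_mult power_abs intro!: mult_left_mono mult_right_mono trunc5_bounds)
  qed (measurable, intro AE_I2 tendsto_intros trunc5_tendsto)
  have "(LINT z|lborel. \<psi>t z * (sv z ^ 5 * res strip u z))
      + (LINT z|lborel. \<psi> z * (5 * sv z ^ 4 * (svt z * res strip u z)))
      + (LINT z|lborel. \<psi> z * (sv z ^ 5 * res K ut z)) = 0"
    using tendsto_add[OF tendsto_add[OF lim1 lim2] lim3] unfolding ident by (simp add: LIMSEQ_const_iff)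
  moreover have "(LINT z|lborel. \<psi> z * (5 * sv z ^ 4 * (svt z * res strip u z)))
      = 5 * (LINT z|lborel. \<psi> z * (svt z * (sv z ^ 4 * res strip u z)))"
    by (subst integral_mult_right_zero[symmetric]) (simp add: mult_ac)
  ultimately show ?thesis by simp
qed

end

section \<open>The two parts of the time derivative of the weight, and the assembled
  estimate\<close>

context nlw_weight
begin

text \<open>The time derivative of the weight splits into minus this term, which carries the
  quantity to be estimated, and \<open>dcut\<close>, which plays the part of the boundary terms in
  time.\<close>

definition cutw :: "spacetime \<Rightarrow> real" where
  "cutw z = \<eta> (fst z) * w (fst z + norm (snd z))"

definition dcut :: "spacetime \<Rightarrow> real" where
  "dcut z = \<eta>' (fst z) * W (fst z + norm (snd z))"

lemma \<psi>t_eq: "\<psi>t z = dcut z - cutw z"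
  by (simp add: \<psi>t_def dcut_def cutw_def)

lemma borel_fst_snd [measurable]:
  "(fst :: spacetime \<Rightarrow> real) \<in> borel_measurable borel" "(snd :: spacetime \<Rightarrow> R3) \<in> borel_measurable borel"
  by (intro borel_measurable_continuous_onI continuous_intros)+

lemma borel_cut [measurable]: "cutw \<in> borel_measurable borel" "dcut \<in> borel_measurable borel"
  unfolding cutw_def[abs_def] dcut_def[abs_def] by measurable

lemma cutw_bounds: "0 \<le> cutw z" "\<bar>cutw z\<bar> \<le> B"
proof -
  show "0 \<le> cutw z" unfolding cutw_def using \<eta>(4) W(4) by simp
  have "\<bar>cutw z\<bar> \<le> 1 * B"
    unfolding cutw_def abs_mult using \<eta>(4,5) W(4,5) by (intro mult_mono) auto
  then show "\<bar>cutw z\<bar> \<le> B" by simp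
qed

lemma dcut_bounded: obtains C where "\<And>z. \<bar>dcut z\<bar> \<le> C"
proof -
  obtain C where C: "\<And>z. \<bar>\<psi>t z\<bar> \<le> C" using bounded_\<psi> by metis
  have "\<bar>dcut z\<bar> \<le> C + B" for z
    using C[of z] cutw_bounds[of z] unfolding \<psi>t_eq by linarith
  then show ?thesis using that by blast
qed

lemma integrable_dcut_cutw:
  assumes "integrable lborel f"
  shows "integrable lborel (\<lambda>z. dcut z * f z)" "integrable lborel (\<lambda>z. cutw z * f z)"
    "(LINT z|lborel. \<psi>t z * f z) = (LINT z|lborel. dcut z * f z) - (LINT z|lborel. cutw z * f z)"
proof -
  obtain C where C: "\<And>z. \<bar>dcut z\<bar> \<le> C" using dcut_bounded by blast
  show 1: "integrable lborel (\<lambda>z. dcut z * f z)" "integrable lborel (\<lambda>z. cutw z * f z)"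
    by (rule integrable_bounded_mult[OF assms _ C] integrable_bounded_mult[OF assms _ cutw_bounds(2)]; simp)+
  show "(LINT z|lborel. \<psi>t z * f z) = (LINT z|lborel. dcut z * f z) - (LINT z|lborel. cutw z * f z)"
    unfolding \<psi>t_eq left_diff_distrib by (rule Bochner_Integration.integral_diff[OF 1])
qed

text \<open>The derivative of the cutoff has integral at most 4 in absolute value however steep it
  is. The term is thus controlled by a bound on the time slices and does not deteriorate as the
  cutoff approaches the indicator of the interval.\<close>

lemma dcut_integral_le:
  assumes A: "\<And>s. a \<le> s \<Longrightarrow> 0 \<le> W s \<and> W s \<le> A" "0 \<le> A" and c: "0 \<le> c"
    and \<eta>': "(\<integral>\<^sup>+t. ennreal \<bar>\<eta>' t\<bar> \<partial>lborel) \<le> 4"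
    and f: "integrable lborel f" "AE t in lborel. (\<integral>\<^sup>+x. ennreal \<bar>f (t, x)\<bar> \<partial>lborel) \<le> ennreal c"
  shows "\<bar>LINT z|lborel. dcut z * f z\<bar> \<le> 4 * A * c"
proof -
  have [measurable]: "f \<in> borel_measurable borel" using f by auto
  have "ennreal \<bar>LINT z|lborel. dcut z * f z\<bar> \<le> (\<integral>\<^sup>+z. ennreal \<bar>dcut z * f z\<bar> \<partial>lborel)"
    using integral_norm_bound_ennreal[OF integrable_dcut_cutw(1)[OF f(1)]] by simp
  also have "\<dots> = (\<integral>\<^sup>+t. (\<integral>\<^sup>+x. ennreal \<bar>dcut (t, x) * f (t, x)\<bar> \<partial>lborel) \<partial>lborel)"
    by (rule nn_integral_spacetime) measurable
  also have "\<dots> \<le> (\<integral>\<^sup>+t. ennreal \<bar>\<eta>' t\<bar> * (ennreal A * ennreal c) \<partial>lborel)"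
    using f(2)
  proof (intro nn_integral_mono_AE, eventually_elim)
    case (elim t)
    have "(\<integral>\<^sup>+x. ennreal \<bar>dcut (t, x) * f (t, x)\<bar> \<partial>lborel)
        \<le> (\<integral>\<^sup>+x. (ennreal \<bar>\<eta>' t\<bar> * ennreal A) * ennreal \<bar>f (t, x)\<bar> \<partial>lborel)"
    proof (rule nn_integral_mono)
      fix x
      have "\<bar>dcut (t, x)\<bar> \<le> \<bar>\<eta>' t\<bar> * A"
      proof (cases "t \<in> {a1..b1}")
        case True
        then have "a \<le> t + norm x" using inside norm_ge_zero[of x] by (auto intro: add_increasing2)
        then show ?thesis
          using A(1)[of "t + norm x"] by (auto simp: dcut_def abs_mult intro!: mult_left_mono)
      qed (use \<eta>'_eq_0 in \<open>simp add: dcut_def\<close>)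
      then have "\<bar>dcut (t, x) * f (t, x)\<bar> \<le> (\<bar>\<eta>' t\<bar> * A) * \<bar>f (t, x)\<bar>"
        unfolding abs_mult[of "dcut (t, x)"] by (rule mult_right_mono) simp
      then show "ennreal \<bar>dcut (t, x) * f (t, x)\<bar> \<le> (ennreal \<bar>\<eta>' t\<bar> * ennreal A) * ennreal \<bar>f (t, x)\<bar>"
        using A(2) by (simp add: ennreal_leI flip: ennreal_mult)
    qed
    also have "\<dots> = (ennreal \<bar>\<eta>' t\<bar> * ennreal A) * (\<integral>\<^sup>+x. ennreal \<bar>f (t, x)\<bar> \<partial>lborel)"
      by (rule nn_integral_cmult) measurable
    also have "\<dots> \<le> (ennreal \<bar>\<eta>' t\<bar> * ennreal A) * ennreal c"
      by (intro mult_left_mono elim) simp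
    finally show ?case by (simp add: mult.assoc)
  qed
  also have "\<dots> = (\<integral>\<^sup>+t. ennreal \<bar>\<eta>' t\<bar> \<partial>lborel) * (ennreal A * ennreal c)"
    by (rule nn_integral_multc) measurable
  also have "\<dots> \<le> 4 * (ennreal A * ennreal c)"
    by (intro mult_right_mono \<eta>') simp
  also have "\<dots> = ennreal (4 * A * c)"
  proof -
    have "(4::ennreal) = ennreal 4" by simp
    then show ?thesis using A(2) c by (simp only: ennreal_mult mult.assoc mult_nonneg_nonneg zero_le_numeral)
  qed
  finally show ?thesis using A(2) c by (simp add: ennreal_le_iff)
qed

text \<open>Every remaining binomial term contains y^2 and a cubic factor; the coefficients 10, 10,
  5 and 1 add up to 26.\<close>

lemma remainder_le:
  fixes x y :: real
  shows "\<bar>(x + y) ^ 5 - x ^ 5 - 5 * (x ^ 4 * y)\<bar> \<le> 26 * (\<bar>y\<bar>\<^sup>2 * (\<bar>y\<bar> + \<bar>x\<bar>) ^ 3)"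
proof -
  have eq: "(x + y) ^ 5 - x ^ 5 - 5 * (x ^ 4 * y) = y\<^sup>2 * (10 * x ^ 3 + (10 * x\<^sup>2 * y + (5 * x * y\<^sup>2 + y ^ 3)))"
    by (simp add: power2_eq_square power3_eq_cube eval_nat_numeral algebra_simps)
  let ?s = "\<bar>y\<bar> + \<bar>x\<bar>"
  have p: "\<bar>x\<bar> ^ i * \<bar>y\<bar> ^ j \<le> ?s ^ 3" if "i + j = 3" for i j
  proof -
    have "\<bar>x\<bar> ^ i * \<bar>y\<bar> ^ j \<le> ?s ^ i * ?s ^ j" by (intro mult_mono power_mono) auto
    then show ?thesis using that by (simp flip: power_add)
  qed
  have "\<bar>10 * x ^ 3\<bar> \<le> 10 * ?s ^ 3" using p[of 3 0] by (simp add: abs_mult power_abs)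
  moreover have "\<bar>10 * x\<^sup>2 * y\<bar> \<le> 10 * ?s ^ 3" using p[of 2 1] by (simp add: abs_mult power_abs)
  moreover have "\<bar>5 * x * y\<^sup>2\<bar> \<le> 5 * ?s ^ 3" using p[of 1 2] by (simp add: abs_mult power_abs)
  moreover have "\<bar>y ^ 3\<bar> \<le> ?s ^ 3" using p[of 0 3] by (simp add: power_abs)
  ultimately have "\<bar>10 * x ^ 3 + (10 * x\<^sup>2 * y + (5 * x * y\<^sup>2 + y ^ 3))\<bar> \<le> 26 * ?s ^ 3" by linarith
  then have "\<bar>y\<bar>\<^sup>2 * \<bar>10 * x ^ 3 + (10 * x\<^sup>2 * y + (5 * x * y\<^sup>2 + y ^ 3))\<bar> \<le> \<bar>y\<bar>\<^sup>2 * (26 * ?s ^ 3)"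
    by (rule mult_left_mono) simp
  then show ?thesis unfolding eq abs_mult[of "y\<^sup>2"] by simp
qed

text \<open>The energy inequality bounds the integral of \<psi> v_t (v + F)^5. On expanding the
  power, v_t v^5 becomes the derivative of v^6/6, the term 5 v_t v^4 F yields the two signed
  integrals and a boundary term, and the rest is at least quadratic in F.\<close>

lemma weighted_estimate:
  assumes A: "\<And>s. a \<le> s \<Longrightarrow> 0 \<le> W s \<and> W s \<le> A" "0 \<le> A"
    and \<eta>': "(\<integral>\<^sup>+t. ennreal \<bar>\<eta>' t\<bar> \<partial>lborel) \<le> 4"
    and q: "0 \<le> q" "AE t in lborel. (\<integral>\<^sup>+x. ennreal \<bar>sv (t, x) ^ 5 * sF (t, x)\<bar> \<partial>lborel) \<le> ennreal q"
    and P: "0 \<le> P" "(\<integral>\<^sup>+z. ennreal (\<bar>sF z\<bar>\<^sup>2 * (\<bar>sF z\<bar> + \<bar>sv z\<bar>) ^ 3 * \<bar>svt z\<bar>) \<partial>lborel) \<le> ennreal P"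
    and int: "integrable lborel (\<lambda>z. \<psi> z * (sv z ^ 5 * res K Ft z))"
  shows "(LINT z|lborel. cutw z * \<bar>sv z\<bar> ^ 6) \<le> 6 * (4 * A * S + 4 * A * q + 26 * A * P
    + \<bar>LINT z|lborel. cutw z * (sv z ^ 5 * sF z)\<bar> + \<bar>LINT z|lborel. \<psi> z * (sv z ^ 5 * res K Ft z)\<bar>)"
proof -
  define R where "R z = sG z - sv z ^ 5 - 5 * (sv z ^ 4 * sF z)" for z
  have [measurable]: "R \<in> borel_measurable borel" unfolding R_def[abs_def] by measurable
  \<comment> \<open>38 = 32 + 1 + 5, from the three terms of \<open>R\<close>. This crude bound
    serves integrability; the estimate itself uses \<open>remainder_le\<close>.\<close>
  have R_le: "\<bar>R z\<bar> \<le> 38 * (\<bar>sv z\<bar> ^ 5 + \<bar>sF z\<bar> ^ 5)" for z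
  proof -
    have "\<bar>sv z ^ 5\<bar> = \<bar>sv z\<bar> ^ 5" "0 \<le> \<bar>sF z\<bar> ^ 5" by (simp_all add: power_abs)
    then show ?thesis
      using quintic_bounds(1)[of "sv z" "sF z"] quintic_bounds(2)[of "sv z" "sF z"]
      unfolding R_def sG_eq distrib_left by linarith
  qed
  have i5: "integrable lborel (\<lambda>z. svt z * sv z ^ 5)"
    by (rule integrable_svt_quintic[where C = 1]) (auto simp: power_abs)
  have i4: "integrable lborel (\<lambda>z. svt z * (sv z ^ 4 * sF z))"
    by (rule integrable_svt_quintic[where C = 1]) (use quintic_bounds(1) in auto)
  have iR: "integrable lborel (\<lambda>z. svt z * R z)"
    by (rule integrable_svt_quintic[OF _ R_le]) measurable
  obtain B' where B': "\<And>z. \<bar>\<psi> z\<bar> \<le> B'" using bounded_\<psi> by metis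
  have i\<psi>: "integrable lborel (\<lambda>z. \<psi> z * f z)" if "integrable lborel f" for f
    by (rule integrable_bounded_mult[OF that _ B']) simp
  have split: "(LINT z|lborel. \<psi> z * (svt z * sG z))
      = (LINT z|lborel. \<psi> z * (svt z * sv z ^ 5)) + 5 * (LINT z|lborel. \<psi> z * (svt z * (sv z ^ 4 * sF z)))
        + (LINT z|lborel. \<psi> z * (svt z * R z))"
  proof -
    have "(LINT z|lborel. \<psi> z * (svt z * sG z)) = (LINT z|lborel. \<psi> z * (svt z * sv z ^ 5)
        + 5 * (\<psi> z * (svt z * (sv z ^ 4 * sF z))) + \<psi> z * (svt z * R z))"
      by (intro Bochner_Integration.integral_cong) (simp_all add: R_def algebra_simps)
    then show ?thesis using i\<psi>[OF i5] i\<psi>[OF i4] i\<psi>[OF iR] by simp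
  qed
  have sv6: "sv z ^ 5 * sv z = \<bar>sv z\<bar> ^ 6" for z
    by (simp add: eval_nat_numeral)
  have i6: "integrable lborel (\<lambda>z. sv z ^ 5 * sv z)" unfolding sv6 by (rule integrable_sv6)
  \<comment> \<open>The product rule with \<open>u = v\<close>: the terms 5 v_t v^5 and v_t v^5 add
    up to six times the same integral.\<close>
  have B1: "6 * (LINT z|lborel. \<psi> z * (svt z * sv z ^ 5))
      = (LINT z|lborel. cutw z * \<bar>sv z\<bar> ^ 6) - (LINT z|lborel. dcut z * \<bar>sv z\<bar> ^ 6)"
  proof -
    have same: "\<psi> z * (sv z ^ 5 * res K vt z) = \<psi> z * (svt z * sv z ^ 5)" for z
      using outside_K0(1)[of z] K_facts(4) by (cases "z \<in> K0") (auto simp: res_K svt_def)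
    have p4: "sv z ^ 4 * res strip v z = sv z ^ 5" for z
      by (simp add: sv_def eval_nat_numeral)
    have 1: "(LINT z|lborel. \<psi>t z * (sv z ^ 5 * res strip v z))
      + 5 * (LINT z|lborel. \<psi> z * (svt z * (sv z ^ 4 * res strip v z)))
      + (LINT z|lborel. \<psi> z * (sv z ^ 5 * res K vt z)) = 0"
    proof (rule weighted_product[OF sol_simps(6)])
      show "res strip v \<in> borel_measurable borel" using borel_s(1) by (simp add: sv_def)
      have "(\<integral>\<^sup>+z. ennreal ((res K v z)\<^sup>2) \<partial>lborel) \<le> (\<integral>\<^sup>+z. indicator K z + ennreal (\<bar>sv z\<bar> ^ 6) \<partial>lborel)"
      proof (rule nn_integral_mono)
        fix z
        \<comment> \<open>\<open>K\<close> has finite measure, so integrability of the sixth power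
          yields square integrability on \<open>K\<close>.\<close>
        have "y\<^sup>2 \<le> 1 + \<bar>y\<bar> ^ 6" for y :: real
          by (cases "\<bar>y\<bar> \<le> 1") (use power_le_one[of "\<bar>y\<bar>" 2] power_increasing[of 2 6 "\<bar>y\<bar>"] in \<open>auto simp: add_increasing add_increasing2\<close>)
        from ennreal_leI[OF this[of "sv z"]]
        show "ennreal ((res K v z)\<^sup>2) \<le> indicator K z + ennreal (\<bar>sv z\<bar> ^ 6)"
          unfolding res_K sv_def[symmetric] by (auto simp: indicator_def simp flip: ennreal_1 ennreal_plus)
      qed
      also have "\<dots> = emeasure lborel K + (\<integral>\<^sup>+z. ennreal (\<bar>sv z\<bar> ^ 6) \<partial>lborel)"
        using K_facts(5) by (subst nn_integral_add) auto
      also have "\<dots> < \<top>"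
        using L6_sv emeasure_compact_finite[OF K_facts(1)] by simp
      finally show "(\<integral>\<^sup>+z. ennreal ((res K v z)\<^sup>2) \<partial>lborel) < \<top>" .
      show "integrable lborel (\<lambda>z. sv z ^ 5 * res strip v z)" using i6 by (simp add: sv_def)
      show "integrable lborel (\<lambda>z. svt z * (sv z ^ 4 * res strip v z))" unfolding p4 by (rule i5)
      show "integrable lborel (\<lambda>z. \<psi> z * (sv z ^ 5 * res K vt z))" unfolding same by (rule i\<psi>[OF i5])
    qed
    have "(LINT z|lborel. \<psi>t z * (sv z ^ 5 * sv z)) + 6 * (LINT z|lborel. \<psi> z * (svt z * sv z ^ 5)) = 0"
      using 1 unfolding p4 same by (simp add: sv_def)
    then show ?thesis
      using integrable_dcut_cutw(3)[OF i6] unfolding sv6 by linarith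
  qed
  \<comment> \<open>The same product rule with \<open>u = F\<close>; the time derivative of
    \<open>F\<close> is kept inside a signed integral.\<close>
  have B2: "5 * (LINT z|lborel. \<psi> z * (svt z * (sv z ^ 4 * sF z)))
      = (LINT z|lborel. cutw z * (sv z ^ 5 * sF z)) - (LINT z|lborel. dcut z * (sv z ^ 5 * sF z))
        - (LINT z|lborel. \<psi> z * (sv z ^ 5 * res K Ft z))"
  proof -
    have "(LINT z|lborel. \<psi>t z * (sv z ^ 5 * res strip F z))
      + 5 * (LINT z|lborel. \<psi> z * (svt z * (sv z ^ 4 * res strip F z)))
      + (LINT z|lborel. \<psi> z * (sv z ^ 5 * res K Ft z)) = 0"
    proof (rule weighted_product[OF Ft _ _ _ _ int])
      show "res strip F \<in> borel_measurable borel" using borel_s(3) by (simp add: sF_def)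
      have "(\<integral>\<^sup>+z. ennreal ((res K F z)\<^sup>2) \<partial>lborel) \<le> (\<integral>\<^sup>+z. indicator K z + ennreal (\<bar>sF z\<bar> ^ 6) \<partial>lborel)"
      proof (rule nn_integral_mono)
        fix z
        have "y\<^sup>2 \<le> 1 + \<bar>y\<bar> ^ 6" for y :: real
          by (cases "\<bar>y\<bar> \<le> 1") (use power_le_one[of "\<bar>y\<bar>" 2] power_increasing[of 2 6 "\<bar>y\<bar>"] in \<open>auto simp: add_increasing add_increasing2\<close>)
        from ennreal_leI[OF this[of "sF z"]]
        show "ennreal ((res K F z)\<^sup>2) \<le> indicator K z + ennreal (\<bar>sF z\<bar> ^ 6)"
          unfolding res_K sF_def[symmetric] by (auto simp: indicator_def simp flip: ennreal_1 ennreal_plus)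
      qed
      also have "\<dots> = emeasure lborel K + (\<integral>\<^sup>+z. ennreal (\<bar>sF z\<bar> ^ 6) \<partial>lborel)"
        using K_facts(5) by (subst nn_integral_add) auto
      also have "\<dots> < \<top>"
        using L6_sF emeasure_compact_finite[OF K_facts(1)] by simp
      finally show "(\<integral>\<^sup>+z. ennreal ((res K F z)\<^sup>2) \<partial>lborel) < \<top>" .
      show "integrable lborel (\<lambda>z. sv z ^ 5 * res strip F z)"
        using integrable_sv5_sF by (simp add: sF_def)
      show "integrable lborel (\<lambda>z. svt z * (sv z ^ 4 * res strip F z))" using i4 by (simp add: sF_def)
    qed
    then show ?thesis
      using integrable_dcut_cutw(3)[OF integrable_sv5_sF] unfolding sF_def[symmetric] by linarith
  qed
  \<comment> \<open>The boundary term of v^6 from \<open>B1\<close> joins the quadratic energy, so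
    that together they are bounded by the full energy and not separately.\<close>
  have e1: "\<bar>LINT z|lborel. dcut z * (edens z + 1/6 * \<bar>sv z\<bar> ^ 6)\<bar> \<le> 4 * A * S"
  proof (rule dcut_integral_le[OF A energy_le(2) \<eta>'])
    show "integrable lborel (\<lambda>z. edens z + 1/6 * \<bar>sv z\<bar> ^ 6)"
      by (intro Bochner_Integration.integrable_add integrable_mult_right integrable_edens integrable_sv6)
    show "AE t in lborel. (\<integral>\<^sup>+x. ennreal \<bar>edens (t, x) + 1/6 * \<bar>sv (t, x)\<bar> ^ 6\<bar> \<partial>lborel) \<le> ennreal S"
      using slice_energy edens_nonneg by (auto simp: abs_of_nonneg add_nonneg_nonneg)
  qed
  have "(LINT z|lborel. dcut z * (edens z + 1/6 * \<bar>sv z\<bar> ^ 6))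
      = (LINT z|lborel. dcut z * edens z) + 1/6 * (LINT z|lborel. dcut z * \<bar>sv z\<bar> ^ 6)"
  proof -
    have "(LINT z|lborel. dcut z * (edens z + 1/6 * \<bar>sv z\<bar> ^ 6)) = (LINT z|lborel. dcut z * edens z + 1/6 * (dcut z * \<bar>sv z\<bar> ^ 6))"
      by (intro Bochner_Integration.integral_cong) (simp_all add: algebra_simps)
    then show ?thesis
      using integrable_dcut_cutw(1)[OF integrable_edens] integrable_dcut_cutw(1)[OF integrable_sv6] by simp
  qed
  with e1 have e1': "(LINT z|lborel. dcut z * edens z) + 1/6 * (LINT z|lborel. dcut z * \<bar>sv z\<bar> ^ 6) \<le> 4 * A * S"
    by linarith
  have e2: "\<bar>LINT z|lborel. dcut z * (sv z ^ 5 * sF z)\<bar> \<le> 4 * A * q"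
    by (rule dcut_integral_le[OF A q(1) \<eta>' integrable_sv5_sF q(2)])
  have e3: "\<bar>LINT z|lborel. \<psi> z * (svt z * R z)\<bar> \<le> 26 * A * P"
  proof -
    have "ennreal \<bar>LINT z|lborel. \<psi> z * (svt z * R z)\<bar> \<le> (\<integral>\<^sup>+z. ennreal \<bar>\<psi> z * (svt z * R z)\<bar> \<partial>lborel)"
      using integral_norm_bound_ennreal[OF i\<psi>[OF iR]] by simp
    also have "\<dots> \<le> (\<integral>\<^sup>+z. ennreal (26 * A) * ennreal (\<bar>sF z\<bar>\<^sup>2 * (\<bar>sF z\<bar> + \<bar>sv z\<bar>) ^ 3 * \<bar>svt z\<bar>) \<partial>lborel)"
    proof (rule nn_integral_mono)
      fix z
      have \<psi>A: "\<bar>\<psi> z\<bar> \<le> A"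
      proof (cases "z \<in> K0")
        case True
        then have "a \<le> fst z + norm (snd z)"
          using inside norm_ge_zero[of "snd z"] by (auto simp: K0_def intro: add_increasing2)
        then have "\<bar>\<eta> (fst z)\<bar> * \<bar>W (fst z + norm (snd z))\<bar> \<le> 1 * A"
          using A(1)[of "fst z + norm (snd z)"] \<eta>(4,5) by (intro mult_mono) auto
        then show ?thesis by (simp add: \<psi>_def abs_mult)
      qed (use outside_K0(1) A(2) in simp)
      have "\<bar>\<psi> z\<bar> * (\<bar>svt z\<bar> * \<bar>R z\<bar>) \<le> A * (\<bar>svt z\<bar> * (26 * (\<bar>sF z\<bar>\<^sup>2 * (\<bar>sF z\<bar> + \<bar>sv z\<bar>) ^ 3)))"
        using remainder_le[of "sv z" "sF z"] \<psi>A A(2) unfolding R_def sG_eq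
        by (intro mult_mono) auto
      then have "\<bar>\<psi> z * (svt z * R z)\<bar> \<le> (26 * A) * (\<bar>sF z\<bar>\<^sup>2 * (\<bar>sF z\<bar> + \<bar>sv z\<bar>) ^ 3 * \<bar>svt z\<bar>)"
        by (simp add: abs_mult mult_ac)
      then show "ennreal \<bar>\<psi> z * (svt z * R z)\<bar>
          \<le> ennreal (26 * A) * ennreal (\<bar>sF z\<bar>\<^sup>2 * (\<bar>sF z\<bar> + \<bar>sv z\<bar>) ^ 3 * \<bar>svt z\<bar>)"
        using A(2) by (subst ennreal_mult[symmetric]) (auto intro: ennreal_leI)
    qed
    also have "\<dots> = ennreal (26 * A) * (\<integral>\<^sup>+z. ennreal (\<bar>sF z\<bar>\<^sup>2 * (\<bar>sF z\<bar> + \<bar>sv z\<bar>) ^ 3 * \<bar>svt z\<bar>) \<partial>lborel)"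
      by (rule nn_integral_cmult) measurable
    also have "\<dots> \<le> ennreal (26 * A) * ennreal P" by (intro mult_left_mono P) simp
    also have "\<dots> = ennreal (26 * A * P)" using A(2) P(1) by (subst ennreal_mult) auto
    finally show ?thesis using A(2) P(1) by (simp add: ennreal_le_iff)
  qed
  have E: "(LINT z|lborel. \<psi> z * (svt z * sG z)) \<le> (LINT z|lborel. dcut z * edens z)"
    using weighted_energy by (simp add: dcut_def)
  \<comment> \<open>Pure arithmetic: \<open>split\<close> and the product rules express the v^6
    integral through the bounded terms, and multiplication by 6 clears the factor 1/6.\<close>
  have combine: "c6 \<le> 6 * p1 + 6 * p2 + 6 * p3 + 6 * \<bar>cf\<bar> + 6 * \<bar>x\<bar>"
    if "i \<le> d1" "i = i5 + 5 * i4 + ir" "6 * i5 = c6 - d6" "5 * i4 = cf - df - x"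
      "d1 + 1/6 * d6 \<le> p1" "\<bar>df\<bar> \<le> p2" "\<bar>ir\<bar> \<le> p3"
    for i i4 i5 ir d1 d6 df c6 cf x p1 p2 p3 :: real
    using that by (simp add: abs_le_iff) linarith
  show ?thesis
    unfolding distrib_left by (rule combine[OF E split B1 B2 e1' e2 e3])
qed

end

section \<open>Tail integrals and cutoffs\<close>

definition tail :: "(real \<Rightarrow> real) \<Rightarrow> real \<Rightarrow> real" where
  "tail f s = (LINT \<tau>:{s..}|lborel. f \<tau>)"

lemma tail_eq: "tail f s = (LINT \<tau>|lborel. indicator {s..} \<tau> * f \<tau>)"
  by (simp add: tail_def set_lebesgue_integral_def)

lemma integrable_indicator_times:
  assumes "integrable lborel (f :: real \<Rightarrow> real)" "A \<in> sets borel"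
  shows "integrable lborel (\<lambda>\<tau>. indicator A \<tau> * f \<tau>)"
  using integrable_mult_indicator[OF _ assms(1), of A] assms(2) by simp

lemma tail_nonneg: "(\<And>\<tau>. 0 \<le> f \<tau>) \<Longrightarrow> 0 \<le> tail f s"
  unfolding tail_eq by (intro Bochner_Integration.integral_nonneg) (simp add: indicator_def)

lemma tail_le:
  assumes "integrable lborel f" "integrable lborel g" "\<And>\<tau>. \<tau> \<ge> s \<Longrightarrow> f \<tau> \<le> g \<tau>"
  shows "tail f s \<le> tail g s"
  unfolding tail_eq
  by (intro integral_mono integrable_indicator_times assms) (use assms(3) in \<open>auto simp: indicator_def\<close>)

lemma tail_antimono:
  assumes "integrable lborel f" "\<And>\<tau>. 0 \<le> f \<tau>" "s \<le> s'"
  shows "tail f s' \<le> tail f s"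
  unfolding tail_eq
  by (intro integral_mono integrable_indicator_times assms) (use assms in \<open>auto simp: indicator_def\<close>)

lemma tail_le_total:
  assumes "integrable lborel f" "\<And>\<tau>. 0 \<le> f \<tau>"
  shows "tail f s \<le> (LINT \<tau>|lborel. f \<tau>)"
  unfolding tail_eq
  by (intro integral_mono integrable_indicator_times assms) (use assms in \<open>auto simp: indicator_def\<close>)

lemma tail_tendsto:
  assumes "\<And>n. fn n \<in> borel_measurable borel" "f \<in> borel_measurable borel" "integrable lborel g"
    and "AE \<tau> in lborel. \<tau> \<ge> s \<longrightarrow> (\<lambda>n. fn n \<tau>) \<longlonglongrightarrow> f \<tau>" "\<And>n \<tau>. \<tau> \<ge> s \<Longrightarrow> \<bar>fn n \<tau>\<bar> \<le> g \<tau>" "\<And>\<tau>. 0 \<le> g \<tau>"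
  shows "(\<lambda>n. tail (fn n) s) \<longlonglongrightarrow> tail f s"
  unfolding tail_eq
proof (rule integral_dominated_convergence[OF _ _ assms(3)])
  show "AE \<tau> in lborel. (\<lambda>n. indicator {s..} \<tau> * fn n \<tau>) \<longlonglongrightarrow> indicator {s..} \<tau> * f \<tau>"
    using assms(4) by eventually_elim (auto simp: indicator_def)
  show "AE \<tau> in lborel. norm (indicator {s..} \<tau> * fn n \<tau>) \<le> g \<tau>" for n
    using assms(5,6) by (intro AE_I2) (auto simp: indicator_def)
qed (use assms(1,2) in measurable)

text \<open>Dominated convergence: the indicators of the half-lines converge except possibly at the
  single point \<open>s\<close>.\<close>

lemma continuous_tail:
  assumes f: "integrable lborel f"
  shows "continuous_on UNIV (tail f)"
proof -
  have [measurable]: "f \<in> borel_measurable borel" using f by auto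
  have "(\<lambda>n. tail f (X n)) \<longlonglongrightarrow> tail f s" if X: "X \<longlonglongrightarrow> s" for X s
    unfolding tail_eq
  proof (rule integral_dominated_convergence)
    show "integrable lborel (\<lambda>\<tau>. \<bar>f \<tau>\<bar>)" using f by (rule integrable_abs)
    show "AE \<tau> in lborel. norm (indicator {X n..} \<tau> * f \<tau>) \<le> \<bar>f \<tau>\<bar>" for n
      by (intro AE_I2) (auto simp: indicator_def)
    have "AE \<tau> in lborel. \<tau> \<noteq> s" by (rule AE_lborel_singleton)
    then show "AE \<tau> in lborel. (\<lambda>n. indicator {X n..} \<tau> * f \<tau>) \<longlonglongrightarrow> indicator {s..} \<tau> * f \<tau>"
    proof eventually_elim
      case (elim \<tau>)
      have "eventually (\<lambda>n. indicator {X n..} \<tau> * f \<tau> = indicator {s..} \<tau> * f \<tau>) sequentially"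
      proof (cases "\<tau> < s")
        case True
        from order_tendstoD(1)[OF X this] show ?thesis
          by eventually_elim (use True in \<open>auto simp: indicator_def\<close>)
      next
        case False
        then have "s < \<tau>" using elim by simp
        from order_tendstoD(2)[OF X this] show ?thesis
          by eventually_elim (use \<open>s < \<tau>\<close> in \<open>auto simp: indicator_def\<close>)
      qed
      then show ?case by (rule tendsto_eventually)
    qed
  qed measurable
  then show ?thesis by (auto simp: continuous_on_sequentially o_def)
qed

lemma tail_tendsto_0:
  assumes f: "integrable lborel f"
  shows "(\<lambda>n. tail f (real n)) \<longlonglongrightarrow> 0"
proof -
  have [measurable]: "f \<in> borel_measurable borel" using f by auto
  have "(\<lambda>n. tail f (real n)) \<longlonglongrightarrow> (LINT \<tau>|(lborel :: real measure). 0)"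
    unfolding tail_eq
  proof (rule integral_dominated_convergence)
    show "integrable lborel (\<lambda>\<tau>. \<bar>f \<tau>\<bar>)" using f by (rule integrable_abs)
    show "AE \<tau> in lborel. norm (indicator {real n..} \<tau> * f \<tau>) \<le> \<bar>f \<tau>\<bar>" for n
      by (intro AE_I2) (auto simp: indicator_def)
    show "AE \<tau> in lborel. (\<lambda>n. indicator {real n..} \<tau> * f \<tau>) \<longlonglongrightarrow> 0"
    proof (rule AE_I2)
      fix \<tau>
      obtain N where "\<tau> < real N" using reals_Archimedean2 by blast
      then have "eventually (\<lambda>n. indicator {real n..} \<tau> * f \<tau> = 0) sequentially"
        unfolding eventually_sequentially by (intro exI[of _ N]) (auto simp: indicator_def)
      then show "(\<lambda>n. indicator {real n..} \<tau> * f \<tau>) \<longlonglongrightarrow> 0" by (rule tendsto_eventually)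
    qed
  qed measurable
  then show ?thesis by simp
qed

text \<open>As \<open>f\<close> vanishes left of \<open>l\<close>, the tail is the total integral
  minus an integral over a compact interval, to which the fundamental theorem applies.\<close>

lemma tail_derivative:
  assumes f: "continuous_on UNIV f" "integrable lborel f" "\<And>\<tau>. \<tau> \<le> l \<Longrightarrow> f \<tau> = 0"
  shows "(tail f has_real_derivative - f s) (at s)"
proof -
  define c where "c = min l s - 1"
  define d where "d = s + 1"
  have eq: "tail f u = (LINT \<tau>|lborel. f \<tau>) - integral {c..u} f" if u: "u \<in> {c<..<d}" for u
  proof -
    have "set_integrable lborel {c..u} f"
      unfolding set_integrable_def using integrable_indicator_times[OF f(2)] by simp
    from set_borel_integral_eq_integral(2)[OF this]
    have 1: "integral {c..u} f = (LINT \<tau>|lborel. indicator {c..u} \<tau> * f \<tau>)"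
      by (simp add: set_lebesgue_integral_def)
    have "(LINT \<tau>|lborel. f \<tau>) = (LINT \<tau>|lborel. indicator {c..u} \<tau> * f \<tau> + indicator {u..} \<tau> * f \<tau>)"
    proof (rule integral_cong_AE)
      have "AE \<tau> in lborel. \<tau> \<noteq> u" by (rule AE_lborel_singleton)
      then show "AE \<tau> in lborel. f \<tau> = indicator {c..u} \<tau> * f \<tau> + indicator {u..} \<tau> * f \<tau>"
        by eventually_elim (use u f(3) in \<open>auto simp: indicator_def c_def\<close>)
    qed (use f(2) in measurable)
    then show ?thesis
      unfolding tail_eq 1 using integrable_indicator_times[OF f(2)] by simp
  qed
  have "((\<lambda>u. integral {c..u} f) has_real_derivative f s) (at s within {c..d})"
    using f(1) by (intro integral_has_real_derivative) (auto intro: continuous_on_subset simp: c_def d_def)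
  moreover have "at s within {c..d} = at s"
    by (rule at_within_interior) (auto simp: c_def d_def)
  ultimately have "((\<lambda>u. integral {c..u} f) has_real_derivative f s) (at s)" by simp
  then have "((\<lambda>u. (LINT \<tau>|lborel. f \<tau>) - integral {c..u} f) has_real_derivative - f s) (at s)"
    by (auto intro!: derivative_eq_intros)
  then show ?thesis
    by (rule has_field_derivative_transform_within_open[where S = "{c<..<d}"])
       (use eq in \<open>auto simp: c_def d_def\<close>)
qed

text \<open>For fixed x the map from t to t + |x| is a translation, so by Tonelli's theorem the
  preimage of a null set is a null set.\<close>

lemma AE_cone:
  assumes "AE \<tau> in lborel. P \<tau>"
  shows "AE z in (lborel :: spacetime measure). P (fst z + norm (snd z))"
proof -
  obtain N where N: "N \<in> null_sets lborel" "{\<tau>. \<not> P \<tau>} \<subseteq> N"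
  proof -
    obtain N where "\<And>\<tau>. \<tau> \<in> space lborel - N \<Longrightarrow> P \<tau>" "N \<in> null_sets lborel"
      using AE_E3[OF assms] by blast
    then show ?thesis using that by auto
  qed
  then have [measurable]: "N \<in> sets borel" by auto
  have "AE \<tau> in lborel. \<tau> \<notin> N" using N(1) by (rule AE_not_in)
  have "(\<integral>\<^sup>+z. indicator N (fst z + norm (snd z)) \<partial>(lborel :: spacetime measure))
      = (\<integral>\<^sup>+z. indicator N (fst z + norm (snd z)) \<partial>(lborel \<Otimes>\<^sub>M lborel :: spacetime measure))"
    by (simp add: lborel_prod)
  also have "\<dots> = (\<integral>\<^sup>+x. (\<integral>\<^sup>+t. indicator N (t + norm x) \<partial>lborel) \<partial>(lborel :: R3 measure))"
    by (subst lborel_pair.nn_integral_snd[symmetric]) auto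
  also have "\<dots> = (\<integral>\<^sup>+x. 0 \<partial>(lborel :: R3 measure))"
  proof (rule nn_integral_cong)
    fix x :: R3
    have "(\<integral>\<^sup>+t. indicator N (t + norm x) \<partial>lborel) = (\<integral>\<^sup>+t. indicator N t \<partial>lborel)"
      using nn_integral_lborel_shift[of "indicator N" "norm x"] by (simp add: add.commute)
    then show "(\<integral>\<^sup>+t. indicator N (t + norm x) \<partial>lborel) = 0"
      using N(1) by (simp add: null_sets_def)
  qed
  finally have 0: "(\<integral>\<^sup>+z. indicator N (fst z + norm (snd z)) \<partial>(lborel :: spacetime measure)) = 0" by simp
  have m: "(\<lambda>z::spacetime. indicator N (fst z + norm (snd z)) :: ennreal) \<in> borel_measurable lborel"
  proof -
    have [measurable]: "(\<lambda>z::spacetime. fst z + norm (snd z)) \<in> borel_measurable borel"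
      by (intro borel_measurable_continuous_onI continuous_intros)
    show ?thesis by measurable
  qed
  have "AE z in (lborel :: spacetime measure). indicator N (fst z + norm (snd z)) = (0::ennreal)"
    using 0 nn_integral_0_iff_AE[OF m] by simp
  then show ?thesis
    by eventually_elim (use N(2) in \<open>auto simp: indicator_def split: if_splits\<close>)
qed

section \<open>Time cutoffs of class C^1 with explicit bounds\<close>

definition pos2 :: "real \<Rightarrow> real" where "pos2 r = (max 0 r)\<^sup>2"

lemma pos2_derivative: "(pos2 has_real_derivative 2 * max 0 r) (at r)"
proof -
  consider "r > 0" | "r < 0" | "r = 0" by linarith
  then show ?thesis
  proof cases
    case 1
    have "((\<lambda>r. r\<^sup>2) has_real_derivative 2 * max 0 r) (at r)"
      using 1 by (auto intro!: derivative_eq_intros)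
    then show ?thesis
      by (rule has_field_derivative_transform_within_open[where S = "{0<..}"])
         (use 1 in \<open>auto simp: pos2_def\<close>)
  next
    case 2
    have "((\<lambda>r. 0) has_real_derivative 2 * max 0 r) (at r)" using 2 by simp
    then show ?thesis
      by (rule has_field_derivative_transform_within_open[where S = "{..<0}"])
         (use 2 in \<open>auto simp: pos2_def\<close>)
  next
    case 3
    have "((\<lambda>h. (pos2 (0 + h) - pos2 0) / h) \<longlongrightarrow> max 0 0) (at 0)"
    proof (rule Lim_transform_eventually)
      show "((\<lambda>h::real. max 0 h) \<longlongrightarrow> max 0 0) (at 0)" by (intro tendsto_intros)
      show "\<forall>\<^sub>F h in at 0. max 0 h = (pos2 (0 + h) - pos2 0) / h"
        by (auto simp: eventually_at_filter pos2_def max_def power2_eq_square)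
    qed
    then show ?thesis using 3 by (simp add: DERIV_def)
  qed
qed

text \<open>A quadratic spline: 2 r^2 up to r = 1/2, then 1 - 2 (1 - r)^2 up to r = 1. It is C^1
  with slope at most 2, as much regularity as \<open>cone_weight\<close> asks for.\<close>

definition ramp :: "real \<Rightarrow> real" where
  "ramp r = 2 * pos2 r - 4 * pos2 (r - 1/2) + 2 * pos2 (r - 1)"

definition ramp' :: "real \<Rightarrow> real" where
  "ramp' r = 4 * max 0 r - 8 * max 0 (r - 1/2) + 4 * max 0 (r - 1)"

lemma ramp_derivative: "(ramp has_real_derivative ramp' r) (at r)"
proof -
  have "((\<lambda>r. pos2 (r - c)) has_real_derivative 2 * max 0 (r - c)) (at r)" for c
    by (rule DERIV_chain'[where g = pos2, OF _ pos2_derivative, THEN DERIV_cong])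
       (auto intro!: derivative_eq_intros)
  from this[of 0] this[of "1/2"] this[of 1] show ?thesis
    unfolding ramp_def[abs_def] ramp'_def
    by (auto intro!: derivative_eq_intros)
qed

lemma ramp_facts:
  "r \<le> 0 \<Longrightarrow> ramp r = 0" "r \<ge> 1 \<Longrightarrow> ramp r = 1" "0 \<le> ramp r" "ramp r \<le> 1"
  "\<bar>ramp' r\<bar> \<le> 2" "r \<notin> {0..1} \<Longrightarrow> ramp' r = 0"
proof -
  show 0: "ramp r = 0" if "r \<le> 0" using that by (simp add: ramp_def pos2_def)
  show 1: "ramp r = 1" if "r \<ge> 1"
    using that by (simp add: ramp_def pos2_def max_def power2_eq_square algebra_simps)
  have half: "ramp r = 2 * r\<^sup>2" if "0 \<le> r" "r \<le> 1/2" using that by (simp add: ramp_def pos2_def max_def)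
  have half': "ramp r = 1 - 2 * (1 - r)\<^sup>2" if "1/2 \<le> r" "r \<le> 1"
    using that by (simp add: ramp_def pos2_def max_def power2_eq_square algebra_simps)
  have sq: "x\<^sup>2 \<le> 1/4" if "0 \<le> x" "x \<le> 1/2" for x :: real
    using power_mono[OF that(2,1), of 2] by (simp add: power2_eq_square)
  consider "r \<le> 0" | "0 \<le> r" "r \<le> 1/2" | "1/2 \<le> r" "r \<le> 1" | "r \<ge> 1" by linarith
  then have "0 \<le> ramp r \<and> ramp r \<le> 1"
  proof cases
    case 2 then show ?thesis using half sq[of r] by simp
  next
    case 3 then show ?thesis using half' sq[of "1 - r"] zero_le_power2[of "1 - r"] by simp
  qed (use 0 1 in auto)
  then show "0 \<le> ramp r" "ramp r \<le> 1" by auto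
  show "\<bar>ramp' r\<bar> \<le> 2" "r \<notin> {0..1} \<Longrightarrow> ramp' r = 0"
    by (auto simp: ramp'_def max_def)
qed

text \<open>The shift by 1 keeps a margin \<open>h\<close> at both ends, so that the support lies
  strictly inside the interval; the plateau begins at distance \<open>2 * h\<close> from the
  ends.\<close>

definition cutoff :: "real \<Rightarrow> real \<Rightarrow> real \<Rightarrow> real \<Rightarrow> real" where
  "cutoff a b h t = ramp ((t - a) / h - 1) * ramp ((b - t) / h - 1)"

definition cutoff' :: "real \<Rightarrow> real \<Rightarrow> real \<Rightarrow> real \<Rightarrow> real" where
  "cutoff' a b h t = ramp' ((t - a) / h - 1) / h * ramp ((b - t) / h - 1)
    - ramp' ((b - t) / h - 1) / h * ramp ((t - a) / h - 1)"

lemma cutoff_facts: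
  assumes "h > 0"
  shows "(cutoff a b h has_real_derivative cutoff' a b h t) (at t)"
    "continuous_on UNIV (cutoff' a b h)"
    "t \<notin> {a + h..b - h} \<Longrightarrow> cutoff a b h t = 0"
    "0 \<le> cutoff a b h t" "cutoff a b h t \<le> 1"
    "(\<integral>\<^sup>+t. ennreal \<bar>cutoff' a b h t\<bar> \<partial>lborel) \<le> 4"
    "t \<in> {a + 2 * h..b - 2 * h} \<Longrightarrow> cutoff a b h t = 1"
proof -
  have "((\<lambda>t. ramp ((t - a) / h - 1)) has_real_derivative ramp' ((t - a) / h - 1) * (1 / h)) (at t)" for t
    by (rule DERIV_chain'[where g = ramp, OF _ ramp_derivative, THEN DERIV_cong])
       (use assms in \<open>auto intro!: derivative_eq_intros\<close>)
  moreover have "((\<lambda>t. ramp ((b - t) / h - 1)) has_real_derivative ramp' ((b - t) / h - 1) * (- 1 / h)) (at t)" for t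
    by (rule DERIV_chain'[where g = ramp, OF _ ramp_derivative, THEN DERIV_cong])
       (use assms in \<open>auto intro!: derivative_eq_intros\<close>)
  ultimately show "(cutoff a b h has_real_derivative cutoff' a b h t) (at t)"
    unfolding cutoff_def[abs_def] cutoff'_def
    by (intro DERIV_mult[THEN DERIV_cong]) (auto simp: divide_inverse)
  have "continuous_on UNIV ramp'" unfolding ramp'_def[abs_def] by (intro continuous_intros)
  moreover have "continuous_on UNIV ramp"
    using ramp_derivative by (meson DERIV_continuous continuous_at_imp_continuous_on)
  ultimately have c: "continuous_on UNIV (\<lambda>t. ramp (g t))" "continuous_on UNIV (\<lambda>t. ramp' (g t))"
    if "continuous_on UNIV g" for g :: "real \<Rightarrow> real"
    by (auto intro!: continuous_on_compose2[OF _ that, of UNIV])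
  have "continuous_on UNIV (\<lambda>t. (t - a) / h - 1)" "continuous_on UNIV (\<lambda>t. (b - t) / h - 1)"
    using assms by (auto intro!: continuous_intros)
  note c[OF this(1)] c[OF this(2)]
  then show "continuous_on UNIV (cutoff' a b h)"
    unfolding cutoff'_def[abs_def] using assms
    by (intro continuous_on_diff continuous_on_mult continuous_on_divide continuous_on_const) auto
  show "cutoff a b h t = 0" if "t \<notin> {a + h..b - h}"
  proof -
    have "(t - a) / h - 1 \<le> 0 \<or> (b - t) / h - 1 \<le> 0"
      using that assms by (auto simp: field_simps)
    then show ?thesis unfolding cutoff_def using ramp_facts(1) by auto
  qed
  show "0 \<le> cutoff a b h t" "cutoff a b h t \<le> 1"
    unfolding cutoff_def using ramp_facts(3,4) by (auto intro: mult_le_one)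
  show "cutoff a b h t = 1" if "t \<in> {a + 2 * h..b - 2 * h}"
    using that assms unfolding cutoff_def by (subst (1 2) ramp_facts(2)) (auto simp: field_simps)
  have "(\<integral>\<^sup>+t. ennreal \<bar>cutoff' a b h t\<bar> \<partial>lborel)
      \<le> (\<integral>\<^sup>+t. ennreal (2 / h) * indicator {a + h..a + 2 * h} t + ennreal (2 / h) * indicator {b - 2 * h..b - h} t \<partial>lborel)"
  proof (rule nn_integral_mono)
    fix t
    \<comment> \<open>Each ramp has slope at most 2/h over a length \<open>h\<close> and so
      contributes 2 to the total of 4.\<close>
    have "\<bar>ramp' r / h * ramp r'\<bar> \<le> 2 / h * indicator {0..1} r" for r r'
    proof (cases "r \<in> {0..1}")
      case True
      have "\<bar>ramp' r / h * ramp r'\<bar> \<le> 2 / h * 1"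
        unfolding abs_mult using ramp_facts(3,4)[of r'] ramp_facts(5)[of r] assms
        by (intro mult_mono) (auto simp: divide_right_mono)
      then show ?thesis using True by simp
    qed (simp add: ramp_facts(6))
    from this[of "(t - a) / h - 1" "(b - t) / h - 1"] this[of "(b - t) / h - 1" "(t - a) / h - 1"]
    have "\<bar>cutoff' a b h t\<bar> \<le> 2 / h * indicator {0..1} ((t - a) / h - 1) + 2 / h * indicator {0..1} ((b - t) / h - 1)"
      unfolding cutoff'_def by linarith
    also have "indicator {0..1} ((t - a) / h - 1) = (indicator {a + h..a + 2 * h} t :: real)"
      using assms by (auto simp: indicator_def field_simps)
    also have "indicator {0..1} ((b - t) / h - 1) = (indicator {b - 2 * h..b - h} t :: real)"
      using assms by (auto simp: indicator_def field_simps)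
    finally have "ennreal \<bar>cutoff' a b h t\<bar> \<le> ennreal (2 / h * indicator {a + h..a + 2 * h} t + 2 / h * indicator {b - 2 * h..b - h} t)"
      by (rule ennreal_leI)
    also have "\<dots> = ennreal (2 / h) * indicator {a + h..a + 2 * h} t + ennreal (2 / h) * indicator {b - 2 * h..b - h} t"
      using assms
      by (cases "t \<in> {a + h..a + 2 * h}"; cases "t \<in> {b - 2 * h..b - h}") (simp_all flip: ennreal_plus)
    finally show "ennreal \<bar>cutoff' a b h t\<bar> \<le> \<dots>" .
  qed
  also have "\<dots> = ennreal (2 / h) * ennreal h + ennreal (2 / h) * ennreal h"
    using assms by (simp add: nn_integral_add nn_integral_cmult_indicator)
  also have "\<dots> = 4" using assms by (simp flip: ennreal_mult ennreal_plus)
  finally show "(\<integral>\<^sup>+t. ennreal \<bar>cutoff' a b h t\<bar> \<partial>lborel) \<le> 4" .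
qed

section \<open>Integrable weights\<close>

text \<open>\<open>q\<close> bounds the slice pairing of v^5 with \<open>F\<close>, and
  \<open>P\<close> bounds the last integral of the estimate. The integrability of the term with
  \<open>Ft\<close> is stated on the open interval, where the weak derivative is specified.\<close>

locale nlw_cone = nlw_data F Ft v vt Dv a b S M
  for F Ft v vt :: "real \<Rightarrow> R3 \<Rightarrow> real" and Dv :: "real \<Rightarrow> R3 \<Rightarrow> R3" and a b S M :: real +
  fixes w :: "real \<Rightarrow> real" and q P :: real
  assumes ab: "0 \<le> a" "a < b"
    and w: "integrable lborel w" "\<And>\<tau>. 0 \<le> w \<tau>"
    and q: "0 \<le> q" "AE t in lborel. (\<integral>\<^sup>+x. ennreal \<bar>sv (t, x) ^ 5 * sF (t, x)\<bar> \<partial>lborel) \<le> ennreal q"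
    and P: "0 \<le> P" "(\<integral>\<^sup>+z. ennreal (\<bar>sF z\<bar>\<^sup>2 * (\<bar>sF z\<bar> + \<bar>sv z\<bar>) ^ 3 * \<bar>svt z\<bar>) \<partial>lborel) \<le> ennreal P"
    and integrable_tail_Ft: "integrable lborel (\<lambda>z. tail w (fst z + norm (snd z)) * (sv z ^ 5 * res ({a<..<b} \<times> UNIV) Ft z))"
    and integrable_w_F: "integrable lborel (\<lambda>z. w (fst z + norm (snd z)) * (sv z ^ 5 * sF z))"
begin

definition sFt where "sFt = res ({a<..<b} \<times> UNIV) Ft"

text \<open>\<open>Ft\<close> is only locally integrable on the open strip, so its measurability
  comes from an exhaustion by compact sets.\<close>

lemma borel_sFt [measurable]: "sFt \<in> borel_measurable borel"
proof -
  define K where "K n = {a + inverse (real (Suc n))..b - inverse (real (Suc n))} \<times> cball (0::R3) (real n)" for n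
  have K: "compact (K n)" "K n \<subseteq> {a<..<b} \<times> UNIV" for n
  proof -
    show "compact (K n)" unfolding K_def by (intro compact_Times) auto
    have "{a + i..b - i} \<subseteq> {a<..<b}" if "0 < i" for i using that by auto
    from this[of "inverse (real (Suc n))"] show "K n \<subseteq> {a<..<b} \<times> UNIV"
      unfolding K_def by (intro Sigma_mono) auto
  qed
  show ?thesis
  proof (rule borel_measurable_LIMSEQ_real)
    show "res (K n) Ft \<in> borel_measurable borel" for n
      using integrable_res[OF _ K, of Ft n] Ft by (auto simp: weak_time_derivative_def)
    fix z :: spacetime
    show "(\<lambda>n. res (K n) Ft z) \<longlonglongrightarrow> sFt z"
    proof (cases "z \<in> {a<..<b} \<times> UNIV")
      case True
      obtain N where N: "norm (snd z) \<le> real N" using real_arch_simple by blast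
      from True have "0 < min (fst z - a) (b - fst z)" by auto
      with LIMSEQ_inverse_real_of_nat have "\<forall>\<^sub>F n in sequentially. inverse (real (Suc n)) < min (fst z - a) (b - fst z)"
        by (rule order_tendstoD)
      moreover have "\<forall>\<^sub>F n in sequentially. N \<le> n" by (rule eventually_ge_at_top)
      ultimately have "\<forall>\<^sub>F n in sequentially. z \<in> K n"
      proof eventually_elim
        case (elim n)
        then have "norm (snd z) \<le> real n" using N by linarith
        then show ?case using elim by (cases z) (auto simp: K_def simp del: of_nat_Suc)
      qed
      then have "\<forall>\<^sub>F n in sequentially. res (K n) Ft z = sFt z"
        by eventually_elim (use True in \<open>auto simp: res_def sFt_def\<close>)
      then show ?thesis by (rule tendsto_eventually)
    next
      case False
      then have "z \<notin> K n" for n using K(2) by blast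
      then have "res (K n) Ft z = sFt z" for n using False by (simp add: res_def sFt_def)
      then show ?thesis by simp
    qed
  qed
qed

lemma borel_fst_snd [measurable]:
  "(fst :: spacetime \<Rightarrow> real) \<in> borel_measurable borel" "(snd :: spacetime \<Rightarrow> R3) \<in> borel_measurable borel"
  by (intro borel_measurable_continuous_onI continuous_intros)+

definition Q where "Q = 4 * S + 4 * q + 26 * P"

lemma Q_nonneg: "0 \<le> Q"
  using energy_le(2) q(1) P(1) by (simp add: Q_def)

text \<open>The two weights and the mass are parameters, so that one inequality can be carried
  through successive limits. The left side is an extended integral, ready for Fatou's lemma.\<close>

definition estimate :: "(spacetime \<Rightarrow> real) \<Rightarrow> (spacetime \<Rightarrow> real) \<Rightarrow> real \<Rightarrow> bool" where
  "estimate c d \<alpha> \<longleftrightarrow> (\<integral>\<^sup>+z. ennreal (c z * \<bar>sv z\<bar> ^ 6) \<partial>lborel)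
    \<le> ennreal (6 * (\<alpha> * Q + \<bar>LINT z|lborel. c z * (sv z ^ 5 * sF z)\<bar> + \<bar>LINT z|lborel. d z * (sv z ^ 5 * sFt z)\<bar>))"

lemma estimate_mono: "estimate c d \<alpha> \<Longrightarrow> \<alpha> \<le> \<alpha>' \<Longrightarrow> estimate c d \<alpha>'"
  unfolding estimate_def
  by (erule order_trans) (auto intro!: ennreal_leI mult_right_mono Q_nonneg)

text \<open>Fatou's lemma on the left, dominated convergence for both signed integrals on the
  right.\<close>

lemma estimate_limit:
  assumes est: "\<And>n::nat. estimate (cn n) (dn n) (\<alpha>n n)"
    and [measurable]: "\<And>n. cn n \<in> borel_measurable borel" "\<And>n. dn n \<in> borel_measurable borel"
      "c \<in> borel_measurable borel" "d \<in> borel_measurable borel"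
    and lim: "AE z in (lborel :: spacetime measure). (\<lambda>n. cn n z) \<longlonglongrightarrow> c z" "AE z in (lborel :: spacetime measure). (\<lambda>n. dn n z) \<longlonglongrightarrow> d z" "\<alpha>n \<longlonglongrightarrow> \<alpha>"
    and dom: "\<And>n z. \<bar>cn n z * (sv z ^ 5 * sF z)\<bar> \<le> Da z" "integrable lborel Da"
      "\<And>n z. \<bar>dn n z * (sv z ^ 5 * sFt z)\<bar> \<le> Db z" "integrable lborel Db"
  shows "estimate c d \<alpha>"
proof -
  let ?r = "\<lambda>c d \<alpha>. 6 * (\<alpha> * Q + \<bar>LINT z|lborel. c z * (sv z ^ 5 * sF z)\<bar> + \<bar>LINT z|lborel. d z * (sv z ^ 5 * sFt z)\<bar>)"
  have l1: "(\<lambda>n. LINT z|lborel. cn n z * (sv z ^ 5 * sF z)) \<longlonglongrightarrow> (LINT z|lborel. c z * (sv z ^ 5 * sF z))"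
  proof (rule integral_dominated_convergence[OF _ _ dom(2)])
    show "AE z in (lborel :: spacetime measure). (\<lambda>n. cn n z * (sv z ^ 5 * sF z)) \<longlonglongrightarrow> c z * (sv z ^ 5 * sF z)"
      using lim(1) by eventually_elim (intro tendsto_intros)
  qed (use dom(1) in auto)
  have l2: "(\<lambda>n. LINT z|lborel. dn n z * (sv z ^ 5 * sFt z)) \<longlonglongrightarrow> (LINT z|lborel. d z * (sv z ^ 5 * sFt z))"
  proof (rule integral_dominated_convergence[OF _ _ dom(4)])
    show "AE z in (lborel :: spacetime measure). (\<lambda>n. dn n z * (sv z ^ 5 * sFt z)) \<longlonglongrightarrow> d z * (sv z ^ 5 * sFt z)"
      using lim(2) by eventually_elim (intro tendsto_intros)
  qed (use dom(3) in auto)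
  have r: "(\<lambda>n. ennreal (?r (cn n) (dn n) (\<alpha>n n))) \<longlonglongrightarrow> ennreal (?r c d \<alpha>)"
    by (intro tendsto_ennrealI tendsto_intros l1 l2 lim(3))
  have "(\<integral>\<^sup>+z. ennreal (c z * \<bar>sv z\<bar> ^ 6) \<partial>lborel)
      = (\<integral>\<^sup>+z. liminf (\<lambda>n. ennreal (cn n z * \<bar>sv z\<bar> ^ 6)) \<partial>lborel)"
  proof (rule nn_integral_cong_AE)
    show "AE z in (lborel :: spacetime measure). ennreal (c z * \<bar>sv z\<bar> ^ 6) = liminf (\<lambda>n. ennreal (cn n z * \<bar>sv z\<bar> ^ 6))"
      using lim(1)
    proof eventually_elim
      case (elim z)
      then have "(\<lambda>n. ennreal (cn n z * \<bar>sv z\<bar> ^ 6)) \<longlonglongrightarrow> ennreal (c z * \<bar>sv z\<bar> ^ 6)"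
        by (intro tendsto_ennrealI tendsto_intros)
      then show ?case using lim_imp_Liminf[OF sequentially_bot] by metis
    qed
  qed
  also have "\<dots> \<le> liminf (\<lambda>n. \<integral>\<^sup>+z. ennreal (cn n z * \<bar>sv z\<bar> ^ 6) \<partial>lborel)"
    by (rule nn_integral_liminf) measurable
  also have "\<dots> \<le> liminf (\<lambda>n. ennreal (?r (cn n) (dn n) (\<alpha>n n)))"
    using est unfolding estimate_def by (intro Liminf_mono always_eventually) auto
  also have "\<dots> = ennreal (?r c d \<alpha>)"
    using lim_imp_Liminf[OF sequentially_bot r] .
  finally show ?thesis unfolding estimate_def .
qed

text \<open>A continuous weight supported in [-1, T] has a C^1 tail that vanishes beyond
  \<open>T\<close>, as the cone weight demands. Its total mass bounds the tail and becomes the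
  factor in front of \<open>Q\<close>.\<close>

lemma estimate_smooth:
  assumes h: "0 < h" "4 * h \<le> b - a"
    and w': "continuous_on UNIV w'" "\<And>\<tau>. 0 \<le> w' \<tau>" "\<And>\<tau>. w' \<tau> \<le> B" "\<And>\<tau>. \<tau> \<le> -1 \<Longrightarrow> w' \<tau> = 0" "\<And>\<tau>. \<tau> \<ge> T \<Longrightarrow> w' \<tau> = 0"
    and int: "integrable lborel (\<lambda>z. tail w' (fst z + norm (snd z)) * (sv z ^ 5 * sFt z))"
  shows "estimate (\<lambda>z. cutoff a b h (fst z) * w' (fst z + norm (snd z)))
    (\<lambda>z. cutoff a b h (fst z) * tail w' (fst z + norm (snd z))) (LINT \<tau>|lborel. w' \<tau>)"
proof -
  note cf = cutoff_facts[OF h(1), where a = a and b = b]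
  have iw: "integrable lborel w'"
    by (rule integrable_continuous_compact_support[OF w'(1) compact_Icc[of "-1" T]]) (use w'(4,5) in force)
  interpret nw: nlw_weight F Ft v vt Dv a b S M "cutoff a b h" "cutoff' a b h" "tail w'" w' "a + h" "b - h" T B
  proof
    show "tail w' s = 0" if "s \<ge> T" for s
    proof -
      have "(\<lambda>\<tau>. indicator {s..} \<tau> * w' \<tau>) = (\<lambda>\<tau>. 0)" using that w'(5) by (auto simp: indicator_def fun_eq_iff)
      then show ?thesis by (simp add: tail_eq)
    qed
    show "cutoff a b h t = 0" if "t \<notin> {a + h..b - h}" for t by (rule cf(3)[OF that])
  qed (use cf(1,2,4,5) w' h tail_derivative[OF w'(1) iw w'(4)] in auto)
  let ?A = "LINT \<tau>|lborel. w' \<tau>"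
  have same: "nw.\<psi> z * (sv z ^ 5 * res nw.K Ft z) = cutoff a b h (fst z) * tail w' (fst z + norm (snd z)) * (sv z ^ 5 * sFt z)" for z
  proof (cases "z \<in> nw.K0")
    case True
    then have "res nw.K Ft z = sFt z"
      using nw.K_facts(2,4) by (auto simp: res_def sFt_def indicator_def)
    then show ?thesis by (simp add: nw.\<psi>_def)
  qed (use nw.outside_K0(1)[of z] in \<open>simp add: nw.\<psi>_def\<close>)
  have m: "(\<lambda>z::spacetime. cutoff a b h (fst z)) \<in> borel_measurable borel"
    using nw.borel_weights(1) by measurable
  have "(LINT z|lborel. nw.cutw z * \<bar>sv z\<bar> ^ 6) \<le> 6 * (4 * ?A * S + 4 * ?A * q + 26 * ?A * P
    + \<bar>LINT z|lborel. nw.cutw z * (sv z ^ 5 * sF z)\<bar> + \<bar>LINT z|lborel. nw.\<psi> z * (sv z ^ 5 * res nw.K Ft z)\<bar>)"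
  proof (rule nw.weighted_estimate[OF _ _ cf(6) q P])
    show "0 \<le> tail w' s \<and> tail w' s \<le> ?A" for s
      using tail_nonneg[of w'] tail_le_total[OF iw] w'(2) by simp
    show "0 \<le> ?A" using w'(2) by (intro Bochner_Integration.integral_nonneg) simp
    show "integrable lborel (\<lambda>z. nw.\<psi> z * (sv z ^ 5 * res nw.K Ft z))"
      unfolding same mult.assoc
      by (rule integrable_bounded_mult[OF int, where B = 1]) (use m cf(4,5) in auto)
  qed
  then have le: "(LINT z|lborel. nw.cutw z * \<bar>sv z\<bar> ^ 6) \<le> 6 * (?A * Q
    + \<bar>LINT z|lborel. nw.cutw z * (sv z ^ 5 * sF z)\<bar> + \<bar>LINT z|lborel. nw.\<psi> z * (sv z ^ 5 * res nw.K Ft z)\<bar>)"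
    by (simp add: Q_def algebra_simps)
  have "(\<integral>\<^sup>+z. ennreal (nw.cutw z * \<bar>sv z\<bar> ^ 6) \<partial>lborel) = ennreal (LINT z|lborel. nw.cutw z * \<bar>sv z\<bar> ^ 6)"
    by (rule nn_integral_eq_integral[OF nw.integrable_dcut_cutw(2)[OF integrable_sv6]])
       (use nw.cutw_bounds(1) in auto)
  with ennreal_leI[OF le] show ?thesis
    unfolding estimate_def same nw.cutw_def[symmetric] by simp
qed

text \<open>Since 0 <= a, only arguments t + |x| >= 0 matter, where this is 1. The ramp on [-1, 0]
  ends the support on the left without a jump.\<close>

definition left_cut :: "real \<Rightarrow> real" where "left_cut \<tau> = max 0 (min 1 (\<tau> + 1))"

text \<open>Keeping only points where the tail of \<open>w\<close> exceeds 1/(m + 1) bounds the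
  support on the right. It also makes the tail of the truncation at most a constant multiple of the
  tail of \<open>w\<close>, which transfers the assumed integrability of the term with
  \<open>Ft\<close>.\<close>

definition wtrunc :: "nat \<Rightarrow> real \<Rightarrow> real" where
  "wtrunc m \<tau> = clip (real m) (w \<tau>) * indicator {\<tau>. tail w \<tau> > inverse (real (Suc m))} \<tau> * left_cut \<tau>"

lemma borel_w [measurable]: "w \<in> borel_measurable borel" "tail w \<in> borel_measurable borel" "left_cut \<in> borel_measurable borel"
proof -
  show "w \<in> borel_measurable borel" using w(1) by auto
  show "tail w \<in> borel_measurable borel" by (rule borel_measurable_continuous_onI[OF continuous_tail[OF w(1)]])
  show "left_cut \<in> borel_measurable borel"
    unfolding left_cut_def[abs_def] by (intro borel_measurable_continuous_onI continuous_intros)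
qed

lemma borel_wtrunc [measurable]: "wtrunc m \<in> borel_measurable borel"
  unfolding wtrunc_def[abs_def] by measurable

lemma wtrunc_bounds: "0 \<le> wtrunc m \<tau>" "wtrunc m \<tau> \<le> w \<tau>"
proof -
  have c: "0 \<le> clip (real m) (w \<tau>)" "clip (real m) (w \<tau>) \<le> w \<tau>"
    using w(2)[of \<tau>] by (auto simp: clip_def)
  have l: "0 \<le> left_cut \<tau>" "left_cut \<tau> \<le> 1" by (auto simp: left_cut_def)
  show "0 \<le> wtrunc m \<tau>" unfolding wtrunc_def using c l by (intro mult_nonneg_nonneg) auto
  have "indicator {\<tau>. tail w \<tau> > inverse (real (Suc m))} \<tau> * left_cut \<tau> \<le> 1"
    using l by (simp add: indicator_def)
  then have "clip (real m) (w \<tau>) * (indicator {\<tau>. tail w \<tau> > inverse (real (Suc m))} \<tau> * left_cut \<tau>) \<le> clip (real m) (w \<tau>) * 1"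
    by (intro mult_left_mono c)
  then show "wtrunc m \<tau> \<le> w \<tau>" unfolding wtrunc_def using c by (simp add: mult.assoc)
qed

lemma integrable_wtrunc: "integrable lborel (wtrunc m)"
  by (rule Bochner_Integration.integrable_bound[OF w(1)]) (use wtrunc_bounds w(2) in auto)

text \<open>The truncated weight is an almost everywhere limit of bounded continuous ones:
  continuous approximants replace \<open>w\<close>, and an increasingly steep function of
  \<open>tail w \<tau> - \<delta>\<close> replaces the indicator.\<close>

lemma estimate_truncated:
  assumes h: "0 < h" "4 * h \<le> b - a"
  shows "estimate (\<lambda>z. cutoff a b h (fst z) * wtrunc m (fst z + norm (snd z)))
    (\<lambda>z. cutoff a b h (fst z) * tail (wtrunc m) (fst z + norm (snd z))) (LINT \<tau>|lborel. wtrunc m \<tau>)"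
proof -
  define \<delta> where "\<delta> = inverse (real (Suc m))"
  have "\<delta> > 0" by (simp add: \<delta>_def)
  obtain g where g: "\<And>n::nat. continuous_on UNIV (g n)" "AE \<tau> in lborel. (\<lambda>n. g n \<tau>) \<longlonglongrightarrow> w \<tau>"
    using borel_AE_limit_continuous[OF borel_w(1)] by blast
  define wn where "wn n \<tau> = max 0 (clip (real m) (g n \<tau>)) * min 1 (real n * max 0 (tail w \<tau> - \<delta>)) * left_cut \<tau>" for n \<tau>
  from order_tendstoD(2)[OF tail_tendsto_0[OF w(1)] \<open>\<delta> > 0\<close>]
  obtain N where N: "tail w (real N) < \<delta>" by (auto simp: eventually_sequentially)
  \<comment> \<open>Beyond \<open>T\<close> the tail of \<open>w\<close> is at most \<delta>, so
    every approximating weight vanishes there.\<close>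
  define T where "T = real N"
  have tail_T: "tail w \<tau> \<le> \<delta>" if "\<tau> \<ge> T" for \<tau>
    using tail_antimono[OF w(1,2), of "real N" \<tau>] N that by (simp add: T_def)
  have wn_cont: "continuous_on UNIV (wn n)" for n
    unfolding wn_def[abs_def] left_cut_def
    by (intro continuous_intros continuous_on_compose2[OF continuous_clip g(1)] continuous_tail[OF w(1)]) auto
  have wn_bounds: "0 \<le> wn n \<tau>" "wn n \<tau> \<le> real m" "\<tau> \<le> -1 \<Longrightarrow> wn n \<tau> = 0" "tail w \<tau> \<le> \<delta> \<Longrightarrow> wn n \<tau> = 0" for n \<tau>
  proof -
    show "0 \<le> wn n \<tau>" unfolding wn_def left_cut_def by (intro mult_nonneg_nonneg) auto
    have "wn n \<tau> \<le> real m * 1 * 1"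
      unfolding wn_def left_cut_def using abs_clip_le(1)[of "real m" "g n \<tau>"]
      by (intro mult_mono mult_nonneg_nonneg) auto
    then show "wn n \<tau> \<le> real m" by simp
  qed (auto simp: wn_def left_cut_def)
  have wn_T: "wn n \<tau> = 0" if "\<tau> \<ge> T" for n \<tau> using wn_bounds(4) tail_T[OF that] by blast
  let ?dom = "\<lambda>\<tau>. real m * indicator {-1..T} \<tau>"
  have dom: "integrable lborel ?dom" "\<bar>wn n \<tau>\<bar> \<le> ?dom \<tau>" for n \<tau>
  proof -
    show "integrable lborel ?dom"
      by (intro integrable_mult_right integrable_real_indicator) (auto simp: emeasure_lborel_Icc_eq)
    show "\<bar>wn n \<tau>\<bar> \<le> ?dom \<tau>"
      using wn_bounds[where n = n and \<tau> = \<tau>] wn_T[of \<tau> n] by (cases "\<tau> \<in> {-1..T}") auto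
  qed
  have [measurable]: "wn n \<in> borel_measurable borel" for n by (rule borel_measurable_continuous_onI[OF wn_cont])
  have iwn: "integrable lborel (wn n)" for n
    by (rule Bochner_Integration.integrable_bound[OF dom(1)]) (use dom(2) in \<open>auto intro: order_trans\<close>)
  have lim: "AE \<tau> in lborel. (\<lambda>n. wn n \<tau>) \<longlonglongrightarrow> wtrunc m \<tau>"
    using g(2)
  proof eventually_elim
    case (elim \<tau>)
    have 1: "(\<lambda>n. max 0 (clip (real m) (g n \<tau>))) \<longlonglongrightarrow> max 0 (clip (real m) (w \<tau>))"
      by (intro tendsto_max tendsto_const continuous_on_tendsto_compose[OF continuous_clip elim]) auto
    have 2: "(\<lambda>n. min 1 (real n * max 0 (tail w \<tau> - \<delta>))) \<longlonglongrightarrow> indicator {\<tau>. tail w \<tau> > \<delta>} \<tau>"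
    proof (cases "tail w \<tau> > \<delta>")
      case True
      obtain n0 where n0: "1 \<le> real n0 * (tail w \<tau> - \<delta>)"
        using reals_Archimedean3[of "tail w \<tau> - \<delta>"] True by (metis diff_gt_0_iff_gt less_imp_le)
      have "min 1 (real n * max 0 (tail w \<tau> - \<delta>)) = 1" if "n \<ge> n0" for n
      proof -
        have "real n0 * (tail w \<tau> - \<delta>) \<le> real n * (tail w \<tau> - \<delta>)"
          using that True by (intro mult_right_mono) auto
        then have "1 \<le> real n * (tail w \<tau> - \<delta>)" using n0 by linarith
        then show ?thesis using True by (simp add: max_def min_absorb1 del: right_diff_distrib)
      qed
      then have "\<forall>\<^sub>F n in sequentially. min 1 (real n * max 0 (tail w \<tau> - \<delta>)) = indicator {\<tau>. tail w \<tau> > \<delta>} \<tau>"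
        using True unfolding eventually_sequentially by (intro exI[of _ n0]) simp
      then show ?thesis by (rule tendsto_eventually)
    qed (simp add: max_def)
    have "max 0 (clip (real m) (w \<tau>)) = clip (real m) (w \<tau>)"
      using w(2)[of \<tau>] by (simp add: clip_def)
    then show ?case
      unfolding wn_def wtrunc_def \<delta>_def[symmetric] using tendsto_mult[OF tendsto_mult[OF 1 2] tendsto_const] by simp
  qed
  \<comment> \<open>If the tail of \<open>w\<close> at \<open>s\<close> is at most \<delta>, the
    approximating weight vanishes from \<open>s\<close> on. Otherwise the trivial bound m (T + 1),
    height times the length of [-1, T], may be multiplied by tail / \<delta>, which exceeds
    1.\<close>
  have tail_le_const: "\<bar>tail (wn n) s\<bar> \<le> real m * (T + 1) / \<delta> * tail w s" for n s
  proof (cases "tail w s \<le> \<delta>")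
    case True
    have "(\<lambda>\<tau>. indicator {s..} \<tau> * wn n \<tau>) = (\<lambda>\<tau>. 0)"
    proof
      fix \<tau>
      show "indicator {s..} \<tau> * wn n \<tau> = 0"
        using tail_antimono[OF w(1,2), of s \<tau>] True wn_bounds(4)[of \<tau> n] by (cases "s \<le> \<tau>") auto
    qed
    then have "tail (wn n) s = 0" by (simp add: tail_eq)
    then show ?thesis using tail_nonneg[of w s] w(2) \<open>\<delta> > 0\<close> by (simp add: T_def)
  next
    case False
    have "tail (wn n) s \<le> (LINT \<tau>|lborel. wn n \<tau>)" by (rule tail_le_total[OF iwn wn_bounds(1)])
    also have "\<dots> \<le> (LINT \<tau>|lborel. ?dom \<tau>)"
      using dom(2)[of n] by (intro integral_mono iwn dom(1)) (auto simp: abs_le_iff)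
    also have "\<dots> = real m * (T + 1)" by (simp add: T_def)
    also have "\<dots> \<le> real m * (T + 1) * (tail w s / \<delta>)"
    proof -
      have "1 \<le> tail w s / \<delta>" using False \<open>\<delta> > 0\<close> by simp
      from mult_left_mono[OF this, of "real m * (T + 1)"] show ?thesis by (simp add: T_def)
    qed
    finally show ?thesis using tail_nonneg[of "wn n" s] wn_bounds(1) by simp
  qed
  have mc: "(\<lambda>t. cutoff a b h t) \<in> borel_measurable borel"
    using cutoff_facts(1)[OF h(1)] by (auto intro!: borel_measurable_continuous_onI continuous_at_imp_continuous_on DERIV_continuous)
  note [measurable] = mc
  have mt [measurable]: "tail f \<in> borel_measurable borel" if "integrable lborel f" for f
    by (rule borel_measurable_continuous_onI[OF continuous_tail[OF that]])
  note [measurable] = mt[OF iwn] mt[OF integrable_wtrunc]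
  have cb: "\<bar>cutoff a b h t\<bar> \<le> 1" for t using cutoff_facts(4,5)[OF h(1)] by simp
  show ?thesis
  proof (rule estimate_limit[where cn = "\<lambda>n z. cutoff a b h (fst z) * wn n (fst z + norm (snd z))"
        and dn = "\<lambda>n z. cutoff a b h (fst z) * tail (wn n) (fst z + norm (snd z))"
        and \<alpha>n = "\<lambda>n. LINT \<tau>|lborel. wn n \<tau>"
        and Da = "\<lambda>z. real m * \<bar>sv z ^ 5 * sF z\<bar>"
        and Db = "\<lambda>z. real m * (T + 1) / \<delta> * \<bar>tail w (fst z + norm (snd z)) * (sv z ^ 5 * sFt z)\<bar>"])
    show "integrable lborel (\<lambda>z. real m * (T + 1) / \<delta> * \<bar>tail w (fst z + norm (snd z)) * (sv z ^ 5 * sFt z)\<bar>)"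
      using integrable_tail_Ft unfolding sFt_def by (intro integrable_mult_right integrable_abs)
    have d2: "\<bar>tail (wn n) (fst z + norm (snd z)) * (sv z ^ 5 * sFt z)\<bar>
        \<le> real m * (T + 1) / \<delta> * \<bar>tail w (fst z + norm (snd z)) * (sv z ^ 5 * sFt z)\<bar>" for n z
      using mult_right_mono[OF tail_le_const[of n "fst z + norm (snd z)"], of "\<bar>sv z ^ 5 * sFt z\<bar>"]
        tail_nonneg[of w "fst z + norm (snd z)"] w(2) by (simp add: abs_mult mult.assoc)
    show "\<bar>cutoff a b h (fst z) * tail (wn n) (fst z + norm (snd z)) * (sv z ^ 5 * sFt z)\<bar>
        \<le> real m * (T + 1) / \<delta> * \<bar>tail w (fst z + norm (snd z)) * (sv z ^ 5 * sFt z)\<bar>" for n z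
      using order_trans[OF mult_left_le_one_le[OF abs_ge_zero abs_ge_zero cb] d2]
      by (simp add: abs_mult mult.assoc)
    show "estimate (\<lambda>z. cutoff a b h (fst z) * wn n (fst z + norm (snd z)))
        (\<lambda>z. cutoff a b h (fst z) * tail (wn n) (fst z + norm (snd z))) (LINT \<tau>|lborel. wn n \<tau>)" for n
    proof (rule estimate_smooth[OF h wn_cont wn_bounds(1,2) wn_bounds(3) wn_T])
      show "integrable lborel (\<lambda>z. tail (wn n) (fst z + norm (snd z)) * (sv z ^ 5 * sFt z))"
      proof (rule Bochner_Integration.integrable_bound)
        show "integrable lborel (\<lambda>z. real m * (T + 1) / \<delta> * \<bar>tail w (fst z + norm (snd z)) * (sv z ^ 5 * sFt z)\<bar>)"
          by fact
        show "AE z in (lborel :: spacetime measure). norm (tail (wn n) (fst z + norm (snd z)) * (sv z ^ 5 * sFt z))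
            \<le> norm (real m * (T + 1) / \<delta> * \<bar>tail w (fst z + norm (snd z)) * (sv z ^ 5 * sFt z)\<bar>)"
          unfolding real_norm_def by (intro AE_I2 order_trans[OF d2 abs_ge_self])
      qed measurable
    qed
    show "(\<lambda>n. LINT \<tau>|lborel. wn n \<tau>) \<longlonglongrightarrow> (LINT \<tau>|lborel. wtrunc m \<tau>)"
      by (rule integral_dominated_convergence[OF _ _ dom(1) lim]) (use dom(2) in auto)
    show "AE z in (lborel :: spacetime measure). (\<lambda>n. cutoff a b h (fst z) * wn n (fst z + norm (snd z)))
        \<longlonglongrightarrow> cutoff a b h (fst z) * wtrunc m (fst z + norm (snd z))"
      using AE_cone[OF lim] by eventually_elim (intro tendsto_intros)
    show "AE z in (lborel :: spacetime measure). (\<lambda>n. cutoff a b h (fst z) * tail (wn n) (fst z + norm (snd z)))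
        \<longlonglongrightarrow> cutoff a b h (fst z) * tail (wtrunc m) (fst z + norm (snd z))"
    proof -
      have L: "AE \<tau> in lborel. s \<le> \<tau> \<longrightarrow> (\<lambda>n. wn n \<tau>) \<longlonglongrightarrow> wtrunc m \<tau>" for s
        using lim by eventually_elim simp
      have "(\<lambda>n. tail (wn n) s) \<longlonglongrightarrow> tail (wtrunc m) s" for s
        by (rule tail_tendsto[OF _ _ dom(1) L dom(2)]) auto
      then show ?thesis by (intro AE_I2 tendsto_mult tendsto_const)
    qed
    show "\<bar>cutoff a b h (fst z) * wn n (fst z + norm (snd z)) * (sv z ^ 5 * sF z)\<bar> \<le> real m * \<bar>sv z ^ 5 * sF z\<bar>" for n z
    proof -
      have "\<bar>cutoff a b h (fst z)\<bar> * \<bar>wn n (fst z + norm (snd z))\<bar> \<le> 1 * real m"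
        using cb wn_bounds(1,2) by (intro mult_mono) auto
      from mult_right_mono[OF this, of "\<bar>sv z ^ 5 * sF z\<bar>"] show ?thesis by (simp add: abs_mult mult.assoc)
    qed
    show "integrable lborel (\<lambda>z. real m * \<bar>sv z ^ 5 * sF z\<bar>)"
      by (intro integrable_mult_right integrable_abs integrable_sv5_sF)
  qed measurable
qed

text \<open>From the first nonnegative zero of the tail on, \<open>w\<close> has integral 0 and so
  vanishes almost everywhere. Discarding the points with zero tail therefore loses nothing.\<close>

lemma AE_tail_pos: "AE \<tau> in lborel. \<tau> \<ge> 0 \<longrightarrow> w \<tau> = 0 \<or> tail w \<tau> > 0"
proof (cases "{0..} \<inter> tail w -` {0} = {}")
  case True
  then have "tail w \<tau> > 0" if "\<tau> \<ge> 0" for \<tau>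
    using that tail_nonneg[of w \<tau>] w(2) by (fastforce simp: order_less_le)
  then show ?thesis by simp
next
  case False
  let ?Z = "{0..} \<inter> tail w -` {0}"
  have "closed ?Z"
    using continuous_tail[OF w(1)] by (intro closed_Int closed_vimage) auto
  then have "Inf ?Z \<in> ?Z"
    by (intro closed_contains_Inf False) auto
  then have "(LINT \<tau>|lborel. indicator {Inf ?Z..} \<tau> * w \<tau>) = 0" by (simp add: tail_eq)
  then have "AE \<tau> in lborel. indicator {Inf ?Z..} \<tau> * w \<tau> = 0"
    using integral_nonneg_eq_0_iff_AE[OF integrable_indicator_times[OF w(1)], of "{Inf ?Z..}"] w(2) by auto
  then show ?thesis
  proof eventually_elim
    case (elim \<tau>)
    show ?case
    proof (intro impI)
      assume "\<tau> \<ge> 0"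
      show "w \<tau> = 0 \<or> tail w \<tau> > 0"
      proof (cases "tail w \<tau> = 0")
        case True
        then have "Inf ?Z \<le> \<tau>" using \<open>\<tau> \<ge> 0\<close> by (intro cInf_lower) auto
        then show ?thesis using elim by simp
      next
        case False
        then show ?thesis using tail_nonneg[of w \<tau>] w(2) by (simp add: order_less_le)
      qed
    qed
  qed
qed

text \<open>Where the tail is positive, all three truncations are eventually inactive; elsewhere
  \<open>w\<close> is 0 almost everywhere.\<close>

lemma wtrunc_tendsto: "AE \<tau> in lborel. \<tau> \<ge> 0 \<longrightarrow> (\<lambda>m. wtrunc m \<tau>) \<longlonglongrightarrow> w \<tau>"
  using AE_tail_pos
proof eventually_elim
  case (elim \<tau>)
  show ?case
  proof
    assume \<tau>: "\<tau> \<ge> 0"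
    show "(\<lambda>m. wtrunc m \<tau>) \<longlonglongrightarrow> w \<tau>"
    proof (cases "w \<tau> = 0")
      case True
      then have "wtrunc m \<tau> = w \<tau>" for m using wtrunc_bounds[of m \<tau>] by simp
      then show ?thesis by simp
    next
      case False
      then have "tail w \<tau> > 0" using elim \<tau> by blast
      from order_tendstoD(2)[OF LIMSEQ_inverse_real_of_nat this]
      have e1: "\<forall>\<^sub>F m in sequentially. inverse (real (Suc m)) < tail w \<tau>" .
      obtain N where "w \<tau> \<le> real N" using real_arch_simple by blast
      then have e2: "\<forall>\<^sub>F m in sequentially. w \<tau> \<le> real m"
        unfolding eventually_sequentially by (intro exI[of _ N]) auto
      have "left_cut \<tau> = 1" using \<tau> by (simp add: left_cut_def)
      have "\<forall>\<^sub>F m in sequentially. wtrunc m \<tau> = w \<tau>"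
        using e1 e2 by eventually_elim (use \<open>left_cut \<tau> = 1\<close> w(2)[of \<tau>] in \<open>simp add: wtrunc_def clip_def\<close>)
      then show ?thesis by (rule tendsto_eventually)
    qed
  qed
qed

text \<open>The time cutoff widens to the open interval while the truncation level tends to
  infinity. The integrands with the full \<open>w\<close> and its full tail dominate, which is where
  the two integrability assumptions enter.\<close>

lemma estimate_final:
  "estimate (\<lambda>z. indicator {a<..<b} (fst z) * w (fst z + norm (snd z)))
    (\<lambda>z. indicator {a<..<b} (fst z) * tail w (fst z + norm (snd z))) (LINT \<tau>|lborel. w \<tau>)"
proof -
  define h where "h m = (b - a) / (4 * real (Suc m))" for m
  have h: "0 < h m" "4 * h m \<le> b - a" for m
  proof -
    show "0 < h m" using ab(2) by (simp add: h_def)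
    have "(b - a) / real (Suc m) \<le> (b - a) / 1" using ab(2) by (intro divide_left_mono) auto
    moreover have "4 * (y / (4 * x)) = y / x" for x y :: real by simp
    then have "4 * h m = (b - a) / real (Suc m)" unfolding h_def .
    ultimately show "4 * h m \<le> b - a" by (simp only: div_by_1)
  qed
  have h0: "h \<longlonglongrightarrow> 0"
  proof -
    have "(\<lambda>m. (b - a) / 4 * inverse (real (Suc m))) \<longlonglongrightarrow> (b - a) / 4 * 0"
      by (intro tendsto_mult tendsto_const LIMSEQ_inverse_real_of_nat)
    moreover have "y / (4 * x) = y / 4 * inverse x" for x y :: real
      by (cases "x = 0") (simp_all add: field_simps)
    then have "h = (\<lambda>m. (b - a) / 4 * inverse (real (Suc m)))"
      by (intro ext) (simp only: h_def)
    ultimately show ?thesis by (simp only: mult_zero_right)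
  qed
  have cut_lim: "(\<lambda>m. cutoff a b (h m) t) \<longlonglongrightarrow> indicator {a<..<b} t" for t
  proof (cases "t \<in> {a<..<b}")
    case True
    then have "0 < min (t - a) (b - t) / 2" by auto
    from order_tendstoD(2)[OF h0 this]
    have "\<forall>\<^sub>F m in sequentially. cutoff a b (h m) t = indicator {a<..<b} t"
      by eventually_elim (use True cutoff_facts(7)[OF h(1)] in auto)
    then show ?thesis by (rule tendsto_eventually)
  next
    case False
    then have "cutoff a b (h m) t = 0" for m
      using h(1)[of m] by (intro cutoff_facts(3)[OF h(1)]) auto
    then show ?thesis using False by simp
  qed
  have cut0: "cutoff a b (h m) t = 0" if "t \<notin> {a<..<b}" for m t
    using h(1)[of m] that by (intro cutoff_facts(3)[OF h(1)]) auto
  have mc [measurable]: "cutoff a b (h m) \<in> borel_measurable borel" for m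
    using cutoff_facts(1)[OF h(1)] by (auto intro!: borel_measurable_continuous_onI continuous_at_imp_continuous_on DERIV_continuous)
  have [measurable]: "tail (wtrunc m) \<in> borel_measurable borel" for m
    by (rule borel_measurable_continuous_onI[OF continuous_tail[OF integrable_wtrunc]])
  have cb: "\<bar>cutoff a b (h m) t\<bar> \<le> 1" for m t using cutoff_facts(4,5)[OF h(1)] by simp
  have tails: "0 \<le> tail (wtrunc m) s" "tail (wtrunc m) s \<le> tail w s" for m s
    using tail_nonneg wtrunc_bounds tail_le[OF integrable_wtrunc w(1)] by blast+
  show ?thesis
  proof (rule estimate_limit[where cn = "\<lambda>m z. cutoff a b (h m) (fst z) * wtrunc m (fst z + norm (snd z))"
        and dn = "\<lambda>m z. cutoff a b (h m) (fst z) * tail (wtrunc m) (fst z + norm (snd z))"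
        and \<alpha>n = "\<lambda>m. LINT \<tau>|lborel. w \<tau>"
        and Da = "\<lambda>z. \<bar>w (fst z + norm (snd z)) * (sv z ^ 5 * sF z)\<bar>"
        and Db = "\<lambda>z. \<bar>tail w (fst z + norm (snd z)) * (sv z ^ 5 * sFt z)\<bar>"])
    \<comment> \<open>The mass of each truncation is enlarged to that of \<open>w\<close>, so the
      sequence of masses is constant.\<close>
    show "estimate (\<lambda>z. cutoff a b (h m) (fst z) * wtrunc m (fst z + norm (snd z)))
        (\<lambda>z. cutoff a b (h m) (fst z) * tail (wtrunc m) (fst z + norm (snd z))) (LINT \<tau>|lborel. w \<tau>)" for m
      by (rule estimate_mono[OF estimate_truncated[OF h]])
         (intro integral_mono integrable_wtrunc w(1) wtrunc_bounds)
    show "AE z in (lborel :: spacetime measure). (\<lambda>m. cutoff a b (h m) (fst z) * wtrunc m (fst z + norm (snd z)))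
        \<longlonglongrightarrow> indicator {a<..<b} (fst z) * w (fst z + norm (snd z))"
      using AE_cone[OF wtrunc_tendsto]
    proof eventually_elim
      case (elim z)
      show ?case
      proof (cases "fst z \<in> {a<..<b}")
        case True
        then have "0 \<le> fst z + norm (snd z)" using ab(1) by simp
        then show ?thesis using elim by (intro tendsto_mult cut_lim) blast
      qed (simp add: cut0)
    qed
    show "AE z in (lborel :: spacetime measure). (\<lambda>m. cutoff a b (h m) (fst z) * tail (wtrunc m) (fst z + norm (snd z)))
        \<longlonglongrightarrow> indicator {a<..<b} (fst z) * tail w (fst z + norm (snd z))"
    proof (rule AE_I2)
      fix z :: spacetime
      show "(\<lambda>m. cutoff a b (h m) (fst z) * tail (wtrunc m) (fst z + norm (snd z)))
        \<longlonglongrightarrow> indicator {a<..<b} (fst z) * tail w (fst z + norm (snd z))"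
      proof (cases "fst z \<in> {a<..<b}")
        case True
        then have s: "0 \<le> fst z + norm (snd z)" using ab(1) by simp
        have "(\<lambda>m. tail (wtrunc m) (fst z + norm (snd z))) \<longlonglongrightarrow> tail w (fst z + norm (snd z))"
        proof (rule tail_tendsto[OF _ _ w(1)])
          show "AE \<tau> in lborel. fst z + norm (snd z) \<le> \<tau> \<longrightarrow> (\<lambda>m. wtrunc m \<tau>) \<longlonglongrightarrow> w \<tau>"
            using wtrunc_tendsto by eventually_elim (use s in auto)
        qed (use wtrunc_bounds w(2) in auto)
        then show ?thesis by (intro tendsto_mult cut_lim)
      qed (simp add: cut0)
    qed
    show "\<bar>cutoff a b (h m) (fst z) * wtrunc m (fst z + norm (snd z)) * (sv z ^ 5 * sF z)\<bar>
        \<le> \<bar>w (fst z + norm (snd z)) * (sv z ^ 5 * sF z)\<bar>" for m z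
    proof -
      have "\<bar>cutoff a b (h m) (fst z)\<bar> * \<bar>wtrunc m (fst z + norm (snd z))\<bar> \<le> 1 * \<bar>w (fst z + norm (snd z))\<bar>"
        using cb wtrunc_bounds[of m "fst z + norm (snd z)"] by (intro mult_mono) auto
      from mult_right_mono[OF this, of "\<bar>sv z ^ 5 * sF z\<bar>"] show ?thesis by (simp add: abs_mult mult.assoc)
    qed
    show "\<bar>cutoff a b (h m) (fst z) * tail (wtrunc m) (fst z + norm (snd z)) * (sv z ^ 5 * sFt z)\<bar>
        \<le> \<bar>tail w (fst z + norm (snd z)) * (sv z ^ 5 * sFt z)\<bar>" for m z
    proof -
      have "\<bar>cutoff a b (h m) (fst z)\<bar> * \<bar>tail (wtrunc m) (fst z + norm (snd z))\<bar> \<le> 1 * \<bar>tail w (fst z + norm (snd z))\<bar>"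
        using cb tails[of m "fst z + norm (snd z)"] by (intro mult_mono) auto
      from mult_right_mono[OF this, of "\<bar>sv z ^ 5 * sFt z\<bar>"] show ?thesis by (simp add: abs_mult mult.assoc)
    qed
  qed (use integrable_w_F integrable_tail_Ft in \<open>auto simp: sFt_def[symmetric] intro: integrable_abs\<close>)
qed

end

section \<open>The flux estimate\<close>

text \<open>Six times the difference of the two sides is (s - r)^2 times a polynomial with positive
  coefficients.\<close>

lemma Young_5_1:
  fixes s r :: real
  assumes "0 \<le> s" "0 \<le> r"
  shows "s ^ 5 * r \<le> 5/6 * s ^ 6 + 1/6 * r ^ 6"
proof -
  have "0 \<le> (s - r)\<^sup>2 * (5 * s ^ 4 + 4 * s ^ 3 * r + 3 * s\<^sup>2 * r\<^sup>2 + 2 * s * r ^ 3 + r ^ 4)"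
    using assms by (intro mult_nonneg_nonneg add_nonneg_nonneg) auto
  also have "\<dots> = 6 * (5/6 * s ^ 6 + 1/6 * r ^ 6 - s ^ 5 * r)"
    by (simp add: eval_nat_numeral algebra_simps)
  finally show ?thesis by simp
qed

text \<open>Young's inequality for f/\<alpha> and g/\<beta>. If \<alpha> or \<beta> is 0 this
  normalisation breaks down, but then the product vanishes almost everywhere.\<close>

lemma Hoelder_5_1:
  fixes f g :: "'a \<Rightarrow> real"
  assumes [measurable]: "f \<in> borel_measurable M" "g \<in> borel_measurable M"
    and f: "(\<integral>\<^sup>+x. ennreal (\<bar>f x\<bar> ^ 6) \<partial>M) \<le> ennreal (\<alpha> ^ 6)" "0 \<le> \<alpha>"
    and g: "(\<integral>\<^sup>+x. ennreal (\<bar>g x\<bar> ^ 6) \<partial>M) \<le> ennreal (\<beta> ^ 6)" "0 \<le> \<beta>"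
  shows "(\<integral>\<^sup>+x. ennreal \<bar>f x ^ 5 * g x\<bar> \<partial>M) \<le> ennreal (\<alpha> ^ 5 * \<beta>)"
proof (cases "\<alpha> = 0 \<or> \<beta> = 0")
  case True
  have "AE x in M. f x ^ 5 * g x = 0"
  proof (cases "\<alpha> = 0")
    case True
    then have "(\<integral>\<^sup>+x. ennreal (\<bar>f x\<bar> ^ 6) \<partial>M) = 0" using f by simp
    then have "AE x in M. ennreal (\<bar>f x\<bar> ^ 6) = 0" by (subst (asm) nn_integral_0_iff_AE) auto
    then show ?thesis by eventually_elim simp
  next
    case False
    then have "(\<integral>\<^sup>+x. ennreal (\<bar>g x\<bar> ^ 6) \<partial>M) = 0" using True g by simp
    then have "AE x in M. ennreal (\<bar>g x\<bar> ^ 6) = 0" by (subst (asm) nn_integral_0_iff_AE) auto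
    then show ?thesis by eventually_elim simp
  qed
  then have "(\<integral>\<^sup>+x. ennreal \<bar>f x ^ 5 * g x\<bar> \<partial>M) = (\<integral>\<^sup>+x. 0 \<partial>M)"
    by (intro nn_integral_cong_AE) (auto elim: eventually_mono)
  then show ?thesis by simp
next
  case False
  then have pos: "\<alpha> > 0" "\<beta> > 0" using f(2) g(2) by auto
  \<comment> \<open>These coefficients come from multiplying the normalised inequality by \<alpha>^5
    \<beta>; with the bounds on f and g inserted they contribute 5/6 and 1/6 of the result.\<close>
  let ?c1 = "5/6 * \<beta> / \<alpha>" and ?c2 = "1/6 * \<alpha> ^ 5 / \<beta> ^ 5"
  have "(\<integral>\<^sup>+x. ennreal \<bar>f x ^ 5 * g x\<bar> \<partial>M)
      \<le> (\<integral>\<^sup>+x. ennreal ?c1 * ennreal (\<bar>f x\<bar> ^ 6) + ennreal ?c2 * ennreal (\<bar>g x\<bar> ^ 6) \<partial>M)"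
  proof (rule nn_integral_mono)
    fix x
    have "(\<bar>f x\<bar> / \<alpha>) ^ 5 * (\<bar>g x\<bar> / \<beta>) \<le> 5/6 * (\<bar>f x\<bar> / \<alpha>) ^ 6 + 1/6 * (\<bar>g x\<bar> / \<beta>) ^ 6"
      by (rule Young_5_1) (use pos in auto)
    then have "\<alpha> ^ 5 * \<beta> * ((\<bar>f x\<bar> / \<alpha>) ^ 5 * (\<bar>g x\<bar> / \<beta>))
        \<le> \<alpha> ^ 5 * \<beta> * (5/6 * (\<bar>f x\<bar> / \<alpha>) ^ 6 + 1/6 * (\<bar>g x\<bar> / \<beta>) ^ 6)"
      using pos by (intro mult_left_mono) auto
    also have "\<alpha> ^ 5 * \<beta> * ((\<bar>f x\<bar> / \<alpha>) ^ 5 * (\<bar>g x\<bar> / \<beta>)) = \<bar>f x ^ 5 * g x\<bar>"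
      using pos by (simp add: power_divide abs_mult power_abs)
    also have "\<alpha> ^ 5 * \<beta> * (5/6 * (\<bar>f x\<bar> / \<alpha>) ^ 6 + 1/6 * (\<bar>g x\<bar> / \<beta>) ^ 6) = ?c1 * \<bar>f x\<bar> ^ 6 + ?c2 * \<bar>g x\<bar> ^ 6"
      using pos by (simp add: power_divide field_simps eval_nat_numeral)
    finally have "ennreal \<bar>f x ^ 5 * g x\<bar> \<le> ennreal (?c1 * \<bar>f x\<bar> ^ 6 + ?c2 * \<bar>g x\<bar> ^ 6)"
      by (rule ennreal_leI)
    also have "\<dots> = ennreal (?c1 * \<bar>f x\<bar> ^ 6) + ennreal (?c2 * \<bar>g x\<bar> ^ 6)"
      using pos by (intro ennreal_plus) auto
    also have "\<dots> = ennreal ?c1 * ennreal (\<bar>f x\<bar> ^ 6) + ennreal ?c2 * ennreal (\<bar>g x\<bar> ^ 6)"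
      using pos by (subst (1 2) ennreal_mult) auto
    finally show "ennreal \<bar>f x ^ 5 * g x\<bar> \<le> \<dots>" .
  qed
  also have "\<dots> = ennreal ?c1 * (\<integral>\<^sup>+x. ennreal (\<bar>f x\<bar> ^ 6) \<partial>M) + ennreal ?c2 * (\<integral>\<^sup>+x. ennreal (\<bar>g x\<bar> ^ 6) \<partial>M)"
    by (simp add: nn_integral_add nn_integral_cmult)
  also have "\<dots> \<le> ennreal ?c1 * ennreal (\<alpha> ^ 6) + ennreal ?c2 * ennreal (\<beta> ^ 6)"
    by (intro add_mono mult_left_mono f g) auto
  also have "\<dots> = ennreal (?c1 * \<alpha> ^ 6) + ennreal (?c2 * \<beta> ^ 6)"
    using pos by (subst (1 2) ennreal_mult) auto
  also have "\<dots> = ennreal (?c1 * \<alpha> ^ 6 + ?c2 * \<beta> ^ 6)"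
    using pos by (intro ennreal_plus[symmetric]) auto
  also have "?c1 * \<alpha> ^ 6 + ?c2 * \<beta> ^ 6 = \<alpha> ^ 5 * \<beta>"
    using pos by (simp add: field_simps eval_nat_numeral)
  finally show ?thesis .
qed

context nlw_data
begin

text \<open>The integral of v^6 is at most 6 E, so Hoelder's inequality contributes (6 E)^(5/6), and
  6^(5/6) <= 6.\<close>

lemma quintic_pairing:
  assumes q': "\<And>t. t \<in> {a..b} \<Longrightarrow> epowr (energy (v t) (Dv t) (vt t)) (5/6) \<le> ennreal q'" "0 \<le> q'"
  shows "AE t in lborel. (\<integral>\<^sup>+x. ennreal \<bar>sv (t, x) ^ 5 * sF (t, x)\<bar> \<partial>lborel) \<le> ennreal (6 * q' * M)"
  using slice_sF6
proof eventually_elim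
  case (elim t)
  show ?case
  proof (cases "t \<in> {a..b}")
    case True
    let ?E = "energy (v t) (Dv t) (vt t)"
    have "?E < \<top>" using energy_le(1)[OF True] by (simp add: order.strict_trans1)
    then obtain e where e: "?E = ennreal e" "0 \<le> e" by (cases ?E) auto
    have "(\<integral>\<^sup>+x. ennreal (\<bar>sv (t, x)\<bar> ^ 6) \<partial>lborel) \<le> (\<integral>\<^sup>+x. 6 * ennreal (1/2 * (norm (Dv t x))\<^sup>2 + 1/2 * \<bar>vt t x\<bar>\<^sup>2 + 1/6 * \<bar>v t x\<bar> ^ 6) \<partial>lborel)"
    proof (rule nn_integral_mono)
      fix x
      have "ennreal (\<bar>sv (t, x)\<bar> ^ 6) \<le> ennreal (6 * (1/2 * (norm (Dv t x))\<^sup>2 + 1/2 * \<bar>vt t x\<bar>\<^sup>2 + 1/6 * \<bar>v t x\<bar> ^ 6))"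
        by (rule ennreal_leI) (simp add: s_inside[OF True])
      then show "ennreal (\<bar>sv (t, x)\<bar> ^ 6) \<le> 6 * ennreal (1/2 * (norm (Dv t x))\<^sup>2 + 1/2 * \<bar>vt t x\<bar>\<^sup>2 + 1/6 * \<bar>v t x\<bar> ^ 6)"
        by (subst (asm) ennreal_mult) auto
    qed
    also have "\<dots> = 6 * ?E"
    proof -
      have "(\<lambda>x. ennreal (edens (t, x) + 1/6 * \<bar>sv (t, x)\<bar> ^ 6))
          = (\<lambda>x. ennreal (1/2 * (norm (Dv t x))\<^sup>2 + 1/2 * \<bar>vt t x\<bar>\<^sup>2 + 1/6 * \<bar>v t x\<bar> ^ 6))"
        by (simp only: edens_energy[OF True])
      moreover have "(\<lambda>x. ennreal (edens (t, x) + 1/6 * \<bar>sv (t, x)\<bar> ^ 6)) \<in> borel_measurable lborel"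
        by measurable
      ultimately show ?thesis unfolding energy_def by (intro nn_integral_cmult) simp
    qed
    also have "\<dots> = ennreal (((6 * e) powr (1/6)) ^ 6)"
    proof -
      have "((6 * e) powr (1/6)) ^ 6 = 6 * e"
        using e(2) by (cases "e = 0") (auto simp: powr_realpow[symmetric] powr_powr)
      then show ?thesis using e by (simp add: ennreal_mult)
    qed
    finally have "(\<integral>\<^sup>+x. ennreal \<bar>sv (t, x) ^ 5 * sF (t, x)\<bar> \<partial>lborel) \<le> ennreal (((6 * e) powr (1/6)) ^ 5 * M)"
      using elim F_le(2) by (intro Hoelder_5_1) auto
    also have "\<dots> \<le> ennreal (6 * q' * M)"
    proof (intro ennreal_leI mult_right_mono F_le(2))
      have "((6 * e) powr (1/6)) ^ 5 = (6 * e) powr (5/6)"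
        using e(2) by (cases "e = 0") (auto simp: powr_realpow[symmetric] powr_powr)
      also have "\<dots> = 6 powr (5/6) * e powr (5/6)" using e(2) by (simp add: powr_mult)
      also have "\<dots> \<le> 6 * q'"
      proof (rule mult_mono)
        have "(6::real) powr (5/6) \<le> 6 powr 1" by (rule powr_mono) auto
        then show "(6::real) powr (5/6) \<le> 6" by simp
        show "e powr (5/6) \<le> q'" using q'(1)[OF True] q'(2) e by (simp add: epowr_ennreal)
      qed auto
      finally show "((6 * e) powr (1/6)) ^ 5 \<le> 6 * q'" .
    qed
    finally show ?thesis .
  qed (simp add: s_outside)
qed

end

lemma weighted_slices_eq_0:
  fixes f :: "real \<Rightarrow> 'a::euclidean_space \<Rightarrow> real"
  assumes "AE t in lborel. t \<in> {a..b} \<longrightarrow> (AE x in lborel. f t x = 0)"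
  shows "(\<integral>\<^sup>+t\<in>{a..b}. (\<integral>\<^sup>+x. ennreal (f t x) \<partial>lborel) \<partial>lborel) = 0"
proof -
  have "(\<integral>\<^sup>+t\<in>{a..b}. (\<integral>\<^sup>+x. ennreal (f t x) \<partial>lborel) \<partial>lborel) = (\<integral>\<^sup>+t. 0 \<partial>(lborel :: real measure))"
  proof (rule nn_integral_cong_AE)
    have "(\<integral>\<^sup>+x. ennreal (f t x) \<partial>lborel) = 0" if "AE x in lborel. f t x = 0" for t
    proof -
      have "(\<integral>\<^sup>+x. ennreal (f t x) \<partial>lborel) = (\<integral>\<^sup>+x. 0 \<partial>(lborel :: 'a measure))"
        using that by (intro nn_integral_cong_AE) (auto elim: eventually_mono)
      then show ?thesis by simp
    qed
    then show "AE t in lborel. (\<integral>\<^sup>+x. ennreal (f t x) \<partial>lborel) * indicator {a..b} t = 0"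
      using assms by (auto elim!: eventually_mono simp: indicator_def)
  qed
  then show ?thesis by simp
qed

lemma AE_open_interval: "AE t in lborel. t \<in> {a..b} \<longleftrightarrow> t \<in> {a<..<b::real}"
  using AE_lborel_singleton[of a] AE_lborel_singleton[of b] by eventually_elim auto

text \<open>Fubini turns the spacetime integrals of \<open>estimate_final\<close> into the iterated
  integrals of the theorem; the open and the closed time interval differ by a null set.\<close>

lemma flux_estimate:
  fixes F Ft v vt :: "real \<Rightarrow> R3 \<Rightarrow> real" and Dv :: "real \<Rightarrow> R3 \<Rightarrow> R3" and w :: "real \<Rightarrow> real"
  assumes data: "nlw_data F Ft v vt Dv a b S M" and ab: "0 \<le> a" "a < b"
    and w: "integrable lborel w" "\<And>\<tau>. 0 \<le> w \<tau>"
    and q': "\<And>t. t \<in> {a..b} \<Longrightarrow> epowr (energy (v t) (Dv t) (vt t)) (5/6) \<le> ennreal q'" "0 \<le> q'"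
    and P: "(\<integral>\<^sup>+t\<in>{a..b}. (\<integral>\<^sup>+x. ennreal (\<bar>F t x\<bar>\<^sup>2 * (\<bar>F t x\<bar> + \<bar>v t x\<bar>) ^ 3 * \<bar>vt t x\<bar>) \<partial>lborel) \<partial>lborel) = ennreal P" "0 \<le> P"
    and J1: "set_integrable lborel ({a..b} \<times> UNIV)
         (\<lambda>(t, x). (LINT \<tau>:{t + norm x..}|lborel. w \<tau>) * Ft t x * v t x ^ 5)"
    and J2: "set_integrable lborel ({a..b} \<times> UNIV) (\<lambda>(t, x). w (t + norm x) * F t x * v t x ^ 5)"
  shows "(\<integral>\<^sup>+t\<in>{a..b}. (\<integral>\<^sup>+x. ennreal (w (t + norm x) * \<bar>v t x\<bar> ^ 6) \<partial>lborel) \<partial>lborel)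
    \<le> ennreal (6 * ((LINT \<tau>|lborel. w \<tau>) * (4 * S + 4 * (6 * q' * M) + 26 * P)
      + \<bar>LINT t:{a..b}|lborel. (LINT x|lborel. w (t + norm x) * F t x * v t x ^ 5)\<bar>
      + \<bar>LINT t:{a..b}|lborel. (LINT x|lborel. (LINT \<tau>:{t + norm x..}|lborel. w \<tau>) * Ft t x * v t x ^ 5)\<bar>))"
proof -
  interpret nlw_data F Ft v vt Dv a b S M by (rule data)
  have J1': "integrable lborel (\<lambda>z. tail w (fst z + norm (snd z)) * (sv z ^ 5 * res ({a<..<b} \<times> UNIV) Ft z))"
  proof -
    have "integrable lborel (\<lambda>z. indicator ({a<..<b} \<times> UNIV) z *\<^sub>R (indicator ({a..b} \<times> UNIV) z *\<^sub>R
        (case z of (t, x) \<Rightarrow> (LINT \<tau>:{t + norm x..}|lborel. w \<tau>) * Ft t x * v t x ^ 5)) :: real)"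
      by (rule integrable_mult_indicator[OF _ J1[unfolded set_integrable_def]])
         (simp add: borel_open open_Times)
    also have "(\<lambda>z. indicator ({a<..<b} \<times> UNIV) z *\<^sub>R (indicator ({a..b} \<times> UNIV) z *\<^sub>R
        (case z of (t, x) \<Rightarrow> (LINT \<tau>:{t + norm x..}|lborel. w \<tau>) * Ft t x * v t x ^ 5)) :: real)
      = (\<lambda>z. tail w (fst z + norm (snd z)) * (sv z ^ 5 * res ({a<..<b} \<times> UNIV) Ft z))"
      by (auto simp: fun_eq_iff indicator_def tail_def sv_def res_def strip_def)
    finally show ?thesis .
  qed
  have J2': "integrable lborel (\<lambda>z. w (fst z + norm (snd z)) * (sv z ^ 5 * sF z))"
  proof -
    have "(\<lambda>z. indicator ({a..b} \<times> UNIV) z *\<^sub>R (case z of (t, x) \<Rightarrow> w (t + norm x) * F t x * v t x ^ 5) :: real)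
      = (\<lambda>z. w (fst z + norm (snd z)) * (sv z ^ 5 * sF z))"
      by (auto simp: fun_eq_iff indicator_def sv_def sF_def res_def strip_def)
    then show ?thesis using J2 unfolding set_integrable_def by simp
  qed
  have P': "(\<integral>\<^sup>+z. ennreal (\<bar>sF z\<bar>\<^sup>2 * (\<bar>sF z\<bar> + \<bar>sv z\<bar>) ^ 3 * \<bar>svt z\<bar>) \<partial>lborel) \<le> ennreal P"
  proof -
    have "(\<integral>\<^sup>+z. ennreal (\<bar>sF z\<bar>\<^sup>2 * (\<bar>sF z\<bar> + \<bar>sv z\<bar>) ^ 3 * \<bar>svt z\<bar>) \<partial>lborel)
        = (\<integral>\<^sup>+t. (\<integral>\<^sup>+x. ennreal (\<bar>sF (t, x)\<bar>\<^sup>2 * (\<bar>sF (t, x)\<bar> + \<bar>sv (t, x)\<bar>) ^ 3 * \<bar>svt (t, x)\<bar>) \<partial>lborel) \<partial>lborel)"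
      by (rule nn_integral_spacetime) measurable
    also have "\<dots> = (\<integral>\<^sup>+t\<in>{a..b}. (\<integral>\<^sup>+x. ennreal (\<bar>F t x\<bar>\<^sup>2 * (\<bar>F t x\<bar> + \<bar>v t x\<bar>) ^ 3 * \<bar>vt t x\<bar>) \<partial>lborel) \<partial>lborel)"
    proof (rule nn_integral_cong)
      fix t
      show "(\<integral>\<^sup>+x. ennreal (\<bar>sF (t, x)\<bar>\<^sup>2 * (\<bar>sF (t, x)\<bar> + \<bar>sv (t, x)\<bar>) ^ 3 * \<bar>svt (t, x)\<bar>) \<partial>lborel)
        = (\<integral>\<^sup>+x. ennreal (\<bar>F t x\<bar>\<^sup>2 * (\<bar>F t x\<bar> + \<bar>v t x\<bar>) ^ 3 * \<bar>vt t x\<bar>) \<partial>lborel) * indicator {a..b} t"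
        by (cases "t \<in> {a..b}") (simp_all add: s_inside s_outside)
    qed
    finally show ?thesis using P(1) by simp
  qed
  interpret nlw_cone F Ft v vt Dv a b S M w "6 * q' * M" P
    by unfold_locales (use ab w q'(2) F_le(2) quintic_pairing[OF q'] P(2) P' J1' J2' in auto)
  have [measurable]: "(\<lambda>z::spacetime. indicator {a<..<b} (fst z) :: real) \<in> borel_measurable borel"
    by measurable
  have lhs: "(\<integral>\<^sup>+t\<in>{a..b}. (\<integral>\<^sup>+x. ennreal (w (t + norm x) * \<bar>v t x\<bar> ^ 6) \<partial>lborel) \<partial>lborel)
      = (\<integral>\<^sup>+z. ennreal (indicator {a<..<b} (fst z) * w (fst z + norm (snd z)) * \<bar>sv z\<bar> ^ 6) \<partial>lborel)"
  proof -
    have "(\<integral>\<^sup>+z. ennreal (indicator {a<..<b} (fst z) * w (fst z + norm (snd z)) * \<bar>sv z\<bar> ^ 6) \<partial>lborel)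
        = (\<integral>\<^sup>+t. (\<integral>\<^sup>+x. ennreal (indicator {a<..<b} (fst (t, x)) * w (fst (t, x) + norm (snd (t, x))) * \<bar>sv (t, x)\<bar> ^ 6) \<partial>lborel) \<partial>lborel)"
      by (rule nn_integral_spacetime) measurable
    also have "\<dots> = (\<integral>\<^sup>+t\<in>{a..b}. (\<integral>\<^sup>+x. ennreal (w (t + norm x) * \<bar>v t x\<bar> ^ 6) \<partial>lborel) \<partial>lborel)"
      using AE_open_interval[of a b]
    proof (intro nn_integral_cong_AE, eventually_elim)
      case (elim t)
      then show ?case by (cases "t \<in> {a<..<b}") (auto simp: s_inside)
    qed
    finally show ?thesis ..
  qed
  have mid1: "(LINT z|lborel. indicator {a<..<b} (fst z) * w (fst z + norm (snd z)) * (sv z ^ 5 * sF z))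
      = (LINT t:{a..b}|lborel. (LINT x|lborel. w (t + norm x) * F t x * v t x ^ 5))"
  proof -
    have int: "integrable lborel (\<lambda>z. indicator {a<..<b} (fst z) * w (fst z + norm (snd z)) * (sv z ^ 5 * sF z))"
      unfolding mult.assoc by (rule integrable_bounded_mult[OF J2', where B = 1]) (auto simp: indicator_def)
    have m: "(\<lambda>t. LINT x|lborel. indicator {a<..<b} (fst (t, x)) * w (fst (t, x) + norm (snd (t, x))) * (sv (t, x) ^ 5 * sF (t, x))) \<in> borel_measurable lborel"
      by measurable
    have "(LINT z|lborel. indicator {a<..<b} (fst z) * w (fst z + norm (snd z)) * (sv z ^ 5 * sF z))
        = (LINT t|lborel. LINT x|lborel. indicator {a<..<b} (fst (t, x)) * w (fst (t, x) + norm (snd (t, x))) * (sv (t, x) ^ 5 * sF (t, x)))"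
      by (rule LINT_spacetime[OF int])
    also have "\<dots> = (LINT t|lborel. indicator {a..b} t *\<^sub>R (LINT x|lborel. w (t + norm x) * F t x * v t x ^ 5))"
    proof (rule integral_cong_AE[OF m])
      have "(\<lambda>t. indicator {a..b} t *\<^sub>R (LINT x|lborel. w (t + norm x) * F t x * v t x ^ 5))
          = (\<lambda>t. LINT x|lborel. w (t + norm x) * (sv (t, x) ^ 5 * sF (t, x)))"
      proof
        fix t
        show "indicator {a..b} t *\<^sub>R (LINT x|lborel. w (t + norm x) * F t x * v t x ^ 5)
            = (LINT x|lborel. w (t + norm x) * (sv (t, x) ^ 5 * sF (t, x)))"
          by (cases "t \<in> {a..b}") (simp_all add: s_inside s_outside mult_ac)
      qed
      also have "\<dots> \<in> borel_measurable lborel" by measurable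
      finally show "(\<lambda>t. indicator {a..b} t *\<^sub>R (LINT x|lborel. w (t + norm x) * F t x * v t x ^ 5)) \<in> borel_measurable lborel" .
      show "AE t in lborel. (LINT x|lborel. indicator {a<..<b} (fst (t, x)) * w (fst (t, x) + norm (snd (t, x))) * (sv (t, x) ^ 5 * sF (t, x)))
          = indicator {a..b} t *\<^sub>R (LINT x|lborel. w (t + norm x) * F t x * v t x ^ 5)"
        using AE_open_interval[of a b]
        by eventually_elim (auto simp: s_inside mult_ac indicator_def)
    qed
    finally show ?thesis by (simp add: set_lebesgue_integral_def)
  qed
  have mid2: "(LINT z|lborel. indicator {a<..<b} (fst z) * tail w (fst z + norm (snd z)) * (sv z ^ 5 * sFt z))
      = (LINT t:{a..b}|lborel. (LINT x|lborel. (LINT \<tau>:{t + norm x..}|lborel. w \<tau>) * Ft t x * v t x ^ 5))"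
  proof -
    have int: "integrable lborel (\<lambda>z. indicator {a<..<b} (fst z) * tail w (fst z + norm (snd z)) * (sv z ^ 5 * sFt z))"
      unfolding mult.assoc sFt_def by (rule integrable_bounded_mult[OF J1', where B = 1]) (auto simp: indicator_def)
    have m: "(\<lambda>t. LINT x|lborel. indicator {a<..<b} (fst (t, x)) * tail w (fst (t, x) + norm (snd (t, x))) * (sv (t, x) ^ 5 * sFt (t, x))) \<in> borel_measurable lborel"
      by measurable
    have "(LINT z|lborel. indicator {a<..<b} (fst z) * tail w (fst z + norm (snd z)) * (sv z ^ 5 * sFt z))
        = (LINT t|lborel. LINT x|lborel. indicator {a<..<b} (fst (t, x)) * tail w (fst (t, x) + norm (snd (t, x))) * (sv (t, x) ^ 5 * sFt (t, x)))"
      by (rule LINT_spacetime[OF int])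
    also have "\<dots> = (LINT t|lborel. indicator {a..b} t *\<^sub>R (LINT x|lborel. tail w (t + norm x) * Ft t x * v t x ^ 5))"
    proof (rule integral_cong_AE[OF m])
      have 1: "(\<lambda>z. indicator ({a..b} \<times> UNIV) z *\<^sub>R (case z of (t, x) \<Rightarrow> tail w (t + norm x) * Ft t x * v t x ^ 5) :: real) \<in> borel_measurable lborel"
        using J1 unfolding set_integrable_def tail_def[symmetric] by (rule borel_measurable_integrable)
      have "(\<lambda>t. indicator {a..b} t *\<^sub>R (LINT x|lborel. tail w (t + norm x) * Ft t x * v t x ^ 5))
          = (\<lambda>t. LINT x|lborel. indicator ({a..b} \<times> UNIV) (t, x) *\<^sub>R (case (t, x) of (t, x) \<Rightarrow> tail w (t + norm x) * Ft t x * v t x ^ 5))"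
      proof
        fix t
        show "indicator {a..b} t *\<^sub>R (LINT x|lborel. tail w (t + norm x) * Ft t x * v t x ^ 5)
            = (LINT x|lborel. indicator ({a..b} \<times> UNIV) (t, x) *\<^sub>R (case (t, x) of (t, x) \<Rightarrow> tail w (t + norm x) * Ft t x * v t x ^ 5))"
          by (cases "t \<in> {a..b}") simp_all
      qed
      also have "\<dots> \<in> borel_measurable lborel"
      proof (rule lborel.borel_measurable_lebesgue_integral)
        show "(\<lambda>(t, x). indicator ({a..b} \<times> UNIV) (t, x) *\<^sub>R (case (t, x) of (t, x) \<Rightarrow> tail w (t + norm x) * Ft t x * v t x ^ 5))
            \<in> borel_measurable (lborel \<Otimes>\<^sub>M lborel)"
          using 1 by (simp add: lborel_prod case_prod_beta')
      qed
      finally show "(\<lambda>t. indicator {a..b} t *\<^sub>R (LINT x|lborel. tail w (t + norm x) * Ft t x * v t x ^ 5)) \<in> borel_measurable lborel" .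
      show "AE t in lborel. (LINT x|lborel. indicator {a<..<b} (fst (t, x)) * tail w (fst (t, x) + norm (snd (t, x))) * (sv (t, x) ^ 5 * sFt (t, x)))
          = indicator {a..b} t *\<^sub>R (LINT x|lborel. tail w (t + norm x) * Ft t x * v t x ^ 5)"
        using AE_open_interval[of a b]
        by eventually_elim (auto simp: s_inside mult_ac indicator_def sFt_def res_def)
    qed
    finally show ?thesis by (simp add: set_lebesgue_integral_def tail_def)
  qed
  show ?thesis
    using estimate_final unfolding estimate_def lhs[symmetric] mid1 mid2 Q_def .
qed

theorem proposition6p7:
  shows "\<exists>C::real. C > 0 \<and>
    (\<forall>(F :: real \<Rightarrow> R3 \<Rightarrow> real) (Ft :: real \<Rightarrow> R3 \<Rightarrow> real) (a :: real) (b :: real)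
       (v :: real \<Rightarrow> R3 \<Rightarrow> real) (Dv :: real \<Rightarrow> R3 \<Rightarrow> R3) (vt :: real \<Rightarrow> R3 \<Rightarrow> real)
       (w :: real \<Rightarrow> real).
       in_mixed_L 5 10 UNIV F \<longrightarrow>
       solves_wave UNIV F (\<lambda>t x. 0) \<longrightarrow>
       0 \<le> a \<longrightarrow> a \<le> b \<longrightarrow>
       weak_time_derivative ({a<..<b} \<times> UNIV) F Ft \<longrightarrow>
       forced_nlw_solution F a b v Dv vt \<longrightarrow>
       in_L 1 w \<longrightarrow> (\<forall>\<tau>. 0 \<le> w \<tau>) \<longrightarrow>
       set_integrable lborel ({a..b} \<times> UNIV)
         (\<lambda>(t, x). (LINT \<tau>:{t + norm x..}|lborel. w \<tau>) * Ft t x * v t x ^ 5) \<longrightarrow>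
       set_integrable lborel ({a..b} \<times> UNIV)
         (\<lambda>(t, x). w (t + norm x) * F t x * v t x ^ 5) \<longrightarrow>
       (\<integral>\<^sup>+t\<in>{a..b}. (\<integral>\<^sup>+x. ennreal (w (t + norm x) * \<bar>v t x\<bar> ^ 6) \<partial>lborel) \<partial>lborel)
       \<le> ennreal C *
         (Lnorm 1 w * (SUP t\<in>{a..b}. energy (v t) (Dv t) (vt t))
          + Lnorm 1 w * mixed_norm_infty 6 {a..b} F
              * (SUP t\<in>{a..b}. epowr (energy (v t) (Dv t) (vt t)) (5/6))
          + ennreal \<bar>LINT t:{a..b}|lborel. (LINT x|lborel.
                (LINT \<tau>:{t + norm x..}|lborel. w \<tau>) * Ft t x * v t x ^ 5)\<bar>
          + ennreal \<bar>LINT t:{a..b}|lborel. (LINT x|lborel.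
                w (t + norm x) * F t x * v t x ^ 5)\<bar>
          + Lnorm 1 w * (\<integral>\<^sup>+t\<in>{a..b}. (\<integral>\<^sup>+x. ennreal
                (\<bar>F t x\<bar>\<^sup>2 * (\<bar>F t x\<bar> + \<bar>v t x\<bar>) ^ 3 * \<bar>vt t x\<bar>) \<partial>lborel) \<partial>lborel)))"
\<comment> \<open>The coefficients that arise are 6 * 4 = 24, 6 * 24 = 144, 6 * 26 = 156 and 6 for
  each signed integral; 200 exceeds them all.\<close>
proof (rule exI[of _ 200], intro conjI allI impI)
  fix F Ft v vt :: "real \<Rightarrow> R3 \<Rightarrow> real" and Dv :: "real \<Rightarrow> R3 \<Rightarrow> R3" and a b :: real and w :: "real \<Rightarrow> real"
  assume F: "in_mixed_L 5 10 UNIV F" and a: "0 \<le> a" "a \<le> b"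
    and Ft: "weak_time_derivative ({a<..<b} \<times> UNIV) F Ft" and sol: "forced_nlw_solution F a b v Dv vt"
    and w: "in_L 1 w" "\<forall>\<tau>. 0 \<le> w \<tau>"
    and J1: "set_integrable lborel ({a..b} \<times> UNIV)
         (\<lambda>(t, x). (LINT \<tau>:{t + norm x..}|lborel. w \<tau>) * Ft t x * v t x ^ 5)"
    and J2: "set_integrable lborel ({a..b} \<times> UNIV) (\<lambda>(t, x). w (t + norm x) * F t x * v t x ^ 5)"
  let ?E = "\<lambda>t. energy (v t) (Dv t) (vt t)"
  define L where "L = (\<integral>\<^sup>+t\<in>{a..b}. (\<integral>\<^sup>+x. ennreal (w (t + norm x) * \<bar>v t x\<bar> ^ 6) \<partial>lborel) \<partial>lborel)"
  define SE where "SE = (SUP t\<in>{a..b}. ?E t)"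
  define SQ where "SQ = (SUP t\<in>{a..b}. epowr (?E t) (5/6))"
  define MF where "MF = mixed_norm_infty 6 {a..b} F"
  define PF where "PF = (\<integral>\<^sup>+t\<in>{a..b}. (\<integral>\<^sup>+x. ennreal (\<bar>F t x\<bar>\<^sup>2 * (\<bar>F t x\<bar> + \<bar>v t x\<bar>) ^ 3 * \<bar>vt t x\<bar>) \<partial>lborel) \<partial>lborel)"
  define I1 where "I1 = \<bar>LINT t:{a..b}|lborel. (LINT x|lborel. (LINT \<tau>:{t + norm x..}|lborel. w \<tau>) * Ft t x * v t x ^ 5)\<bar>"
  define I2 where "I2 = \<bar>LINT t:{a..b}|lborel. (LINT x|lborel. w (t + norm x) * F t x * v t x ^ 5)\<bar>"
  define A where "A = (LINT \<tau>|lborel. w \<tau>)"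
  have [measurable]: "w \<in> borel_measurable borel" using w(1) by (simp add: in_L_def)
  have iw: "integrable lborel w"
    using w by (intro integrableI_bounded) (auto simp: in_L_def Lnorm_def epowr_less_top)
  have A: "0 \<le> A" unfolding A_def using w(2) by (intro Bochner_Integration.integral_nonneg) simp
  have NW: "Lnorm 1 w = ennreal A"
  proof -
    have "(\<integral>\<^sup>+\<tau>. ennreal (w \<tau>) \<partial>lborel) = ennreal A"
      unfolding A_def by (rule nn_integral_eq_integral[OF iw]) (use w(2) in auto)
    then show ?thesis using w(2) A by (simp add: Lnorm_def epowr_ennreal)
  qed
  have "L \<le> ennreal 200 * (ennreal A * SE + ennreal A * MF * SQ + ennreal I1 + ennreal I2 + ennreal A * PF)"
  \<comment> \<open>Degenerate data give L = 0. Otherwise the mass of \<open>w\<close>, the length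
    of the interval and the energy are positive, which excludes products 0 * \<top> = 0 that would
    conceal an infinite norm on the right.\<close>
  proof (cases "L = 0")
    case False
    have "A > 0"
    proof (rule ccontr)
      assume "\<not> A > 0"
      then have "(LINT \<tau>|lborel. w \<tau>) = 0" using A by (simp add: A_def)
      then have "AE \<tau> in lborel. w \<tau> = 0"
        using integral_nonneg_eq_0_iff_AE[OF iw] w(2) by simp
      from AE_cone[OF this]
      have "AE z in (lborel :: real measure) \<Otimes>\<^sub>M (lborel :: R3 measure). w (fst z + norm (snd z)) = 0"
        unfolding lborel_prod .
      from lborel_pair.AE_pair[OF this]
      have "AE t in lborel. AE x in (lborel :: R3 measure). w (t + norm x) = 0" by simp
      then have "AE t in lborel. t \<in> {a..b} \<longrightarrow> (AE x in lborel. w (t + norm x) * \<bar>v t x\<bar> ^ 6 = 0)"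
        by (auto elim!: eventually_mono)
      then have "L = 0" unfolding L_def by (rule weighted_slices_eq_0)
      then show False using False by contradiction
    qed
    have "a \<noteq> b"
    proof
      assume "a = b"
      have "AE t in lborel. t \<in> {a..b} \<longrightarrow> (AE x in lborel. w (t + norm x) * \<bar>v t x\<bar> ^ 6 = 0)"
        using AE_lborel_singleton[of a] by eventually_elim (use \<open>a = b\<close> in auto)
      then have "L = 0" unfolding L_def by (rule weighted_slices_eq_0)
      then show False using False by contradiction
    qed
    then have "a < b" using a by simp
    \<comment> \<open>Zero energy at all times forces v = 0 almost everywhere, hence L = 0.\<close>
    have SQ0: "SQ > 0"
    proof (rule ccontr)
      assume "\<not> SQ > 0"
      then have SQ: "SQ = 0" by (simp add: not_gr_zero)
      have v0: "AE x in lborel. v t x = 0" if t: "t \<in> {a..b}" for t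
      proof -
        have "epowr (?E t) (5/6) \<le> SQ" unfolding SQ_def by (rule SUP_upper[OF t])
        then have "epowr (?E t) (5/6) = 0" using SQ by simp
        then have E0: "?E t = 0"
          by (auto simp: epowr_def enn2real_eq_0_iff split: if_splits)
        have [measurable]: "v t \<in> borel_measurable borel" "vt t \<in> borel_measurable borel" "Dv t \<in> borel_measurable borel"
          using sol t by (auto simp: forced_nlw_solution_def C0_Hdot1_def C0_L2_def in_Hdot1_def in_L_def)
        from E0 have "AE x in lborel. ennreal (1/2 * (norm (Dv t x))\<^sup>2 + 1/2 * \<bar>vt t x\<bar>\<^sup>2 + 1/6 * \<bar>v t x\<bar> ^ 6) = 0"
          unfolding energy_def by (subst (asm) nn_integral_0_iff_AE) auto
        then show ?thesis
        proof eventually_elim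
          case (elim x)
          then have "1/2 * (norm (Dv t x))\<^sup>2 + 1/2 * \<bar>vt t x\<bar>\<^sup>2 + 1/6 * \<bar>v t x\<bar> ^ 6 \<le> 0" by simp
          moreover have "0 \<le> 1/2 * (norm (Dv t x))\<^sup>2" "0 \<le> 1/2 * \<bar>vt t x\<bar>\<^sup>2" by simp_all
          ultimately have "\<bar>v t x\<bar> ^ 6 \<le> 0" by linarith
          then show ?case by (simp add: power_le_zero_eq)
        qed
      qed
      have "AE x in lborel. w (t + norm x) * \<bar>v t x\<bar> ^ 6 = 0" if "t \<in> {a..b}" for t
        using v0[OF that] by eventually_elim simp
      then have "AE t in lborel. t \<in> {a..b} \<longrightarrow> (AE x in lborel. w (t + norm x) * \<bar>v t x\<bar> ^ 6 = 0)"
        by (auto simp del: mult_eq_0_iff)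
      then have "L = 0" unfolding L_def by (rule weighted_slices_eq_0)
      then show False using False by contradiction
    qed
    show ?thesis
    \<comment> \<open>With \<open>A\<close> and \<open>SQ\<close> positive, an infinite factor makes
      the right side infinite and the claim trivial.\<close>
    proof (cases "SE = \<top> \<or> MF = \<top> \<or> PF = \<top>")
      case True
      then have "ennreal A * SE + ennreal A * MF * SQ + ennreal I1 + ennreal I2 + ennreal A * PF = \<top>"
        using \<open>A > 0\<close> SQ0 by (auto simp: ennreal_mult_eq_top_iff)
      moreover have "ennreal 200 * \<top> = \<top>" by (simp add: ennreal_mult_eq_top_iff)
      ultimately show ?thesis by (simp only: top_greatest)
    next
      case False
      then obtain S M P where S: "SE = ennreal S" "0 \<le> S" and M: "MF = ennreal M" "0 \<le> M"
        and P: "PF = ennreal P" "0 \<le> P"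
        by (cases SE; cases MF; cases PF) auto
      have E_le: "?E t \<le> ennreal S" if "t \<in> {a..b}" for t
        using SUP_upper[OF that, of ?E] S(1) by (simp add: SE_def)
      have "SQ \<le> epowr (ennreal S) (5/6)"
        unfolding SQ_def by (rule SUP_least) (intro epowr_mono E_le, simp)
      then obtain Q where Q: "SQ = ennreal Q" "0 \<le> Q"
        using S(2) by (cases SQ) (auto simp: epowr_ennreal top_unique)
      have Q_le: "epowr (?E t) (5/6) \<le> ennreal Q" if "t \<in> {a..b}" for t
        using SUP_upper[OF that, of "\<lambda>t. epowr (?E t) (5/6)"] Q(1) by (simp add: SQ_def)
      \<comment> \<open>The essential supremum bounds the norm of \<open>F\<close> at almost every
        time of the restricted measure; this is rewritten as a conditional statement on the whole
        line.\<close>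
      have F_le: "AE t in lborel. t \<in> {a..b} \<longrightarrow> Lnorm 6 (F t) \<le> ennreal M"
        using esssup_AE[of "\<lambda>t. Lnorm 6 (F t)" "restrict_space lborel {a..b}"] M(1)
        by (subst (asm) AE_restrict_space_iff) (auto simp: MF_def mixed_norm_infty_def)
      have data: "nlw_data F Ft v vt Dv a b S M"
        by unfold_locales (use F Ft sol E_le S(2) F_le M(2) in auto)
      have nn: "0 \<le> A * S" "0 \<le> A * M * Q" "0 \<le> A * P" "0 \<le> I1" "0 \<le> I2"
        using A S(2) M(2) P(2) Q(2) by (auto simp: I1_def I2_def)
      have "L \<le> ennreal (6 * (A * (4 * S + 4 * (6 * Q * M) + 26 * P) + I2 + I1))"
        using flux_estimate[OF data a(1) \<open>a < b\<close> iw _ Q_le Q(2) _ P(2) J1 J2] w(2) P(1)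
        unfolding L_def A_def I1_def I2_def PF_def by simp
      also have "\<dots> \<le> ennreal (200 * (A * S + A * M * Q + I1 + I2 + A * P))"
      proof (rule ennreal_leI)
        have "6 * (A * (4 * S + 4 * (6 * Q * M) + 26 * P) + I2 + I1)
            = 24 * (A * S) + 144 * (A * M * Q) + 156 * (A * P) + 6 * I2 + 6 * I1"
          by (simp add: algebra_simps)
        then show "6 * (A * (4 * S + 4 * (6 * Q * M) + 26 * P) + I2 + I1)
            \<le> 200 * (A * S + A * M * Q + I1 + I2 + A * P)"
          using nn unfolding distrib_left by linarith
      qed
      also have "\<dots> = ennreal 200 * ennreal (A * S + A * M * Q + I1 + I2 + A * P)"
        using nn by (intro ennreal_mult) auto
      also have "ennreal (A * S + A * M * Q + I1 + I2 + A * P)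
          = ennreal A * SE + ennreal A * MF * SQ + ennreal I1 + ennreal I2 + ennreal A * PF"
        unfolding S(1) M(1) P(1) Q(1) using nn A S(2) M(2) P(2) Q(2) by (simp add: ennreal_mult)
      finally show ?thesis .
    qed
  qed simp
  then show "(\<integral>\<^sup>+t\<in>{a..b}. (\<integral>\<^sup>+x. ennreal (w (t + norm x) * \<bar>v t x\<bar> ^ 6) \<partial>lborel) \<partial>lborel)
       \<le> ennreal 200 *
         (Lnorm 1 w * (SUP t\<in>{a..b}. energy (v t) (Dv t) (vt t))
          + Lnorm 1 w * mixed_norm_infty 6 {a..b} F
              * (SUP t\<in>{a..b}. epowr (energy (v t) (Dv t) (vt t)) (5/6))
          + ennreal \<bar>LINT t:{a..b}|lborel. (LINT x|lborel.
                (LINT \<tau>:{t + norm x..}|lborel. w \<tau>) * Ft t x * v t x ^ 5)\<bar>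
          + ennreal \<bar>LINT t:{a..b}|lborel. (LINT x|lborel.
                w (t + norm x) * F t x * v t x ^ 5)\<bar>
          + Lnorm 1 w * (\<integral>\<^sup>+t\<in>{a..b}. (\<integral>\<^sup>+x. ennreal
                (\<bar>F t x\<bar>\<^sup>2 * (\<bar>F t x\<bar> + \<bar>v t x\<bar>) ^ 3 * \<bar>vt t x\<bar>) \<partial>lborel) \<partial>lborel))"
    unfolding L_def SE_def SQ_def MF_def PF_def I1_def I2_def NW .
qed simp

end
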